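(* Let $m>1$ be an integer, let $L$ be a link admitting non-trivial $m$-colorings, and let $D$ and $D'$ be two diagrams of $L$. Let $G$ be a subgroup of $\mathbf{Aut}_m$. Then there is a bijection from $m\mathcal{C}D$ to $m\mathcal{C}D'$ which preserves the $G$-equivalence classes; that is, two elements of $m\mathcal{C}D$ lie in the same $G$-equivalence class if and only if their images lie in the same $G$-equivalence class of $m\mathcal{C}D'$.
   Context: Given a diagram $D$ of a link and an integer $m>1$, an $m$-coloring (Fox coloring) of $D$ is an assignment $\mathcal{C}$ of elements of $\mathbf{Z}_m=\mathbf{Z}/m\mathbf{Z}$ (colors) to the arcs of $D$ such that at each crossing, with over-arc $b$ and under-arcs $a,c$, one has $2\mathcal{C}(b)=\mathcal{C}(a)+\mathcal{C}(c)$ in $\mathbf{Z}_m$. An $m$-coloring is trivial if it assigns the same color to every arc, and non-trivial otherwise. A link admits non-trivial $m$-colorings if some (equivalently any) diagram of it has a non-trivial $m$-coloring. $m\mathcal{C}D$ denotes the set of non-trivial $m$-colorings of $D$. $\mathbf{Aut}_m$ is the group (under composition) of permutations $f$ of $\mathbf{Z}_m$ with $f(a\ast b)=f(a)\ast f(b)$ for all $a,b\in\mathbf{Z}_m$, where $x\ast y=2y-x$; it consists exactly of the maps $f_{\lambda,\mu}(x)=\lambda x+\mu$ with $\lambda\in\mathbf{Z}_m^{\ast}$ (the units) and $\mu\in\mathbf{Z}_m$. A subgroup $G$ of $\mathbf{Aut}_m$ acts on $m\mathcal{C}D$ by $(g\mathcal{C})(a)=g(\mathcal{C}(a))$ for each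 arc $a$ of $D$. The $G$-equivalence classes of $m$-colorings of $D$ are the orbits of this action on $m\mathcal{C}D$. *)

theory Defs
  imports "HOL-Analysis.Analysis" "HOL-Number_Theory.Cong" "HOL-Algebra.Group_Action"
begin

text \<open>
  Links are tame (polygonal) links in space. Space is written as plane times line: diagrams are
  obtained by the projection \<^term>\<open>fst\<close>, and \<^term>\<open>snd\<close> is the height that decides which strand of
  a crossing lies over the other.
\<close>

type_synonym plane = "real \<times> real"
type_synonym space = "plane \<times> real"


section \<open>Polygonal links and their equivalence\<close>

text \<open>
  A polygonal link is given by the finite set of its edges, an edge being the set of its two end
  points. Every vertex lies on exactly two edges and edges meet only in common vertices, so the
  union of the edges is a finite disjoint union of simple closed polygons. No orientation is
  recorded.
\<close>

definition edge_union :: "space set set \<Rightarrow> space set" where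
  "edge_union K = (\<Union>e\<in>K. convex hull e)"

definition polygonal_link :: "space set set \<Rightarrow> bool" where
  "polygonal_link K \<longleftrightarrow>
     finite K \<and> K \<noteq> {} \<and>
     (\<forall>e\<in>K. card e = 2) \<and>
     (\<forall>v\<in>\<Union>K. card {e \<in> K. v \<in> e} = 2) \<and>
     (\<forall>e\<in>K. \<forall>f\<in>K. e \<noteq> f \<longrightarrow> convex hull e \<inter> convex hull f = e \<inter> f)"

text \<open>
  The elementary deformation (Delta-move) of Reidemeister: an edge is replaced by the other two
  sides of a triangle that meets the link in that edge only. Equivalence of links is generated by
  these moves and their inverses. Subdividing an edge is a composition of such moves, so only
  nondegenerate triangles are needed.
\<close>

definition triangle_move :: "space set set \<Rightarrow> space set set \<Rightarrow> bool" where
  "triangle_move K K' \<longleftrightarrow>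
     polygonal_link K \<and> polygonal_link K' \<and>
     (\<exists>a b c. {a, b} \<in> K \<and> \<not> collinear {a, b, c} \<and>
        convex hull {a, b, c} \<inter> edge_union K = closed_segment a b \<and>
        K' = (K - {{a, b}}) \<union> {{a, c}, {c, b}})"

definition link_equivalent :: "space set set \<Rightarrow> space set set \<Rightarrow> bool" where
  "link_equivalent = equivclp triangle_move"


section \<open>Diagrams\<close>

text \<open>
  Regular position: no vertex is projected to the same point as another point of the link, and no
  three points of the link have the same projection. Since an overlap of two projected edges would
  contain the projection of a vertex, all multiple points are then transversal double points, and
  no edge is vertical.
\<close>

definition regular_position :: "space set set \<Rightarrow> bool" where
  "regular_position K \<longleftrightarrow>
     (\<forall>v\<in>\<Union>K. \<forall>p\<in>edge_union K. fst p = fst v \<longrightarrow> p = v) \<and>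
     (\<forall>p\<in>edge_union K. \<forall>q\<in>edge_union K. \<forall>r\<in>edge_union K.
        fst p = fst q \<and> fst q = fst r \<longrightarrow> p = q \<or> q = r \<or> p = r)"

text \<open>The points where the link passes under itself; the link is cut there into strands.\<close>

definition under_points :: "space set set \<Rightarrow> space set" where
  "under_points K =
     {u \<in> edge_union K. \<exists>v\<in>edge_union K. fst v = fst u \<and> snd u < snd v}"

definition strands :: "space set set \<Rightarrow> space set set" where
  "strands K = components (edge_union K - under_points K)"

definition starts_along :: "space set \<Rightarrow> space \<Rightarrow> space \<Rightarrow> bool" where
  "starts_along A u p \<longleftrightarrow> (\<exists>w\<in>open_segment u p. open_segment u w \<subseteq> A)"

text \<open>
  A diagram consists of its arcs, which are pairwise disjoint subsets of the plane, and its
  crossings. A crossing is given by its position, an under-arc, the over-arc and the other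
  under-arc. As there is no preferred order of the two under-arcs, each crossing is
  listed in both orders. The arcs at a crossing need not be distinct.
\<close>

record diagram =
  arcs :: "plane set set"
  crossings :: "(plane \<times> plane set \<times> plane set \<times> plane set) set"

definition diagram_of :: "space set set \<Rightarrow> diagram" where
  "diagram_of K =
     \<lparr>arcs = (\<lambda>A. fst ` A) ` strands K,
      crossings =
        {(fst u, fst ` A, fst ` B, fst ` C) | u v p q A B C.
           u \<in> edge_union K \<and> v \<in> edge_union K \<and> fst v = fst u \<and> snd u < snd v \<and>
           {p, q} \<in> K \<and> u \<in> open_segment p q \<and>
           A \<in> strands K \<and> B \<in> strands K \<and> C \<in> strands K \<and>
           v \<in> B \<and> starts_along A u p \<and> starts_along C u q}\<rparr>"

definition is_diagram_of :: "diagram \<Rightarrow> space set set \<Rightarrow> bool" where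
  "is_diagram_of D L \<longleftrightarrow>
     (\<exists>K. polygonal_link K \<and> link_equivalent L K \<and> regular_position K \<and> D = diagram_of K)"


section \<open>Fox colorings\<close>

text \<open>The ring of integers modulo \<open>m\<close> is represented by the residues \<open>0, \<dots>, m - 1\<close>.\<close>

definition Zmod :: "int \<Rightarrow> int set" where
  "Zmod m = {0..<m}"

definition colorings :: "int \<Rightarrow> diagram \<Rightarrow> (plane set \<Rightarrow> int) set" where
  "colorings m D =
     {C \<in> arcs D \<rightarrow>\<^sub>E Zmod m.
        \<forall>(x, a, b, c)\<in>crossings D. [2 * C b = C a + C c] (mod m)}"

definition trivial_coloring :: "diagram \<Rightarrow> (plane set \<Rightarrow> int) \<Rightarrow> bool" where
  "trivial_coloring D C \<longleftrightarrow> (\<exists>k. \<forall>a\<in>arcs D. C a = k)"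

definition nontrivial_colorings :: "int \<Rightarrow> diagram \<Rightarrow> (plane set \<Rightarrow> int) set" where
  "nontrivial_colorings m D = {C \<in> colorings m D. \<not> trivial_coloring D C}"

definition admits_nontrivial_colorings :: "int \<Rightarrow> space set set \<Rightarrow> bool" where
  "admits_nontrivial_colorings m L \<longleftrightarrow>
     (\<exists>D. is_diagram_of D L \<and> nontrivial_colorings m D \<noteq> {})"


section \<open>Equivalence classes of colorings\<close>

definition dihedral_op :: "int \<Rightarrow> int \<Rightarrow> int \<Rightarrow> int" where
  "dihedral_op m x y = (2 * y - x) mod m"

definition Aut :: "int \<Rightarrow> (int \<Rightarrow> int) monoid" where
  "Aut m = BijGroup (Zmod m)
     \<lparr>carrier := {f \<in> Bij (Zmod m). \<forall>a\<in>Zmod m. \<forall>b\<in>Zmod m.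
        f (dihedral_op m a b) = dihedral_op m (f a) (f b)}\<rparr>"

definition color_action ::
  "int \<Rightarrow> diagram \<Rightarrow> (int \<Rightarrow> int) \<Rightarrow> (plane set \<Rightarrow> int) \<Rightarrow> (plane set \<Rightarrow> int)" where
  "color_action m D g = (\<lambda>C\<in>nontrivial_colorings m D. \<lambda>a\<in>arcs D. g (C a))"

definition coloring_classes ::
  "int \<Rightarrow> (int \<Rightarrow> int) set \<Rightarrow> diagram \<Rightarrow> (plane set \<Rightarrow> int) set set" where
  "coloring_classes m G D =
     orbits (Aut m\<lparr>carrier := G\<rparr>) (nontrivial_colorings m D) (color_action m D)"

definition same_class ::
  "int \<Rightarrow> (int \<Rightarrow> int) set \<Rightarrow> diagram \<Rightarrow> (plane set \<Rightarrow> int) \<Rightarrow> (plane set \<Rightarrow> int) \<Rightarrow> bool" where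
  "same_class m G D C1 C2 \<longleftrightarrow> (\<exists>X\<in>coloring_classes m G D. C1 \<in> X \<and> C2 \<in> X)"

end

theory Submission
 imports Defs
begin

text \<open>
 Fox colorings only use the axioms of a kei (an involutory quandle). A coloring is treated as a
 function on the link without its under points, so that it suffices to find a bijection between
 such functions which commutes with all endomorphisms of the kei: the automorphisms give the group
 action, and the constant endomorphisms detect the trivial colorings.

 For a triangle move between links in regular position the bijection comes from a membrane. The part
 of the link above the triangle casts a shadow on it. The color of a vertex of the triangle extends
 over the triangle, where crossing the shadow of a strand of color \<open>q\<close> acts by \<open>q\<close>; this rule has no
 monodromy because it is consistent near every point, which for two crossing shadows is
 self-distributivity. The membrane gives the colors of the new sides and acts on the colors of the
 strands below the triangle. Doing the same from the other side inverts the construction.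

 An arbitrary chain of moves is put into regular position by one small generic shear of space. A
 small shear moves the crossings of the first and the last link a little but preserves their pattern.
\<close>


section \<open>Flat functions and their continuation\<close>

text \<open>Working with arbitrary triangles instead of Reidemeister moves avoids case distinctions
  on diagrams, but any number of strands may then pass over and under the triangle. This is why a
  coloring is phrased as a condition on straight segments that meet a wall at most once: the same
  notion \<open>flat\<close> describes a coloring along an edge (wall: the under points) and the
  membrane over the plane triangle (wall: the shadow). The membrane exists by a monodromy theorem:
  if all small balls around each point of a convex set carry exactly one flat function for each
  prescribed value, then every flat germ extends to the whole set. Its germ is prescribed at one
  corner only; that it fits the whole old path and the other corner follows from uniqueness along
  the old sides. Links in the middle of a chain of moves need not be in regular position, and a
  triangle may project to a segment; hence the shear. As one shear must serve all links of the
  chain, the bad shears are shown to form closed sets with empty interior, a property that survives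
  finite unions.\<close>

abbreviation conv :: "'a::real_vector set \<Rightarrow> 'a set" where
 "conv S \<equiv> convex hull S"

abbreviation seg :: "'a::real_vector \<Rightarrow> 'a \<Rightarrow> 'a set" where
 "seg \<equiv> closed_segment"

lemma closed_segment_param:
 fixes x d :: "'v::real_vector"
 assumes "p \<le> q"
 shows "seg (x + p *\<^sub>R d) (x + q *\<^sub>R d) = (\<lambda>\<nu>. x + \<nu> *\<^sub>R d) ` {p..q}"
proof -
 have "seg (p *\<^sub>R d) (q *\<^sub>R d) = (\<lambda>\<nu>. \<nu> *\<^sub>R d) ` seg p q"
  by (rule closed_segment_linear_image) (simp add: linear_scaleR_left)
 then have "seg (x + p *\<^sub>R d) (x + q *\<^sub>R d) = (\<lambda>u. x + u) ` (\<lambda>\<nu>. \<nu> *\<^sub>R d) ` seg p q"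
  using closed_segment_translation[of x "p *\<^sub>R d" "q *\<^sub>R d"] by simp
 then show ?thesis using assms by (simp only: closed_segment_eq_real_ivl image_image if_True)
qed

lemma open_segment_paramE:
 fixes x y :: "'v::real_vector"
 assumes "s \<in> open_segment x y"
 obtains t where "0 < t" "t < 1" "s = x + t *\<^sub>R (y - x)"
 using assms by (auto simp: in_segment algebra_simps)

lemma closed_segment_paramE:
 fixes x y :: "'v::real_vector"
 assumes "s \<in> seg x y"
 obtains t where "0 \<le> t" "t \<le> 1" "s = x + t *\<^sub>R (y - x)"
 using assms by (auto simp: in_segment algebra_simps)

text \<open>Localises a crossing: when \<open>s\<close> is the only point of a segment on a wall,
  the outer pieces up to \<open>u\<close> and from \<open>v\<close> avoid the wall, so all change
  happens between \<open>u\<close> and \<open>v\<close>, which may be taken as close to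
  \<open>s\<close> as desired.\<close>

lemma segment_points_around:
 fixes x y :: "'v::real_vector"
 assumes s: "s \<in> open_segment x y" and u: "u \<in> open_segment x s" and v: "v \<in> open_segment y s"
 shows "u \<in> seg x y" "v \<in> seg x y"
  "seg x u \<subseteq> seg x y - {s}"
  "seg v y \<subseteq> seg x y - {s}"
  "s \<in> seg u v" "seg u v \<subseteq> seg x y"
proof -
 obtain a where a: "0 < a" "a < 1" "s = x + a *\<^sub>R (y - x)" using s by (rule open_segment_paramE)
 obtain b' where b': "0 < b'" "b' < 1" "u = x + b' *\<^sub>R (s - x)" using u by (rule open_segment_paramE)
 obtain c' where c': "0 < c'" "c' < 1" "v = y + c' *\<^sub>R (s - y)" using v by (rule open_segment_paramE)
 define b where "b = b' * a"
 define c where "c = 1 - c' * (1 - a)"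
 have b: "u = x + b *\<^sub>R (y - x)" "0 < b" "b < a" using a b' by (auto simp: b_def)
 have "v = (1 - c') *\<^sub>R y + c' *\<^sub>R s" using c'(3) by (simp add: algebra_simps)
 also have "\<dots> = x + c *\<^sub>R (y - x)" unfolding a(3) c_def by (simp add: algebra_simps)
 finally have c: "v = x + c *\<^sub>R (y - x)" .
 have "0 < c' * (1 - a)" "c' * (1 - a) < 1 * (1 - a)" using a c' by (simp, intro mult_strict_right_mono, auto)
 then have c2: "a < c" "c < 1" by (auto simp: c_def)
 have ne: "y - x \<noteq> 0" using s by auto
 have y: "y = x + 1 *\<^sub>R (y - x)" and x: "x = x + 0 *\<^sub>R (y - x)" by auto
 have seg: "seg x y = (\<lambda>\<nu>. x + \<nu> *\<^sub>R (y - x)) ` {0..1}"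
  using closed_segment_param[of 0 1 x "y - x"] by simp
 have seg1: "seg x u = (\<lambda>\<nu>. x + \<nu> *\<^sub>R (y - x)) ` {0..b}"
  using closed_segment_param[of 0 b x "y - x"] b by simp
 have seg2: "seg v y = (\<lambda>\<nu>. x + \<nu> *\<^sub>R (y - x)) ` {c..1}"
  using closed_segment_param[of c 1 x "y - x"] c c2 by simp
 have seg3: "seg u v = (\<lambda>\<nu>. x + \<nu> *\<^sub>R (y - x)) ` {b..c}"
  using closed_segment_param[of b c x "y - x"] b c c2 by simp
 show "u \<in> seg x y" unfolding seg b(1) using b c2 by (intro imageI) auto
 show "v \<in> seg x y" unfolding seg c(1) using a c2 by (intro imageI) auto
 show "seg x u \<subseteq> seg x y - {s}" unfolding seg seg1 a(3) using b c2 ne by auto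
 show "seg v y \<subseteq> seg x y - {s}" unfolding seg seg2 a(3) using a c2 ne by auto
 show "s \<in> seg u v" unfolding seg3 a(3) using b c2 by (intro imageI) auto
 show "seg u v \<subseteq> seg x y" unfolding seg3 seg using b c2 by (intro image_mono) auto
qed

lemma open_segment_near:
 fixes x s :: "'v::euclidean_space"
 assumes "x \<noteq> s" "\<epsilon> > 0"
 obtains y where "y \<in> open_segment x s" "dist s y < \<epsilon>"
proof -
 define t where "t = min (1/2) (\<epsilon> / (2 * dist x s))"
 define y where "y = s + t *\<^sub>R (x - s)"
 have d: "dist x s > 0" using assms by simp
 have t: "0 < t" "t < 1" using assms d by (auto simp: t_def)
 have "y \<in> open_segment s x"
  unfolding in_segment using assms t by (intro conjI exI[of _ t]) (auto simp: y_def scaleR_diff_left scaleR_diff_right)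
 moreover have "dist s y = t * dist x s" using t by (simp add: y_def dist_norm)
 moreover have "t * dist x s \<le> \<epsilon> / (2 * dist x s) * dist x s"
  by (intro mult_right_mono) (auto simp: t_def)
 moreover have "\<epsilon> / (2 * dist x s) * dist x s < \<epsilon>" using d assms by (simp add: field_simps)
 ultimately show ?thesis using that[of y] by (simp add: open_segment_commute)
qed

locale kei =
 fixes Q :: "'q set" and act :: "'q \<Rightarrow> 'q \<Rightarrow> 'q"  (infixl "\<rhd>" 70)
 assumes act_closed: "x \<in> Q \<Longrightarrow> y \<in> Q \<Longrightarrow> x \<rhd> y \<in> Q"
  and act_idem: "x \<in> Q \<Longrightarrow> x \<rhd> x = x"
  and act_invol: "x \<in> Q \<Longrightarrow> y \<in> Q \<Longrightarrow> x \<rhd> y \<rhd> y = x"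
  and act_distrib: "x \<in> Q \<Longrightarrow> y \<in> Q \<Longrightarrow> z \<in> Q \<Longrightarrow> x \<rhd> y \<rhd> z = (x \<rhd> z) \<rhd> (y \<rhd> z)"
begin

text \<open>\<open>B\<close> is a wall in \<open>C\<close> and \<open>\<kappa>\<close> gives its
  colors. Only segments that meet the wall at most once are constrained; a passage through several
  points can be subdivided. A crossing at a point where \<open>\<kappa>\<close> is
  \<open>None\<close> is left free, which is how corners, bends and double points of a shadow are
  exempted.\<close>

definition flat :: "'v::euclidean_space set \<Rightarrow> 'v set \<Rightarrow> ('v \<Rightarrow> 'q option) \<Rightarrow> ('v \<Rightarrow> 'q) \<Rightarrow> bool" where
 "flat C B \<kappa> f \<longleftrightarrow> (\<forall>x\<in>C - B. f x \<in> Q) \<and>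
   (\<forall>x\<in>C - B. \<forall>y\<in>C - B.
    (seg x y \<inter> B = {} \<longrightarrow> f y = f x) \<and>
    (\<forall>s q. seg x y \<inter> B = {s} \<and> \<kappa> s = Some q \<longrightarrow> f y = f x \<rhd> q))"

lemma flatI:
 assumes "\<And>x. x \<in> C \<Longrightarrow> x \<notin> B \<Longrightarrow> f x \<in> Q"
  and "\<And>x y. x \<in> C \<Longrightarrow> x \<notin> B \<Longrightarrow> y \<in> C \<Longrightarrow> y \<notin> B \<Longrightarrow> seg x y \<inter> B = {} \<Longrightarrow> f y = f x"
  and "\<And>x y s q. x \<in> C \<Longrightarrow> x \<notin> B \<Longrightarrow> y \<in> C \<Longrightarrow> y \<notin> B \<Longrightarrow> seg x y \<inter> B = {s} \<Longrightarrow>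
      \<kappa> s = Some q \<Longrightarrow> f y = f x \<rhd> q"
 shows "flat C B \<kappa> f"
 unfolding flat_def
 by (simp add: assms(1,2,3))

lemma flat_in:
 assumes "flat C B \<kappa> f" "x \<in> C" "x \<notin> B"
 shows "f x \<in> Q"
 by (rule assms(1)[unfolded flat_def, THEN conjunct1, rule_format, OF DiffI, OF assms(2,3)])

lemma flat_const:
 assumes "flat C B \<kappa> f" "x \<in> C" "y \<in> C" "seg x y \<inter> B = {}"
 shows "f y = f x"
 by (smt (verit, best) Diff_iff IntI assms(1,2,3,4) empty_iff ends_in_segment(1,2) kei.flat_def kei_axioms)

lemma flat_cross:
 assumes "flat C B \<kappa> f" "x \<in> C" "x \<notin> B" "y \<in> C" "y \<notin> B" "seg x y \<inter> B = {s}" "\<kappa> s = Some q"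
 shows "f y = f x \<rhd> q"
 using assms(1)[unfolded flat_def, THEN conjunct2, THEN bspec, OF DiffI, OF assms(2,3), THEN bspec, OF DiffI,
   OF assms(4,5), THEN conjunct2, THEN spec, THEN spec, THEN mp, OF conjI, OF assms(6,7)] .

lemma flat_mono:
 assumes "flat C B \<kappa> f" "C' \<subseteq> C"
 shows "flat C' B \<kappa> f"
 by (smt (verit) DiffD1 DiffD2 assms(1,2) flat_const flat_cross flat_def flat_in subset_iff)

lemma flat_cong:
 assumes "flat C B \<kappa> f" and "\<And>x. x \<in> C \<Longrightarrow> x \<notin> B \<Longrightarrow> g x = f x"
 shows "flat C B \<kappa> g"
 by (smt (verit, best) DiffD1 DiffD2 assms(1,2) kei.flat_def kei_axioms)

text \<open>Convexity keeps every segment between points of \<open>C\<close> inside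
  \<open>C\<close>, so only the trace of the wall on \<open>C\<close> and the colors there enter the
  condition.\<close>

lemma flat_cong_barrier:
 assumes "flat C B \<kappa> f" "convex C" and "C \<inter> B = C \<inter> B'" "\<And>x. x \<in> C \<inter> B \<Longrightarrow> \<kappa>' x = \<kappa> x"
  and "\<And>x. x \<in> C \<Longrightarrow> x \<notin> B \<Longrightarrow> g x = f x"
 shows "flat C B' \<kappa>' g"
proof -
 have seg: "seg x y \<inter> B' = seg x y \<inter> B" if "x \<in> C" "y \<in> C" for x y
 proof -
  have "seg x y = seg x y \<inter> C"
   using closed_segment_subset[OF that assms(2)] by (simp add: Int_absorb2)
  then show ?thesis using assms(3) by (metis Int_assoc)
 qed
 have nB: "x \<notin> B" if "x \<in> C" "x \<notin> B'" for x
  using assms(3) that(1,2) by auto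
 show ?thesis
 proof (rule flatI)
  fix x assume "x \<in> C" "x \<notin> B'"
  moreover from this have "x \<notin> B" using nB by simp
  ultimately show "g x \<in> Q" using assms(5) flat_in[OF assms(1)] by simp
 next
  fix x y assume xy: "x \<in> C" "x \<notin> B'" "y \<in> C" "y \<notin> B'" and s: "seg x y \<inter> B' = {}"
  have n: "x \<notin> B" "y \<notin> B" using xy nB by simp_all
  have "seg x y \<inter> B = {}" using seg[OF xy(1,3)] s by (rule trans[OF sym])
  from flat_const[OF assms(1) xy(1,3) this]
  show "g y = g x" using assms(5)[OF xy(1) n(1)] assms(5)[OF xy(3) n(2)] by simp
 next
  fix x y s q assume xy: "x \<in> C" "x \<notin> B'" "y \<in> C" "y \<notin> B'" and s: "seg x y \<inter> B' = {s}" "\<kappa>' s = Some q"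
  have n: "x \<notin> B" "y \<notin> B" using xy nB by simp_all
  have i: "seg x y \<inter> B = {s}" using seg[OF xy(1,3)] s(1) by (rule trans[OF sym])
  then have "s \<in> seg x y" "s \<in> B" by auto
  then have "s \<in> C \<inter> B" using closed_segment_subset[OF xy(1,3) assms(2)] by (simp add: subsetD)
  then have "\<kappa> s = Some q" using assms(4)[of s] s(2) by simp
  from flat_cross[OF assms(1) xy(1) n(1) xy(3) n(2) i this]
  show "g y = g x \<rhd> q" using assms(5)[OF xy(1) n(1)] assms(5)[OF xy(3) n(2)] by simp
 qed
qed

text \<open>Along a segment that avoids the wall the function is locally constant, hence constant by
  connectedness. A segment with one crossing is shortened to a piece around the crossing point that
  fits into a ball given by \<open>loc\<close>.\<close>

lemma flat_local_to_global:
 assumes C: "convex C" and loc: "\<And>t. t \<in> C \<Longrightarrow> \<exists>\<epsilon>>0. flat (C \<inter> ball t \<epsilon>) B \<kappa> f"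
 shows "flat C B \<kappa> f"
proof (rule flatI)
 fix x assume "x \<in> C" "x \<notin> B"
 then obtain \<epsilon> where "\<epsilon> > 0" "flat (C \<inter> ball x \<epsilon>) B \<kappa> f" using loc by blast
 then show "f x \<in> Q" using flat_in[of "C \<inter> ball x \<epsilon>" B \<kappa> f x] \<open>x \<in> C\<close> \<open>x \<notin> B\<close> by simp
next
 have *: "f y = f x" if "x \<in> C" "y \<in> C" "seg x y \<inter> B = {}" for x y
 proof (rule connected_local_const[where A = "seg x y" and a = y and b = x])
  show "\<forall>a\<in>seg x y. \<forall>\<^sub>F b in at a within seg x y. f a = f b"
  proof
   fix a assume a: "a \<in> seg x y"
   then have aC: "a \<in> C" using closed_segment_subset[OF that(1,2) C] by blast
   then obtain \<epsilon> where e: "\<epsilon> > 0" "flat (C \<inter> ball a \<epsilon>) B \<kappa> f" using loc by blast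
   show "\<forall>\<^sub>F b in at a within seg x y. f a = f b"
    unfolding eventually_at
   proof (intro exI[of _ \<epsilon>] conjI ballI impI)
    fix b assume b: "b \<in> seg x y" "b \<noteq> a \<and> dist b a < \<epsilon>"
    have "seg a b \<subseteq> seg x y"
     using a b by (simp add: subset_closed_segment)
    then show "f a = f b"
     using flat_const[OF e(2), of b a] a b that(3) closed_segment_subset[OF that(1,2) C] e(1) aC
     by (auto simp: dist_commute closed_segment_commute)
   qed (use e in auto)
  qed
 qed auto
 fix x y assume xy: "x \<in> C" "x \<notin> B" "y \<in> C" "y \<notin> B"
 show "seg x y \<inter> B = {} \<Longrightarrow> f y = f x" using * xy by blast
 fix s q assume s: "seg x y \<inter> B = {s}" "\<kappa> s = Some q"
 have sseg: "s \<in> seg x y" "s \<in> B" using s by auto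
 then have ne: "s \<noteq> x" "s \<noteq> y" "s \<in> C" using xy closed_segment_subset[OF xy(1,3) C] by auto
 then obtain \<epsilon> where e: "\<epsilon> > 0" "flat (C \<inter> ball s \<epsilon>) B \<kappa> f" using loc by blast
 obtain u where u: "u \<in> open_segment x s" "dist s u < \<epsilon>" using open_segment_near[of x s \<epsilon>] ne e(1) by metis
 obtain v where v: "v \<in> open_segment y s" "dist s v < \<epsilon>" using open_segment_near[of y s \<epsilon>] ne e(1) by metis
 have so: "s \<in> open_segment x y" using sseg ne by (simp add: open_segment_def)
 note sg = segment_points_around[OF so u(1) v(1)]
 have uC: "u \<in> C" "v \<in> C" using sg(1,2) closed_segment_subset[OF xy(1,3) C] by auto
 have uB: "u \<notin> B" "v \<notin> B" using sg(1,2) s u(1) v(1) by (auto simp: open_segment_def)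
 have "f u = f x" using *[OF xy(1) uC(1)] sg(3) s by blast
 moreover have "f y = f v" using *[OF uC(2) xy(3)] sg(4) s by blast
 moreover have "seg u v \<inter> B = {s}" using sg s by blast
 then have "f v = f u \<rhd> q" using flat_cross[OF e(2), of u v s q] uC uB u v s by simp
 ultimately show "f y = f x \<rhd> q" by simp
qed

end

section \<open>Germs of flat functions and their continuation\<close>

context kei
begin

definition flat_at :: "'v::euclidean_space set \<Rightarrow> 'v set \<Rightarrow> ('v \<Rightarrow> 'q option) \<Rightarrow> 'v \<Rightarrow> ('v \<Rightarrow> 'q) \<Rightarrow> bool" where
 "flat_at C B \<kappa> t f \<longleftrightarrow> (\<exists>\<epsilon>>0. flat (C \<inter> ball t \<epsilon>) B \<kappa> f)"

text \<open>On such a ball a flat function exists and is unique once its value at a single point off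
  the wall is prescribed: there is no local monodromy.\<close>

definition good_ball :: "'v::euclidean_space set \<Rightarrow> 'v set \<Rightarrow> ('v \<Rightarrow> 'q option) \<Rightarrow> 'v \<Rightarrow> real \<Rightarrow> bool" where
 "good_ball C B \<kappa> t \<epsilon> \<longleftrightarrow>
   C \<inter> ball t \<epsilon> - B \<noteq> {} \<and>
   (\<forall>x\<in>C \<inter> ball t \<epsilon> - B. \<forall>q\<in>Q. \<exists>f. flat (C \<inter> ball t \<epsilon>) B \<kappa> f \<and> f x = q) \<and>
   (\<forall>f g. \<forall>x\<in>C \<inter> ball t \<epsilon> - B. flat (C \<inter> ball t \<epsilon>) B \<kappa> f \<and> flat (C \<inter> ball t \<epsilon>) B \<kappa> g \<and> f x = g x \<longrightarrow>
    (\<forall>y\<in>C \<inter> ball t \<epsilon> - B. f y = g y))"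

text \<open>All sufficiently small radii are required, so that a good ball can be found inside any
  given neighbourhood.\<close>

definition good :: "'v::euclidean_space set \<Rightarrow> 'v set \<Rightarrow> ('v \<Rightarrow> 'q option) \<Rightarrow> 'v \<Rightarrow> bool" where
 "good C B \<kappa> t \<longleftrightarrow> (\<exists>\<epsilon>0>0. \<forall>\<epsilon>. 0 < \<epsilon> \<and> \<epsilon> \<le> \<epsilon>0 \<longrightarrow> good_ball C B \<kappa> t \<epsilon>)"

lemma good_ball_nonempty: "good_ball C B \<kappa> t \<epsilon> \<Longrightarrow> C \<inter> ball t \<epsilon> - B \<noteq> {}"
 unfolding good_ball_def by (rule conjunct1)

lemma good_ball_exists:
 assumes "good_ball C B \<kappa> t \<epsilon>" "x \<in> C" "x \<in> ball t \<epsilon>" "x \<notin> B" "q \<in> Q"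
 shows "\<exists>f. flat (C \<inter> ball t \<epsilon>) B \<kappa> f \<and> f x = q"
 using assms(1)[unfolded good_ball_def, THEN conjunct2, THEN conjunct1, rule_format, of x q] assms(2-5) by simp

lemma good_ball_unique:
 assumes "good_ball C B \<kappa> t \<epsilon>" "flat (C \<inter> ball t \<epsilon>) B \<kappa> f" "flat (C \<inter> ball t \<epsilon>) B \<kappa> g"
  and x: "x \<in> C" "x \<in> ball t \<epsilon>" "x \<notin> B" "f x = g x" and y: "y \<in> C" "y \<in> ball t \<epsilon>" "y \<notin> B"
 shows "f y = g y"
 by (smt (verit, best) Diff_iff IntI assms(1,2,3) good_ball_def x(1,2,3,4) y(1,2,3))

lemma goodE:
 assumes "good C B \<kappa> t" "\<delta> > 0"
 obtains \<epsilon> where "0 < \<epsilon>" "\<epsilon> \<le> \<delta>" "good_ball C B \<kappa> t \<epsilon>"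
 by (smt (verit, best) assms(1,2) good_def)

text \<open>Equality of germs at \<open>t\<close>, taken off the wall.\<close>

definition agree_at :: "'v::euclidean_space set \<Rightarrow> 'v set \<Rightarrow> ('v \<Rightarrow> 'q) \<Rightarrow> ('v \<Rightarrow> 'q) \<Rightarrow> 'v \<Rightarrow> bool" where
 "agree_at C B f g t \<longleftrightarrow> (\<exists>\<epsilon>>0. \<forall>y\<in>C \<inter> ball t \<epsilon> - B. f y = g y)"

lemma agree_at_refl: "agree_at C B f f t"
 unfolding agree_at_def by (intro exI[of _ 1]) simp

lemma agree_at_sym: "agree_at C B f g t \<Longrightarrow> agree_at C B g f t"
 unfolding agree_at_def by (elim exE conjE, rule exI, rule conjI, assumption) simp

lemma agree_at_trans:
 assumes "agree_at C B f g t" "agree_at C B g h t"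
 shows "agree_at C B f h t"
proof -
 obtain d e where "d > 0" "\<forall>y\<in>C \<inter> ball t d - B. f y = g y" "e > 0" "\<forall>y\<in>C \<inter> ball t e - B. g y = h y"
  using assms unfolding agree_at_def by auto
 then show ?thesis unfolding agree_at_def by (intro exI[of _ "min d e"]) auto
qed

lemma ball_in_ball:
 fixes s t :: "'v::euclidean_space"
 assumes "dist t s < e"
 obtains d where "d > 0" "ball s d \<subseteq> ball t e"
 using openE[OF open_ball, of s t e] assms by auto

lemma flat_at_cong:
 assumes "flat_at C B \<kappa> t f" "agree_at C B f g t"
 shows "flat_at C B \<kappa> t g"
proof -
 obtain d where d: "d > 0" "flat (C \<inter> ball t d) B \<kappa> f" using assms(1) unfolding flat_at_def by auto
 obtain e where e: "e > 0" "\<forall>y\<in>C \<inter> ball t e - B. f y = g y" using assms(2) unfolding agree_at_def by auto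
 have "flat (C \<inter> ball t (min d e)) B \<kappa> f" by (rule flat_mono[OF d(2)]) auto
 then have "flat (C \<inter> ball t (min d e)) B \<kappa> g" by (rule flat_cong) (use e in auto)
 then show ?thesis unfolding flat_at_def using d(1) e(1) by (intro exI[of _ "min d e"]) simp
qed

lemma flat_at_near:
 assumes "flat_at C B \<kappa> t f"
 obtains e where "e > 0" "\<And>s. dist t s < e \<Longrightarrow> flat_at C B \<kappa> s f"
proof -
 obtain d where d: "d > 0" "flat (C \<inter> ball t d) B \<kappa> f" using assms(1) unfolding flat_at_def by auto
 show ?thesis
 proof (rule that[OF d(1)])
  fix s assume "dist t s < d"
  then obtain e where e: "e > 0" "ball s e \<subseteq> ball t d" by (rule ball_in_ball)
  have "flat (C \<inter> ball s e) B \<kappa> f" by (rule flat_mono[OF d(2)]) (use e(2) in auto)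
  then show "flat_at C B \<kappa> s f" unfolding flat_at_def using e(1) by auto
 qed
qed

lemma agree_at_near:
 assumes "agree_at C B f g t"
 obtains e where "e > 0" "\<And>s. dist t s < e \<Longrightarrow> agree_at C B f g s"
proof -
 obtain d where d: "d > 0" "\<forall>y\<in>C \<inter> ball t d - B. f y = g y" using assms unfolding agree_at_def by auto
 show ?thesis
 proof (rule that[OF d(1)])
  fix s assume "dist t s < d"
  then obtain e where e: "e > 0" "ball s e \<subseteq> ball t d" by (rule ball_in_ball)
  have "\<forall>y\<in>C \<inter> ball s e - B. f y = g y" using d(2) e(2) by blast
  then show "agree_at C B f g s" unfolding agree_at_def using e(1) by auto
 qed
qed

text \<open>In a good ball, agreement at one point off the wall spreads to the whole ball. The only
  alternatives are therefore agreement throughout and disagreement throughout, which makes agreement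
  an open and closed condition.\<close>

lemma agree_or_disagree:
 assumes "good C B \<kappa> t" "flat_at C B \<kappa> t f" "flat_at C B \<kappa> t g"
 shows "agree_at C B f g t \<or> (\<exists>\<epsilon>>0. \<forall>y\<in>C \<inter> ball t \<epsilon> - B. f y \<noteq> g y)"
proof -
 obtain d where d: "d > 0" "flat (C \<inter> ball t d) B \<kappa> f" using assms(2) unfolding flat_at_def by auto
 obtain e where e: "e > 0" "flat (C \<inter> ball t e) B \<kappa> g" using assms(3) unfolding flat_at_def by auto
 have "min d e > 0" using d e by simp
 then obtain \<epsilon> where eps: "0 < \<epsilon>" "\<epsilon> \<le> min d e" and gb: "good_ball C B \<kappa> t \<epsilon>"
  by (rule goodE[OF assms(1)])
 have "flat (C \<inter> ball t \<epsilon>) B \<kappa> f" "flat (C \<inter> ball t \<epsilon>) B \<kappa> g"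
  by (rule flat_mono[OF d(2)], use eps in auto) (rule flat_mono[OF e(2)], use eps in auto)
 note un' = good_ball_unique[OF gb this]
 show ?thesis
  by (smt (verit, best) Diff_iff Int_iff agree_at_def eps(1) un')
qed

lemma not_agree_if_disagree:
 assumes "good C B \<kappa> t" "\<epsilon> > 0" "\<forall>y\<in>C \<inter> ball t \<epsilon> - B. f y \<noteq> g y"
 shows "\<not> agree_at C B f g t"
proof
 assume "agree_at C B f g t"
 then obtain d where d: "d > 0" "\<forall>y\<in>C \<inter> ball t d - B. f y = g y" unfolding agree_at_def by auto
 have "min d \<epsilon> > 0" using d assms by simp
 then obtain e where "0 < e" "e \<le> min d \<epsilon>" "good_ball C B \<kappa> t e" by (rule goodE[OF assms(1)])
 with good_ball_nonempty[OF this(3)] obtain y where "y \<in> C \<inter> ball t d - B" "y \<in> C \<inter> ball t \<epsilon> - B" by fastforce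
 then show False using d(2)[rule_format, of y] assms(3)[rule_format, of y] by simp
qed

lemma agree_on_connected:
 assumes W: "connected W" "W \<subseteq> C" and good: "\<And>t. t \<in> W \<Longrightarrow> good C B \<kappa> t"
  and f: "\<And>t. t \<in> W \<Longrightarrow> flat_at C B \<kappa> t f" and g: "\<And>t. t \<in> W \<Longrightarrow> flat_at C B \<kappa> t g"
  and s: "s \<in> W" "agree_at C B f g s" and t: "t \<in> W"
 shows "agree_at C B f g t"
proof -
 have "agree_at C B f g s = agree_at C B f g t"
 proof (rule connected_local_const[OF W(1) s(1) t], intro ballI)
  fix u assume u: "u \<in> W"
  consider "agree_at C B f g u" | \<epsilon> where "\<epsilon> > 0" "\<forall>y\<in>C \<inter> ball u \<epsilon> - B. f y \<noteq> g y"
   using agree_or_disagree[OF good f g] u by blast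
  then show "\<forall>\<^sub>F v in at u within W. agree_at C B f g u = agree_at C B f g v"
  proof cases
   case 1
   then obtain e where "e > 0" "\<And>s. dist u s < e \<Longrightarrow> agree_at C B f g s" by (rule agree_at_near) blast
   then show ?thesis using 1 unfolding eventually_at by (intro exI[of _ e]) (simp add: dist_commute)
  next
   case 2
   have "\<not> agree_at C B f g v" if "v \<in> W" "dist v u < \<epsilon>" for v
   proof -
    have "dist u v < \<epsilon>" using that by (simp add: dist_commute)
    then obtain d where d: "d > 0" "ball v d \<subseteq> ball u \<epsilon>" by (rule ball_in_ball)
    have "\<forall>y\<in>C \<inter> ball v d - B. f y \<noteq> g y" using 2(2) d(2) by blast
    then show ?thesis by (rule not_agree_if_disagree[OF good[OF that(1)] d(1)])
   qed
   moreover have "\<not> agree_at C B f g u" by (rule not_agree_if_disagree[OF good[OF u] 2])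
   ultimately show ?thesis using 2(1) unfolding eventually_at by (intro exI[of _ \<epsilon>]) auto
  qed
 qed
 then show ?thesis using s(2) by simp
qed

lemma flat_unique:
 assumes C: "convex C" and good: "\<And>t. t \<in> C \<Longrightarrow> good C B \<kappa> t"
  and fg: "flat C B \<kappa> f" "flat C B \<kappa> g" and s: "s \<in> C" "agree_at C B f g s" and t: "t \<in> C" "t \<notin> B"
 shows "f t = g t"
proof -
 have fl: "flat_at C B \<kappa> u h" if "flat C B \<kappa> h" for u h
  unfolding flat_at_def by (intro exI[of _ 1] conjI flat_mono[OF that]) auto
 have "agree_at C B f g t"
  by (rule agree_on_connected[OF convex_connected[OF C] subset_refl good fl[OF fg(1)] fl[OF fg(2)] s t(1)])
 then show ?thesis unfolding agree_at_def using t by (metis DiffI IntI centre_in_ball)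
qed

text \<open>The argument of analytic continuation: the parameters up to which the germ extends form
  an open and closed subset of the unit interval. Open, because flatness at a point implies flatness
  nearby; closed, because a good ball around a limit point contains a flat function that takes over
  from the continuation obtained so far.\<close>

lemma continue_along_segment:
 assumes C: "convex C" and good: "\<And>t. t \<in> C \<Longrightarrow> good C B \<kappa> t"
  and a: "a \<in> C" "flat_at C B \<kappa> a f0" and t: "t \<in> C"
 shows "\<exists>f. (\<forall>u\<in>seg a t. flat_at C B \<kappa> u f) \<and> agree_at C B f f0 a"
proof (cases "t = a")
 case True
 then show ?thesis using a(2) agree_at_refl by (intro exI[of _ f0]) simp
next
 case False
 define \<gamma> where "\<gamma> s = a + s *\<^sub>R (t - a)" for s :: real
 define P where "P s \<longleftrightarrow> (\<exists>f. (\<forall>r\<in>{0..s}. flat_at C B \<kappa> (\<gamma> r) f) \<and> agree_at C B f f0 a)" for s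
 have L: "norm (t - a) > 0" using False by simp
 have dg: "dist (\<gamma> r) (\<gamma> s) = \<bar>r - s\<bar> * norm (t - a)" for r s
  by (simp add: \<gamma>_def dist_norm flip: scaleR_diff_left)
 have da: "dist a (\<gamma> r) = r * norm (t - a)" if "r \<ge> 0" for r
  using that by (simp add: \<gamma>_def dist_norm)
 have gC: "\<gamma> s \<in> C" if "0 \<le> s" "s \<le> 1" for s
 proof -
  have "\<gamma> s = (1 - s) *\<^sub>R a + s *\<^sub>R t" by (simp add: \<gamma>_def algebra_simps)
  then show ?thesis using C a(1) t that by (simp add: convexD)
 qed
 have mono: "P s'" if "P s" "s' \<le> s" for s s'
  using that unfolding P_def by (elim exE) (intro exI conjI ballI, auto)
 have "P 0 = P 1"
 proof (rule connected_local_const[where A = "{0..1::real}"])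
  show "\<forall>s\<in>{0..1}. \<forall>\<^sub>F s' in at s within {0..1}. P s = P s'"
  proof
   fix s :: real assume s: "s \<in> {0..1}"
   obtain \<epsilon> where eps: "0 < \<epsilon>" "\<epsilon> \<le> 1" and gs: "good_ball C B \<kappa> (\<gamma> s) \<epsilon>"
    by (rule goodE[OF good[OF gC] zero_less_one, of s]) (use s in auto)
   define \<delta> where "\<delta> = \<epsilon> / norm (t - a)"
   have dpos: "\<delta> > 0" using eps L by (simp add: \<delta>_def)
   have near: "\<gamma> r \<in> ball (\<gamma> s) \<epsilon>" if "\<bar>r - s\<bar> < \<delta>" for r
    using that L by (simp add: dg \<delta>_def pos_less_divide_eq abs_minus_commute)
   have fl: "flat_at C B \<kappa> (\<gamma> r) g" if "flat (C \<inter> ball (\<gamma> s) \<epsilon>) B \<kappa> g" "\<bar>r - s\<bar> < \<delta>" for r g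
   proof -
    have "flat_at C B \<kappa> (\<gamma> r) g" if "ball (\<gamma> r) d \<subseteq> ball (\<gamma> s) \<epsilon>" "d > 0" for d
     unfolding flat_at_def using that
     by (intro exI[of _ d] conjI flat_mono[OF \<open>flat (C \<inter> ball (\<gamma> s) \<epsilon>) B \<kappa> g\<close>]) auto
    then show ?thesis using ball_in_ball[of "\<gamma> s" "\<gamma> r" \<epsilon>] near[OF that(2)] by auto
   qed
   \<comment> \<open>A continuation \<open>f\<close> up to some \<open>s'\<close> close below
     \<open>s\<close> is taken over by the flat function \<open>g\<close> on the good ball at
     \<open>\<gamma> s\<close> that has the value of \<open>f\<close> at one point near
     \<open>\<gamma> s'\<close>.\<close>
   have backw: "P s" if s': "P s'" "0 \<le> s'" "s' < s" "s - s' < \<delta>" for s'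
   proof -
    obtain f where f: "\<forall>r\<in>{0..s'}. flat_at C B \<kappa> (\<gamma> r) f" "agree_at C B f f0 a"
     using s'(1) unfolding P_def by blast
    have gs': "\<gamma> s' \<in> C" using gC s s' by simp
    have fs': "flat_at C B \<kappa> (\<gamma> s') f" using f(1) s'(2) by simp
    have "dist (\<gamma> s) (\<gamma> s') < \<epsilon>" using near[of s'] s' by simp
    then obtain d where d: "d > 0" "ball (\<gamma> s') d \<subseteq> ball (\<gamma> s) \<epsilon>" by (rule ball_in_ball)
    obtain e where e: "e > 0" "flat (C \<inter> ball (\<gamma> s') e) B \<kappa> f" using fs' unfolding flat_at_def by auto
    have "min d e > 0" using d e by simp
    then obtain \<eta> where eta: "0 < \<eta>" "\<eta> \<le> min d e" and gb: "good_ball C B \<kappa> (\<gamma> s') \<eta>"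
     by (rule goodE[OF good[OF gs']])
    obtain x where x: "x \<in> C" "x \<in> ball (\<gamma> s') \<eta>" "x \<notin> B" using good_ball_nonempty[OF gb] by blast
    have ff: "flat (C \<inter> ball (\<gamma> s') \<eta>) B \<kappa> f" by (rule flat_mono[OF e(2)]) (use eta in auto)
    have "f x \<in> Q" by (rule flat_in[OF ff _ x(3)]) (use x in simp)
    have "ball (\<gamma> s') \<eta> \<subseteq> ball (\<gamma> s') d" using eta by (simp add: subset_ball)
    then have sb: "ball (\<gamma> s') \<eta> \<subseteq> ball (\<gamma> s) \<epsilon>" using d(2) by (rule subset_trans)
    have "x \<in> ball (\<gamma> s) \<epsilon>" using x(2) sb by (rule subsetD[rotated])
    then obtain g where g: "flat (C \<inter> ball (\<gamma> s) \<epsilon>) B \<kappa> g" "g x = f x"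
     using good_ball_exists[OF gs x(1) _ x(3) \<open>f x \<in> Q\<close>] by auto
    have gg: "flat (C \<inter> ball (\<gamma> s') \<eta>) B \<kappa> g" by (rule flat_mono[OF g(1)]) (use sb in auto)
    have fg: "g y = f y" if "y \<in> C" "y \<in> ball (\<gamma> s') \<eta>" "y \<notin> B" for y
     by (rule good_ball_unique[OF gb gg ff x g(2) that])
    \<comment> \<open>The two functions are glued along the sphere around \<open>a\<close> through
      \<open>\<gamma> s'\<close>. The distance to \<open>a\<close> increases along the segment, and
      both functions agree near \<open>\<gamma> s'\<close>, where the segment meets the
      sphere.\<close>
    define h where "h y = (if dist a y < dist a (\<gamma> s') then f y else g y)" for y
    have hf: "agree_at C B h f (\<gamma> r)" if "0 \<le> r" "r < s'" for r
    proof -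
     have lt: "dist a (\<gamma> r) < dist a (\<gamma> s')" using that L da by simp
     show ?thesis unfolding agree_at_def
     proof (intro exI[of _ "dist a (\<gamma> s') - dist a (\<gamma> r)"] conjI ballI)
      fix y assume "y \<in> C \<inter> ball (\<gamma> r) (dist a (\<gamma> s') - dist a (\<gamma> r)) - B"
      then have "dist a y < dist a (\<gamma> s')" using dist_triangle[of a y "\<gamma> r"] by simp
      then show "h y = f y" by (simp add: h_def)
     qed (use lt in simp)
    qed
    have hg: "agree_at C B h g (\<gamma> r)" if "s' < r" for r
    proof -
     have lt: "dist a (\<gamma> r) > dist a (\<gamma> s')" using that L da s'(2) by simp
     show ?thesis unfolding agree_at_def
     proof (intro exI[of _ "dist a (\<gamma> r) - dist a (\<gamma> s')"] conjI ballI)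
      fix y assume "y \<in> C \<inter> ball (\<gamma> r) (dist a (\<gamma> r) - dist a (\<gamma> s')) - B"
      then have "\<not> dist a y < dist a (\<gamma> s')" using dist_triangle[of a "\<gamma> r" y] by (simp add: dist_commute)
      then show "h y = g y" by (simp add: h_def)
     qed (use lt in simp)
    qed
    have hf': "agree_at C B h f (\<gamma> s')" unfolding agree_at_def
     by (intro exI[of _ \<eta>] conjI ballI) (use eta fg in \<open>simp_all add: h_def\<close>)
    have "flat_at C B \<kappa> (\<gamma> r) h" if r: "r \<in> {0..s}" for r
    proof -
     consider "r < s'" | "r = s'" | "r > s'" by linarith
     then show ?thesis
     proof cases
      case 1
      then show ?thesis using flat_at_cong[OF _ agree_at_sym[OF hf[of r]]] f(1) r by simp
     next
      case 2
      then show ?thesis using flat_at_cong[OF fs' agree_at_sym[OF hf']] by simp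
     next
      case 3
      then have "flat_at C B \<kappa> (\<gamma> r) g" using fl[OF g(1), of r] r s' by simp
      then show ?thesis by (rule flat_at_cong[OF _ agree_at_sym[OF hg[OF 3]]])
     qed
    qed
    moreover have "agree_at C B h f0 a"
    proof -
     have "a = \<gamma> 0" by (simp add: \<gamma>_def)
     then have "agree_at C B h f a" using hf[of 0] hf' s'(2) by (cases "s' = 0") auto
     then show ?thesis using f(2) by (rule agree_at_trans)
    qed
    ultimately show ?thesis unfolding P_def by blast
   qed
   show "\<forall>\<^sub>F s' in at s within {0..1}. P s = P s'"
   proof (cases "P s")
    case True
    then obtain f where f: "\<forall>r\<in>{0..s}. flat_at C B \<kappa> (\<gamma> r) f" "agree_at C B f f0 a"
     unfolding P_def by blast
    have "flat_at C B \<kappa> (\<gamma> s) f" using f(1) s by simp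
    then obtain e where e: "e > 0" "\<And>u. dist (\<gamma> s) u < e \<Longrightarrow> flat_at C B \<kappa> u f" by (rule flat_at_near) blast
    have "P s'" if "dist s' s < e / norm (t - a)" for s'
    proof -
     have "flat_at C B \<kappa> (\<gamma> r) f" if r: "r \<in> {0..s'}" for r
     proof (cases "r \<le> s")
      case False
      then have "\<bar>s - r\<bar> < e / norm (t - a)"
       using \<open>dist s' s < e / norm (t - a)\<close> r by (simp add: dist_real_def)
      then have "dist (\<gamma> s) (\<gamma> r) < e" using L by (simp add: dg pos_less_divide_eq)
      then show ?thesis by (rule e(2))
     qed (use f(1) r in simp)
     then show ?thesis unfolding P_def using f(2) by blast
    qed
    then show ?thesis using True L e(1) unfolding eventually_at
     by (intro exI[of _ "e / norm (t - a)"]) simp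
   next
    case False
    have "\<not> P s'" if "s' \<in> {0..1}" "dist s' s < \<delta>" for s'
     using mono[of s' s] backw[of s'] False that by (cases "s' < s") (auto simp: dist_real_def)
    then show ?thesis using False dpos unfolding eventually_at by (intro exI[of _ \<delta>]) auto
   qed
  qed
 qed auto
 moreover have "P 0" unfolding P_def using a(2) agree_at_refl by (intro exI[of _ f0]) (simp add: \<gamma>_def)
 ultimately obtain f where f: "\<forall>r\<in>{0..1}. flat_at C B \<kappa> (\<gamma> r) f" "agree_at C B f f0 a"
  unfolding P_def by blast
 have "seg a t = \<gamma> ` {0..1}"
  using closed_segment_param[of 0 1 a "t - a"] by (simp add: \<gamma>_def)
 then show ?thesis using f by auto
qed

text \<open>Every point is reached from \<open>a\<close> by a straight segment, and \<open>S\<close>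
  takes at \<open>x\<close> the end value of the continuation along the segment to \<open>x\<close>.
  It is flat because continuations along neighbouring segments agree.\<close>

theorem monodromy:
 assumes C: "convex C" and good: "\<And>t. t \<in> C \<Longrightarrow> good C B \<kappa> t"
  and a: "a \<in> C" "flat_at C B \<kappa> a f0"
 shows "\<exists>S. flat C B \<kappa> S \<and> agree_at C B S f0 a"
proof -
 have "\<forall>t\<in>C. \<exists>f. (\<forall>u\<in>seg a t. flat_at C B \<kappa> u f) \<and> agree_at C B f f0 a"
  using continue_along_segment[OF C good a] by blast
 then obtain F where F: "\<And>t u. t \<in> C \<Longrightarrow> u \<in> seg a t \<Longrightarrow> flat_at C B \<kappa> u (F t)"
  "\<And>t. t \<in> C \<Longrightarrow> agree_at C B (F t) f0 a" by metis
 define S where "S x = F x x" for x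
 have SF: "agree_at C B S (F t) t" if t: "t \<in> C" for t
 proof -
  \<comment> \<open>Compactness of the segment gives a tube of radius \<open>e\<close> on which the
    one continuation \<open>F t\<close> is flat; the segments from \<open>a\<close> to all points
    near \<open>t\<close> stay in this tube.\<close>
  define W where "W = {u. flat_at C B \<kappa> u (F t)}"
  have "open W" unfolding open_dist W_def
   by (metis dist_commute kei.flat_at_near kei_axioms mem_Collect_eq)
  moreover have "seg a t \<subseteq> W" using F(1)[OF t] by (auto simp: W_def)
  ultimately obtain e where e: "e > 0" "(\<Union>x\<in>seg a t. ball x e) \<subseteq> W"
   using compact_subset_open_imp_ball_epsilon_subset[of "seg a t" W] by auto
  have "F x x = F t x" if x: "x \<in> C \<inter> ball t e - B" for x
  proof -
   have xC: "x \<in> C" "dist t x < e" "x \<notin> B" using x by auto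
   have sub: "seg a x \<subseteq> C" using C a(1) xC(1) by (simp add: closed_segment_subset)
   have "flat_at C B \<kappa> u (F t)" if u: "u \<in> seg a x" for u
   proof -
    obtain r where r: "0 \<le> r" "r \<le> 1" "u = a + r *\<^sub>R (x - a)" using u by (rule closed_segment_paramE)
    define v where "v = a + r *\<^sub>R (t - a)"
    have "v = (1 - r) *\<^sub>R a + r *\<^sub>R t" by (simp add: v_def algebra_simps)
    then have "v \<in> seg a t" using r by (auto simp: in_segment)
    moreover have "dist v u < e"
    proof -
     have "v - u = r *\<^sub>R (t - x)" by (simp add: v_def r(3) algebra_simps)
     then have "dist v u = r * dist t x" using r by (simp add: dist_norm)
     also have "\<dots> \<le> 1 * dist t x" using r by (intro mult_right_mono) auto
     finally show ?thesis using xC by simp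
    qed
    ultimately have "u \<in> (\<Union>x\<in>seg a t. ball x e)" by auto
    then have "u \<in> W" using e(2) by (rule subsetD[rotated])
    then show ?thesis by (simp add: W_def)
   qed
   \<comment> \<open>Both continuations have the germ \<open>f0\<close> at \<open>a\<close>, so they
     agree along the whole segment to \<open>x\<close>.\<close>
   then have "agree_at C B (F x) (F t) x"
    by (intro agree_on_connected[OF connected_segment(1) sub good[OF subsetD[OF sub]] F(1)[OF xC(1)] _
       ends_in_segment(1) agree_at_trans[OF F(2)[OF xC(1)] agree_at_sym[OF F(2)[OF t]]] ends_in_segment(2)]) auto
   then obtain d where "d > 0" "\<forall>y\<in>C \<inter> ball x d - B. F x y = F t y" unfolding agree_at_def by auto
   then show ?thesis using xC by simp
  qed
  then show ?thesis unfolding agree_at_def S_def using e(1) by auto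
 qed
 have "flat C B \<kappa> S"
 proof (rule flat_local_to_global[OF C])
  fix t assume t: "t \<in> C"
  have "flat_at C B \<kappa> t S" by (rule flat_at_cong[OF F(1)[OF t ends_in_segment(2)] agree_at_sym[OF SF[OF t]]])
  then show "\<exists>\<epsilon>>0. flat (C \<inter> ball t \<epsilon>) B \<kappa> S" unfolding flat_at_def .
 qed
 moreover have "agree_at C B S f0 a" using agree_at_trans[OF SF[OF a(1)] F(2)[OF a(1)]] .
 ultimately show ?thesis by blast
qed

end


section \<open>Local models of a barrier\<close>

lemma affine_along:
 fixes A :: "'v::real_vector \<Rightarrow> real"
 assumes "linear A"
 shows "A (x + u *\<^sub>R (y - x) - t) = A (x - t) + u * (A (y - t) - A (x - t))"
 using assms by (simp add: linear_diff linear_add linear_cmul)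

lemma in_segment_param: "0 \<le> u \<Longrightarrow> u \<le> 1 \<Longrightarrow> x + u *\<^sub>R (y - x) \<in> seg x y"
 unfolding in_segment by (intro exI[of _ u]) (simp add: algebra_simps)

lemma in_open_segment_if: "s \<in> seg x y \<Longrightarrow> s \<noteq> x \<Longrightarrow> s \<noteq> y \<Longrightarrow> s \<in> open_segment x y"
 by (simp add: open_segment_def)

lemma affine_zero_on_segment:
 fixes A :: "'v::real_vector \<Rightarrow> real"
 assumes A: "linear A" and "A (x - t) > 0 \<longleftrightarrow> \<not> A (y - t) > 0" "A (x - t) \<noteq> 0" "A (y - t) \<noteq> 0"
 shows "\<exists>s\<in>seg x y. A (s - t) = 0"
proof -
 define u where "u = A (x - t) / (A (x - t) - A (y - t))"
 have "0 \<le> u" "u \<le> 1" "A (x - t) + u * (A (y - t) - A (x - t)) = 0"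
  using assms(2-4) by (auto simp: u_def divide_simps algebra_simps)
 then show ?thesis
  using in_segment_param[of u x y] by (intro bexI[of _ "x + u *\<^sub>R (y - x)"]) (simp_all add: affine_along[OF A])
qed

lemma affine_sign_change:
 fixes A :: "'v::real_vector \<Rightarrow> real"
 assumes A: "linear A" and s: "s \<in> seg x y" "A (s - t) = 0" and "A (x - t) \<noteq> 0" "A (y - t) \<noteq> 0"
 shows "A (x - t) > 0 \<longleftrightarrow> \<not> A (y - t) > 0"
proof -
 obtain u where u: "0 \<le> u" "u \<le> 1" "s = x + u *\<^sub>R (y - x)" using s(1) by (rule closed_segment_paramE)
 have *: "(1 - u) * A (x - t) + u * A (y - t) = 0" using s(2) unfolding u(3) affine_along[OF A] by (simp add: algebra_simps)
 have "\<not> (A (x - t) > 0 \<and> A (y - t) > 0)" "\<not> (A (x - t) < 0 \<and> A (y - t) < 0)"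
 proof -
  show "\<not> (A (x - t) > 0 \<and> A (y - t) > 0)"
   using * u(1,2) by (smt (verit) mult_nonneg_nonneg mult_pos_pos)
  show "\<not> (A (x - t) < 0 \<and> A (y - t) < 0)"
   using * u(1,2) by (smt (verit) mult_nonneg_nonpos mult_pos_neg)
 qed
 then show ?thesis using assms(4,5) by linarith
qed

lemma affine_zero_unique:
 fixes A :: "'v::real_vector \<Rightarrow> real"
 assumes A: "linear A" and s: "s \<in> seg x y" "A (s - t) = 0" and s': "s' \<in> seg x y" "A (s' - t) = 0"
  and "A (x - t) \<noteq> 0"
 shows "s' = s"
proof -
 obtain u where u: "s = x + u *\<^sub>R (y - x)" using s(1) by (rule closed_segment_paramE)
 obtain v where v: "s' = x + v *\<^sub>R (y - x)" using s'(1) by (rule closed_segment_paramE)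
 have "A (x - t) + u * (A (y - t) - A (x - t)) = A (x - t) + v * (A (y - t) - A (x - t))"
  using s(2) s'(2) unfolding u v affine_along[OF A] by simp
 moreover have "A (y - t) - A (x - t) \<noteq> 0" using s(2) assms(6) unfolding u affine_along[OF A] by auto
 ultimately show ?thesis by (simp add: u v)
qed

lemma scaled_into_ball:
 fixes v :: "'v::euclidean_space"
 assumes "\<epsilon> > 0"
 obtains \<eta> where "0 < \<eta>" "\<eta> < 1" "\<And>r. \<bar>r\<bar> \<le> \<eta> \<Longrightarrow> t + r *\<^sub>R v \<in> ball t \<epsilon>"
proof -
 define k where "k = norm v + 1"
 define \<eta> where "\<eta> = min (1/2) (\<epsilon> / (2 * k))"
 have k: "k > 0" "norm v \<le> k" using norm_ge_zero[of v] unfolding k_def by linarith+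
 have "0 < \<eta>" "\<eta> < 1" using assms k by (auto simp: \<eta>_def)
 moreover have "t + r *\<^sub>R v \<in> ball t \<epsilon>" if "\<bar>r\<bar> \<le> \<eta>" for r
 proof -
  have "\<bar>r\<bar> * norm v \<le> \<eta> * k" using that k by (intro mult_mono) auto
  also have "\<dots> \<le> \<epsilon> / (2 * k) * k" using k by (intro mult_right_mono) (auto simp: \<eta>_def)
  also have "\<dots> = \<epsilon> / 2" using k by simp
  finally show ?thesis using assms by (simp add: dist_norm)
 qed
 ultimately show ?thesis by (rule that)
qed

context kei
begin

lemma good_ballI:
 assumes "C \<inter> ball t \<epsilon> - B \<noteq> {}"
  and "\<And>x q. x \<in> C \<inter> ball t \<epsilon> \<Longrightarrow> x \<notin> B \<Longrightarrow> q \<in> Q \<Longrightarrow> \<exists>f. flat (C \<inter> ball t \<epsilon>) B \<kappa> f \<and> f x = q"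
  and "\<And>f g x y. flat (C \<inter> ball t \<epsilon>) B \<kappa> f \<Longrightarrow> flat (C \<inter> ball t \<epsilon>) B \<kappa> g \<Longrightarrow> x \<in> C \<inter> ball t \<epsilon> \<Longrightarrow> x \<notin> B \<Longrightarrow>
    f x = g x \<Longrightarrow> y \<in> C \<inter> ball t \<epsilon> \<Longrightarrow> y \<notin> B \<Longrightarrow> f y = g y"
 shows "good_ball C B \<kappa> t \<epsilon>"
 unfolding good_ball_def
 by (smt (verit, best) Diff_iff assms(1,2,3))

lemma act_cancel: "x \<in> Q \<Longrightarrow> y \<in> Q \<Longrightarrow> z \<in> Q \<Longrightarrow> x \<rhd> z = y \<rhd> z \<longleftrightarrow> x = y"
 using act_invol by metis

text \<open>Pairs across which the equality of two flat functions can be transported in both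
  directions. Uniqueness in a ball then reduces to joining any two points by a chain of such
  pairs.\<close>

definition linked :: "'v::euclidean_space set \<Rightarrow> 'v set \<Rightarrow> ('v \<Rightarrow> 'q option) \<Rightarrow> 'v \<Rightarrow> 'v \<Rightarrow> bool" where
 "linked D B \<kappa> x y \<longleftrightarrow> x \<in> D - B \<and> y \<in> D - B \<and>
   (seg x y \<inter> B = {} \<or> (\<exists>s q. seg x y \<inter> B = {s} \<and> \<kappa> s = Some q \<and> q \<in> Q))"

lemma linked_transfer:
 assumes f: "flat D B \<kappa> f" and g: "flat D B \<kappa> g" and l: "linked D B \<kappa> x y"
 shows "f x = g x \<longleftrightarrow> f y = g y"
proof -
 have xy: "x \<in> D" "x \<notin> B" "y \<in> D" "y \<notin> B" using l unfolding linked_def by blast+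
 show ?thesis
 proof (cases "seg x y \<inter> B = {}")
  case True
  then show ?thesis using flat_const[OF f xy(1,3)] flat_const[OF g xy(1,3)] by simp
 next
  case False
  then obtain s q where "seg x y \<inter> B = {s}" "\<kappa> s = Some q" "q \<in> Q" using l unfolding linked_def by blast
  then show ?thesis using flat_cross[OF f xy] flat_cross[OF g xy] act_cancel[OF flat_in[OF f xy(1,2)] flat_in[OF g xy(1,2)]] by simp
 qed
qed

lemma good_ball_linked:
 assumes "C \<inter> ball t \<epsilon> - B \<noteq> {}"
  and "\<And>x q. x \<in> C \<inter> ball t \<epsilon> \<Longrightarrow> x \<notin> B \<Longrightarrow> q \<in> Q \<Longrightarrow> \<exists>f. flat (C \<inter> ball t \<epsilon>) B \<kappa> f \<and> f x = q"
  and "\<And>x y. x \<in> C \<inter> ball t \<epsilon> \<Longrightarrow> x \<notin> B \<Longrightarrow> y \<in> C \<inter> ball t \<epsilon> \<Longrightarrow> y \<notin> B \<Longrightarrow> equivclp (linked (C \<inter> ball t \<epsilon>) B \<kappa>) x y"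
 shows "good_ball C B \<kappa> t \<epsilon>"
proof (rule good_ballI[OF assms(1,2)])
 let ?D = "C \<inter> ball t \<epsilon>"
 fix f g x y assume fg: "flat ?D B \<kappa> f" "flat ?D B \<kappa> g" and x: "x \<in> ?D" "x \<notin> B" "f x = g x" and y: "y \<in> ?D" "y \<notin> B"
 have "equivclp (linked ?D B \<kappa>) x y" by (rule assms(3)[OF x(1,2) y])
 then show "f y = g y"
 proof (induction rule: equivclp_induct)
  case base show ?case by (rule x(3))
 next
  case (step y z) then show ?case using linked_transfer[OF fg] by blast
 qed
qed

text \<open>The action of \<open>q\<close> is an involution, so the values \<open>r\<close> and
  \<open>r \<rhd> q\<close> on the two sides of a wall of the single color \<open>q\<close> are
  consistent in both directions of passage.\<close>

lemma two_sided_flat: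
 assumes miss: "\<And>x y. x \<in> D \<Longrightarrow> x \<notin> B \<Longrightarrow> y \<in> D \<Longrightarrow> y \<notin> B \<Longrightarrow> seg x y \<inter> B = {} \<Longrightarrow> S x \<longleftrightarrow> S y"
  and cross: "\<And>x y s q'. x \<in> D \<Longrightarrow> x \<notin> B \<Longrightarrow> y \<in> D \<Longrightarrow> y \<notin> B \<Longrightarrow> seg x y \<inter> B = {s} \<Longrightarrow> \<kappa> s = Some q' \<Longrightarrow> q' = q \<and> (S x \<longleftrightarrow> \<not> S y)"
  and q: "q \<in> Q" "r \<in> Q"
 shows "\<exists>f. flat D B \<kappa> f \<and> f x0 = r"
proof (intro exI conjI)
 let ?f = "\<lambda>x. if S x \<longleftrightarrow> S x0 then r else r \<rhd> q"
 show "flat D B \<kappa> ?f"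
 proof (rule flatI)
  show "?f x \<in> Q" for x using q by (simp add: act_closed)
  show "?f y = ?f x" if "x \<in> D" "x \<notin> B" "y \<in> D" "y \<notin> B" "seg x y \<inter> B = {}" for x y using miss[OF that] by simp
  show "?f y = ?f x \<rhd> q'" if "x \<in> D" "x \<notin> B" "y \<in> D" "y \<notin> B" "seg x y \<inter> B = {s}" "\<kappa> s = Some q'" for x y s q'
   using cross[OF that] act_invol[OF q(2,1)] by auto
 qed
qed simp

text \<open>Model for a point away from the shadow, and for a corner that is an isolated point of
  the shadow. No segment passes through an extreme point, so near \<open>t\<close> the flat
  functions are the constant ones.\<close>

lemma good_point:
 assumes C: "convex C" "t \<in> C" and e0: "\<epsilon>0 > 0" and B: "C \<inter> ball t \<epsilon>0 \<inter> B \<subseteq> {t}"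
  and ext: "\<And>x y. t \<in> B \<Longrightarrow> x \<in> C \<Longrightarrow> y \<in> C \<Longrightarrow> t \<notin> open_segment x y" and z: "z \<in> C" "z \<noteq> t"
 shows "good C B \<kappa> t"
 unfolding good_def
proof (intro exI[of _ \<epsilon>0] conjI allI impI e0)
 fix \<epsilon> assume eps: "0 < \<epsilon> \<and> \<epsilon> \<le> \<epsilon>0"
 define D where "D = C \<inter> ball t \<epsilon>"
 have D: "convex D" using C by (simp add: D_def convex_Int)
 have DB: "s = t" if "s \<in> D" "s \<in> B" for s using that B eps by (auto simp: D_def)
 have miss: "seg x y \<inter> B = {}" if xy: "x \<in> D" "x \<notin> B" "y \<in> D" "y \<notin> B" for x y
 proof -
  have "False" if s: "s \<in> seg x y" "s \<in> B" for s
  proof -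
   have "s = t" using DB closed_segment_subset[OF xy(1,3) D] s by blast
   moreover have "s \<in> open_segment x y" using s xy by (intro in_open_segment_if) auto
   ultimately show False using ext[of x y] s xy by (simp add: D_def)
  qed
  then show ?thesis by blast
 qed
 show "good_ball C B \<kappa> t \<epsilon>"
 proof (rule good_ball_linked; fold D_def)
  obtain y where y: "y \<in> open_segment z t" "dist t y < \<epsilon>" using open_segment_near[of z t \<epsilon>] z eps by auto
  then have "y \<in> C" "y \<noteq> t" using closed_segment_subset[OF z(1) C(2,1)] by (auto simp: open_segment_def)
  then have "y \<in> D" "y \<notin> B" using y DB by (auto simp: D_def)
  then show "D - B \<noteq> {}" by blast
 next
  fix x q assume q: "q \<in> Q"
  have "flat D B \<kappa> (\<lambda>_. q)" by (rule flatI) (use miss q in blast)+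
  then show "\<exists>f. flat D B \<kappa> f \<and> f x = q" by blast
 next
  fix x y assume "x \<in> D" "x \<notin> B" "y \<in> D" "y \<notin> B"
  then have "linked D B \<kappa> x y" unfolding linked_def using miss[of x y] by blast
  then show "equivclp (linked D B \<kappa>) x y" by (rule r_into_equivclp)
 qed
qed

text \<open>Model for a straight piece of shadow. The color may be missing at \<open>t\<close>
  itself when \<open>t\<close> is an extreme point of \<open>C\<close>, because a crossing at
  \<open>t\<close> cannot occur; this happens where a strand leaves from a corner of the
  triangle.\<close>

lemma good_line:
 fixes A :: "'v::euclidean_space \<Rightarrow> real"
 assumes C: "convex C" "t \<in> C" and e0: "\<epsilon>0 > 0" and A: "linear A"
  and B: "\<And>x. x \<in> C \<Longrightarrow> x \<in> ball t \<epsilon>0 \<Longrightarrow> x \<in> B \<longleftrightarrow> A (x - t) = 0"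
  and \<kappa>: "\<And>x. x \<in> C \<Longrightarrow> x \<in> ball t \<epsilon>0 \<Longrightarrow> A (x - t) = 0 \<Longrightarrow>
    \<kappa> x = Some q \<or> (x = t \<and> (\<forall>x\<in>C. \<forall>y\<in>C. t \<notin> open_segment x y))" and q: "q \<in> Q"
  and z: "z \<in> C" "A (z - t) \<noteq> 0"
 shows "good C B \<kappa> t"
 unfolding good_def
proof (intro exI[of _ \<epsilon>0] conjI allI impI e0)
 fix \<epsilon> assume eps: "0 < \<epsilon> \<and> \<epsilon> \<le> \<epsilon>0"
 define D where "D = C \<inter> ball t \<epsilon>"
 have D: "convex D" using C by (simp add: D_def convex_Int)
 have DB: "s \<in> B \<longleftrightarrow> A (s - t) = 0" if "s \<in> D" for s using that B eps by (auto simp: D_def)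
 have sub: "seg x y \<subseteq> D" if "x \<in> D" "y \<in> D" for x y
  by (rule closed_segment_subset[OF that D])
 have kap: "\<kappa> s = Some q" if xy: "x \<in> D" "x \<notin> B" "y \<in> D" "y \<notin> B" and s: "s \<in> seg x y" "A (s - t) = 0" for x y s
 proof -
  have sD: "s \<in> D" using sub[OF xy(1,3)] s by blast
  then have "s \<in> open_segment x y" using s xy DB by (intro in_open_segment_if) auto
  then show ?thesis using \<kappa>[of s] sD s(2) xy eps by (auto simp: D_def)
 qed
 have same: "seg x y \<inter> B = {}" if xy: "x \<in> D" "x \<notin> B" "y \<in> D" "y \<notin> B" and sgn: "A (x - t) > 0 \<longleftrightarrow> A (y - t) > 0" for x y
 proof -
  have "False" if s: "s \<in> seg x y" "s \<in> B" for s
  proof -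
   have "A (s - t) = 0" using DB sub[OF xy(1,3)] s by blast
   then show False using affine_sign_change[OF A s(1)] DB xy sgn by blast
  qed
  then show ?thesis by blast
 qed
 have diff: "\<exists>s. seg x y \<inter> B = {s} \<and> \<kappa> s = Some q"
  if xy: "x \<in> D" "x \<notin> B" "y \<in> D" "y \<notin> B" and sgn: "A (x - t) > 0 \<longleftrightarrow> \<not> A (y - t) > 0" for x y
 proof -
  have nz: "A (x - t) \<noteq> 0" "A (y - t) \<noteq> 0" using xy DB by blast+
  then obtain s where s: "s \<in> seg x y" "A (s - t) = 0" using affine_zero_on_segment[OF A sgn] by blast
  have "seg x y \<inter> B = {s}"
   using affine_zero_unique[OF A s _ _ nz(1)] s DB sub[OF xy(1,3)] by blast
  then show ?thesis using kap[OF xy s] by blast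
 qed
 show "good_ball C B \<kappa> t \<epsilon>"
 proof (rule good_ball_linked; fold D_def)
  obtain \<eta> where eta: "0 < \<eta>" "\<eta> < 1" "t + \<eta> *\<^sub>R (z - t) \<in> ball t \<epsilon>"
   using scaled_into_ball[of \<epsilon> t "z - t"] eps by (metis abs_of_pos order_refl)
  have "t + \<eta> *\<^sub>R (z - t) \<in> C"
   using in_segment_param[of \<eta> t z] closed_segment_subset[OF C(2) z(1) C(1)] eta by auto
  then have "t + \<eta> *\<^sub>R (z - t) \<in> D" using eta by (simp add: D_def)
  moreover have "A (t + \<eta> *\<^sub>R (z - t) - t) \<noteq> 0" using z A eta by (simp add: linear_cmul)
  ultimately have "t + \<eta> *\<^sub>R (z - t) \<in> D - B" using DB by blast
  then show "D - B \<noteq> {}" by blast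
 next
  fix x0 r assume "x0 \<in> D" "x0 \<notin> B" and r: "r \<in> Q"
  show "\<exists>f. flat D B \<kappa> f \<and> f x0 = r"
  proof (rule two_sided_flat[where S = "\<lambda>x. A (x - t) > 0", OF _ _ q r])
   show "A (x - t) > 0 \<longleftrightarrow> A (y - t) > 0" if "x \<in> D" "x \<notin> B" "y \<in> D" "y \<notin> B" "seg x y \<inter> B = {}" for x y
    using diff[OF that(1-4)] that(5) by auto
   show "q' = q \<and> (A (x - t) > 0 \<longleftrightarrow> \<not> A (y - t) > 0)"
    if "x \<in> D" "x \<notin> B" "y \<in> D" "y \<notin> B" "seg x y \<inter> B = {s}" "\<kappa> s = Some q'" for x y s q'
    using same[OF that(1-4)] diff[OF that(1-4)] that(5,6) by auto
  qed
 next
  fix x y assume "x \<in> D" "x \<notin> B" "y \<in> D" "y \<notin> B"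
  then have "linked D B \<kappa> x y" unfolding linked_def using same[of x y] diff[of x y] q by blast
  then show "equivclp (linked D B \<kappa>) x y" by (rule r_into_equivclp)
 qed
qed

text \<open>Model for a bend of the shadow, in coordinates in which the two arms are the nonnegative
  half axes. They bound the open convex sector \<open>S\<close>. The rest \<open>N\<close> is not
  convex, so it has to be excluded that a segment with both ends in \<open>N\<close> meets an arm
  exactly once. The apex carries no color, because a segment through it may or may not change
  sides.\<close>

lemma good_sector:
 fixes A E :: "'v::euclidean_space \<Rightarrow> real"
 assumes e0: "\<epsilon>0 > 0" "ball t \<epsilon>0 \<subseteq> C" and A: "linear A" and E: "linear E"
  and basis: "A a = 1" "A e = 0" "E a = 0" "E e = 1" and inj: "\<And>v. A v = 0 \<Longrightarrow> E v = 0 \<Longrightarrow> v = 0"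
  and B: "\<And>x. x \<in> ball t \<epsilon>0 \<Longrightarrow>
   x \<in> B \<longleftrightarrow> (A (x - t) = 0 \<and> E (x - t) \<ge> 0) \<or> (E (x - t) = 0 \<and> A (x - t) \<ge> 0)"
  and \<kappa>t: "\<kappa> t = None" and \<kappa>: "\<And>x. x \<in> ball t \<epsilon>0 \<Longrightarrow> x \<in> B \<Longrightarrow> x \<noteq> t \<Longrightarrow> \<kappa> x = Some q" and q: "q \<in> Q"
 shows "good C B \<kappa> t"
 unfolding good_def
proof (intro exI[of _ \<epsilon>0] conjI allI impI e0)
 fix \<epsilon> assume eps: "0 < \<epsilon> \<and> \<epsilon> \<le> \<epsilon>0"
 define D where "D = C \<inter> ball t \<epsilon>"
 have Dball: "D = ball t \<epsilon>" using e0 eps by (auto simp: D_def)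
 have D: "convex D" by (simp add: Dball)
 have DB: "s \<in> B \<longleftrightarrow> (A (s - t) = 0 \<and> E (s - t) \<ge> 0) \<or> (E (s - t) = 0 \<and> A (s - t) \<ge> 0)" if "s \<in> D" for s
  using that B[of s] eps by (auto simp: Dball)
 have sub: "seg x y \<subseteq> D" if "x \<in> D" "y \<in> D" for x y
  by (rule closed_segment_subset[OF that D])
 have kap: "\<kappa> s = Some q" if "s \<in> D" "s \<in> B" "s \<noteq> t" for s
  using \<kappa>[of s] that eps by (simp add: Dball)
 define S where "S x \<longleftrightarrow> A (x - t) > 0 \<and> E (x - t) > 0" for x
 define N where "N x \<longleftrightarrow> A (x - t) < 0 \<or> E (x - t) < 0" for x
 have SN: "\<not> S x \<longleftrightarrow> N x" if "x \<in> D" "x \<notin> B" for x using DB[OF that(1)] that(2) unfolding S_def N_def by linarith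
 have BSN: "\<not> S x" "\<not> N x" if "x \<in> D" "x \<in> B" for x using DB[OF that(1)] that(2) unfolding S_def N_def by linarith+
 have "continuous_on UNIV (\<lambda>x. F (x - t))" if "linear F" for F :: "'v \<Rightarrow> real"
  by (rule bounded_linear.continuous_on[OF that[unfolded linear_conv_bounded_linear]]) (intro continuous_intros)
 note cont = this[OF A] this[OF E]
 have op: "open {x. S x}" "open {x. N x}" unfolding S_def N_def
  by (intro open_Collect_conj open_Collect_disj open_Collect_less continuous_on_const cont)+
 have leave: "seg x y \<inter> B \<noteq> {}" if xy: "x \<in> D" "y \<in> D" and "S x" "N y" for x y
 proof
  assume "seg x y \<inter> B = {}"
  then have "seg x y \<subseteq> {x. S x} \<union> {x. N x}" using SN sub[OF xy] by blast
  moreover have "{x. S x} \<inter> {x. N x} \<inter> seg x y = {}" unfolding S_def N_def by auto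
  ultimately have "{x. S x} \<inter> seg x y = {} \<or> {x. N x} \<inter> seg x y = {}"
   using connectedD[OF connected_segment(1) op] by blast
  then show False using that(3,4) ends_in_segment[of x y] by blast
 qed
 have conv: "S p" if xy: "S x" "S y" and p: "p \<in> seg x y" for x y p
 proof -
  obtain u where u: "0 \<le> u" "u \<le> 1" "p = x + u *\<^sub>R (y - x)" using p by (rule closed_segment_paramE)
  have "A (p - t) = (1 - u) * A (x - t) + u * A (y - t)" "E (p - t) = (1 - u) * E (x - t) + u * E (y - t)"
   unfolding u(3) affine_along[OF A] affine_along[OF E] by (simp_all add: algebra_simps)
  then show ?thesis using xy u unfolding S_def by (cases "u = 0") (auto intro!: add_nonneg_pos)
 qed
 text \<open>A segment that touches one side of the sector away from the apex enters the sector there.\<close>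
 have touch: False if xy: "x \<in> D" "x \<notin> B" "y \<in> D" "y \<notin> B" "N x" "N y" and s: "seg x y \<inter> B = {s}" "F (s - t) = 0" "G (s - t) > 0"
   and FG: "(F = A \<and> G = E) \<or> (F = E \<and> G = A)" for x y s F G
 proof -
  have lin: "linear F" "linear G" using FG A E by auto
  have sxy: "s \<in> seg x y" "s \<in> B" using s(1) by blast+
  obtain v where v: "0 \<le> v" "v \<le> 1" "s = x + v *\<^sub>R (y - x)" using sxy(1) by (rule closed_segment_paramE)
  have "(1 - v) * F (x - t) + v * F (y - t) = 0" using s(2) unfolding v(3) affine_along[OF lin(1)] by (simp add: algebra_simps)
  then have "F (x - t) \<ge> 0 \<or> F (y - t) \<ge> 0" using v(1,2) by (smt (verit) mult_nonneg_nonpos mult_pos_neg)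
  then obtain w where w: "w \<in> {x, y}" "F (w - t) \<ge> 0" by blast
  have wD: "w \<in> D" "N w" "w \<in> seg x y" "w \<noteq> s" using w(1) xy sxy(2) by auto
  \<comment> \<open>The step from \<open>s\<close> towards \<open>w\<close> is short enough to keep
    \<open>G\<close> positive while \<open>F\<close> stays nonnegative, so \<open>p\<close> lies in
    the sector.\<close>
  define u where "u = G (s - t) / (2 * (G (s - t) + \<bar>G (w - t)\<bar>))"
  have u: "0 < u" "u < 1" using s(3) by (auto simp: u_def divide_simps)
  define p where "p = s + u *\<^sub>R (w - s)"
  have psw: "p \<in> seg s w" using in_segment_param[of u s w] u by (simp add: p_def)
  then have pxy: "p \<in> seg x y" using subset_closed_segment[of s w x y] sxy(1) wD(3) by blast
  have Fp: "F (p - t) = u * F (w - t)" unfolding p_def affine_along[OF lin(1)] using s(2) by simp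
  have "u * (G (s - t) - G (w - t)) \<le> u * (G (s - t) + \<bar>G (w - t)\<bar>)" using u by (intro mult_left_mono) auto
  also have "\<dots> = G (s - t) / 2" using s(3) by (auto simp: u_def field_simps)
  finally have Gp: "G (p - t) > 0" unfolding p_def affine_along[OF lin(2)] using s(3) by (simp add: algebra_simps)
  have ps: "p \<noteq> s" using u wD(4) by (simp add: p_def)
  have pD: "p \<in> D" using sub[OF xy(1,3)] pxy by blast
  have only: "b = s" if "b \<in> seg x y" "b \<in> B" for b using IntI[OF that] unfolding s(1) by (rule singletonD)
  have "p \<notin> B" using only[OF pxy] ps by blast
  then have "F (p - t) \<noteq> 0" using DB[OF pD] FG Gp by (elim disjE conjE) simp_all
  moreover have "F (p - t) \<ge> 0" unfolding Fp using u(1) w(2) by simp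
  ultimately have "S p" using FG Gp unfolding S_def by (elim disjE conjE) simp_all
  from leave[OF pD wD(1) this wD(2)] obtain b where b: "b \<in> seg p w" "b \<in> B" by blast
  have "b = s" using b subset_closed_segment[of p w x y] pxy wD(3) by (intro only) blast+
  then have "s \<in> seg p w" using b(1) by simp
  then have "between (p, w) s" "between (s, w) p" using psw by (simp_all add: between_mem_segment)
  then show False using between_antisym[of p w s] ps by simp
 qed
 have cross: "(S x \<longleftrightarrow> \<not> S y) \<and> \<kappa> s = Some q" if xy: "x \<in> D" "x \<notin> B" "y \<in> D" "y \<notin> B"
  and s: "seg x y \<inter> B = {s}" "s \<noteq> t" for x y s
 proof -
  have sD: "s \<in> D" "s \<in> B" "s \<in> seg x y" using sub[OF xy(1,3)] s by auto
  have "A (s - t) \<noteq> 0 \<or> E (s - t) \<noteq> 0" using inj[of "s - t"] s(2) by auto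
  then have "A (s - t) = 0 \<and> E (s - t) > 0 \<or> E (s - t) = 0 \<and> A (s - t) > 0" using DB[OF sD(1)] sD(2) by force
  then have "\<not> (N x \<and> N y)" using touch[OF xy _ _ s(1)] by blast
  moreover have "\<not> (S x \<and> S y)" using conv[of x y s] BSN(1)[OF sD(1,2)] sD(3) by blast
  ultimately show ?thesis using SN[OF xy(1,2)] SN[OF xy(3,4)] kap[OF sD(1,2) s(2)] by blast
 qed
 obtain \<eta> where eta: "0 < \<eta>" "\<And>r. \<bar>r\<bar> \<le> \<eta> \<Longrightarrow> t + r *\<^sub>R (a + e) \<in> ball t \<epsilon>" "\<And>r. \<bar>r\<bar> \<le> \<eta> \<Longrightarrow> t + r *\<^sub>R (2 *\<^sub>R a + e) \<in> ball t \<epsilon>"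
 proof -
  obtain \<eta>1 where 1: "0 < \<eta>1" "\<And>r. \<bar>r\<bar> \<le> \<eta>1 \<Longrightarrow> t + r *\<^sub>R (a + e) \<in> ball t \<epsilon>" using scaled_into_ball[of \<epsilon>] eps by blast
  obtain \<eta>2 where 2: "0 < \<eta>2" "\<And>r. \<bar>r\<bar> \<le> \<eta>2 \<Longrightarrow> t + r *\<^sub>R (2 *\<^sub>R a + e) \<in> ball t \<epsilon>" using scaled_into_ball[of \<epsilon>] eps by blast
  show ?thesis by (rule that[of "min \<eta>1 \<eta>2"]) (use 1 2 in auto)
 qed
 \<comment> \<open>Doubling the component along \<open>a\<close> in \<open>y\<close> makes the
   segment from \<open>z\<close> to \<open>y\<close> pass beside the apex and cross the arm
   \<open>E = 0\<close> at its midpoint. This segment links the two sides.\<close>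
 define y z where "y = t + \<eta> *\<^sub>R (2 *\<^sub>R a + e)" and "z = t + (- \<eta>) *\<^sub>R (a + e)"
 have yzD: "y \<in> D" "z \<in> D" unfolding y_def z_def Dball using eta by (simp_all del: scaleR_minus_left)
 have val: "A (y - t) = 2 * \<eta>" "E (y - t) = \<eta>" "A (z - t) = - \<eta>" "E (z - t) = - \<eta>"
  unfolding y_def z_def using A E basis by (simp_all add: linear_add linear_cmul linear_diff linear_neg)
 have SNyz: "S y" "N z" using val eta(1) by (simp_all add: S_def N_def)
 then have yzB: "y \<notin> B" "z \<notin> B" using BSN[OF yzD(1)] BSN[OF yzD(2)] by blast+
 have "\<exists>s. seg z y \<inter> B = {s} \<and> s \<noteq> t"
 proof -
  have "p \<in> B \<longleftrightarrow> p = z + (1 / 2) *\<^sub>R (y - z)" if p: "p \<in> seg z y" for p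
  proof -
   obtain u where u: "0 \<le> u" "u \<le> 1" "p = z + u *\<^sub>R (y - z)" using p by (rule closed_segment_paramE)
   have "A (p - t) = \<eta> * (3 * u - 1)" "E (p - t) = \<eta> * (2 * u - 1)" unfolding u(3) affine_along[OF A] affine_along[OF E] val by (simp_all add: algebra_simps)
   moreover have "p \<in> D" using sub[OF yzD(2,1)] p by blast
   ultimately have "p \<in> B \<longleftrightarrow> u = 1 / 2" using DB eta(1) by (auto simp: zero_le_mult_iff)
   moreover have "y \<noteq> z" using SNyz unfolding S_def N_def by auto
   ultimately show ?thesis unfolding u(3) by simp
  qed
  then have "seg z y \<inter> B = {z + (1 / 2) *\<^sub>R (y - z)}" using in_segment_param[of "1 / 2" z y] by auto
  moreover have "A (z + (1 / 2) *\<^sub>R (y - z) - t) \<noteq> 0" unfolding affine_along[OF A] val using eta(1) by simp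
  ultimately show ?thesis using A by (auto simp: linear_0)
 qed
 then obtain s where s: "seg z y \<inter> B = {s}" "s \<noteq> t" by blast
 have zy: "linked D B \<kappa> z y"
  using cross[OF yzD(2) yzB(2) yzD(1) yzB(1) s] yzD yzB s(1) q unfolding linked_def by blast
 have base: "equivclp (linked D B \<kappa>) x z" if x: "x \<in> D" "x \<notin> B" for x
 proof (cases "S x")
  case True
  have "seg x y \<inter> B = {}" using conv[OF True SNyz(1)] BSN(1) sub[OF x(1) yzD(1)] by blast
  then have "linked D B \<kappa> x y" unfolding linked_def using x yzD yzB by blast
  then show ?thesis using zy by (meson equivclp_sym equivclp_trans r_into_equivclp)
 next
  case False
  then have "N x" using SN[OF x] by blast
  \<comment> \<open>The set \<open>N\<close> is star-shaped around \<open>z\<close>, both of whose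
    coordinates are negative.\<close>
  have "N p" if p: "p \<in> seg z x" for p
  proof -
   obtain u where u: "0 \<le> u" "u \<le> 1" "p = z + u *\<^sub>R (x - z)" using p by (rule closed_segment_paramE)
   have "A (p - t) = u * A (x - t) - (1 - u) * \<eta>" "E (p - t) = u * E (x - t) - (1 - u) * \<eta>"
    unfolding u(3) affine_along[OF A] affine_along[OF E] val by (simp_all add: algebra_simps)
   moreover have "u * r - (1 - u) * \<eta> < 0" if "r < 0" for r
   proof (cases "u = 0")
    case False
    then have "u * r < 0" "0 \<le> (1 - u) * \<eta>" using u that eta(1) by (simp_all add: mult_pos_neg)
    then show ?thesis by linarith
   qed (use eta(1) in simp)
   ultimately show ?thesis using \<open>N x\<close> unfolding N_def by metis
  qed
  then have "seg z x \<inter> B = {}" using BSN(2) sub[OF yzD(2) x(1)] by blast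
  then have "linked D B \<kappa> z x" unfolding linked_def using x yzD yzB by blast
  then show ?thesis by (meson equivclp_sym r_into_equivclp)
 qed
 show "good_ball C B \<kappa> t \<epsilon>"
 proof (rule good_ball_linked; fold D_def)
  show "D - B \<noteq> {}" using yzD yzB by blast
  show "equivclp (linked D B \<kappa>) x y" if "x \<in> D" "x \<notin> B" "y \<in> D" "y \<notin> B" for x y
   using base[OF that(1,2)] base[OF that(3,4)] by (meson equivclp_sym equivclp_trans)
  fix x0 r assume "r \<in> Q"
  show "\<exists>f. flat D B \<kappa> f \<and> f x0 = r"
  proof (rule two_sided_flat[where S = S, OF _ _ q \<open>r \<in> Q\<close>])
   show "S x \<longleftrightarrow> S y" if xy: "x \<in> D" "x \<notin> B" "y \<in> D" "y \<notin> B" "seg x y \<inter> B = {}" for x y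
    using leave[OF xy(1,3)] leave[OF xy(3,1)] SN[OF xy(1,2)] SN[OF xy(3,4)] xy(5) closed_segment_commute[of x y] by metis
   show "q' = q \<and> (S x \<longleftrightarrow> \<not> S y)" if xy: "x \<in> D" "x \<notin> B" "y \<in> D" "y \<notin> B" "seg x y \<inter> B = {s}" "\<kappa> s = Some q'" for x y s q'
    using cross[OF xy(1-5)] xy(6) \<kappa>t by (cases "s = t") auto
  qed
 qed
qed

text \<open>Model for a double point of the shadow. The wall \<open>A = 0\<close> belongs to the
  upper strand, of color \<open>q\<close>; the lower strand is \<open>E = 0\<close>, and its color
  changes from \<open>p\<close> to \<open>p \<rhd> q\<close> where it passes under. Going around the
  double point is consistent by self-distributivity.\<close>

lemma good_cross:
 fixes A E :: "'v::euclidean_space \<Rightarrow> real"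
 assumes e0: "\<epsilon>0 > 0" "ball t \<epsilon>0 \<subseteq> C" and A: "linear A" and E: "linear E"
  and basis: "A a = 1" "A e = 0" "E a = 0" "E e = 1" and inj: "\<And>v. A v = 0 \<Longrightarrow> E v = 0 \<Longrightarrow> v = 0"
  and B: "\<And>x. x \<in> ball t \<epsilon>0 \<Longrightarrow> x \<in> B \<longleftrightarrow> A (x - t) = 0 \<or> E (x - t) = 0"
  and \<kappa>t: "\<kappa> t = None"
  and \<kappa>A: "\<And>x. x \<in> ball t \<epsilon>0 \<Longrightarrow> A (x - t) = 0 \<Longrightarrow> E (x - t) \<noteq> 0 \<Longrightarrow> \<kappa> x = Some q"
  and \<kappa>E: "\<And>x. x \<in> ball t \<epsilon>0 \<Longrightarrow> E (x - t) = 0 \<Longrightarrow> A (x - t) > 0 \<Longrightarrow> \<kappa> x = Some p"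
  and \<kappa>E': "\<And>x. x \<in> ball t \<epsilon>0 \<Longrightarrow> E (x - t) = 0 \<Longrightarrow> A (x - t) < 0 \<Longrightarrow> \<kappa> x = Some (p \<rhd> q)"
  and q: "q \<in> Q" "p \<in> Q"
 shows "good C B \<kappa> t"
 unfolding good_def
proof (intro exI[of _ \<epsilon>0] conjI allI impI e0)
 fix \<epsilon> assume eps: "0 < \<epsilon> \<and> \<epsilon> \<le> \<epsilon>0"
 define D where "D = C \<inter> ball t \<epsilon>"
 have Dball: "D = ball t \<epsilon>" using e0 eps by (auto simp: D_def)
 have D: "convex D" by (simp add: Dball)
 have D0: "s \<in> ball t \<epsilon>0" if "s \<in> D" for s using that eps by (simp add: Dball)
 have DB: "s \<in> B \<longleftrightarrow> A (s - t) = 0 \<or> E (s - t) = 0" if "s \<in> D" for s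
  using B[OF D0[OF that]] .
 have sub: "seg x y \<subseteq> D" if "x \<in> D" "y \<in> D" for x y
  by (rule closed_segment_subset[OF that D])
 define a' where "a' x \<longleftrightarrow> A (x - t) > 0" for x
 define e' where "e' x \<longleftrightarrow> E (x - t) > 0" for x
 have nz: "A (x - t) \<noteq> 0" "E (x - t) \<noteq> 0" if "x \<in> D" "x \<notin> B" for x using DB that by auto
 have same: "seg x y \<inter> B = {}" if xy: "x \<in> D" "x \<notin> B" "y \<in> D" "y \<notin> B" "a' x = a' y" "e' x = e' y" for x y
 proof -
  have "False" if s: "s \<in> seg x y" "s \<in> B" for s
  proof -
   have "A (s - t) = 0 \<or> E (s - t) = 0" using DB sub[OF xy(1,3)] s by blast
   then show False using affine_sign_change[OF A s(1) _ nz(1)[OF xy(1,2)] nz(1)[OF xy(3,4)]]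
    affine_sign_change[OF E s(1) _ nz(2)[OF xy(1,2)] nz(2)[OF xy(3,4)]] xy(5,6) by (auto simp: a'_def e'_def)
  qed
  then show ?thesis by blast
 qed
 have miss: "a' x = a' y" "e' x = e' y" if xy: "x \<in> D" "x \<notin> B" "y \<in> D" "y \<notin> B" "seg x y \<inter> B = {}" for x y
 proof -
  have *: "A (s - t) \<noteq> 0" "E (s - t) \<noteq> 0" if "s \<in> seg x y" for s using DB[of s] sub[OF xy(1,3)] xy(5) that by auto
  show "a' x = a' y" using affine_zero_on_segment[OF A, of x t y] nz(1)[OF xy(1,2)] nz(1)[OF xy(3,4)] * by (auto simp: a'_def)
  show "e' x = e' y" using affine_zero_on_segment[OF E, of x t y] nz(2)[OF xy(1,2)] nz(2)[OF xy(3,4)] * by (auto simp: e'_def)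
 qed
 have once: "(F (x - t) > 0 \<longleftrightarrow> \<not> F (y - t) > 0) \<and> (G (x - t) > 0 \<longleftrightarrow> G (s - t) > 0) \<and> (G (y - t) > 0 \<longleftrightarrow> G (s - t) > 0)"
  if FG: "(F = A \<and> G = E) \<or> (F = E \<and> G = A)" and xy: "x \<in> D" "x \<notin> B" "y \<in> D" "y \<notin> B" and s: "seg x y \<inter> B = {s}"
   and F: "F (s - t) = 0" "G (s - t) \<noteq> 0" for x y s F G
 proof -
  have lin: "linear F" "linear G" using FG A E by auto
  have ss: "s \<in> seg x y" using s by auto
  have G: "G (w - t) > 0 \<longleftrightarrow> G (s - t) > 0" if w: "w \<in> D" "w \<notin> B" "w \<in> seg x y" for w
  proof (rule ccontr)
   assume *: "\<not> (G (w - t) > 0 \<longleftrightarrow> G (s - t) > 0)"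
   have "G (w - t) \<noteq> 0" using nz[OF w(1,2)] FG by auto
   then obtain v where v: "v \<in> seg w s" "G (v - t) = 0"
    using affine_zero_on_segment[OF lin(2), of w t s] * F(2) by blast
   have v2: "v \<in> seg x y" using v(1) subset_closed_segment[of w s x y] w(3) ss by auto
   then have "v \<in> D" using sub[OF xy(1,3)] by blast
   then have "v \<in> B" using DB FG v(2) by auto
   then have "v = s" using s v2 by blast
   then show False using v(2) F(2) by simp
  qed
  have "F (x - t) \<noteq> 0" "F (y - t) \<noteq> 0" using nz[OF xy(1,2)] nz[OF xy(3,4)] FG by auto
  then show ?thesis using G[OF xy(1,2)] G[OF xy(3,4)] affine_sign_change[OF lin(1) ss F(1)] by auto
 qed
 have cross: "(a' x \<longleftrightarrow> \<not> a' y) \<and> e' x = e' y \<and> \<kappa> s = Some q \<or>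
   a' x = a' y \<and> (e' x \<longleftrightarrow> \<not> e' y) \<and> \<kappa> s = Some (if a' x then p else p \<rhd> q)"
  if xy: "x \<in> D" "x \<notin> B" "y \<in> D" "y \<notin> B" and s: "seg x y \<inter> B = {s}" "s \<noteq> t" for x y s
 proof -
  have sD: "s \<in> D" "s \<in> B" using sub[OF xy(1,3)] s by auto
  have "A (s - t) \<noteq> 0 \<or> E (s - t) \<noteq> 0" using inj[of "s - t"] s(2) by auto
  then consider "A (s - t) = 0" "E (s - t) \<noteq> 0" | "E (s - t) = 0" "A (s - t) \<noteq> 0" using DB[OF sD(1)] sD(2) by blast
  then show ?thesis
  proof cases
   case 1
   then show ?thesis using once[of A E, OF _ xy s(1)] \<kappa>A[OF D0[OF sD(1)]] by (auto simp: a'_def e'_def)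
  next
   case 2
   have "a' x \<longleftrightarrow> A (s - t) > 0" "a' y \<longleftrightarrow> A (s - t) > 0" "e' x \<longleftrightarrow> \<not> e' y"
    using once[of E A, OF _ xy s(1)] 2 by (auto simp: a'_def e'_def)
   then show ?thesis using \<kappa>E[OF D0[OF sD(1)] 2(1)] \<kappa>E'[OF D0[OF sD(1)] 2(1)] 2(2)
    by (cases "A (s - t) > 0") auto
  qed
 qed
 have single: "\<exists>s. seg x y \<inter> B = {s} \<and> s \<noteq> t"
  if xy: "x \<in> D" "x \<notin> B" "y \<in> D" "y \<notin> B" and c: "(a' x \<longleftrightarrow> \<not> a' y) \<and> e' x = e' y \<or> a' x = a' y \<and> (e' x \<longleftrightarrow> \<not> e' y)" for x y
 proof -
  obtain F G where FG: "(F = A \<and> G = E) \<or> (F = E \<and> G = A)"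
   and sg: "F (x - t) > 0 \<longleftrightarrow> \<not> F (y - t) > 0" "G (x - t) > 0 \<longleftrightarrow> G (y - t) > 0"
   using c unfolding a'_def e'_def by blast
  have lin: "linear F" "linear G" using FG A E by auto
  have nF: "F (x - t) \<noteq> 0" "F (y - t) \<noteq> 0" "G (x - t) \<noteq> 0" "G (y - t) \<noteq> 0"
   using nz[OF xy(1,2)] nz[OF xy(3,4)] FG by auto
  have G: "G (w - t) \<noteq> 0" if "w \<in> seg x y" for w
   using affine_sign_change[OF lin(2) that _ nF(3,4)] sg(2) by blast
  obtain s where s: "s \<in> seg x y" "F (s - t) = 0" using affine_zero_on_segment[OF lin(1) sg(1) nF(1,2)] by blast
  have "seg x y \<inter> B = {s}"
  proof -
   have "w \<in> B \<longleftrightarrow> F (w - t) = 0" if "w \<in> seg x y" for w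
    using DB[of w] sub[OF xy(1,3)] that FG G[OF that] by auto
   then show ?thesis using affine_zero_unique[OF lin(1) s _ _ nF(1)] s by blast
  qed
  moreover have "s \<noteq> t" using G[OF s(1)] lin by (auto simp: linear_0)
  ultimately show ?thesis by blast
 qed
 have rep: "\<exists>z\<in>D. z \<notin> B \<and> a' z = i \<and> e' z = j" for i j
 proof -
  define v where "v = (if i then 1 else -1) *\<^sub>R a + (if j then 1 else -1) *\<^sub>R e"
  obtain \<eta> where eta: "0 < \<eta>" "t + \<eta> *\<^sub>R v \<in> ball t \<epsilon>"
   using scaled_into_ball[of \<epsilon> t v] eps by (metis abs_of_pos order_refl)
  have "A (t + \<eta> *\<^sub>R v - t) = \<eta> * (if i then 1 else -1)" "E (t + \<eta> *\<^sub>R v - t) = \<eta> * (if j then 1 else -1)"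
   using A E basis by (simp_all add: v_def linear_add linear_cmul linear_diff linear_neg)
  then show ?thesis using eta DB[of "t + \<eta> *\<^sub>R v"] unfolding a'_def e'_def
   by (intro bexI[of _ "t + \<eta> *\<^sub>R v"]) (auto simp: Dball)
 qed
 show "good_ball C B \<kappa> t \<epsilon>"
 proof (rule good_ball_linked; fold D_def)
  show "D - B \<noteq> {}" using rep by blast
 next
  fix x0 r assume x0: "x0 \<in> D" "x0 \<notin> B" "r \<in> Q"
  \<comment> \<open>\<open>w\<close> becomes the value on the quadrant where both coordinates are
    positive; it is found by undoing the crossings between that quadrant and
    \<open>x0\<close>.\<close>
  define w1 where "w1 = (if a' x0 then r else r \<rhd> q)"
  define w where "w = (if e' x0 then w1 else w1 \<rhd> p)"
  have w1: "w1 \<in> Q" and w: "w \<in> Q" using x0 q by (simp_all add: w1_def w_def act_closed)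
  define f1 where "f1 x = (if e' x then w else w \<rhd> p)" for x
  define f where "f x = (if a' x then f1 x else f1 x \<rhd> q)" for x
  have f1Q: "f1 x \<in> Q" for x using w q by (simp add: f1_def act_closed)
  have fQ: "f x \<in> Q" for x using f1Q q by (simp add: f_def act_closed)
  have "flat D B \<kappa> f"
  proof (rule flatI)
   fix x y assume xy: "x \<in> D" "x \<notin> B" "y \<in> D" "y \<notin> B" "seg x y \<inter> B = {}"
   then show "f y = f x" using miss[OF xy] by (simp add: f_def f1_def)
  next
   fix x y s q' assume xy: "x \<in> D" "x \<notin> B" "y \<in> D" "y \<notin> B" and s: "seg x y \<inter> B = {s}" "\<kappa> s = Some q'"
   have "s \<noteq> t" using s(2) \<kappa>t by auto
   from cross[OF xy s(1) this] show "f y = f x \<rhd> q'"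
   proof (elim disjE conjE)
    assume "a' x \<longleftrightarrow> \<not> a' y" "e' x = e' y" "\<kappa> s = Some q"
    then show ?thesis using s(2) act_invol[OF f1Q[of x] q(1)] by (auto simp: f_def f1_def)
   next
    assume *: "a' x = a' y" "e' x \<longleftrightarrow> \<not> e' y" "\<kappa> s = Some (if a' x then p else p \<rhd> q)"
    then have 1: "f1 y = f1 x \<rhd> p" using act_invol[OF w q(2)] by (auto simp: f1_def)
    \<comment> \<open>For negative \<open>A\<close> the value and the color of the lower strand are
      both moved by \<open>q\<close>, and distributivity turns the crossing with \<open>p\<close>
      into a crossing with \<open>p \<rhd> q\<close>.\<close>
    show ?thesis
     using * s(2) 1 act_distrib[OF f1Q[of x] q(2) q(1)] by (auto simp: f_def)
   qed
  qed (rule fQ)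
  moreover have "f x0 = r"
   using act_invol[OF w1 q(2)] act_invol[OF x0(3) q(1)] by (auto simp: f_def f1_def w_def w1_def)
  ultimately show "\<exists>f. flat D B \<kappa> f \<and> f x0 = r" by blast
 next
  fix x y assume x: "x \<in> D" "x \<notin> B" and y: "y \<in> D" "y \<notin> B"
  have 1: "linked D B \<kappa> x y" if xy: "x \<in> D" "x \<notin> B" "y \<in> D" "y \<notin> B"
   "a' x = a' y \<and> e' x = e' y \<or> (a' x \<longleftrightarrow> \<not> a' y) \<and> e' x = e' y \<or> a' x = a' y \<and> (e' x \<longleftrightarrow> \<not> e' y)" for x y
  proof (cases "a' x = a' y \<and> e' x = e' y")
   case True
   then show ?thesis unfolding linked_def using same[OF that(1-4)] that(1-4) by blast
  next
   case False
   then obtain s where s: "seg x y \<inter> B = {s}" "s \<noteq> t" using single[OF xy(1-4)] xy(5) by blast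
   then obtain q' where "\<kappa> s = Some q'" "q' \<in> Q" using cross[OF xy(1-4) s] q act_closed by auto
   then show ?thesis unfolding linked_def using s(1) that(1-4) by blast
  qed
  \<comment> \<open>Opposite quadrants are joined through an adjacent one, since a direct segment
    might pass through the double point.\<close>
  obtain z where z: "z \<in> D" "z \<notin> B" "a' z = a' x" "e' z = e' y" using rep by blast
  have "linked D B \<kappa> x z" "linked D B \<kappa> z y" using z by (intro 1 x y z(1,2); blast)+
  then show "equivclp (linked D B \<kappa>) x y" by (meson equivclp_trans r_into_equivclp)
 qed
qed

end


section \<open>Links in regular position\<close>

definition det2 :: "plane \<Rightarrow> plane \<Rightarrow> real" where
 "det2 x y = fst x * snd y - snd x * fst y"

lemma linear_det2: "linear (det2 x)"
 by (intro linearI) (auto simp: det2_def algebra_simps)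

lemma det2_zeroE:
 assumes "det2 x y = 0" "x \<noteq> 0"
 obtains k where "y = k *\<^sub>R x"
proof -
 define n where "n = fst x * fst x + snd x * snd x"
 have n: "n \<noteq> 0" using assms(2) unfolding n_def by (auto simp: sum_squares_eq_zero_iff prod_eq_iff)
 have "n * fst y = (fst x * fst y + snd x * snd y) * fst x" "n * snd y = (fst x * fst y + snd x * snd y) * snd x"
  using assms(1) unfolding n_def det2_def by algebra+
 then have "y = ((fst x * fst y + snd x * snd y) / n) *\<^sub>R x"
  using n by (auto simp: prod_eq_iff field_simps)
 then show ?thesis by (rule that)
qed

lemma det2_scaleR: "det2 x (k *\<^sub>R x) = 0"
 by (simp add: det2_def)

lemma det2_self: "det2 x x = 0"
 by (simp add: det2_def)

lemma det2_commute: "det2 y x = - det2 x y"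
 by (simp add: det2_def)

lemma fst_closed_segment: "fst ` seg x y = seg (fst x) (fst y)"
 by (simp add: closed_segment_linear_image linear_fst)

lemma edge_hull: "conv {p, q} = seg p q"
 by (simp add: segment_convex_hull)

lemma edge_hull_subset: "e \<in> K \<Longrightarrow> conv e \<subseteq> edge_union K"
 by (auto simp: edge_union_def)

lemma edge_unionE:
 assumes "x \<in> edge_union K"
 obtains e where "e \<in> K" "x \<in> conv e"
 using assms by (auto simp: edge_union_def)

lemma edge_union_Un: "edge_union (A \<union> B) = edge_union A \<union> edge_union B"
 by (auto simp: edge_union_def)

lemma edgeE:
 assumes "polygonal_link K" "e \<in> K"
 obtains p q where "e = {p, q}" "p \<noteq> q" "conv e = seg p q"
proof -
 have "card e = 2" using assms by (simp add: polygonal_link_def)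
 from card_2_iff[THEN iffD1, OF this] obtain p q where "e = {p, q}" "p \<noteq> q" by (elim exE conjE)
 then show ?thesis using that[of p q] edge_hull[of p q] by simp
qed

lemma edges_meet:
 "polygonal_link K \<Longrightarrow> e \<in> K \<Longrightarrow> f \<in> K \<Longrightarrow> e \<noteq> f \<Longrightarrow> conv e \<inter> conv f = e \<inter> f"
 by (simp add: polygonal_link_def)

lemma finite_link: "polygonal_link K \<Longrightarrow> finite K"
 by (simp add: polygonal_link_def)

lemma edge_compact:
 assumes "polygonal_link K" "e \<in> K" shows "compact (conv e)"
 using edgeE[OF assms] by (metis compact_segment(1))

lemma edge_union_compact: "polygonal_link K \<Longrightarrow> E \<subseteq> K \<Longrightarrow> compact (edge_union E)"
 unfolding edge_union_def by (intro compact_UN) (auto simp: finite_link finite_subset edge_compact subset_iff)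

lemma vertex_in_edge_union: "v \<in> \<Union>K \<Longrightarrow> v \<in> edge_union K"
 unfolding edge_union_def by (blast intro: hull_inc)

lemma vertex_of_edge:
 assumes "polygonal_link K" "e \<in> K" "v \<in> \<Union>K" "v \<in> conv e"
 shows "v \<in> e"
 using assms(1,2,3,4) edges_meet hull_inc by fastforce

lemma nonvertex_edge_unique:
 assumes "polygonal_link K" "e \<in> K" "f \<in> K" "v \<notin> \<Union>K" "v \<in> conv e" "v \<in> conv f"
 shows "e = f"
 using edges_meet[OF assms(1-3)] assms(2,4-6) by blast

lemma regular_vertex:
 assumes "regular_position K" "v \<in> \<Union>K" "p \<in> edge_union K" "fst p = fst v"
 shows "p = v"
 using assms unfolding regular_position_def by blast

lemma regular_triple:
 assumes "regular_position K" "p \<in> edge_union K" "q \<in> edge_union K" "r \<in> edge_union K" "fst p = fst q" "fst q = fst r"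
 shows "p = q \<or> q = r \<or> p = r"
 using assms by (simp add: regular_position_def)

text \<open>Of two arms that start at the same projected point in the same projected direction, the
  shorter one ends at a vertex with the same projection as some point of the other edge. Regularity
  identifies the two points, so the edges share this vertex or coincide.\<close>

lemma same_direction:
 assumes K: "polygonal_link K" "regular_position K" and e: "{p, q} \<in> K" "{r, s} \<in> K"
  and u: "u \<in> seg p q" and w: "w \<in> seg r s" and uw: "fst u = fst w"
  and d: "fst q - fst u = \<beta> *\<^sub>R d" "fst s - fst w = \<delta> *\<^sub>R d" "\<beta> > 0" "\<delta> > 0"
 shows "{p, q} = {r, s} \<or> q = s"
proof -
 have *: "{p, q} = {r, s} \<or> q = s"
  if e: "{p, q} \<in> K" "{r, s} \<in> K" and u: "u \<in> seg p q" and w: "w \<in> seg r s" and uw: "fst u = fst w"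
  and d: "fst q - fst u = \<beta> *\<^sub>R d" "fst s - fst w = \<delta> *\<^sub>R d" "\<beta> > 0" "\<delta> > 0" and le: "\<beta> \<le> \<delta>" for p q r s u w \<beta> \<delta>
 proof (rule disjCI)
  assume "q \<noteq> s"
  \<comment> \<open>The point of the longer arm with the same projection as the end \<open>q\<close>
    of the shorter one.\<close>
  define y where "y = w + (\<beta> / \<delta>) *\<^sub>R (s - w)"
  have "y \<in> seg w s" unfolding y_def using d le by (intro in_segment_param) auto
  moreover have "seg w s \<subseteq> seg r s" using w by (simp add: subset_closed_segment)
  ultimately have y: "y \<in> seg r s" by blast
  then have yX: "y \<in> edge_union K" using edge_hull_subset[OF e(2)] edge_hull by blast
  have "fst y = fst w + (\<beta> / \<delta>) *\<^sub>R (\<delta> *\<^sub>R d)" by (simp add: y_def flip: d(2))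
  also have "\<dots> = fst q" using d(4) d(1) uw by (simp add: algebra_simps)
  finally have "y = q" using regular_vertex[OF K(2) _ yX] e(1) by blast
  moreover have "q \<noteq> r"
  proof
   assume "q = r"
   obtain c where c: "0 \<le> c" "c \<le> 1" "w = r + c *\<^sub>R (s - r)" using w by (rule closed_segment_paramE)
   have "r + c *\<^sub>R (s - r) + k *\<^sub>R (s - (r + c *\<^sub>R (s - r))) - r = (c + k * (1 - c)) *\<^sub>R (s - r)" for k
    by (simp add: algebra_simps)
   then have "y - r = (c + (\<beta> / \<delta>) * (1 - c)) *\<^sub>R (s - r)" unfolding y_def c(3) by blast
   then have "(c + (\<beta> / \<delta>) * (1 - c)) *\<^sub>R (s - r) = 0" using \<open>y = q\<close> \<open>q = r\<close> by simp
   moreover have "s \<noteq> r" using \<open>q \<noteq> s\<close> \<open>q = r\<close> by simp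
   ultimately have "c + (\<beta> / \<delta>) * (1 - c) = 0" by simp
   moreover have "(\<beta> / \<delta>) * (1 - c) \<ge> 0" using c d by simp
   ultimately have "c = 0" "(\<beta> / \<delta>) * (1 - c) = 0" using c by linarith+
   then show False using d by simp
  qed
  moreover have "q \<in> {r, s} \<or> {p, q} = {r, s}"
   using edges_meet[OF K(1) e] y \<open>y = q\<close> edge_hull[of p q] edge_hull[of r s] by auto
  ultimately show "{p, q} = {r, s}" using \<open>q \<noteq> s\<close> by blast
 qed
 show ?thesis
  by (smt (verit, ccfv_SIG) "*" d(1,2,3,4) e(1,2) u uw w)
qed

lemma edge_not_vertical:
 assumes "polygonal_link K" "regular_position K" "{p, q} \<in> K" "p \<noteq> q"
 shows "fst p \<noteq> fst q"
proof
 assume eq: "fst p = fst q"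
 have "p \<in> \<Union>K" "q \<in> \<Union>K" using assms(3) by blast+
 then have "q = p" using regular_vertex[OF assms(2) _ vertex_in_edge_union] eq by metis
 then show False using assms(4) by simp
qed

lemma edge_inj:
 assumes "polygonal_link K" "regular_position K" "e \<in> K"
 shows "inj_on fst (conv e)"
proof (rule inj_onI)
 fix x y assume xy: "x \<in> conv e" "y \<in> conv e" "fst x = fst y"
 obtain p q where e: "e = {p, q}" "p \<noteq> q" "conv e = seg p q" using edgeE assms by metis
 obtain u v where u: "x = p + u *\<^sub>R (q - p)" and v: "y = p + v *\<^sub>R (q - p)"
  using xy(1,2) unfolding e(3) by (meson closed_segment_paramE)
 have "u *\<^sub>R (fst q - fst p) = v *\<^sub>R (fst q - fst p)" using xy(3) unfolding u v by simp
 then have "u = v" using edge_not_vertical[OF assms(1,2), of p q] assms(3) e by auto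
 then show "x = y" using u v by simp
qed

lemma crossing_nonvertex:
 assumes "regular_position K" "u \<in> edge_union K" "w \<in> edge_union K" "fst u = fst w" "u \<noteq> w"
 shows "u \<notin> \<Union>K"
 using regular_vertex[OF assms(1), of u w] assms by auto

lemma nonvertex_interior:
 assumes "polygonal_link K" "{p, q} \<in> K" "u \<in> seg p q" "u \<notin> \<Union>K"
 shows "u \<in> open_segment p q"
 using assms by (auto simp: open_segment_def)

text \<open>If the projections were parallel, the edges would have arms in a common direction on
  both sides of the crossing, so both pairs of end points would coincide by
  \<open>same_direction\<close>.\<close>

lemma crossing_transversal:
 assumes K: "polygonal_link K" "regular_position K" and e: "{p, q} \<in> K" "{r, s} \<in> K"
  and u: "u \<in> seg p q" and w: "w \<in> seg r s" and uw: "fst u = fst w" "u \<noteq> w"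
 shows "det2 (fst q - fst p) (fst s - fst r) \<noteq> 0"
proof
 assume det: "det2 (fst q - fst p) (fst s - fst r) = 0"
 have X: "u \<in> edge_union K" "w \<in> edge_union K" using u w edge_hull_subset[OF e(1)] edge_hull_subset[OF e(2)] edge_hull by blast+
 have nv: "u \<notin> \<Union>K" "w \<notin> \<Union>K" using crossing_nonvertex[OF K(2) X uw] crossing_nonvertex[OF K(2) X(2,1)] uw by auto
 have uo: "u \<in> open_segment p q" "w \<in> open_segment r s" using nonvertex_interior[OF K(1)] e u w nv by auto
 have ne: "{p, q} \<noteq> {r, s}"
 proof
  assume "{p, q} = {r, s}"
  then have "seg r s = seg p q" by (metis edge_hull)
  then have "w \<in> seg p q" using w by blast
  then have "u \<in> conv {p, q}" "w \<in> conv {p, q}" using u by (simp_all add: edge_hull)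
  then show False using inj_onD[OF edge_inj[OF K e(1)] uw(1)] uw(2) by blast
 qed
 have pq: "p \<noteq> q" "r \<noteq> s" using uo by auto
 define d where "d = fst q - fst p"
 have "d \<noteq> 0" using edge_not_vertical[OF K e(1) pq(1)] by (simp add: d_def)
 then obtain k where k: "fst s - fst r = k *\<^sub>R d" using det2_zeroE det unfolding d_def by metis
 have "k \<noteq> 0" using edge_not_vertical[OF K e(2) pq(2)] k by auto
 obtain \<alpha> where a: "0 < \<alpha>" "\<alpha> < 1" "u = p + \<alpha> *\<^sub>R (q - p)" using uo(1) by (rule open_segment_paramE)
 obtain \<gamma> where g: "0 < \<gamma>" "\<gamma> < 1" "w = r + \<gamma> *\<^sub>R (s - r)" using uo(2) by (rule open_segment_paramE)
 have q: "fst q - fst u = (1 - \<alpha>) *\<^sub>R d" and p: "fst p - fst u = \<alpha> *\<^sub>R (- d)"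
  unfolding a(3) d_def by (simp_all add: algebra_simps)
 have s: "fst s - fst w = ((1 - \<gamma>) * k) *\<^sub>R d" and r: "fst r - fst w = (\<gamma> * k) *\<^sub>R (- d)"
  using k unfolding g(3) by (simp_all add: algebra_simps flip: scaleR_scaleR k)
 have u': "u \<in> seg q p" and w': "w \<in> seg s r" using u w by (simp_all add: closed_segment_commute)
 have e': "{q, p} \<in> K" "{s, r} \<in> K" using e by (simp_all add: insert_commute)
 have ne': "{q, p} \<noteq> {s, r}" "{p, q} \<noteq> {s, r}" "{q, p} \<noteq> {r, s}" using ne by (simp_all add: insert_commute)
 have pos: "1 - \<alpha> > 0" "\<alpha> > 0" "1 - \<gamma> > 0" "\<gamma> > 0" using a g by simp_all
 show False
 proof (cases "k > 0")
  case True
  then have "q = s" using same_direction[OF K e u w uw(1) q s pos(1)] pos(3) ne by simp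
  moreover have "p = r" using same_direction[OF K e' u' w' uw(1) p r pos(2)] pos(4) ne'(1) True by simp
  ultimately show False using ne by simp
 next
  case False
  then have k0: "- k > 0" using \<open>k \<noteq> 0\<close> by simp
  have s': "fst s - fst w = ((1 - \<gamma>) * (- k)) *\<^sub>R (- d)" and r': "fst r - fst w = (\<gamma> * (- k)) *\<^sub>R d" using r s by simp_all
  have "q = r" using same_direction[OF K e(1) e'(2) u w' uw(1) q r' pos(1) mult_pos_pos[OF pos(4) k0]] ne'(2) by blast
  moreover have "p = s" using same_direction[OF K e'(1) e(2) u' w uw(1) p s' pos(2) mult_pos_pos[OF pos(3) k0]] ne'(3) by blast
  ultimately show False using ne by (simp add: insert_commute)
 qed
qed

lemma edges_near:
 assumes "polygonal_link K" "E \<subseteq> K"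
 obtains \<epsilon> where "\<epsilon> > 0" "\<And>e y. e \<in> E \<Longrightarrow> y \<in> conv e \<Longrightarrow> dist x y < \<epsilon> \<Longrightarrow> x \<in> conv e"
proof -
 define N where "N = (\<Union>e\<in>{e\<in>E. x \<notin> conv e}. conv e)"
 have fin: "finite E" using assms finite_link finite_subset by blast
 have "closed N" unfolding N_def
  using fin assms by (intro closed_UN) (auto intro: compact_imp_closed edge_compact)
 moreover have "x \<notin> N" by (auto simp: N_def)
 ultimately obtain \<epsilon> where e: "\<epsilon> > 0" "ball x \<epsilon> \<subseteq> - N"
  using openE[of "- N" x] by (auto simp: open_Compl)
 show ?thesis
 proof (rule that[OF e(1)])
  fix f y assume "f \<in> E" "y \<in> conv f" "dist x y < \<epsilon>"
  then show "x \<in> conv f" using e(2) by (auto simp: N_def)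
 qed
qed

lemma vertex_edges:
 assumes "polygonal_link K" "v \<in> \<Union>K"
 obtains p q where "{v, p} \<in> K" "{v, q} \<in> K" "p \<noteq> q" "p \<noteq> v" "q \<noteq> v" "\<And>e. e \<in> K \<Longrightarrow> v \<in> e \<Longrightarrow> e = {v, p} \<or> e = {v, q}"
proof -
 have "card {e \<in> K. v \<in> e} = 2" using assms unfolding polygonal_link_def by blast
 from card_2_iff[THEN iffD1, OF this]
 obtain e f where ef: "{e \<in> K. v \<in> e} = {e, f}" "e \<noteq> f" by (elim exE conjE)
 have other: "\<exists>p. e = {v, p} \<and> p \<noteq> v" if eK: "e \<in> K" "v \<in> e" for e
  using assms(1) edgeE that(1,2) by blast
 have "e \<in> K" "v \<in> e" "f \<in> K" "v \<in> f" using ef by auto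
 then obtain p q where pq: "e = {v, p}" "f = {v, q}" "p \<noteq> v" "q \<noteq> v" using other by metis
 have "e' = {v, p} \<or> e' = {v, q}" if "e' \<in> K" "v \<in> e'" for e'
 proof -
  have "e' \<in> {e \<in> K. v \<in> e}" using that by simp
  then show ?thesis unfolding ef(1) pq by simp
 qed
 moreover have "p \<noteq> q" using ef(2) pq by auto
 moreover have "{v, p} \<in> K" "{v, q} \<in> K" using \<open>e \<in> K\<close> \<open>f \<in> K\<close> pq by simp_all
 ultimately show ?thesis using that[of p q] pq(3,4) by simp
qed

text \<open>Treats vertices and interior points of edges alike: near \<open>v\<close> the link
  consists of two straight arms, which are the halves of one edge or two edges at a vertex. Their
  projections do not overlap: in the first case they point in opposite directions, in the second
  \<open>same_direction\<close> applies.\<close>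

lemma local_arms:
 assumes K: "polygonal_link K" "regular_position K" and v: "v \<in> edge_union K"
 obtains p q \<epsilon> e f where "e \<in> K" "f \<in> K" "v \<in> conv e" "v \<in> conv f"
  "p \<in> e" "q \<in> f" "p \<noteq> v" "q \<noteq> v" "\<epsilon> > 0"
  "edge_union K \<inter> ball v \<epsilon> \<subseteq> seg v p \<union> seg v q"
  "\<forall>k>0. fst q - fst v \<noteq> k *\<^sub>R (fst p - fst v)"
  "\<forall>g\<in>K. v \<in> conv g \<longrightarrow> g = e \<or> g = f"
  "v \<notin> \<Union>K \<longrightarrow> e = {p, q} \<and> f = e \<and> v \<in> open_segment p q"
  "v \<in> \<Union>K \<longrightarrow> e = {v, p} \<and> f = {v, q} \<and> e \<noteq> f"
proof -
 obtain \<epsilon> where eps: "\<epsilon> > 0" "\<And>e y. e \<in> K \<Longrightarrow> y \<in> conv e \<Longrightarrow> dist v y < \<epsilon> \<Longrightarrow> v \<in> conv e"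
  using edges_near[OF K(1) subset_refl, of v] by blast
 show ?thesis
 proof (cases "v \<in> \<Union>K")
  case True
  then obtain p q where pq: "{v, p} \<in> K" "{v, q} \<in> K" "p \<noteq> q" "p \<noteq> v" "q \<noteq> v"
   "\<And>e. e \<in> K \<Longrightarrow> v \<in> e \<Longrightarrow> e = {v, p} \<or> e = {v, q}" by (rule vertex_edges[OF K(1)]) blast
  have ne: "{v, p} \<noteq> {v, q}" using pq by auto
  have *: "g = {v, p} \<or> g = {v, q}" if "g \<in> K" "v \<in> conv g" for g
   using pq(6)[OF that(1) vertex_of_edge[OF K(1) that(1) True that(2)]] .
  show ?thesis
  proof (rule that[of "{v, p}" "{v, q}" p q \<epsilon>])
   show "edge_union K \<inter> ball v \<epsilon> \<subseteq> seg v p \<union> seg v q"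
   proof
    fix x assume x: "x \<in> edge_union K \<inter> ball v \<epsilon>"
    then obtain g where g: "g \<in> K" "x \<in> conv g" by (auto elim: edge_unionE)
    then have "g = {v, p} \<or> g = {v, q}" using * eps(2) x by auto
    then show "x \<in> seg v p \<union> seg v q" using g(2) by (auto simp: edge_hull)
   qed
   show "\<forall>k>0. fst q - fst v \<noteq> k *\<^sub>R (fst p - fst v)"
   proof (intro allI impI notI)
    fix k :: real assume k: "k > 0"
    assume "fst q - fst v = k *\<^sub>R (fst p - fst v)"
    then have "{v, q} = {v, p} \<or> q = p"
     using same_direction[OF K pq(2,1) ends_in_segment(1) ends_in_segment(1) refl, of k "fst p - fst v" 1] k by simp
    then show False using ne pq(3) by auto
   qed
  next
   show "v \<in> conv {v, p}" "v \<in> conv {v, q}" by (simp_all add: edge_hull)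
   show "\<forall>g\<in>K. v \<in> conv g \<longrightarrow> g = {v, p} \<or> g = {v, q}" using * by blast
  qed (use pq(1,2,4,5) eps(1) True ne in simp_all)
 next
  case False
  obtain e where e: "e \<in> K" "v \<in> conv e" using v by (rule edge_unionE)
  obtain p q where pq: "e = {p, q}" "p \<noteq> q" "conv e = seg p q" using edgeE[OF K(1) e(1)] .
  have vo: "v \<in> open_segment p q" using nonvertex_interior[OF K(1), of p q v] e pq False by simp
  have *: "g = e" if "g \<in> K" "v \<in> conv g" for g
   using nonvertex_edge_unique[OF K(1) that(1) e(1) False that(2) e(2)] .
  show ?thesis
  proof (rule that[of e e p q \<epsilon>])
   show "edge_union K \<inter> ball v \<epsilon> \<subseteq> seg v p \<union> seg v q"
   proof
    fix x assume x: "x \<in> edge_union K \<inter> ball v \<epsilon>"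
    then obtain g where g: "g \<in> K" "x \<in> conv g" by (auto elim: edge_unionE)
    then have "g = e" using * eps(2) x by auto
    then have "x \<in> seg p q" using g(2) pq by simp
    moreover have "seg p q = seg p v \<union> seg v q"
     using vo by (intro Un_closed_segment[symmetric]) (rule open_closed_segment)
    ultimately show "x \<in> seg v p \<union> seg v q" by (auto simp: closed_segment_commute)
   qed
   show "\<forall>k>0. fst q - fst v \<noteq> k *\<^sub>R (fst p - fst v)"
   proof (intro allI impI notI)
    fix k :: real assume k: "k > 0"
    assume *: "fst q - fst v = k *\<^sub>R (fst p - fst v)"
    obtain u where u: "0 < u" "u < 1" "v = p + u *\<^sub>R (q - p)" using vo by (rule open_segment_paramE)
    have "(1 - u) *\<^sub>R (fst q - fst p) = fst q - fst v" "k *\<^sub>R (fst p - fst v) = (- k * u) *\<^sub>R (fst q - fst p)"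
     unfolding u(3) by (simp_all add: algebra_simps)
    then have "(1 - u) *\<^sub>R (fst q - fst p) = (- k * u) *\<^sub>R (fst q - fst p)" using * by simp
    then have "(1 - u - (- k * u)) *\<^sub>R (fst q - fst p) = 0" unfolding scaleR_diff_left by simp
    moreover have "1 - u - (- k * u) > 0" using u k by (simp add: add_pos_pos)
    ultimately show False using edge_not_vertical[OF K, of p q] e pq by simp
   qed
  next
   show "p \<noteq> v" "q \<noteq> v" using vo unfolding open_segment_def by blast+
   show "\<forall>g\<in>K. v \<in> conv g \<longrightarrow> g = e \<or> g = e" using * by blast
  qed (use pq(1) eps(1) False e vo in simp_all)
 qed
qed

text \<open>Transversal lines meet only once. The second pair may consist of equal points, so this
  also shows that two edges which cross in the projection have no point in common.\<close>

lemma crossing_unique: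
 assumes K: "polygonal_link K" "regular_position K" and e: "e \<in> K" "f \<in> K"
  and u: "u \<in> conv e" "w \<in> conv f" "fst u = fst w" "u \<noteq> w"
  and u': "u' \<in> conv e" "w' \<in> conv f" "fst u' = fst w'"
 shows "u' = u \<and> w' = w"
proof -
 obtain p q where p: "e = {p, q}" "p \<noteq> q" "conv e = seg p q" using edgeE[OF K(1) e(1)] .
 obtain r s where r: "f = {r, s}" "r \<noteq> s" "conv f = seg r s" using edgeE[OF K(1) e(2)] .
 have det: "det2 (fst q - fst p) (fst s - fst r) \<noteq> 0"
  using crossing_transversal[OF K, of p q r s u w] e u p r by simp
 obtain x y x' y' where x: "u = p + x *\<^sub>R (q - p)" and y: "w = r + y *\<^sub>R (s - r)"
  and x': "u' = p + x' *\<^sub>R (q - p)" and y': "w' = r + y' *\<^sub>R (s - r)"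
  using u u' unfolding p(3) r(3) by (meson closed_segment_paramE)
 have "fst u - fst u' = fst w - fst w'" using u u' by simp
 then have *: "(x - x') *\<^sub>R (fst q - fst p) = (y - y') *\<^sub>R (fst s - fst r)"
  unfolding x y x' y' by (simp add: algebra_simps)
 have "(x - x') * det2 (fst q - fst p) (fst s - fst r) = det2 ((x - x') *\<^sub>R (fst q - fst p)) (fst s - fst r)"
  by (simp add: det2_def algebra_simps)
 also have "\<dots> = 0" unfolding * by (simp add: det2_def)
 finally have xx: "x = x'" using det by simp
 have "(y - y') * det2 (fst q - fst p) (fst s - fst r) = det2 (fst q - fst p) ((y - y') *\<^sub>R (fst s - fst r))"
  by (simp add: det2_def algebra_simps)
 also have "\<dots> = 0" unfolding *[symmetric] by (simp add: det2_def)
 finally have yy: "y = y'" using det by simp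
 show ?thesis unfolding x y x' y' xx yy by simp
qed

section \<open>Crossing points, over points and colorings of the link as a point set\<close>

definition crossing_points :: "space set set \<Rightarrow> space set" where
 "crossing_points K = {u \<in> edge_union K. \<exists>v\<in>edge_union K. fst v = fst u \<and> v \<noteq> u}"

lemma finite_crossing_points:
 assumes K: "polygonal_link K" "regular_position K"
 shows "finite (crossing_points K)"
proof -
 define P where "P e f = {u \<in> conv e. \<exists>v\<in>conv f. fst v = fst u \<and> v \<noteq> u}" for e f :: "space set"
 have "finite (P e f)" if "e \<in> K" "f \<in> K" for e f
 proof (cases "P e f = {}")
  case False
  then obtain u where "u \<in> P e f" by blast
  then have uP: "u \<in> conv e" "\<exists>v\<in>conv f. fst v = fst u \<and> v \<noteq> u" by (simp_all add: P_def)
  then obtain v where v: "v \<in> conv f" "fst v = fst u" "v \<noteq> u" by blast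
  note u = uP(1) v(1) v(2)[symmetric] v(3)[symmetric]
  have "P e f \<subseteq> {u}"
  proof
   fix x assume "x \<in> P e f"
   then have xP: "x \<in> conv e" "\<exists>y\<in>conv f. fst y = fst x \<and> y \<noteq> x" by (simp_all add: P_def)
   then obtain y where "x \<in> conv e" "y \<in> conv f" "fst x = fst y" by metis
   then show "x \<in> {u}" using crossing_unique[OF K that u] by blast
  qed
  then show ?thesis by (rule finite_subset) simp
 qed simp
 then have "finite (\<Union>e\<in>K. \<Union>f\<in>K. P e f)" using finite_link[OF K(1)] by blast
 moreover have "crossing_points K \<subseteq> (\<Union>e\<in>K. \<Union>f\<in>K. P e f)"
  by (auto simp: crossing_points_def P_def edge_union_def)
 ultimately show ?thesis by (rule rev_finite_subset)
qed

lemma under_points_crossing: "under_points K \<subseteq> crossing_points K"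
 by (auto simp: under_points_def crossing_points_def)

lemma finite_under_points:
 "polygonal_link K \<Longrightarrow> regular_position K \<Longrightarrow> finite (under_points K)"
 using finite_crossing_points under_points_crossing finite_subset by blast

lemma isolated_from_finite:
 fixes F :: "'v::metric_space set"
 assumes "finite F"
 obtains \<epsilon> where "\<epsilon> > 0" "\<And>y. y \<in> F \<Longrightarrow> dist x y < \<epsilon> \<Longrightarrow> y = x"
proof -
 have "closed (F - {x})" using assms by (simp add: finite_imp_closed)
 then have "open (- (F - {x}))" "x \<in> - (F - {x})" by (blast intro: open_Compl)+
 then obtain \<epsilon> where "\<epsilon> > 0" "ball x \<epsilon> \<subseteq> - (F - {x})" using openE by blast
 then show ?thesis by (intro that[of \<epsilon>]) auto
qed

definition over :: "space set set \<Rightarrow> space \<Rightarrow> space" where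
 "over K u = (THE v. v \<in> edge_union K \<and> fst v = fst u \<and> snd u < snd v)"

lemma over_eq:
 assumes R: "regular_position K" and "u \<in> edge_union K" "v \<in> edge_union K" "fst v = fst u" "snd u < snd v"
 shows "over K u = v"
 unfolding over_def
proof (rule the_equality)
 fix w assume w: "w \<in> edge_union K \<and> fst w = fst u \<and> snd u < snd w"
 then show "w = v" using regular_triple[OF R, of u v w] assms by auto
qed (use assms in auto)

lemma under_pointE:
 assumes "regular_position K" "u \<in> under_points K"
 obtains v where "over K u = v" "v \<in> edge_union K" "v \<notin> under_points K" "fst v = fst u" "snd u < snd v" "u \<in> edge_union K"
 by (smt (verit, best) assms(1,2) mem_Collect_eq over_eq under_points_def)

lemma under_pointI:
 "u \<in> edge_union K \<Longrightarrow> v \<in> edge_union K \<Longrightarrow> fst v = fst u \<Longrightarrow> snd u < snd v \<Longrightarrow> u \<in> under_points K"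
 by (auto simp: under_points_def)

lemma vertex_not_crossing:
 assumes "regular_position K" "v \<in> \<Union>K"
 shows "v \<notin> crossing_points K"
 using regular_vertex[OF assms] by (auto simp: crossing_points_def)

context kei
begin

text \<open>The wall color at an under point is the value of \<open>c\<close> itself at the point
  above it. The condition speaks of single edges; constancy along a strand that turns at vertices
  follows, as a vertex is no under point and belongs to both of its edges.\<close>

definition point_colorings :: "space set set \<Rightarrow> (space \<Rightarrow> 'q) set" where
 "point_colorings K = {c \<in> (edge_union K - under_points K) \<rightarrow>\<^sub>E Q.
   \<forall>e\<in>K. flat (conv e) (under_points K) (Some \<circ> c \<circ> over K) c}"

lemma point_coloring_in: "c \<in> point_colorings K \<Longrightarrow> x \<in> edge_union K \<Longrightarrow> x \<notin> under_points K \<Longrightarrow> c x \<in> Q"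
 by (auto simp: point_colorings_def)

lemma point_coloring_flat:
 "c \<in> point_colorings K \<Longrightarrow> e \<in> K \<Longrightarrow> flat (conv e) (under_points K) (Some \<circ> c \<circ> over K) c"
 by (simp add: point_colorings_def)

end

text \<open>Two links \<open>ZE \<union> EA\<close> and \<open>ZE \<union> EB\<close> that differ by a triangle move on the triangle \<open>a b c\<close>, in
 either direction. The map \<open>x \<mapsto> snd a + g (x - fst a)\<close> is the height of the plane of the triangle.\<close>


section \<open>The triangle move\<close>

locale swap =
 fixes ZE EA EB :: "space set set" and a b c :: space and g :: "plane \<Rightarrow> real"
 assumes KA: "polygonal_link (ZE \<union> EA)" and RA: "regular_position (ZE \<union> EA)"
  and KB: "polygonal_link (ZE \<union> EB)" and RB: "regular_position (ZE \<union> EB)"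
  and sides: "EA = {{a, b}} \<and> EB = {{a, c}, {c, b}} \<or> EA = {{a, c}, {c, b}} \<and> EB = {{a, b}}"
  and disj: "conv {a, b, c} \<inter> edge_union ZE = {a, b}"
  and noncol: "det2 (fst b - fst a) (fst c - fst a) \<noteq> 0"
  and g: "linear g" "g (fst b - fst a) = snd b - snd a" "g (fst c - fst a) = snd c - snd a"
begin

lemma swap_sym: "swap ZE EB EA a b c g"
 using swap_axioms swap_def by auto

definition "Z = edge_union ZE"
definition "T = conv {a, b, c}"
definition "\<Delta> = conv {fst a, fst b, fst c}"
definition "level p = snd p - snd a - g (fst p - fst a)"
text \<open>The bound is closed, which makes \<open>Ov\<close> compact. At level 0 it admits only
  the corners \<open>a\<close> and \<open>b\<close>, so the projections of both belong to the
  shadow.\<close>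

definition "Ov = {p \<in> Z. fst p \<in> \<Delta> \<and> level p \<ge> 0}"
definition "sh = fst ` Ov"

text \<open>Barycentric coordinates with respect to the projected corners, by Cramer's rule; each is
  named after the corner at which it equals 1.\<close>

definition "bc x = det2 (fst b - fst a) (x - fst a) / det2 (fst b - fst a) (fst c - fst a)"
definition "bb x = det2 (x - fst a) (fst c - fst a) / det2 (fst b - fst a) (fst c - fst a)"
definition "ba x = 1 - bb x - bc x"

lemma bary: "x = fst a + bb x *\<^sub>R (fst b - fst a) + bc x *\<^sub>R (fst c - fst a)"
proof -
 define D where "D = det2 (fst b - fst a) (fst c - fst a)"
 have D: "D \<noteq> 0" using noncol by (simp add: D_def)
 have "D *\<^sub>R (x - fst a) = det2 (x - fst a) (fst c - fst a) *\<^sub>R (fst b - fst a) + det2 (fst b - fst a) (x - fst a) *\<^sub>R (fst c - fst a)"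
  unfolding D_def by (simp add: prod_eq_iff det2_def algebra_simps)
 then have "(1/D) *\<^sub>R (D *\<^sub>R (x - fst a)) = (1/D) *\<^sub>R (det2 (x - fst a) (fst c - fst a) *\<^sub>R (fst b - fst a) + det2 (fst b - fst a) (x - fst a) *\<^sub>R (fst c - fst a))"
  by simp
 then have "x - fst a = bb x *\<^sub>R (fst b - fst a) + bc x *\<^sub>R (fst c - fst a)"
  using D unfolding bb_def bc_def D_def[symmetric] by (simp add: scaleR_add_right)
 then show ?thesis by (simp add: algebra_simps)
qed

lemma bary_eq:
 "bb (fst a + u *\<^sub>R (fst b - fst a) + v *\<^sub>R (fst c - fst a)) = u"
 "bc (fst a + u *\<^sub>R (fst b - fst a) + v *\<^sub>R (fst c - fst a)) = v"
proof -
 have "det2 (u *\<^sub>R (fst b - fst a) + v *\<^sub>R (fst c - fst a)) (fst c - fst a) = u * det2 (fst b - fst a) (fst c - fst a)"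
  "det2 (fst b - fst a) (u *\<^sub>R (fst b - fst a) + v *\<^sub>R (fst c - fst a)) = v * det2 (fst b - fst a) (fst c - fst a)"
  by (simp_all add: det2_def algebra_simps)
 then show "bb (fst a + u *\<^sub>R (fst b - fst a) + v *\<^sub>R (fst c - fst a)) = u"
  "bc (fst a + u *\<^sub>R (fst b - fst a) + v *\<^sub>R (fst c - fst a)) = v"
  using noncol unfolding bb_def bc_def by (simp_all add: add.assoc)
qed

lemma bary_inj: "bb x = bb y \<Longrightarrow> bc x = bc y \<Longrightarrow> x = y"
 using bary[of x] bary[of y] by simp

lemma bary_vertex:
 "bb (fst a) = 0" "bc (fst a) = 0" "bb (fst b) = 1" "bc (fst b) = 0" "bb (fst c) = 0" "bc (fst c) = 1"
 "ba (fst a) = 1" "ba (fst b) = 0" "ba (fst c) = 0"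
 using bary_eq[of 0 0] bary_eq[of 1 0] bary_eq[of 0 1] by (simp_all add: ba_def)

lemma \<Delta>_iff: "x \<in> \<Delta> \<longleftrightarrow> ba x \<ge> 0 \<and> bb x \<ge> 0 \<and> bc x \<ge> 0"
proof
 assume "x \<in> \<Delta>"
 then obtain u v w where *: "x = u *\<^sub>R fst a + v *\<^sub>R fst b + w *\<^sub>R fst c" "0 \<le> u" "0 \<le> v" "0 \<le> w" "u + v + w = 1"
  unfolding \<Delta>_def convex_hull_3 mem_Collect_eq by (elim exE conjE)
 have u: "u = 1 - v - w" using *(5) by simp
 have "x = fst a + v *\<^sub>R (fst b - fst a) + w *\<^sub>R (fst c - fst a)" unfolding *(1) u by (simp add: algebra_simps)
 then have "bb x = v" "bc x = w" using bary_eq by simp_all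
 then show "ba x \<ge> 0 \<and> bb x \<ge> 0 \<and> bc x \<ge> 0" using * by (simp add: ba_def)
next
 assume *: "ba x \<ge> 0 \<and> bb x \<ge> 0 \<and> bc x \<ge> 0"
 have "x = ba x *\<^sub>R fst a + bb x *\<^sub>R fst b + bc x *\<^sub>R fst c"
  by (subst bary) (simp add: ba_def algebra_simps)
 then show "x \<in> \<Delta>" using * unfolding \<Delta>_def convex_hull_3 mem_Collect_eq
  by (intro exI[of _ "ba x"] exI[of _ "bb x"] exI[of _ "bc x"]) (auto simp: ba_def)
qed

lemma bary_affine:
 "bb (x + u *\<^sub>R (y - x)) = bb x + u * (bb y - bb x)"
 "bc (x + u *\<^sub>R (y - x)) = bc x + u * (bc y - bc x)"
 "ba (x + u *\<^sub>R (y - x)) = ba x + u * (ba y - ba x)"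
proof -
 have num: "det2 (x + u *\<^sub>R (y - x) - fst a) d = det2 (x - fst a) d + u * (det2 (y - fst a) d - det2 (x - fst a) d)"
  "det2 d (x + u *\<^sub>R (y - x) - fst a) = det2 d (x - fst a) + u * (det2 d (y - fst a) - det2 d (x - fst a))" for d
  by (simp_all add: det2_def algebra_simps)
 have div: "(p + u * (q - p)) / D = p / D + u * (q / D - p / D)" for p q D :: real
  by (simp add: add_divide_distrib flip: diff_divide_distrib)
 show 1: "bb (x + u *\<^sub>R (y - x)) = bb x + u * (bb y - bb x)"
  unfolding bb_def num div ..
 show 2: "bc (x + u *\<^sub>R (y - x)) = bc x + u * (bc y - bc x)"
  unfolding bc_def num div ..
 show "ba (x + u *\<^sub>R (y - x)) = ba x + u * (ba y - ba x)"
  unfolding ba_def 1 2 by (simp only: right_diff_distrib distrib_left)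
qed

lemma bary_continuous: "continuous_on UNIV bb" "continuous_on UNIV bc" "continuous_on UNIV ba"
proof -
 show 1: "continuous_on UNIV bb" and 2: "continuous_on UNIV bc"
  unfolding bb_def bc_def det2_def
  by (intro continuous_intros ballI; use noncol in \<open>simp add: det2_def\<close>)+
 show "continuous_on UNIV ba" unfolding ba_def by (intro continuous_intros 1 2)
qed

lemma convex_\<Delta>: "convex \<Delta>" and compact_\<Delta>: "compact \<Delta>" and closed_\<Delta>: "closed \<Delta>"
 unfolding \<Delta>_def by (simp_all add: finite_imp_compact compact_convex_hull compact_imp_closed)

lemma corners_in: "fst a \<in> \<Delta>" "fst b \<in> \<Delta>" "fst c \<in> \<Delta>"
 by (simp_all add: \<Delta>_iff bary_vertex)

lemma interior_ball:
 assumes "ba t > 0" "bb t > 0" "bc t > 0"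
 obtains \<epsilon> where "\<epsilon> > 0" "\<And>x. dist t x < \<epsilon> \<Longrightarrow> ba x > 0 \<and> bb x > 0 \<and> bc x > 0"
proof -
 have "open ({x. 0 < ba x} \<inter> {x. 0 < bb x} \<inter> {x. 0 < bc x})"
  by (intro open_Int open_Collect_less continuous_on_const bary_continuous)
 then obtain \<epsilon> where "\<epsilon> > 0" "ball t \<epsilon> \<subseteq> {x. 0 < ba x} \<inter> {x. 0 < bb x} \<inter> {x. 0 < bc x}"
  using assms openE by (metis (no_types, lifting) IntI mem_Collect_eq)
 then show ?thesis by (intro that[of \<epsilon>]) (auto simp: subset_iff)
qed

lemma level_affine: "level (x + u *\<^sub>R (y - x)) = level x + u * (level y - level x)"
proof -
 have "g (fst x + u *\<^sub>R (fst y - fst x) - fst a) = g (fst x - fst a) + u * (g (fst y - fst a) - g (fst x - fst a))"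
  by (rule affine_along[OF g(1)])
 then show ?thesis unfolding level_def by (simp add: algebra_simps)
qed

lemma level_continuous: "continuous_on UNIV level"
proof -
 have "continuous_on UNIV g" using g(1) by (simp add: linear_continuous_on linear_conv_bounded_linear)
 then have "continuous_on UNIV (\<lambda>p. g (fst p - fst a))"
  by (rule continuous_on_compose2) (auto intro!: continuous_intros)
 then show ?thesis unfolding level_def by (intro continuous_intros)
qed

lemma level_pos_near:
 assumes "level v > 0"
 obtains \<delta> where "\<delta> > 0" "\<And>y. dist v y < \<delta> \<Longrightarrow> level y > 0"
proof -
 have "open {x. 0 < level x}" by (intro open_Collect_less continuous_on_const level_continuous)
 then obtain \<delta> where d: "\<delta> > 0" "ball v \<delta> \<subseteq> {x. 0 < level x}" using assms openE by (metis mem_Collect_eq)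
 show ?thesis by (rule that[OF d(1)]) (use d(2) in \<open>simp only: subset_eq mem_ball mem_Collect_eq\<close>)
qed

lemma level_neg_near:
 assumes "level v < 0"
 obtains \<delta> where "\<delta> > 0" "\<And>y. dist v y < \<delta> \<Longrightarrow> level y < 0"
proof -
 have "open {x. level x < 0}" by (intro open_Collect_less continuous_on_const level_continuous)
 then obtain \<delta> where d: "\<delta> > 0" "ball v \<delta> \<subseteq> {x. level x < 0}" using assms openE by (metis mem_Collect_eq)
 show ?thesis by (rule that[OF d(1)]) (use d(2) in \<open>simp only: subset_eq mem_ball mem_Collect_eq\<close>)
qed

lemma level_fst: "fst p = fst q \<Longrightarrow> level p - level q = snd p - snd q"
 by (simp add: level_def)

lemma level_vertex: "level a = 0" "level b = 0" "level c = 0"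
 using g by (simp_all add: level_def linear_0)

lemma T_iff: "p \<in> T \<longleftrightarrow> fst p \<in> \<Delta> \<and> level p = 0"
proof
 assume "p \<in> T"
 then obtain u v w where *: "p = u *\<^sub>R a + v *\<^sub>R b + w *\<^sub>R c" "0 \<le> u" "0 \<le> v" "0 \<le> w" "u + v + w = 1"
  unfolding T_def convex_hull_3 mem_Collect_eq by (elim exE conjE)
 have u: "u = 1 - v - w" using *(5) by simp
 have "fst p \<in> \<Delta>" unfolding \<Delta>_def convex_hull_3 mem_Collect_eq
  by (intro exI[of _ u] exI[of _ v] exI[of _ w]) (simp add: *)
 moreover have "fst p - fst a = v *\<^sub>R (fst b - fst a) + w *\<^sub>R (fst c - fst a)" unfolding *(1) u by (simp add: algebra_simps)
 then have "g (fst p - fst a) = v * (snd b - snd a) + w * (snd c - snd a)"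
  using g by (simp add: linear_add linear_cmul)
 then have "level p = 0" unfolding level_def *(1) u by (simp add: algebra_simps)
 ultimately show "fst p \<in> \<Delta> \<and> level p = 0" by simp
next
 assume p: "fst p \<in> \<Delta> \<and> level p = 0"
 then obtain u v w where *: "fst p = u *\<^sub>R fst a + v *\<^sub>R fst b + w *\<^sub>R fst c" "0 \<le> u" "0 \<le> v" "0 \<le> w" "u + v + w = 1"
  unfolding \<Delta>_def convex_hull_3 mem_Collect_eq by (elim exE conjE)
 have u: "u = 1 - v - w" using *(5) by simp
 have "fst p - fst a = v *\<^sub>R (fst b - fst a) + w *\<^sub>R (fst c - fst a)" unfolding *(1) u by (simp add: algebra_simps)
 then have "g (fst p - fst a) = v * (snd b - snd a) + w * (snd c - snd a)"
  using g by (simp add: linear_add linear_cmul)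
 then have "snd p = u * snd a + v * snd b + w * snd c" using p unfolding level_def u by (simp add: algebra_simps)
 then have "p = u *\<^sub>R a + v *\<^sub>R b + w *\<^sub>R c" using *(1) by (simp add: prod_eq_iff)
 then show "p \<in> T" unfolding T_def convex_hull_3 mem_Collect_eq using *
  by (intro exI[of _ u] exI[of _ v] exI[of _ w]) simp
qed

lemma T_inj: "p \<in> T \<Longrightarrow> q \<in> T \<Longrightarrow> fst p = fst q \<Longrightarrow> p = q"
 using level_fst[of p q] by (simp add: T_iff prod_eq_iff)

lemma ends_T: "a \<in> T" "b \<in> T" "c \<in> T"
 by (simp_all add: T_def hull_inc)

lemma sides_in_T: "edge_union EA \<subseteq> T" "edge_union EB \<subseteq> T"
proof -
 have "seg a b \<subseteq> T" "seg a c \<subseteq> T" "seg c b \<subseteq> T"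
  using ends_T by (simp_all add: T_def closed_segment_subset)
 then show "edge_union EA \<subseteq> T" "edge_union EB \<subseteq> T"
  using sides unfolding edge_union_def by (elim disjE conjE; simp add: edge_hull)+
qed

lemma Z_level_0: "p \<in> Z \<Longrightarrow> fst p \<in> \<Delta> \<Longrightarrow> level p = 0 \<Longrightarrow> p = a \<or> p = b"
 using disj T_iff[of p] unfolding T_def Z_def by blast

lemma ends_in_Z: "a \<in> Z" "b \<in> Z"
 using disj unfolding Z_def by blast+

lemma distinct_ends: "a \<noteq> b" "a \<noteq> c" "b \<noteq> c"
 using noncol by (auto simp: det2_def)

lemma distinct_fst: "fst a \<noteq> fst b" "fst a \<noteq> fst c" "fst b \<noteq> fst c"
 using noncol by (auto simp: det2_def)

lemma c_notin_Z: "c \<notin> Z"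
 using Z_level_0 corners_in(3) distinct_ends(2,3) level_vertex(3) by blast

lemma Z_sub: "Z \<subseteq> edge_union (ZE \<union> EA)" "Z \<subseteq> edge_union (ZE \<union> EB)"
 by (simp_all add: Z_def edge_union_Un)

lemma ends_vertices: "a \<in> \<Union>(ZE \<union> EA)" "b \<in> \<Union>(ZE \<union> EA)" "a \<in> \<Union>(ZE \<union> EB)" "b \<in> \<Union>(ZE \<union> EB)"
 using sides by (elim disjE conjE; simp)+

lemma over_end: "p \<in> edge_union (ZE \<union> EA) \<Longrightarrow> fst p = fst a \<Longrightarrow> p = a" "p \<in> edge_union (ZE \<union> EA) \<Longrightarrow> fst p = fst b \<Longrightarrow> p = b"
 using regular_vertex[OF RA] ends_vertices by blast+

text \<open>The apex is a vertex of only one of the two links, but \<open>Z\<close> is part of both,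
  so the regularity of that one applies.\<close>

lemma fst_c_notin:
 assumes "p \<in> Z" shows "fst p \<noteq> fst c"
proof
 assume eq: "fst p = fst c"
 have "p = c"
 proof (cases "c \<in> \<Union>(ZE \<union> EA)")
  case True
  show ?thesis by (rule regular_vertex[OF RA True _ eq]) (use assms Z_sub in blast)
 next
  case False
  then have "c \<in> \<Union>(ZE \<union> EB)" using sides by (elim disjE conjE) simp_all
  then show ?thesis by (rule regular_vertex[OF RB _ _ eq]) (use assms Z_sub in blast)
 qed
 then show False using assms c_notin_Z by simp
qed

lemma on_boundary:
 assumes "t \<in> \<Delta>" "ba t = 0 \<or> bb t = 0 \<or> bc t = 0"
 obtains w where "w \<in> edge_union EA \<union> edge_union EB" "w \<in> T" "fst w = t"
proof -
 have seg: "\<exists>w\<in>seg p q. fst w = t" if "t \<in> seg (fst p) (fst q)" for p q :: space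
  using that unfolding fst_closed_segment[symmetric] by (metis imageE)
 have tt: "t = ba t *\<^sub>R fst a + bb t *\<^sub>R fst b + bc t *\<^sub>R fst c"
  by (subst bary) (simp add: ba_def algebra_simps)
 have nn: "ba t \<ge> 0" "bb t \<ge> 0" "bc t \<ge> 0" using assms(1) by (simp_all add: \<Delta>_iff)
 have "t \<in> seg (fst a) (fst b) \<or> t \<in> seg (fst a) (fst c) \<or> t \<in> seg (fst c) (fst b)"
  using assms(2)
 proof (elim disjE)
  assume z: "ba t = 0"
  have "bb t = 1 - bc t" using z by (simp add: ba_def)
  then have "t \<in> seg (fst b) (fst c)" unfolding in_segment
   using tt nn z by (intro exI[of _ "bc t"]) simp
  then show ?thesis by (simp add: closed_segment_commute)
 next
  assume z: "bb t = 0"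
  have "ba t = 1 - bc t" using z by (simp add: ba_def)
  then have "t \<in> seg (fst a) (fst c)" unfolding in_segment
   using tt nn z by (intro exI[of _ "bc t"]) simp
  then show ?thesis by blast
 next
  assume z: "bc t = 0"
  have "ba t = 1 - bb t" using z by (simp add: ba_def)
  then have "t \<in> seg (fst a) (fst b)" unfolding in_segment
   using tt nn z by (intro exI[of _ "bb t"]) simp
  then show ?thesis by blast
 qed
 then obtain w where w: "w \<in> seg a b \<or> w \<in> seg a c \<or> w \<in> seg c b" "fst w = t"
  using seg by blast
 have "{a, b} \<in> EA \<union> EB" "{a, c} \<in> EA \<union> EB" "{c, b} \<in> EA \<union> EB" using sides by (elim disjE conjE; simp)+
 from this[THEN edge_hull_subset]
 have "seg a b \<union> seg a c \<union> seg c b \<subseteq> edge_union EA \<union> edge_union EB"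
  unfolding edge_union_Un edge_hull by simp
 then have "w \<in> edge_union EA \<union> edge_union EB" using w(1) by blast
 then show ?thesis using that w(2) sides_in_T by blast
qed

text \<open>The barycentric coordinates are nonnegative and affine, so a coordinate that vanishes at
  an interior point of a segment vanishes along the segment. At a corner two of them vanish, which
  leaves a single point.\<close>

lemma extreme:
 assumes "w \<in> {a, b}" "x \<in> \<Delta>" "y \<in> \<Delta>"
 shows "fst w \<notin> open_segment x y"
proof
 assume w: "fst w \<in> open_segment x y"
 then obtain u where u: "0 < u" "u < 1" "fst w = x + u *\<^sub>R (y - x)" by (rule open_segment_paramE)
 have zero: "p = 0 \<and> q = 0" if "p \<ge> 0" "q \<ge> 0" "p + u * (q - p) = 0" for p q :: real
 proof -
  have "(1 - u) * p + u * q = 0" using that(3) by (simp add: algebra_simps)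
  moreover have "(1 - u) * p \<ge> 0" "u * q \<ge> 0" using u that by simp_all
  ultimately have "(1 - u) * p = 0" "u * q = 0" by linarith+
  then show ?thesis using u by simp
 qed
 have nn: "ba x \<ge> 0" "bb x \<ge> 0" "bc x \<ge> 0" "ba y \<ge> 0" "bb y \<ge> 0" "bc y \<ge> 0"
  using assms by (simp_all add: \<Delta>_iff)
 have C: "bc x = 0 \<and> bc y = 0"
  using zero[OF nn(3,6)] bary_affine(2)[of x u y] u(3) assms(1) bary_vertex by auto
 consider "w = a" | "w = b" using assms(1) by blast
 then have "bb x = bb y"
 proof cases
  case 1
  then show ?thesis using zero[OF nn(2,5)] bary_affine(1)[of x u y] u(3) bary_vertex by simp
 next
  case 2
  then have "ba x = 0 \<and> ba y = 0" using zero[OF nn(1,4)] bary_affine(3)[of x u y] u(3) bary_vertex by simp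
  then show ?thesis using C by (simp add: ba_def)
 qed
 then have "x = y" using C bary_inj by simp
 then show False using w by simp
qed

lemma compact_Ov: "compact Ov"
proof -
 have "Ov = Z \<inter> (fst -` \<Delta> \<inter> {p. 0 \<le> level p})"
  unfolding Ov_def vimage_def Int_def mem_Collect_eq ..
 moreover have "closed (fst -` \<Delta> \<inter> {p. 0 \<le> level p})"
  by (intro closed_Int closed_vimage_fst closed_\<Delta> closed_Collect_le continuous_on_const level_continuous)
 moreover have "compact Z" using edge_union_compact[OF KA, of ZE] by (simp add: Z_def)
 ultimately show ?thesis by (simp add: compact_Int_closed)
qed

text \<open>Closeness in the projection does not mean closeness in space. By compactness, however,
  points of \<open>Ov\<close> that project close to \<open>t\<close> are close to a point of
  \<open>Ov\<close> over \<open>t\<close>; in particular there are none if the fibre over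
  \<open>t\<close> is empty.\<close>

lemma O_near:
 assumes "\<delta> > 0"
 obtains \<epsilon> where "\<epsilon> > 0" "\<And>p. p \<in> Ov \<Longrightarrow> dist t (fst p) < \<epsilon> \<Longrightarrow> \<exists>v\<in>Ov. fst v = t \<and> dist v p < \<delta>"
proof -
 define N where "N = Ov - (\<Union>v\<in>{v\<in>Ov. fst v = t}. ball v \<delta>)"
 have "compact N" unfolding N_def by (intro compact_diff compact_Ov open_UN) simp
 then have "compact (fst ` N)" by (intro compact_continuous_image continuous_intros)
 then have "open (- (fst ` N))" by (simp add: compact_imp_closed open_Compl)
 moreover have "t \<in> - (fst ` N)"
 proof -
  have "fst p \<noteq> t" if "p \<in> N" for p
  proof
   assume "fst p = t"
   then have "p \<in> ball p \<delta>" "p \<in> Ov" using that assms by (simp_all add: N_def)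
   then show False using that \<open>fst p = t\<close> unfolding N_def by blast
  qed
  then show ?thesis by blast
 qed
 ultimately obtain \<epsilon> where e: "\<epsilon> > 0" "ball t \<epsilon> \<subseteq> - (fst ` N)" using openE by blast
 show ?thesis
 proof (rule that[OF e(1)])
  fix p assume p: "p \<in> Ov" "dist t (fst p) < \<epsilon>"
  then have "fst p \<in> ball t \<epsilon>" by simp
  then have "p \<notin> N" using e(2) by blast
  then obtain v where "v \<in> Ov" "fst v = t" "p \<in> ball v \<delta>" using p(1) unfolding N_def by blast
  then show "\<exists>v\<in>Ov. fst v = t \<and> dist v p < \<delta>" by auto
 qed
qed

lemma OD: "p \<in> Ov \<Longrightarrow> p \<in> Z" "p \<in> Ov \<Longrightarrow> fst p \<in> \<Delta>" "p \<in> Ov \<Longrightarrow> level p \<ge> 0"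
 by (simp_all add: Ov_def)

lemma O_level_pos: "p \<in> Ov \<Longrightarrow> p \<noteq> a \<Longrightarrow> p \<noteq> b \<Longrightarrow> level p > 0"
 using Z_level_0[of p] OD[of p] by linarith

lemma bary_sides: "x \<in> seg a b \<Longrightarrow> bc (fst x) = 0" "x \<in> seg a c \<Longrightarrow> bb (fst x) = 0"
 "x \<in> seg c b \<Longrightarrow> ba (fst x) = 0"
proof -
 show "bc (fst x) = 0" if "x \<in> seg a b"
 proof -
  obtain u where "x = a + u *\<^sub>R (b - a)" using \<open>x \<in> seg a b\<close> by (rule closed_segment_paramE)
  then show ?thesis using bary_affine(2)[of "fst a" u "fst b"] bary_vertex by simp
 qed
 show "bb (fst x) = 0" if "x \<in> seg a c"
 proof -
  obtain u where "x = a + u *\<^sub>R (c - a)" using \<open>x \<in> seg a c\<close> by (rule closed_segment_paramE)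
  then show ?thesis using bary_affine(1)[of "fst a" u "fst c"] bary_vertex by simp
 qed
 show "ba (fst x) = 0" if "x \<in> seg c b"
 proof -
  obtain u where "x = c + u *\<^sub>R (b - c)" using \<open>x \<in> seg c b\<close> by (rule closed_segment_paramE)
  then show ?thesis using bary_affine(3)[of "fst c" u "fst b"] bary_vertex by simp
 qed
qed

lemma level_pos_edge:
 assumes "level p \<noteq> 0" "e \<in> ZE \<union> EA" "p \<in> conv e"
 shows "e \<in> ZE"
proof (rule ccontr)
 assume "e \<notin> ZE"
 then have "p \<in> T" using assms(2,3) sides_in_T(1) edge_hull_subset[of e EA] by blast
 then show False using assms(1) by (simp add: T_iff)
qed

lemma not_all_on_line:
 assumes "d \<noteq> 0"
 obtains z where "z \<in> \<Delta>" "det2 d (z - t) \<noteq> 0"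
proof -
 have "det2 d (fst a - t) \<noteq> 0 \<or> det2 d (fst b - t) \<noteq> 0 \<or> det2 d (fst c - t) \<noteq> 0"
 proof (rule ccontr)
  assume *: "\<not> ?thesis"
  have "fst b - fst a = (fst b - t) - (fst a - t)" "fst c - fst a = (fst c - t) - (fst a - t)" by simp_all
  then have z: "det2 d (fst b - fst a) = 0" "det2 d (fst c - fst a) = 0"
   using * linear_diff[OF linear_det2, of d "fst b - t" "fst a - t"] linear_diff[OF linear_det2, of d "fst c - t" "fst a - t"] by auto
  obtain k where k: "fst b - fst a = k *\<^sub>R d" by (rule det2_zeroE[OF z(1) assms])
  obtain l where l: "fst c - fst a = l *\<^sub>R d" by (rule det2_zeroE[OF z(2) assms])
  have "det2 (fst b - fst a) (fst c - fst a) = 0" unfolding k l by (simp add: det2_def)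
  then show False using noncol by simp
 qed
 then show ?thesis using that corners_in by blast
qed

end

lemma plane_coords:
 assumes "det2 d1 d2 \<noteq> 0"
 shows "x = (det2 x d2 / det2 d1 d2) *\<^sub>R d1 + (det2 d1 x / det2 d1 d2) *\<^sub>R d2"
proof -
 define D where "D = det2 d1 d2"
 have D: "D \<noteq> 0" using assms by (simp add: D_def)
 have "D *\<^sub>R x = det2 x d2 *\<^sub>R d1 + det2 d1 x *\<^sub>R d2"
  unfolding D_def by (simp add: prod_eq_iff det2_def algebra_simps)
 then have "(1/D) *\<^sub>R (D *\<^sub>R x) = (1/D) *\<^sub>R (det2 x d2 *\<^sub>R d1 + det2 d1 x *\<^sub>R d2)" by simp
 then show ?thesis using D unfolding D_def[symmetric] by (simp add: scaleR_add_right)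
qed

lemma linear_coord: "linear (\<lambda>x. det2 d x / D)" "linear (\<lambda>x. det2 x d / D)"
 by (intro linearI; simp add: det2_def add_divide_distrib diff_divide_distrib algebra_simps)+

lemma norm_bound_coeff:
 fixes d :: "'v::real_normed_vector"
 assumes "x - t = r *\<^sub>R d" "dist t x < \<epsilon>" "\<epsilon> \<le> \<eta> * norm d" "d \<noteq> 0"
 shows "\<bar>r\<bar> < \<eta>"
proof -
 have "\<bar>r\<bar> * norm d = dist t x" using assms(1) by (metis dist_commute dist_norm norm_scaleR)
 then have "\<bar>r\<bar> * norm d < \<eta> * norm d" using assms(2,3) by linarith
 then show ?thesis using assms(4) by simp
qed

section \<open>The colored shadow and its local structure\<close>

locale colored_swap = swap ZE EA EB a b c g + kei Q act
 for ZE EA EB :: "space set set" and a b c :: space and g :: "plane \<Rightarrow> real"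
  and Q :: "'q set" and act :: "'q \<Rightarrow> 'q \<Rightarrow> 'q" (infixl "\<rhd>" 70) +
 fixes col :: "space \<Rightarrow> 'q"
 assumes col: "col \<in> point_colorings (ZE \<union> EA)"
begin

abbreviation "K \<equiv> ZE \<union> EA"
abbreviation "U \<equiv> under_points (ZE \<union> EA)"

text \<open>The projection of \<open>ZE\<close> does not bend at \<open>v\<close>: no vertex, or a
  vertex whose two edges project to one line.\<close>

definition "flat_pt v \<longleftrightarrow> v \<notin> \<Union>ZE \<or>
 (\<exists>p q. p \<noteq> q \<and> {v, p} \<in> ZE \<and> {v, q} \<in> ZE \<and> det2 (fst p - fst v) (fst q - fst v) = 0)"
text \<open>The points whose shadow is locally one straight line with a well-defined color. At
  corners, bends and double points the wall color \<open>\<kappa>O\<close> defined from it is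
  \<open>None\<close>.\<close>

definition "simple v \<longleftrightarrow> v \<in> Ov \<and> v \<noteq> a \<and> v \<noteq> b \<and> flat_pt v \<and> (\<forall>w\<in>Ov. fst w = fst v \<longrightarrow> w = v)"
definition "\<kappa>O s = (if \<exists>v. simple v \<and> fst v = s then Some (col (THE v. simple v \<and> fst v = s)) else None)"

lemma simpleD: "simple v \<Longrightarrow> v \<in> Ov" "simple v \<Longrightarrow> w \<in> Ov \<Longrightarrow> fst w = fst v \<Longrightarrow> w = v"
 "simple v \<Longrightarrow> v \<noteq> a" "simple v \<Longrightarrow> v \<noteq> b" "simple v \<Longrightarrow> flat_pt v"
 unfolding simple_def by blast+

lemma \<kappa>_simple:
 assumes "simple v" shows "\<kappa>O (fst v) = Some (col v)"
proof -
 have "(THE w. simple w \<and> fst w = fst v) = v"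
  using assms simpleD(1) simpleD(2)[OF assms] by (intro the_equality) blast+
 moreover have "\<exists>w. simple w \<and> fst w = fst v" using assms by blast
 ultimately show ?thesis unfolding \<kappa>O_def by (simp only: if_True)
qed

lemma \<kappa>_None:
 assumes "\<And>v. simple v \<Longrightarrow> fst v \<noteq> s" shows "\<kappa>O s = None"
proof -
 have "\<not> (\<exists>v. simple v \<and> fst v = s)" using assms by blast
 then show ?thesis unfolding \<kappa>O_def by (rule if_not_P)
qed

lemma Z_in_K: "z \<in> Z \<Longrightarrow> z \<in> edge_union K"
 using Z_sub by blast

lemma Ov_in_K: "v \<in> Ov \<Longrightarrow> v \<in> edge_union K"
 using Z_in_K OD(1) by blast

lemma above_in_Ov:
 assumes "v \<in> Ov" "w \<in> edge_union K" "fst w = fst v" "snd v < snd w"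
 shows "w \<in> Ov" "w \<noteq> v"
proof -
 have l: "level w > 0" using level_fst[OF assms(3)] assms(4) OD(3)[OF assms(1)] by simp
 have "w \<in> Z"
 proof (rule ccontr)
  assume "w \<notin> Z"
  then have "w \<in> edge_union EA" using assms(2) by (simp add: Z_def edge_union_Un)
  then show False using sides_in_T(1) l by (auto simp: T_iff)
 qed
 then show "w \<in> Ov" using l OD(2)[OF assms(1)] assms(3) by (simp add: Ov_def)
 show "w \<noteq> v" using assms(4) by auto
qed

lemma unique_not_under:
 assumes "v \<in> Ov" "\<And>w. w \<in> Ov \<Longrightarrow> fst w = fst v \<Longrightarrow> w = v"
 shows "v \<notin> U"
proof
 assume "v \<in> U"
 then obtain w where "w \<in> edge_union K" "fst w = fst v" "snd v < snd w" by (rule under_pointE[OF RA])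
 then show False using above_in_Ov[OF assms(1)] assms(2) by blast
qed

lemma simpleI:
 assumes "y \<in> Ov" "y \<notin> \<Union>K" "\<And>w. w \<in> Ov \<Longrightarrow> fst w = fst y \<Longrightarrow> w = y"
 shows "simple y"
proof -
 have "y \<noteq> a" "y \<noteq> b" using assms(2) ends_vertices(1,2) by blast+
 moreover have "flat_pt y" using assms(2) unfolding flat_pt_def by blast
 ultimately show ?thesis using assms(1,3) unfolding simple_def by blast
qed

lemma col_near:
 assumes v: "v \<in> edge_union K" "v \<notin> U"
 obtains \<delta> where "\<delta> > 0" "\<And>e y. e \<in> K \<Longrightarrow> v \<in> conv e \<Longrightarrow> y \<in> conv e \<Longrightarrow> dist v y < \<delta> \<Longrightarrow> y \<notin> U \<and> col y = col v"
proof -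
 obtain \<delta> where d: "\<delta> > 0" "\<And>y. y \<in> U \<Longrightarrow> dist v y < \<delta> \<Longrightarrow> y = v"
  using isolated_from_finite[OF finite_under_points[OF KA RA], of v] by blast
 show ?thesis
 proof (rule that[OF d(1)])
  fix e y assume e: "e \<in> K" "v \<in> conv e" "y \<in> conv e" "dist v y < \<delta>"
  have "seg v y \<subseteq> ball v \<delta>" using e(4) d(1) by (intro closed_segment_subset) auto
  then have "x \<notin> U" if "x \<in> seg v y" for x using d(2)[of x] v(2) that by (metis mem_ball subsetD)
  then have "seg v y \<inter> U = {}" by blast
  then show "y \<notin> U \<and> col y = col v"
   using flat_const[OF point_coloring_flat[OF col e(1)] e(2,3)] ends_in_segment(2)[of y v] by blast
 qed
qed

lemma arm_inj:
 assumes inj: "inj_on fst (seg v p)" "inj_on fst (seg v q)"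
  and dir: "\<And>k. k > 0 \<Longrightarrow> fst q - fst v \<noteq> k *\<^sub>R (fst p - fst v)" and pq: "p \<noteq> v" "q \<noteq> v"
  and y: "y \<in> seg v p \<union> seg v q" and w: "w \<in> seg v p \<union> seg v q" and eq: "fst y = fst w"
 shows "y = w"
proof -
 have d: "fst p - fst v \<noteq> 0" "fst q - fst v \<noteq> 0"
  using inj_onD[OF inj(1), of p v] inj_onD[OF inj(2), of q v] pq by auto
 have *: "y = w" if yp: "y \<in> seg v p" and wq: "w \<in> seg v q" and eq: "fst y = fst w" for y w
 proof -
  obtain r where r: "0 \<le> r" "y = v + r *\<^sub>R (p - v)" using yp by (rule closed_segment_paramE)
  obtain s where s: "0 \<le> s" "w = v + s *\<^sub>R (q - v)" using wq by (rule closed_segment_paramE)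
  have rs: "r *\<^sub>R (fst p - fst v) = s *\<^sub>R (fst q - fst v)" using eq unfolding r s by simp
  show ?thesis
  proof (cases "s = 0")
   case True
   then have "r = 0" using rs d by simp
   then show ?thesis using True r s by simp
  next
   case False
   then have "(1/s) *\<^sub>R (r *\<^sub>R (fst p - fst v)) = (1/s) *\<^sub>R (s *\<^sub>R (fst q - fst v))" using rs by simp
   then have "fst q - fst v = (r/s) *\<^sub>R (fst p - fst v)" using False by simp
   moreover have "r \<noteq> 0" using rs d False by auto
   ultimately have False using dir[of "r/s"] r s False by simp
   then show ?thesis ..
  qed
 qed
 consider "y \<in> seg v p" "w \<in> seg v p" | "y \<in> seg v q" "w \<in> seg v q"
  | "y \<in> seg v p" "w \<in> seg v q" | "y \<in> seg v q" "w \<in> seg v p"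
  using y w by blast
 then show ?thesis
 proof cases
  case 1 then show ?thesis using inj_onD[OF inj(1) eq] by blast
 next
  case 2 then show ?thesis using inj_onD[OF inj(2) eq] by blast
 next
  case 3 then show ?thesis using *[OF _ _ eq] by blast
 next
  case 4 then show ?thesis using *[OF _ _ eq[symmetric]] by blast
 qed
qed

text \<open>The shadow near \<open>t\<close> consists of the projections of the two arms of the
  strand at \<open>v\<close>. If they form a line, the line model applies; otherwise
  \<open>v\<close> is a vertex at which the shadow bends, and the sector model applies.\<close>

lemma good_single:
 assumes t: "t \<in> \<Delta>" "t \<noteq> fst a" "t \<noteq> fst b" and v: "v \<in> Ov" "fst v = t" "\<And>w. w \<in> Ov \<Longrightarrow> fst w = t \<Longrightarrow> w = v"
 shows "good \<Delta> sh \<kappa>O t"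
proof -
 have vab: "v \<noteq> a" "v \<noteq> b" using t v(2) by auto
 have lv: "level v > 0" using O_level_pos[OF v(1) vab] .
 have vX: "v \<in> edge_union K" using Ov_in_K[OF v(1)] .
 have vU: "v \<notin> U" using unique_not_under[OF v(1)] v(2,3) by simp
 obtain p q \<epsilon>1 e f where ef: "e \<in> K" "f \<in> K" "v \<in> conv e" "v \<in> conv f"
  and pq: "p \<in> e" "q \<in> f" "p \<noteq> v" "q \<noteq> v" and e1: "\<epsilon>1 > 0"
  "edge_union K \<inter> ball v \<epsilon>1 \<subseteq> seg v p \<union> seg v q"
  and dir: "\<forall>k>0. fst q - fst v \<noteq> k *\<^sub>R (fst p - fst v)"
  and only: "\<forall>g\<in>K. v \<in> conv g \<longrightarrow> g = e \<or> g = f"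
  and nonv: "v \<notin> \<Union>K \<longrightarrow> e = {p, q} \<and> f = e \<and> v \<in> open_segment p q"
  and vert: "v \<in> \<Union>K \<longrightarrow> e = {v, p} \<and> f = {v, q} \<and> e \<noteq> f"
  by (rule local_arms[OF KA RA vX])
 have efZ: "e \<in> ZE" "f \<in> ZE" using level_pos_edge[of v] lv ef by simp_all
 have segs: "seg v p \<subseteq> conv e" "seg v q \<subseteq> conv f"
  using ef pq by (simp_all add: closed_segment_subset hull_inc)
 have segZ: "seg v p \<subseteq> Z" "seg v q \<subseteq> Z"
  using segs edge_hull_subset[OF efZ(1)] edge_hull_subset[OF efZ(2)] unfolding Z_def by blast+
 have inj: "inj_on fst (seg v p)" "inj_on fst (seg v q)"
  using inj_on_subset[OF edge_inj[OF KA RA ef(1)] segs(1)] inj_on_subset[OF edge_inj[OF KA RA ef(2)] segs(2)] by simp_all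
 define d1 where "d1 = fst p - t"
 define d2 where "d2 = fst q - t"
 have d: "d1 \<noteq> 0" "d2 \<noteq> 0"
  using inj_onD[OF inj(1), of p v] inj_onD[OF inj(2), of q v] pq v(2) by (auto simp: d1_def d2_def)
 have dir': "d2 \<noteq> k *\<^sub>R d1" if "k > 0" for k using dir that v(2) by (simp add: d1_def d2_def)
 obtain \<delta>1 where de1: "\<delta>1 > 0" "\<And>y. dist v y < \<delta>1 \<Longrightarrow> level y > 0" using level_pos_near[OF lv] by blast
 obtain \<delta>2 where de2: "\<delta>2 > 0" "\<And>e y. e \<in> K \<Longrightarrow> v \<in> conv e \<Longrightarrow> y \<in> conv e \<Longrightarrow> dist v y < \<delta>2 \<Longrightarrow> y \<notin> U \<and> col y = col v"
  using col_near[OF vX vU] by blast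
 define \<delta> where "\<delta> = Min {\<epsilon>1, \<delta>1, \<delta>2, dist v p, dist v q}"
 have de: "\<delta> > 0" "\<delta> \<le> \<epsilon>1" "\<delta> \<le> \<delta>1" "\<delta> \<le> \<delta>2" "\<delta> \<le> dist v p" "\<delta> \<le> dist v q"
  using e1 de1 de2 pq by (simp_all add: \<delta>_def)
 obtain \<epsilon>2 where e2: "\<epsilon>2 > 0" "\<And>y. y \<in> Ov \<Longrightarrow> dist t (fst y) < \<epsilon>2 \<Longrightarrow> \<exists>w\<in>Ov. fst w = t \<and> dist w y < \<delta>"
  using O_near[OF de(1), of t] by blast
 have near: "dist v y < \<delta> \<and> y \<in> seg v p \<union> seg v q" if y: "y \<in> Ov" "dist t (fst y) < \<epsilon>2" for y
 proof -
  have "dist v y < \<delta>" using e2(2)[OF y] v(3) by blast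
  moreover from this have "y \<in> edge_union K \<inter> ball v \<epsilon>1" using Ov_in_K[OF y(1)] de by simp
  ultimately show ?thesis using e1(2) by blast
 qed
 have arm: "y = w" if "y \<in> seg v p \<union> seg v q" "w \<in> seg v p \<union> seg v q" "fst y = fst w" for y w
  by (rule arm_inj[OF inj dir[rule_format] pq(3,4) that])
 have smp: "simple y \<and> col y = col v" if y: "y \<in> Ov" "dist t (fst y) < \<epsilon>2" "y \<noteq> v" for y
 proof -
  note n = near[OF y(1,2)]
  have ne: "y \<noteq> p" "y \<noteq> q" using n de by auto
  have "e \<subseteq> {v, p, q}" "f \<subseteq> {v, p, q}" using nonv vert by (cases "v \<in> \<Union>K"; auto)+
  then have yef: "y \<notin> e" "y \<notin> f" using ne y(3) by blast+
  obtain h where h: "h \<in> K" "v \<in> conv h" "y \<in> conv h" "y \<notin> h"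
   using n segs ef yef by blast
  have "y \<notin> \<Union>K" using vertex_of_edge[OF KA h(1) _ h(3)] h(4) by blast
  moreover have "w = y" if w: "w \<in> Ov" "fst w = fst y" for w
   using arm[of w y] near[OF w(1)] n w(2) y(2) by simp
  moreover have "col y = col v" using de2(2)[OF h(1-3)] n de by simp
  ultimately show ?thesis using simpleI[OF y(1)] by blast
 qed
 obtain \<eta>1 where eta1: "0 < \<eta>1" "\<eta>1 < 1" "\<And>r. \<bar>r\<bar> \<le> \<eta>1 \<Longrightarrow> v + r *\<^sub>R (p - v) \<in> ball v \<delta>"
  using scaled_into_ball[OF de(1)] by blast
 obtain \<eta>2 where eta2: "0 < \<eta>2" "\<eta>2 < 1" "\<And>r. \<bar>r\<bar> \<le> \<eta>2 \<Longrightarrow> v + r *\<^sub>R (q - v) \<in> ball v \<delta>"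
  using scaled_into_ball[OF de(1)] by blast
 \<comment> \<open>Within this radius a point on a projected arm lifts to a point of the arm at
   distance less than \<open>\<delta>\<close> from \<open>v\<close>.\<close>
 define \<epsilon>0 where "\<epsilon>0 = Min {\<epsilon>2, \<eta>1 * norm d1, \<eta>2 * norm d2}"
 have e0: "\<epsilon>0 > 0" "\<epsilon>0 \<le> \<epsilon>2" "\<epsilon>0 \<le> \<eta>1 * norm d1" "\<epsilon>0 \<le> \<eta>2 * norm d2"
  using e2(1) eta1(1) eta2(1) d by (simp_all add: \<epsilon>0_def)
 have ray: "\<exists>y\<in>Ov. fst y = x" if x: "x \<in> \<Delta>" "x - t = r *\<^sub>R (fst w - t)" "0 \<le> r" "r \<le> 1" "seg v w \<subseteq> Z" "v + r *\<^sub>R (w - v) \<in> ball v \<delta>" for x r w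
 proof -
  let ?y = "v + r *\<^sub>R (w - v)"
  have "?y \<in> Z" using in_segment_param[OF x(3,4), of v w] x(5) by blast
  moreover have "fst ?y = x" using x(2) v(2) by (simp add: algebra_simps)
  moreover have "level ?y > 0" using de1(2)[of ?y] x(6) de(3) by simp
  ultimately show ?thesis using x(1) by (intro bexI[of _ ?y]) (simp_all add: Ov_def)
 qed
 have sh_iff: "x \<in> sh \<longleftrightarrow> (\<exists>r\<ge>0. x - t = r *\<^sub>R d1 \<or> x - t = r *\<^sub>R d2)" if x: "x \<in> \<Delta>" "dist t x < \<epsilon>0" for x
 proof
  assume "x \<in> sh"
  then obtain y where y: "y \<in> Ov" "fst y = x" unfolding sh_def by blast
  then have "y \<in> seg v p \<or> y \<in> seg v q" using near[of y] x e0 by auto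
  then show "\<exists>r\<ge>0. x - t = r *\<^sub>R d1 \<or> x - t = r *\<^sub>R d2"
  proof
   assume "y \<in> seg v p"
   then obtain r where r: "0 \<le> r" "y = v + r *\<^sub>R (p - v)" by (rule closed_segment_paramE)
   then have "x - t = r *\<^sub>R d1" using y v(2) by (auto simp: d1_def)
   then show ?thesis using r(1) by blast
  next
   assume "y \<in> seg v q"
   then obtain r where r: "0 \<le> r" "y = v + r *\<^sub>R (q - v)" by (rule closed_segment_paramE)
   then have "x - t = r *\<^sub>R d2" using y v(2) by (auto simp: d2_def)
   then show ?thesis using r(1) by blast
  qed
 next
  assume "\<exists>r\<ge>0. x - t = r *\<^sub>R d1 \<or> x - t = r *\<^sub>R d2"
  then obtain r where r: "r \<ge> 0" "x - t = r *\<^sub>R d1 \<or> x - t = r *\<^sub>R d2" by blast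
  from r(2) have "\<exists>y\<in>Ov. fst y = x"
  proof
   assume *: "x - t = r *\<^sub>R d1"
   have "\<bar>r\<bar> < \<eta>1" by (rule norm_bound_coeff[OF * x(2) e0(3) d(1)])
   then show ?thesis using ray[OF x(1) *[unfolded d1_def] r(1) _ segZ(1) eta1(3)] eta1(2) by simp
  next
   assume *: "x - t = r *\<^sub>R d2"
   have "\<bar>r\<bar> < \<eta>2" by (rule norm_bound_coeff[OF * x(2) e0(4) d(2)])
   then show ?thesis using ray[OF x(1) *[unfolded d2_def] r(1) _ segZ(2) eta2(3)] eta2(2) by simp
  qed
  then show "x \<in> sh" unfolding sh_def by blast
 qed
 have kap: "\<kappa>O x = Some (col v)" if x: "x \<in> \<Delta>" "dist t x < \<epsilon>0" "x \<in> sh" "x \<noteq> t" for x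
 proof -
  obtain y where y: "y \<in> Ov" "fst y = x" using x(3) unfolding sh_def by blast
  then have "simple y \<and> col y = col v" using smp[of y] x e0 v(2) by auto
  then show ?thesis using \<kappa>_simple[of y] y(2) by simp
 qed
 have colQ: "col v \<in> Q" using point_coloring_in[OF col vX vU] .
 show ?thesis
 proof (cases "det2 d1 d2 = 0")
  case True
  then obtain k where k: "d2 = k *\<^sub>R d1" by (rule det2_zeroE[OF _ d(1)])
  have "\<not> k > 0" "k \<noteq> 0" using dir' k d(2) by auto
  then have k0: "k < 0" by linarith
  have fl: "flat_pt v"
  proof (cases "v \<in> \<Union>ZE")
   case T: True
   then have "e = {v, p}" "f = {v, q}" "p \<noteq> q" using vert by auto
   then show ?thesis unfolding flat_pt_def using efZ True v(2) unfolding d1_def d2_def by blast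
  qed (simp add: flat_pt_def)
  have "simple v" using v vab fl unfolding simple_def by blast
  then have kt: "\<kappa>O t = Some (col v)" using \<kappa>_simple v(2) by blast
  obtain z where z: "z \<in> \<Delta>" "det2 d1 (z - t) \<noteq> 0" by (rule not_all_on_line[OF d(1)])
  show ?thesis
  proof (rule good_line[OF convex_\<Delta> t(1) e0(1) linear_det2[of d1] _ _ colQ z])
   fix x assume x: "x \<in> \<Delta>" "x \<in> ball t \<epsilon>0"
   show iff: "x \<in> sh \<longleftrightarrow> det2 d1 (x - t) = 0"
   proof
    assume "x \<in> sh"
    then obtain r where r: "x - t = r *\<^sub>R d1 \<or> x - t = r *\<^sub>R d2" using sh_iff[OF x(1)] x(2) by auto
    then obtain r' where "x - t = r' *\<^sub>R d1" unfolding k by (metis scaleR_scaleR)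
    then show "det2 d1 (x - t) = 0" by (simp only: det2_scaleR)
   next
    assume "det2 d1 (x - t) = 0"
    then obtain r where r: "x - t = r *\<^sub>R d1" by (rule det2_zeroE[OF _ d(1)])
    have "\<exists>r\<ge>0. x - t = r *\<^sub>R d1 \<or> x - t = r *\<^sub>R d2"
    proof (cases "r \<ge> 0")
     case False
     then have "x - t = (r / k) *\<^sub>R d2" "r / k \<ge> 0" using k0 r k by (simp_all add: divide_nonpos_neg)
     then show ?thesis by blast
    qed (use r in blast)
    then show "x \<in> sh" using sh_iff[OF x(1)] x(2) by simp
   qed
   assume "det2 d1 (x - t) = 0"
   then have "\<kappa>O x = Some (col v)" using kap[of x] kt iff x by (cases "x = t") auto
   then show "\<kappa>O x = Some (col v) \<or> (x = t \<and> (\<forall>x\<in>\<Delta>. \<forall>y\<in>\<Delta>. t \<notin> open_segment x y))" ..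
  qed
 next
  case False
  have vK: "v \<in> \<Union>K"
  proof (rule ccontr)
   assume "v \<notin> \<Union>K"
   then have "v \<in> open_segment p q" using nonv by blast
   then obtain u where u: "v = p + u *\<^sub>R (q - p)" by (rule open_segment_paramE)
   have "d1 = (- u) *\<^sub>R (fst q - fst p)" "d2 = (1 - u) *\<^sub>R (fst q - fst p)"
    unfolding d1_def d2_def v(2)[symmetric] u by (simp_all add: algebra_simps)
   then show False using False by (simp add: det2_def)
  qed
  have ve: "e = {v, p}" "f = {v, q}" "e \<noteq> f" using vert vK by blast+
  have vZE: "v \<in> \<Union>(ZE \<union> EA)" "v \<in> \<Union>(ZE \<union> EB)" "v \<in> \<Union>ZE" using efZ(1) ve(1) by blast+
  have vT: "v \<notin> T" using lv by (simp add: T_iff)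
  \<comment> \<open>A bend does not project to the boundary of the triangle: each side belongs to
    one of the two links, both links are regular, and \<open>v\<close> is a vertex of both.\<close>
  have "\<not> (ba t = 0 \<or> bb t = 0 \<or> bc t = 0)"
  proof
   assume "ba t = 0 \<or> bb t = 0 \<or> bc t = 0"
   then obtain w where w: "w \<in> edge_union EA \<union> edge_union EB" "w \<in> T" "fst w = t" by (rule on_boundary[OF t(1)])
   then have "w = v" using regular_vertex[OF RA vZE(1), of w] regular_vertex[OF RB vZE(2), of w] v(2)
    by (auto simp: edge_union_Un)
   then show False using w vT by simp
  qed
  then have "ba t > 0" "bb t > 0" "bc t > 0" using t(1) unfolding \<Delta>_iff by auto
  then obtain \<epsilon>3 where e3: "\<epsilon>3 > 0" "\<And>x. dist t x < \<epsilon>3 \<Longrightarrow> ba x > 0 \<and> bb x > 0 \<and> bc x > 0" using interior_ball by blast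
  have in\<Delta>: "x \<in> \<Delta>" if "dist t x < \<epsilon>3" for x using e3(2)[OF that] by (simp add: \<Delta>_iff)
  define \<epsilon> where "\<epsilon> = min \<epsilon>0 \<epsilon>3"
  have eps: "\<epsilon> > 0" "\<epsilon> \<le> \<epsilon>0" "\<epsilon> \<le> \<epsilon>3" using e0(1) e3(1) by (simp_all add: \<epsilon>_def)
  have kt: "\<kappa>O t = None"
  proof (rule \<kappa>_None)
   fix w assume w: "simple w"
   show "fst w \<noteq> t"
   proof
    assume "fst w = t"
    then have "w = v" using v(3) simpleD(1)[OF w] by blast
    then have "flat_pt v" using simpleD(5)[OF w] by simp
    then obtain p' q' where p': "p' \<noteq> q'" "{v, p'} \<in> ZE" "{v, q'} \<in> ZE" "det2 (fst p' - fst v) (fst q' - fst v) = 0"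
     using vZE(3) unfolding flat_pt_def by blast
    have "{v, p'} = e \<or> {v, p'} = f" "{v, q'} = e \<or> {v, q'} = f"
     using only p'(2,3) by (simp_all add: hull_inc)
    then have "(p' = p \<and> q' = q) \<or> (p' = q \<and> q' = p)"
     using ve p'(1) pq(3,4) by (metis doubleton_eq_iff)
    then show False using p'(4) False v(2) det2_commute[of d2 d1] unfolding d1_def d2_def by auto
   qed
  qed
  let ?A = "\<lambda>x. det2 x d2 / det2 d1 d2" and ?E = "\<lambda>x. det2 d1 x / det2 d1 d2"
  show ?thesis
  proof (rule good_sector[OF eps(1) _ linear_coord(2)[of d2 "det2 d1 d2"] linear_coord(1)[of d1 "det2 d1 d2"], where a = d1 and e = d2 and q = "col v"])
   show "ball t \<epsilon> \<subseteq> \<Delta>" using in\<Delta> eps by auto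
   fix w assume *: "det2 w d2 / det2 d1 d2 = 0" "det2 d1 w / det2 d1 d2 = 0"
   show "w = 0" by (subst plane_coords[OF False, of w]) (simp only: *, simp)
  next
   fix x assume x: "x \<in> ball t \<epsilon>"
   have xd: "x \<in> \<Delta>" "dist t x < \<epsilon>0" using x in\<Delta>[of x] eps by simp_all
   show "x \<in> sh \<longleftrightarrow> (?A (x - t) = 0 \<and> ?E (x - t) \<ge> 0) \<or> (?E (x - t) = 0 \<and> ?A (x - t) \<ge> 0)"
   proof
    assume "x \<in> sh"
    then obtain r where r: "r \<ge> 0" "x - t = r *\<^sub>R d1 \<or> x - t = r *\<^sub>R d2" using sh_iff[OF xd] by blast
    have "?A (r *\<^sub>R d1) = r" "?E (r *\<^sub>R d1) = 0" "?A (r *\<^sub>R d2) = 0" "?E (r *\<^sub>R d2) = r"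
     using False by (simp_all add: det2_def field_simps)
    then show "(?A (x - t) = 0 \<and> ?E (x - t) \<ge> 0) \<or> (?E (x - t) = 0 \<and> ?A (x - t) \<ge> 0)"
     using r by (metis order_refl)
   next
    assume *: "(?A (x - t) = 0 \<and> ?E (x - t) \<ge> 0) \<or> (?E (x - t) = 0 \<and> ?A (x - t) \<ge> 0)"
    have xt: "x - t = ?A (x - t) *\<^sub>R d1 + ?E (x - t) *\<^sub>R d2" by (rule plane_coords[OF False])
    from * have "\<exists>r\<ge>0. x - t = r *\<^sub>R d1 \<or> x - t = r *\<^sub>R d2"
    proof
     assume **: "?A (x - t) = 0 \<and> ?E (x - t) \<ge> 0"
     then have "x - t = ?E (x - t) *\<^sub>R d2" using xt by (metis add.left_neutral scaleR_zero_left)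
     then show ?thesis using ** by blast
    next
     assume **: "?E (x - t) = 0 \<and> ?A (x - t) \<ge> 0"
     then have "x - t = ?A (x - t) *\<^sub>R d1" using xt by (metis add.right_neutral scaleR_zero_left)
     then show ?thesis using ** by blast
    qed
    then show "x \<in> sh" using sh_iff[OF xd] by blast
   qed
   assume "x \<in> sh" "x \<noteq> t"
   then show "\<kappa>O x = Some (col v)" using kap xd by blast
  qed (use False kt colQ in \<open>simp_all add: det2_self\<close>)
 qed
qed

text \<open>A corner lies on exactly two edges of the link, and one of them is a side of the
  triangle, so a single edge of the common part leaves from it.\<close>

lemma corner_edge:
 assumes w: "w \<in> {a, b}"
 obtains d where "{w, d} \<in> ZE" "d \<noteq> w" "\<And>e. e \<in> ZE \<Longrightarrow> w \<in> conv e \<Longrightarrow> e = {w, d}"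
proof -
 have wK: "w \<in> \<Union>K" using w ends_vertices by blast
 have "w \<in> Z" using w ends_in_Z by blast
 then obtain e where e: "e \<in> ZE" "w \<in> conv e" unfolding Z_def by (rule edge_unionE)
 have we: "w \<in> e" using vertex_of_edge[OF KA _ wK e(2)] e(1) by blast
 obtain p q where pq: "{w, p} \<in> K" "{w, q} \<in> K" "p \<noteq> q" "p \<noteq> w" "q \<noteq> w"
  and only: "\<And>e. e \<in> K \<Longrightarrow> w \<in> e \<Longrightarrow> e = {w, p} \<or> e = {w, q}" by (rule vertex_edges[OF KA wK]) blast
 obtain s where s: "s \<in> EA" "w \<in> s" using w sides by (elim disjE conjE) auto
 \<comment> \<open>Otherwise the whole side would lie in both the triangle and \<open>Z\<close>,
   which share only two points.\<close>
 have "s \<notin> ZE"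
 proof
  assume "s \<in> ZE"
  then have hs: "conv s \<subseteq> Z" unfolding Z_def by (rule edge_hull_subset)
  moreover have "conv s \<subseteq> T" using edge_hull_subset[OF s(1)] sides_in_T(1) by blast
  ultimately have "conv s \<subseteq> {a, b}" using disj unfolding T_def Z_def by blast
  moreover have "infinite (conv s)"
   using sides s(1) distinct_ends by (elim disjE conjE) (auto simp: edge_hull)
  ultimately show False using finite_subset by blast
 qed
 then have uniq: "f = e" if f: "f \<in> ZE" "w \<in> conv f" for f
 proof -
  have wf: "w \<in> f" using vertex_of_edge[OF KA _ wK f(2)] f(1) by blast
  have "e = {w, p} \<or> e = {w, q}" "f = {w, p} \<or> f = {w, q}" "s = {w, p} \<or> s = {w, q}"
   using only e(1) we f(1) wf s by blast+
  then show ?thesis using \<open>s \<notin> ZE\<close> e(1) f(1) by metis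
 qed
 have "e = {w, p} \<or> e = {w, q}" using only e(1) we by blast
 then obtain d where "e = {w, d}" "d \<noteq> w" using pq(4,5) by blast
 then show ?thesis using that[of d] e(1) uniq by blast
qed

lemma level_corner: "w \<in> {a, b} \<Longrightarrow> level w = 0"
 using level_vertex by blast

text \<open>The single edge of \<open>ZE\<close> at the corner either casts no shadow near it apart
  from the corner itself, or a straight one that starts there. No segment of the triangle passes
  through the corner, so no crossing ever asks for a color at this point.\<close>

lemma good_corner:
 assumes w: "w \<in> {a, b}"
 shows "good \<Delta> sh \<kappa>O (fst w)"
proof -
 obtain d where d: "{w, d} \<in> ZE" "d \<noteq> w" "\<And>e. e \<in> ZE \<Longrightarrow> w \<in> conv e \<Longrightarrow> e = {w, d}" by (rule corner_edge[OF w]) blast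
 have dK: "{w, d} \<in> K" using d(1) by blast
 have t: "fst w \<in> \<Delta>" using w corners_in by blast
 have wZ: "w \<in> Z" using w ends_in_Z by blast
 have wO: "w \<in> Ov" using wZ t level_corner[OF w] by (simp add: Ov_def)
 have uniq: "y = w" if "y \<in> edge_union K" "fst y = fst w" for y using w over_end[OF that(1)] that(2) by blast
 have wU: "w \<notin> U" by (rule unique_not_under[OF wO]) (use uniq Ov_in_K in blast)
 have segZ: "seg w d \<subseteq> Z" using edge_hull_subset[OF d(1)] by (simp add: Z_def edge_hull)
 have inj: "inj_on fst (seg w d)" using edge_inj[OF KA RA dK] by (simp add: edge_hull)
 define d1 where "d1 = fst d - fst w"
 have d1: "d1 \<noteq> 0" using inj_onD[OF inj, of d w] d(2) by (auto simp: d1_def)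
 obtain \<epsilon>1 where e1: "\<epsilon>1 > 0" "\<And>e y. e \<in> ZE \<Longrightarrow> y \<in> conv e \<Longrightarrow> dist w y < \<epsilon>1 \<Longrightarrow> w \<in> conv e"
  using edges_near[OF KA, of ZE w] by blast
 obtain \<delta>2 where de2: "\<delta>2 > 0" "\<And>e y. e \<in> K \<Longrightarrow> w \<in> conv e \<Longrightarrow> y \<in> conv e \<Longrightarrow> dist w y < \<delta>2 \<Longrightarrow> y \<notin> U \<and> col y = col w"
  using col_near[OF Z_in_K[OF wZ] wU] by blast
 define \<delta> where "\<delta> = Min {\<epsilon>1, \<delta>2, dist w d}"
 have de: "\<delta> > 0" "\<delta> \<le> \<epsilon>1" "\<delta> \<le> \<delta>2" "\<delta> \<le> dist w d" using e1 de2 d(2) by (simp_all add: \<delta>_def)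
 obtain \<epsilon>2 where e2: "\<epsilon>2 > 0" "\<And>y. y \<in> Ov \<Longrightarrow> dist (fst w) (fst y) < \<epsilon>2 \<Longrightarrow> \<exists>v\<in>Ov. fst v = fst w \<and> dist v y < \<delta>"
  using O_near[OF de(1), of "fst w"] by blast
 have near: "dist w y < \<delta> \<and> y \<in> seg w d" if y: "y \<in> Ov" "dist (fst w) (fst y) < \<epsilon>2" for y
 proof -
  have dy: "dist w y < \<delta>" using e2(2)[OF y] uniq Ov_in_K by blast
  obtain e where e: "e \<in> ZE" "y \<in> conv e" using OD(1)[OF y(1)] unfolding Z_def by (rule edge_unionE)
  then have "w \<in> conv e" using e1(2)[OF e] dy de(2) by linarith
  then show ?thesis using d(3)[OF e(1)] e(2) dy by (simp add: edge_hull)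
 qed
 have smp: "simple y \<and> col y = col w" if y: "y \<in> Ov" "dist (fst w) (fst y) < \<epsilon>2" "y \<noteq> w" for y
 proof -
  note n = near[OF y(1,2)]
  have "y \<noteq> d" using n de by auto
  then have "y \<notin> \<Union>K" using vertex_of_edge[OF KA dK, of y] n y(3) by (auto simp: edge_hull)
  moreover have "v = y" if v: "v \<in> Ov" "fst v = fst y" for v
   using near[OF v(1)] n v(2) y(2) inj_onD[OF inj v(2)] by simp
  moreover have "col y = col w" using de2(2)[OF dK, of y] n de by (simp add: edge_hull)
  ultimately show ?thesis using simpleI[OF y(1)] by blast
 qed
 have ext: "fst w \<notin> open_segment x y" if "x \<in> \<Delta>" "y \<in> \<Delta>" for x y by (rule extreme[OF w that])
 obtain z where z: "z \<in> \<Delta>" "det2 d1 (z - fst w) \<noteq> 0" by (rule not_all_on_line[OF d1])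
 show ?thesis
 proof (cases "\<exists>y0\<in>Ov. dist (fst w) (fst y0) < \<epsilon>2 \<and> y0 \<noteq> w")
  case False
  then have F: "y = w" if "y \<in> Ov" "dist (fst w) (fst y) < \<epsilon>2" for y using that by blast
  show ?thesis
  proof (rule good_point[OF convex_\<Delta> t e2(1) _ _ z(1)])
   show "\<Delta> \<inter> ball (fst w) \<epsilon>2 \<inter> sh \<subseteq> {fst w}"
   proof
    fix x assume x: "x \<in> \<Delta> \<inter> ball (fst w) \<epsilon>2 \<inter> sh"
    then obtain y where y: "y \<in> Ov" "x = fst y" unfolding sh_def by blast
    then show "x \<in> {fst w}" using F[OF y(1)] x by simp
   qed
   show "fst w \<notin> open_segment x y" if "x \<in> \<Delta>" "y \<in> \<Delta>" for x y by (rule ext[OF that])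
   show "z \<noteq> fst w" using z(2) by (auto simp: det2_def)
  qed
 next
  case True
  then obtain y0 where y0: "y0 \<in> Ov" "dist (fst w) (fst y0) < \<epsilon>2" "y0 \<noteq> w" by blast
  obtain r0 where r0: "0 \<le> r0" "r0 \<le> 1" "y0 = w + r0 *\<^sub>R (d - w)" using near[OF y0(1,2)] closed_segment_paramE by blast
  have r0': "r0 > 0" using r0 y0(3) by (cases "r0 = 0") auto
  have lev: "level (w + s *\<^sub>R (d - w)) = s * level d" for s
   using level_affine[of w s d] level_corner[OF w] by simp
  have ld: "level d \<ge> 0" using OD(3)[OF y0(1)] r0' unfolding r0(3) lev by (simp add: zero_le_mult_iff)
  have fy0: "fst y0 = fst w + r0 *\<^sub>R d1" by (simp add: r0(3) d1_def)
  have ray: "w + s *\<^sub>R (d - w) \<in> Ov" if s: "0 \<le> s" "s \<le> r0" for s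
  proof -
   have "w + s *\<^sub>R (d - w) \<in> Z" using in_segment_param[of s w d] s r0 segZ by auto
   moreover have "fst (w + s *\<^sub>R (d - w)) = fst w + (s / r0) *\<^sub>R (fst y0 - fst w)" using r0' by (simp add: fy0 d1_def)
   then have "fst (w + s *\<^sub>R (d - w)) \<in> \<Delta>"
    using in_segment_param[of "s / r0" "fst w" "fst y0"] closed_segment_subset[OF t OD(2)[OF y0(1)] convex_\<Delta>] s r0' by auto
   moreover have "level (w + s *\<^sub>R (d - w)) \<ge> 0" unfolding lev using s ld by simp
   ultimately show ?thesis unfolding Ov_def by blast
  qed
  define \<epsilon>0 where "\<epsilon>0 = min \<epsilon>2 (r0 * norm d1)"
  have e0: "\<epsilon>0 > 0" "\<epsilon>0 \<le> \<epsilon>2" "\<epsilon>0 \<le> r0 * norm d1" using e2(1) r0' d1 by (simp_all add: \<epsilon>0_def)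
  have colQ: "col w \<in> Q" using point_coloring_in[OF col Z_in_K[OF wZ] wU] .
  have iff: "x \<in> sh \<longleftrightarrow> det2 d1 (x - fst w) = 0" if x: "x \<in> \<Delta>" "dist (fst w) x < \<epsilon>0" for x
  proof
   assume "x \<in> sh"
   then obtain y where y: "y \<in> Ov" "x = fst y" unfolding sh_def by blast
   then have "y \<in> seg w d" using near[OF y(1)] x(2) e0(2) by simp
   then obtain r where "y = w + r *\<^sub>R (d - w)" by (rule closed_segment_paramE)
   then have "x - fst w = r *\<^sub>R d1" using y(2) by (simp add: d1_def)
   then show "det2 d1 (x - fst w) = 0" by (simp only: det2_scaleR)
  next
   assume "det2 d1 (x - fst w) = 0"
   then obtain r where r: "x - fst w = r *\<^sub>R d1" by (rule det2_zeroE[OF _ d1])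
   have ra: "\<bar>r\<bar> < r0" by (rule norm_bound_coeff[OF r x(2) e0(3) d1])
   have xr: "x = fst w + r *\<^sub>R d1" using r by (simp add: algebra_simps)
   show "x \<in> sh"
   proof (cases "r \<ge> 0")
    case True
    then have "w + r *\<^sub>R (d - w) \<in> Ov" using ray ra by simp
    moreover have "fst (w + r *\<^sub>R (d - w)) = x" by (simp add: xr d1_def)
    ultimately show ?thesis unfolding sh_def by blast
   next
    case False
    \<comment> \<open>A point of the line on the far side of the corner would put the corner
      strictly between that point and the shadow point \<open>fst y0\<close>; \<open>u\<close> is
      the parameter of the corner on this segment.\<close>
    define u where "u = - r / (r0 - r)"
    have u: "0 < u" "u < 1" using False r0' by (auto simp: u_def field_simps)
    have "r + u * (r0 - r) = 0" using False r0' by (simp add: u_def)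
    moreover have "x + u *\<^sub>R (fst y0 - x) = fst w + (r + u * (r0 - r)) *\<^sub>R d1"
     unfolding xr fy0 by (simp add: algebra_simps)
    ultimately have "fst w = x + u *\<^sub>R (fst y0 - x)" by simp
    then have "fst w = (1 - u) *\<^sub>R x + u *\<^sub>R fst y0" by (simp add: algebra_simps)
    moreover have "x \<noteq> fst y0" using xr fy0 False r0 d1 by auto
    ultimately have "fst w \<in> open_segment x (fst y0)" unfolding in_segment using u by blast
    then show ?thesis using ext[OF x(1) OD(2)[OF y0(1)]] by blast
   qed
  qed
  show ?thesis
  proof (rule good_line[OF convex_\<Delta> t e0(1) linear_det2[of d1] _ _ colQ z])
   fix x assume x: "x \<in> \<Delta>" "x \<in> ball (fst w) \<epsilon>0"
   then show "x \<in> sh \<longleftrightarrow> det2 d1 (x - fst w) = 0" using iff by simp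
   assume "det2 d1 (x - fst w) = 0"
   then have "x \<in> sh" using iff x by simp
   then obtain y where y: "y \<in> Ov" "x = fst y" unfolding sh_def by blast
   show "\<kappa>O x = Some (col w) \<or> (x = fst w \<and> (\<forall>x\<in>\<Delta>. \<forall>y\<in>\<Delta>. fst w \<notin> open_segment x y))"
   proof (cases "y = w")
    case False
    then have "simple y \<and> col y = col w" using smp[OF y(1)] y(2) x(2) e0(2) by simp
    then show ?thesis using \<kappa>_simple[of y] y(2) by simp
   qed (use y(2) ext in blast)
  qed
 qed
qed

lemma Ov_edge:
 assumes "y \<in> Ov" obtains e where "e \<in> ZE" "y \<in> conv e"
 using OD(1)[OF assms] unfolding Z_def by (rule edge_unionE)

lemma Ov_triple:
 assumes "x \<in> Ov" "y \<in> Ov" "w \<in> edge_union EA \<union> edge_union EB \<union> Z" "fst x = fst y" "fst y = fst w"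
 shows "x = y \<or> y = w \<or> x = w"
proof -
 have "w \<in> edge_union (ZE \<union> EA) \<or> w \<in> edge_union (ZE \<union> EB)" using assms(3) by (auto simp: edge_union_Un Z_def)
 then show ?thesis
 proof
  assume "w \<in> edge_union (ZE \<union> EA)"
  then show ?thesis using regular_triple[OF RA _ _ _ assms(4,5)] OD(1) assms(1,2) Z_sub(1) by blast
 next
  assume "w \<in> edge_union (ZE \<union> EB)"
  then show ?thesis using regular_triple[OF RB _ _ _ assms(4,5)] OD(1) assms(1,2) Z_sub(2) by blast
 qed
qed

end

context colored_swap
begin

text \<open>Regularity makes the two strands cross transversally in the projection, away from
  vertices and from the boundary of the triangle, as a side there would give a third point over
  \<open>t\<close>. The upper strand keeps its color, while the color of the lower one changes at
  its under point \<open>v2\<close>, as the crossing model demands.\<close>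

lemma good_double:
 assumes t: "t \<in> \<Delta>" and v: "v1 \<in> Ov" "v2 \<in> Ov" "fst v1 = t" "fst v2 = t" "snd v2 < snd v1"
 shows "good \<Delta> sh \<kappa>O t"
proof -
 have v12: "v1 \<noteq> v2" using v(5) by auto
 have X: "v1 \<in> edge_union K" "v2 \<in> edge_union K" using Ov_in_K v by blast+
 have nv: "v1 \<notin> \<Union>K" "v2 \<notin> \<Union>K"
  using crossing_nonvertex[OF RA X] crossing_nonvertex[OF RA X(2,1)] v(3,4) v12 by auto
 have nab: "v1 \<noteq> a" "v1 \<noteq> b" "v2 \<noteq> a" "v2 \<noteq> b" using nv ends_vertices by blast+
 have lev: "level v1 > 0" "level v2 > 0" using O_level_pos v nab by blast+
 have only: "w = v1 \<or> w = v2" if "w \<in> Ov" "fst w = t" for w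
  using Ov_triple[OF v(1,2), of w] that v(3,4) v12 OD(1)[OF that(1)] by auto
 have "\<not> (ba t = 0 \<or> bb t = 0 \<or> bc t = 0)"
 proof
  assume "ba t = 0 \<or> bb t = 0 \<or> bc t = 0"
  then obtain w where w: "w \<in> edge_union EA \<union> edge_union EB" "w \<in> T" "fst w = t" by (rule on_boundary[OF t])
  then have "w = v1 \<or> w = v2" using Ov_triple[OF v(1,2), of w] v(3,4) v12 by auto
  then show False using w(2) lev by (auto simp: T_iff)
 qed
 then have "ba t > 0" "bb t > 0" "bc t > 0" using t unfolding \<Delta>_iff by auto
 then obtain \<epsilon>3 where e3: "\<epsilon>3 > 0" "\<And>x. dist t x < \<epsilon>3 \<Longrightarrow> ba x > 0 \<and> bb x > 0 \<and> bc x > 0" using interior_ball by blast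
 have in\<Delta>: "x \<in> \<Delta>" if "dist t x < \<epsilon>3" for x using e3(2)[OF that] by (simp add: \<Delta>_iff)
 have v1U: "v1 \<notin> U"
 proof
  assume "v1 \<in> U"
  then obtain w where w: "w \<in> edge_union K" "fst w = fst v1" "snd v1 < snd w" by (rule under_pointE[OF RA])
  have "w = v1 \<or> w = v2" using only[OF above_in_Ov(1)[OF v(1) w]] w(2) v(3) by simp
  then show False using w(3) v(5) by auto
 qed
 have v2U: "v2 \<in> U" "over K v2 = v1"
  using under_pointI[OF X(2,1)] over_eq[OF RA X(2,1)] v by auto
 obtain e1 where e1: "e1 \<in> ZE" "v1 \<in> conv e1" by (rule Ov_edge[OF v(1)])
 obtain e2 where e2: "e2 \<in> ZE" "v2 \<in> conv e2" by (rule Ov_edge[OF v(2)])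
 have eK: "e1 \<in> K" "e2 \<in> K" using e1 e2 by blast+
 obtain p1 q1 where pq1: "e1 = {p1, q1}" "p1 \<noteq> q1" "conv e1 = seg p1 q1" by (rule edgeE[OF KA eK(1)])
 obtain p2 q2 where pq2: "e2 = {p2, q2}" "p2 \<noteq> q2" "conv e2 = seg p2 q2" by (rule edgeE[OF KA eK(2)])
 have seg: "v1 \<in> seg p1 q1" "v2 \<in> seg p2 q2" using e1 e2 pq1 pq2 by simp_all
 have op: "v1 \<in> open_segment p1 q1" "v2 \<in> open_segment p2 q2"
  using nonvertex_interior[OF KA] eK seg nv pq1(1) pq2(1) by blast+
 define d1 where "d1 = fst q1 - fst p1"
 define d2 where "d2 = fst q2 - fst p2"
 have D: "det2 d1 d2 \<noteq> 0"
  using crossing_transversal[OF KA RA, of p1 q1 p2 q2 v1 v2] eK pq1(1) pq2(1) seg v v12 by (simp add: d1_def d2_def)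
 have d: "d1 \<noteq> 0" "d2 \<noteq> 0" using D by (auto simp: det2_def)
 obtain u1 where u1: "0 < u1" "u1 < 1" "v1 = p1 + u1 *\<^sub>R (q1 - p1)" using op(1) by (rule open_segment_paramE)
 obtain u2 where u2: "0 < u2" "u2 < 1" "v2 = p2 + u2 *\<^sub>R (q2 - p2)" using op(2) by (rule open_segment_paramE)
 have on1: "\<exists>r. y = v1 + r *\<^sub>R (q1 - p1)" if "y \<in> conv e1" for y
 proof -
  obtain s where "y = p1 + s *\<^sub>R (q1 - p1)" using \<open>y \<in> conv e1\<close> unfolding pq1(3) by (rule closed_segment_paramE)
  then have "y = v1 + (s - u1) *\<^sub>R (q1 - p1)" by (simp add: u1(3) algebra_simps)
  then show ?thesis by blast
 qed
 have on2: "\<exists>r. y = v2 + r *\<^sub>R (q2 - p2)" if "y \<in> conv e2" for y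
 proof -
  obtain s where "y = p2 + s *\<^sub>R (q2 - p2)" using \<open>y \<in> conv e2\<close> unfolding pq2(3) by (rule closed_segment_paramE)
  then have "y = v2 + (s - u2) *\<^sub>R (q2 - p2)" by (simp add: u2(3) algebra_simps)
  then show ?thesis by blast
 qed
 have in1: "v1 + r *\<^sub>R (q1 - p1) \<in> conv e1" if "\<bar>r\<bar> \<le> min u1 (1 - u1)" for r
 proof -
  have eq: "v1 + r *\<^sub>R (q1 - p1) = p1 + (u1 + r) *\<^sub>R (q1 - p1)" unfolding u1(3) by (simp add: scaleR_add_left)
  have "0 \<le> u1 + r" "u1 + r \<le> 1" using that by (auto simp: abs_le_iff)
  then show ?thesis unfolding pq1(3) eq by (rule in_segment_param)
 qed
 have in2: "v2 + r *\<^sub>R (q2 - p2) \<in> conv e2" if "\<bar>r\<bar> \<le> min u2 (1 - u2)" for r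
 proof -
  have eq: "v2 + r *\<^sub>R (q2 - p2) = p2 + (u2 + r) *\<^sub>R (q2 - p2)" unfolding u2(3) by (simp add: scaleR_add_left)
  have "0 \<le> u2 + r" "u2 + r \<le> 1" using that by (auto simp: abs_le_iff)
  then show ?thesis unfolding pq2(3) eq by (rule in_segment_param)
 qed
 obtain \<delta>1 where de1: "\<delta>1 > 0" "\<And>y. dist v1 y < \<delta>1 \<Longrightarrow> level y > 0" using level_pos_near[OF lev(1)] by blast
 obtain \<delta>2 where de2: "\<delta>2 > 0" "\<And>y. dist v2 y < \<delta>2 \<Longrightarrow> level y > 0" using level_pos_near[OF lev(2)] by blast
 obtain \<delta>3 where de3: "\<delta>3 > 0" "\<And>e y. e \<in> K \<Longrightarrow> v1 \<in> conv e \<Longrightarrow> y \<in> conv e \<Longrightarrow> dist v1 y < \<delta>3 \<Longrightarrow> y \<notin> U \<and> col y = col v1"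
  using col_near[OF X(1) v1U] by blast
 obtain \<delta>4 where de4: "\<delta>4 > 0" "\<And>y. y \<in> U \<Longrightarrow> dist v2 y < \<delta>4 \<Longrightarrow> y = v2"
  using isolated_from_finite[OF finite_under_points[OF KA RA], of v2] by blast
 obtain \<delta>5 where de5: "\<delta>5 > 0" "\<And>e y. e \<in> K \<Longrightarrow> y \<in> conv e \<Longrightarrow> dist v1 y < \<delta>5 \<Longrightarrow> v1 \<in> conv e"
  using edges_near[OF KA subset_refl, of v1] by blast
 obtain \<delta>6 where de6: "\<delta>6 > 0" "\<And>e y. e \<in> K \<Longrightarrow> y \<in> conv e \<Longrightarrow> dist v2 y < \<delta>6 \<Longrightarrow> v2 \<in> conv e"
  using edges_near[OF KA subset_refl, of v2] by blast
 have "v1 \<noteq> p1" "v1 \<noteq> q1" "v2 \<noteq> p2" "v2 \<noteq> q2" using op by (auto simp: open_segment_def)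
 then have dpq: "dist v1 p1 > 0" "dist v1 q1 > 0" "dist v2 p2 > 0" "dist v2 q2 > 0" by simp_all
 define \<delta> where "\<delta> = Min {\<delta>1, \<delta>2, \<delta>3, \<delta>4, \<delta>5, \<delta>6, dist v1 p1, dist v1 q1, dist v2 p2, dist v2 q2}"
 have "\<delta> > 0" unfolding \<delta>_def
  by (subst Min_gr_iff) (simp_all add: de1(1) de2(1) de3(1) de4(1) de5(1) de6(1) dpq del: zero_less_dist_iff)
 moreover have "\<delta> \<le> \<delta>1" "\<delta> \<le> \<delta>2" "\<delta> \<le> \<delta>3" "\<delta> \<le> \<delta>4" "\<delta> \<le> \<delta>5" "\<delta> \<le> \<delta>6"
  "\<delta> \<le> dist v1 p1" "\<delta> \<le> dist v1 q1" "\<delta> \<le> dist v2 p2" "\<delta> \<le> dist v2 q2"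
  unfolding \<delta>_def by (rule Min_le; simp)+
 ultimately have de: "\<delta> > 0" "\<delta> \<le> \<delta>1" "\<delta> \<le> \<delta>2" "\<delta> \<le> \<delta>3" "\<delta> \<le> \<delta>4" "\<delta> \<le> \<delta>5" "\<delta> \<le> \<delta>6"
  "\<delta> \<le> dist v1 p1" "\<delta> \<le> dist v1 q1" "\<delta> \<le> dist v2 p2" "\<delta> \<le> dist v2 q2" by blast+
 obtain \<epsilon>2 where ep2: "\<epsilon>2 > 0" "\<And>y. y \<in> Ov \<Longrightarrow> dist t (fst y) < \<epsilon>2 \<Longrightarrow> \<exists>w\<in>Ov. fst w = t \<and> dist w y < \<delta>"
  using O_near[OF de(1), of t] by blast
 have near: "(dist v1 y < \<delta> \<and> y \<in> conv e1) \<or> (dist v2 y < \<delta> \<and> y \<in> conv e2)"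
  if y: "y \<in> Ov" "dist t (fst y) < \<epsilon>2" for y
 proof -
  obtain e where e: "e \<in> ZE" "y \<in> conv e" by (rule Ov_edge[OF y(1)])
  have "e \<in> K" using e by blast
  obtain w where "w \<in> Ov" "fst w = t" "dist w y < \<delta>" using ep2(2)[OF y] by blast
  then consider "dist v1 y < \<delta>" | "dist v2 y < \<delta>" using only by blast
  then show ?thesis
  proof cases
   case 1
   then have "v1 \<in> conv e" using de5(2)[OF \<open>e \<in> K\<close> e(2)] de by simp
   then have "e = e1" using nonvertex_edge_unique[OF KA \<open>e \<in> K\<close> eK(1) nv(1) _ e1(2)] by blast
   then show ?thesis using 1 e(2) by blast
  next
   case 2
   then have "v2 \<in> conv e" using de6(2)[OF \<open>e \<in> K\<close> e(2)] de by simp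
   then have "e = e2" using nonvertex_edge_unique[OF KA \<open>e \<in> K\<close> eK(2) nv(2) _ e2(2)] by blast
   then show ?thesis using 2 e(2) by blast
  qed
 qed
 obtain \<eta>1' where eta1': "0 < \<eta>1'" "\<And>r. \<bar>r\<bar> \<le> \<eta>1' \<Longrightarrow> v1 + r *\<^sub>R (q1 - p1) \<in> ball v1 \<delta>"
  using scaled_into_ball[OF de(1)] by blast
 obtain \<eta>2' where eta2': "0 < \<eta>2'" "\<And>r. \<bar>r\<bar> \<le> \<eta>2' \<Longrightarrow> v2 + r *\<^sub>R (q2 - p2) \<in> ball v2 \<delta>"
  using scaled_into_ball[OF de(1)] by blast
 define \<eta>1 where "\<eta>1 = min \<eta>1' (min u1 (1 - u1))"
 define \<eta>2 where "\<eta>2 = min \<eta>2' (min u2 (1 - u2))"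
 have eta: "0 < \<eta>1" "0 < \<eta>2" using eta1' eta2' u1 u2 by (simp_all add: \<eta>1_def \<eta>2_def)
 have n1: "dist v1 (v1 + r *\<^sub>R (q1 - p1)) < \<delta>" "v1 + r *\<^sub>R (q1 - p1) \<in> conv e1" if "\<bar>r\<bar> \<le> \<eta>1" for r
  using eta1'(2)[of r] in1[of r] that by (simp_all add: \<eta>1_def)
 have n2: "dist v2 (v2 + r *\<^sub>R (q2 - p2)) < \<delta>" "v2 + r *\<^sub>R (q2 - p2) \<in> conv e2" if "\<bar>r\<bar> \<le> \<eta>2" for r
  using eta2'(2)[of r] in2[of r] that by (simp_all add: \<eta>2_def)
 have f1: "fst (v1 + r *\<^sub>R (q1 - p1)) - t = r *\<^sub>R d1" for r by (simp add: d1_def v(3)[symmetric])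
 have f2: "fst (v2 + r *\<^sub>R (q2 - p2)) - t = r *\<^sub>R d2" for r by (simp add: d2_def v(4)[symmetric])
 \<comment> \<open>The color of the lower strand where the parameter along its edge, counted from
   \<open>v2\<close>, is positive.\<close>
 define p where "p = col (v2 + \<eta>2 *\<^sub>R (q2 - p2))"
 define \<epsilon> where "\<epsilon> = Min {\<epsilon>2, \<epsilon>3, \<eta>1 * norm d1, \<eta>2 * norm d2}"
 have eps: "\<epsilon> > 0" "\<epsilon> \<le> \<epsilon>2" "\<epsilon> \<le> \<epsilon>3" "\<epsilon> \<le> \<eta>1 * norm d1" "\<epsilon> \<le> \<eta>2 * norm d2"
  using ep2(1) e3(1) eta d by (simp_all add: \<epsilon>_def)
 \<comment> \<open>\<open>?E\<close> and \<open>?A\<close> are the coordinates along the upper and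
   along the lower strand, so the shadow of the upper strand is where \<open>?A\<close>
   vanishes.\<close>
 let ?A = "\<lambda>x. det2 d1 x / det2 d1 d2" and ?E = "\<lambda>x. det2 x d2 / det2 d1 d2"
 have xt: "x - t = ?E (x - t) *\<^sub>R d1 + ?A (x - t) *\<^sub>R d2" for x by (rule plane_coords[OF D])
 have AE1: "?A (r *\<^sub>R d1) = 0" "?E (r *\<^sub>R d1) = r" "?A (r *\<^sub>R d2) = r" "?E (r *\<^sub>R d2) = 0" for r
  using D by (simp_all add: det2_def field_simps)
 have lift1: "v1 + ?E (x - t) *\<^sub>R (q1 - p1) \<in> Ov \<and> fst (v1 + ?E (x - t) *\<^sub>R (q1 - p1)) = x \<and> \<bar>?E (x - t)\<bar> \<le> \<eta>1"
  if x: "x \<in> ball t \<epsilon>" "?A (x - t) = 0" for x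
 proof -
  have xd: "x - t = ?E (x - t) *\<^sub>R d1" using xt[of x] x(2) by (metis add.right_neutral scaleR_zero_left)
  have r: "\<bar>?E (x - t)\<bar> < \<eta>1" by (rule norm_bound_coeff[OF xd _ eps(4) d(1)]) (use x in simp)
  let ?y = "v1 + ?E (x - t) *\<^sub>R (q1 - p1)"
  have "fst ?y - t = x - t" unfolding f1 by (rule xd[symmetric])
  then have fy: "fst ?y = x" by simp
  have "?y \<in> Z" using n1(2)[of "?E (x - t)"] r edge_hull_subset[OF e1(1)] by (auto simp: Z_def)
  moreover have "level ?y > 0" using de1(2)[of ?y] n1(1)[of "?E (x - t)"] r de by simp
  moreover have "fst ?y \<in> \<Delta>" unfolding fy using in\<Delta>[of x] x(1) eps by simp
  ultimately have "?y \<in> Ov" unfolding Ov_def by simp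
  then show ?thesis using fy r by simp
 qed
 have lift2: "v2 + ?A (x - t) *\<^sub>R (q2 - p2) \<in> Ov \<and> fst (v2 + ?A (x - t) *\<^sub>R (q2 - p2)) = x \<and> \<bar>?A (x - t)\<bar> \<le> \<eta>2"
  if x: "x \<in> ball t \<epsilon>" "?E (x - t) = 0" for x
 proof -
  have xd: "x - t = ?A (x - t) *\<^sub>R d2" using xt[of x] x(2) by (metis add.left_neutral scaleR_zero_left)
  have r: "\<bar>?A (x - t)\<bar> < \<eta>2" by (rule norm_bound_coeff[OF xd _ eps(5) d(2)]) (use x in simp)
  let ?y = "v2 + ?A (x - t) *\<^sub>R (q2 - p2)"
  have "fst ?y - t = x - t" unfolding f2 by (rule xd[symmetric])
  then have fy: "fst ?y = x" by simp
  have "?y \<in> Z" using n2(2)[of "?A (x - t)"] r edge_hull_subset[OF e2(1)] by (auto simp: Z_def)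
  moreover have "level ?y > 0" using de2(2)[of ?y] n2(1)[of "?A (x - t)"] r de by simp
  moreover have "fst ?y \<in> \<Delta>" unfolding fy using in\<Delta>[of x] x(1) eps by simp
  ultimately have "?y \<in> Ov" unfolding Ov_def by simp
  then show ?thesis using fy r by simp
 qed
 have smp: "simple y" if y: "y \<in> Ov" "dist t (fst y) < \<epsilon>" "fst y \<noteq> t" for y
 proof -
  have ye: "dist t (fst y) < \<epsilon>2" using y(2) eps by simp
  have "y \<notin> \<Union>K"
  proof
   assume yK: "y \<in> \<Union>K"
   from near[OF y(1) ye] show False
   proof (elim disjE conjE)
    assume *: "dist v1 y < \<delta>" "y \<in> conv e1"
    then have "y = p1 \<or> y = q1" using vertex_of_edge[OF KA eK(1) yK] pq1(1) by blast
    then show False using *(1) de by auto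
   next
    assume *: "dist v2 y < \<delta>" "y \<in> conv e2"
    then have "y = p2 \<or> y = q2" using vertex_of_edge[OF KA eK(2) yK] pq2(1) by blast
    then show False using *(1) de by auto
   qed
  qed
  moreover have "w = y" if w: "w \<in> Ov" "fst w = fst y" for w
  proof -
   have we: "dist t (fst w) < \<epsilon>2" using w(2) ye by simp
   have *: "False" if "x \<in> conv e1" "z \<in> conv e2" "fst x = fst z" "fst x \<noteq> t" for x z
   proof -
    obtain r where r: "x = v1 + r *\<^sub>R (q1 - p1)" using on1 \<open>x \<in> conv e1\<close> by blast
    obtain s where s: "z = v2 + s *\<^sub>R (q2 - p2)" using on2 \<open>z \<in> conv e2\<close> by blast
    have rs: "fst x - t = r *\<^sub>R d1" "fst x - t = s *\<^sub>R d2" using f1[of r] f2[of s] r s that(3) by simp_all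
    have "r = 0" using AE1(2)[of r] AE1(4)[of s] rs by metis
    then show False using rs(1) that(4) by simp
   qed
   show ?thesis using near[OF y(1) ye] near[OF w(1) we] *[of y w] *[of w y] w(2) y(3)
     inj_onD[OF edge_inj[OF KA RA eK(1)] w(2)] inj_onD[OF edge_inj[OF KA RA eK(2)] w(2)] by auto
  qed
  ultimately show ?thesis using simpleI[OF y(1)] by blast
 qed
 have v2r: "v2 + r *\<^sub>R (q2 - p2) = v2 \<longleftrightarrow> r = 0" for r using pq2(2) by simp
 have notU: "v2 + r *\<^sub>R (q2 - p2) \<notin> U" if "\<bar>r\<bar> \<le> \<eta>2" "r \<noteq> 0" for r
  using de4(2)[of "v2 + r *\<^sub>R (q2 - p2)"] n2(1)[OF that(1)] de v2r[of r] that(2) by auto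
 have col_pos: "col (v2 + r *\<^sub>R (q2 - p2)) = p" if r: "0 < r" "r \<le> \<eta>2" for r
  unfolding p_def
 proof (rule flat_const[OF point_coloring_flat[OF col eK(2)]])
  have "seg (v2 + r *\<^sub>R (q2 - p2)) (v2 + \<eta>2 *\<^sub>R (q2 - p2)) = (\<lambda>\<nu>. v2 + \<nu> *\<^sub>R (q2 - p2)) ` {r..\<eta>2}"
   by (rule closed_segment_param[OF r(2)])
  then show "seg (v2 + \<eta>2 *\<^sub>R (q2 - p2)) (v2 + r *\<^sub>R (q2 - p2)) \<inter> U = {}"
   using notU r by (subst closed_segment_commute) (fastforce simp: image_iff)
 qed (use n2(2) r eta in simp_all)
 have col_neg: "col (v2 + r *\<^sub>R (q2 - p2)) = p \<rhd> col v1" if r: "r < 0" "- \<eta>2 \<le> r" for r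
  unfolding p_def
 proof (rule flat_cross[OF point_coloring_flat[OF col eK(2)], where s = v2])
  have *: "seg (v2 + r *\<^sub>R (q2 - p2)) (v2 + \<eta>2 *\<^sub>R (q2 - p2)) = (\<lambda>\<nu>. v2 + \<nu> *\<^sub>R (q2 - p2)) ` {r..\<eta>2}"
   by (rule closed_segment_param) (use r eta in simp)
  have "v2 \<in> (\<lambda>\<nu>. v2 + \<nu> *\<^sub>R (q2 - p2)) ` {r..\<eta>2}" using r eta by (intro image_eqI[of _ _ 0]) simp_all
  moreover have "y = v2" if "y \<in> (\<lambda>\<nu>. v2 + \<nu> *\<^sub>R (q2 - p2)) ` {r..\<eta>2}" "y \<in> U" for y
  proof -
   obtain \<nu> where nu: "y = v2 + \<nu> *\<^sub>R (q2 - p2)" "\<nu> \<in> {r..\<eta>2}" using \<open>y \<in> (\<lambda>\<nu>. v2 + \<nu> *\<^sub>R (q2 - p2)) ` {r..\<eta>2}\<close> by blast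
   then have "\<bar>\<nu>\<bar> \<le> \<eta>2" using r by auto
   then have "\<nu> = 0" using notU[of \<nu>] nu(1) \<open>y \<in> U\<close> by blast
   then show ?thesis using nu(1) by simp
  qed
  ultimately show "seg (v2 + \<eta>2 *\<^sub>R (q2 - p2)) (v2 + r *\<^sub>R (q2 - p2)) \<inter> U = {v2}"
   using v2U(1) * by (subst closed_segment_commute) blast
  show "(Some \<circ> col \<circ> over K) v2 = Some (col v1)" using v2U(2) by simp
 qed (use n2(2) r eta notU in simp_all)
 have pQ: "p \<in> Q" unfolding p_def
  using point_coloring_in[OF col _ notU[of \<eta>2]] n2(2)[of \<eta>2] edge_hull_subset[OF eK(2)] eta by auto
 have v1Q: "col v1 \<in> Q" using point_coloring_in[OF col X(1) v1U] .
 show ?thesis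
 proof (rule good_cross[OF eps(1) _ linear_coord(1)[of d1 "det2 d1 d2"] linear_coord(2)[of d2 "det2 d1 d2"],
    where a = d2 and e = d1 and q = "col v1" and p = p])
  show "ball t \<epsilon> \<subseteq> \<Delta>" using in\<Delta> eps by auto
  show "w = 0" if *: "det2 d1 w / det2 d1 d2 = 0" "det2 w d2 / det2 d1 d2 = 0" for w
   using plane_coords[OF D, of w] unfolding *(1) *(2) by (simp only: scaleR_zero_left add_0_left)
  show "\<kappa>O t = None"
  proof (rule \<kappa>_None)
   fix w assume w: "simple w"
   show "fst w \<noteq> t"
   proof
    assume "fst w = t"
    then have "v1 = w" "v2 = w" using simpleD(2)[OF w v(1)] simpleD(2)[OF w v(2)] v(3,4) by simp_all
    then show False using v12 by simp
   qed
  qed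
 next
  fix x assume x: "x \<in> ball t \<epsilon>"
  show "x \<in> sh \<longleftrightarrow> ?A (x - t) = 0 \<or> ?E (x - t) = 0"
  proof
   assume "x \<in> sh"
   then obtain y where y: "y \<in> Ov" "x = fst y" unfolding sh_def by blast
   have "y \<in> conv e1 \<or> y \<in> conv e2" using near[OF y(1)] x y(2) eps by auto
   then have "\<exists>r. x - t = r *\<^sub>R d1 \<or> x - t = r *\<^sub>R d2"
   proof
    assume "y \<in> conv e1"
    then obtain r where "y = v1 + r *\<^sub>R (q1 - p1)" using on1 by blast
    then have "x - t = r *\<^sub>R d1" using f1[of r] y(2) by simp
    then show ?thesis by blast
   next
    assume "y \<in> conv e2"
    then obtain r where "y = v2 + r *\<^sub>R (q2 - p2)" using on2 by blast
    then have "x - t = r *\<^sub>R d2" using f2[of r] y(2) by simp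
    then show ?thesis by blast
   qed
   then show "?A (x - t) = 0 \<or> ?E (x - t) = 0" using AE1(1,4) by metis
  next
   assume "?A (x - t) = 0 \<or> ?E (x - t) = 0"
   then show "x \<in> sh" using lift1[OF x] lift2[OF x] unfolding sh_def by (metis imageI)
  qed
  show "\<kappa>O x = Some (col v1)" if *: "?A (x - t) = 0" "?E (x - t) \<noteq> 0"
  proof -
   let ?y = "v1 + ?E (x - t) *\<^sub>R (q1 - p1)"
   note l = lift1[OF x *(1)]
   have "x \<noteq> t" using *(2) by (auto simp: det2_def)
   then have "simple ?y" using smp[of ?y] l x by simp
   then have "\<kappa>O x = Some (col ?y)" using \<kappa>_simple[of ?y] l by simp
   moreover have "col ?y = col v1" using de3(2)[OF eK(1) e1(2), of ?y] n1[of "?E (x - t)"] l de by simp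
   ultimately show ?thesis by simp
  qed
  have kE: "\<kappa>O x = Some (col (v2 + ?A (x - t) *\<^sub>R (q2 - p2)))" if *: "?E (x - t) = 0" "?A (x - t) \<noteq> 0"
  proof -
   let ?y = "v2 + ?A (x - t) *\<^sub>R (q2 - p2)"
   note l = lift2[OF x *(1)]
   have "x \<noteq> t" using *(2) by (auto simp: det2_def)
   then have "simple ?y" using smp[of ?y] l x by simp
   then show ?thesis using \<kappa>_simple[of ?y] l by simp
  qed
  show "\<kappa>O x = Some p" if *: "?E (x - t) = 0" "?A (x - t) > 0"
  proof -
   have "\<bar>?A (x - t)\<bar> \<le> \<eta>2" using lift2[OF x *(1)] by blast
   then have "?A (x - t) \<le> \<eta>2" "?A (x - t) \<noteq> 0" using *(2) by linarith+
   then show ?thesis using kE[OF *(1)] col_pos[OF *(2)] by metis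
  qed
  show "\<kappa>O x = Some (p \<rhd> col v1)" if *: "?E (x - t) = 0" "?A (x - t) < 0"
  proof -
   have "\<bar>?A (x - t)\<bar> \<le> \<eta>2" using lift2[OF x *(1)] by blast
   then have "- \<eta>2 \<le> ?A (x - t)" "?A (x - t) \<noteq> 0" using *(2) by linarith+
   then show ?thesis using kE[OF *(1)] col_neg[OF *(2)] by metis
  qed
 qed (use D v1Q pQ in \<open>simp_all add: det2_self\<close>)
qed

text \<open>Corners, empty fibres, single points and double points exhaust the cases; a third strand
  over a double point is excluded by regularity within \<open>good_double\<close>.\<close>

theorem good_everywhere:
 assumes "t \<in> \<Delta>" shows "good \<Delta> sh \<kappa>O t"
proof -
 consider "t = fst a \<or> t = fst b" | "\<forall>v\<in>Ov. fst v \<noteq> t"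
  | v where "t \<noteq> fst a" "t \<noteq> fst b" "v \<in> Ov" "fst v = t" "\<And>w. w \<in> Ov \<Longrightarrow> fst w = t \<Longrightarrow> w = v"
  | v w where "v \<in> Ov" "w \<in> Ov" "fst v = t" "fst w = t" "v \<noteq> w" by metis
 then show ?thesis
 proof cases
  case 1
  then show ?thesis using good_corner by blast
 next
  case 2
  obtain \<epsilon> where e: "\<epsilon> > 0" "\<And>y. y \<in> Ov \<Longrightarrow> dist t (fst y) < \<epsilon> \<Longrightarrow> \<exists>v\<in>Ov. fst v = t \<and> dist v y < 1"
   using O_near[OF zero_less_one, of t] by blast
  have none: "x \<notin> sh" if "dist t x < \<epsilon>" for x using e(2) 2 that unfolding sh_def by blast
  obtain z where z: "z \<in> \<Delta>" "z \<noteq> t" using corners_in distinct_fst by metis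
  show ?thesis
  proof (rule good_point[OF convex_\<Delta> assms e(1) _ _ z])
   show "\<Delta> \<inter> ball t \<epsilon> \<inter> sh \<subseteq> {t}" using none by auto
   show "t \<notin> open_segment x y" if "t \<in> sh" for x y using none[of t] that e(1) by simp
  qed
 next
  case 3
  then show ?thesis using good_single[OF assms] by blast
 next
  case (4 v w)
  have "snd v \<noteq> snd w" using 4 by (metis prod_eq_iff)
  then consider "snd w < snd v" | "snd v < snd w" by linarith
  then show ?thesis using good_double[OF assms] 4 by metis
 qed
qed

end

section \<open>The membrane and its values along the old sides\<close>

context kei
begin

lemma flat_unique_point:
 assumes C: "convex C" and good: "\<And>t. t \<in> C \<Longrightarrow> good C B \<kappa> t"
  and fg: "flat C B \<kappa> f" "flat C B \<kappa> g" and s: "s \<in> C" "s \<notin> B" "f s = g s" and t: "t \<in> C" "t \<notin> B"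
 shows "f t = g t"
proof -
 have fl: "flat_at C B \<kappa> s h" if "flat C B \<kappa> h" for h
  unfolding flat_at_def by (intro exI[of _ 1] conjI flat_mono[OF that]) auto
 have ag: "agree_at C B f g s"
  using agree_or_disagree[OF good[OF s(1)] fl[OF fg(1)] fl[OF fg(2)]] s by (metis DiffI IntI centre_in_ball)
 show ?thesis by (rule flat_unique[OF C good fg s(1) ag t])
qed

text \<open>Pulls a flat function of the plane back to a set in space on which the projection is
  injective; segments and their crossings with the wall then correspond.\<close>

lemma flat_fst:
 assumes S: "flat C B \<kappa> S" and D: "convex D" "fst ` D \<subseteq> C" "inj_on fst D"
  and B: "\<And>x. x \<in> D \<Longrightarrow> x \<in> B' \<longleftrightarrow> fst x \<in> B" and \<kappa>: "\<And>x. x \<in> D \<Longrightarrow> x \<in> B' \<Longrightarrow> \<kappa>' x = \<kappa> (fst x)"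
 shows "flat D B' \<kappa>' (\<lambda>x::space. S (fst x))"
proof -
 have seg: "seg (fst x) (fst y) \<inter> B = fst ` (seg x y \<inter> B')" if xy: "x \<in> D" "y \<in> D" for x y
 proof -
  have sub: "seg x y \<subseteq> D" by (rule closed_segment_subset[OF xy D(1)])
  show ?thesis unfolding fst_closed_segment[symmetric] using B sub by blast
 qed
 show ?thesis
 proof (rule flatI)
  show "S (fst x) \<in> Q" if "x \<in> D" "x \<notin> B'" for x using flat_in[OF S, of "fst x"] B that D(2) by blast
 next
  fix x y assume xy: "x \<in> D" "x \<notin> B'" "y \<in> D" "y \<notin> B'" "seg x y \<inter> B' = {}"
  show "S (fst y) = S (fst x)"
   by (rule flat_const[OF S]) (use xy D(2) seg[OF xy(1,3)] in auto)
 next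
  fix x y s q assume xy: "x \<in> D" "x \<notin> B'" "y \<in> D" "y \<notin> B'" and s: "seg x y \<inter> B' = {s}" "\<kappa>' s = Some q"
  have "s \<in> seg x y" "s \<in> B'" using s(1) by blast+
  then have "\<kappa> (fst s) = Some q" using \<kappa>[of s] closed_segment_subset[OF xy(1,3) D(1)] s(2) by auto
  moreover have "seg (fst x) (fst y) \<inter> B = {fst s}" using seg[OF xy(1,3)] s(1) by simp
  moreover have "fst x \<in> C" "fst x \<notin> B" "fst y \<in> C" "fst y \<notin> B" using xy B D(2) by blast+
  ultimately show "S (fst y) = S (fst x) \<rhd> q" using flat_cross[OF S] by blast
 qed
qed

text \<open>In dimension one a wall of isolated colored points has no monodromy. The line model
  applies with the inner product in the direction of the segment, which vanishes on the segment only
  at \<open>t\<close>.\<close>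

lemma segment_good:
 fixes p q :: "'v::euclidean_space"
 assumes D: "convex D" "D \<subseteq> seg p q" and fin: "finite (D \<inter> B)"
  and \<kappa>: "\<And>s. s \<in> D \<Longrightarrow> s \<in> B \<Longrightarrow> \<exists>q\<in>Q. \<kappa> s = Some q" and t: "t \<in> D" and z: "z \<in> D" "z \<noteq> t"
 shows "good D B \<kappa> t"
proof -
 obtain \<epsilon> where e: "\<epsilon> > 0" "\<And>y. y \<in> D \<inter> B \<Longrightarrow> dist t y < \<epsilon> \<Longrightarrow> y = t" using isolated_from_finite[OF fin] by blast
 show ?thesis
 proof (cases "t \<in> B")
  case False
  show ?thesis
  proof (rule good_point[OF D(1) t e(1) _ _ z])
   show "D \<inter> ball t \<epsilon> \<inter> B \<subseteq> {t}" using e(2) by auto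
  qed (use False in blast)
 next
  case True
  obtain k where k: "k \<in> Q" "\<kappa> t = Some k" using \<kappa>[OF t True] by blast
  define A where "A v = inner (q - p) v" for v
  have A: "linear A" unfolding A_def by (simp add: linear_iff inner_right_distrib)
  have A0: "x = t" if x: "x \<in> D" and A0: "A (x - t) = 0" for x
  proof -
   obtain u where u: "x = p + u *\<^sub>R (q - p)" using x D(2) closed_segment_paramE by (metis subsetD)
   obtain v where v: "t = p + v *\<^sub>R (q - p)" using t D(2) closed_segment_paramE by (metis subsetD)
   have "x - t = (u - v) *\<^sub>R (q - p)" unfolding u v by (simp add: algebra_simps)
   then have "(u - v) * inner (q - p) (q - p) = 0" using A0 unfolding A_def by simp
   then have "u = v \<or> q = p" by simp
   then show ?thesis unfolding u v by auto
  qed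
  show ?thesis
  proof (rule good_line[OF D(1) t e(1) A _ _ k(1) z(1)])
   fix x assume x: "x \<in> D" "x \<in> ball t \<epsilon>"
   show "x \<in> B \<longleftrightarrow> A (x - t) = 0"
    using A0[OF x(1)] e(2)[of x] x True linear_0[OF A] by auto
   show "\<kappa> x = Some k \<or> (x = t \<and> (\<forall>x\<in>D. \<forall>y\<in>D. t \<notin> open_segment x y))" if "A (x - t) = 0"
    using A0[OF x(1) that] k(2) by simp
  next
   show "A (z - t) \<noteq> 0" using A0[OF z(1)] z(2) by blast
  qed
 qed
qed

end

lemma convex_minus_end: "convex (seg p q - {p})" "convex (seg p q - {q})"
 for p q :: "'v::euclidean_space"
 using extreme_point_of_stillconvex[of "seg p q" p] extreme_point_of_stillconvex[of "seg p q" q]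
 by (simp_all add: extreme_point_of_segment)

context colored_swap
begin

abbreviation "K' \<equiv> ZE \<union> EB"
abbreviation "U' \<equiv> under_points (ZE \<union> EB)"

lemma corner_col:
 assumes w: "w \<in> {a, b}"
 obtains \<epsilon> where "\<epsilon> > 0" "\<And>y. y \<in> Ov \<Longrightarrow> dist (fst w) (fst y) < \<epsilon> \<Longrightarrow> y \<notin> U \<and> col y = col w"
proof -
 have wZ: "w \<in> Z" using w ends_in_Z by blast
 have wK: "w \<in> edge_union K" using Z_in_K[OF wZ] .
 have "w \<notin> U" using vertex_not_crossing[OF RA, of w] under_points_crossing w ends_vertices(1,2) by blast
 from col_near[OF wK this] obtain \<delta>1 where d1: "\<delta>1 > 0"
  "\<And>e y. e \<in> K \<Longrightarrow> w \<in> conv e \<Longrightarrow> y \<in> conv e \<Longrightarrow> dist w y < \<delta>1 \<Longrightarrow> y \<notin> U \<and> col y = col w" by blast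
 obtain \<delta>2 where d2: "\<delta>2 > 0" "\<And>e y. e \<in> ZE \<Longrightarrow> y \<in> conv e \<Longrightarrow> dist w y < \<delta>2 \<Longrightarrow> w \<in> conv e"
  using edges_near[OF KA, of ZE w] by blast
 have "min \<delta>1 \<delta>2 > 0" using d1 d2 by simp
 from O_near[OF this, of "fst w"] obtain \<epsilon> where e: "\<epsilon> > 0"
  "\<And>y. y \<in> Ov \<Longrightarrow> dist (fst w) (fst y) < \<epsilon> \<Longrightarrow> \<exists>v\<in>Ov. fst v = fst w \<and> dist v y < min \<delta>1 \<delta>2" by blast
 show ?thesis
 proof (rule that[OF e(1)])
  fix y assume y: "y \<in> Ov" "dist (fst w) (fst y) < \<epsilon>"
  obtain v where v: "v \<in> Ov" "fst v = fst w" "dist v y < min \<delta>1 \<delta>2" using e(2)[OF y] by blast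
  have "v = w" using over_end[OF Ov_in_K[OF v(1)]] v(2) w by blast
  obtain h where h: "h \<in> ZE" "y \<in> conv h" by (rule Ov_edge[OF y(1)])
  have "w \<in> conv h" using d2(2)[OF h] v(3) \<open>v = w\<close> by simp
  then show "y \<notin> U \<and> col y = col w" using d1(2)[of h y] h v(3) \<open>v = w\<close> by simp
 qed
qed

lemma \<kappa>_SomeD:
 assumes "\<kappa>O s = Some q" obtains v where "simple v" "fst v = s" "q = col v"
proof -
 have "\<exists>v. simple v \<and> fst v = s" using assms unfolding \<kappa>O_def by (metis option.distinct(1))
 then obtain v where v: "simple v" "fst v = s" by blast
 then show ?thesis using that[OF v] \<kappa>_simple[OF v(1)] assms by simp
qed

lemma corner_Q: "w \<in> {a, b} \<Longrightarrow> col w \<in> Q"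
proof -
 assume w: "w \<in> {a, b}"
 then have "w \<in> Z" using ends_in_Z by blast
 moreover have "w \<notin> U" using vertex_not_crossing[OF RA, of w] under_points_crossing w ends_vertices(1,2) by blast
 ultimately show "col w \<in> Q" using point_coloring_in[OF col] Z_in_K by blast
qed

text \<open>All shadow near a corner comes from the strand through the corner, of color
  \<open>col w\<close>, and crossing it fixes the constant value \<open>col w\<close> by
  idempotence.\<close>

lemma start_flat:
 assumes w: "w \<in> {a, b}"
 shows "flat_at \<Delta> sh \<kappa>O (fst w) (\<lambda>_. col w)"
proof -
 obtain \<epsilon> where e: "\<epsilon> > 0" "\<And>y. y \<in> Ov \<Longrightarrow> dist (fst w) (fst y) < \<epsilon> \<Longrightarrow> y \<notin> U \<and> col y = col w"
  by (rule corner_col[OF w]) blast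
 have "flat (\<Delta> \<inter> ball (fst w) \<epsilon>) sh \<kappa>O (\<lambda>_. col w)"
 proof (rule flatI)
  fix x y s q assume xy: "x \<in> \<Delta> \<inter> ball (fst w) \<epsilon>" "y \<in> \<Delta> \<inter> ball (fst w) \<epsilon>"
   and s: "seg x y \<inter> sh = {s}" "\<kappa>O s = Some q"
  have "convex (\<Delta> \<inter> ball (fst w) \<epsilon>)" by (simp add: convex_\<Delta> convex_Int)
  then have "s \<in> ball (fst w) \<epsilon>" using closed_segment_subset[OF xy] s(1) by blast
  moreover obtain v where v: "simple v" "fst v = s" "q = col v" by (rule \<kappa>_SomeD[OF s(2)])
  ultimately have "col v = col w" using e(2)[OF simpleD(1)[OF v(1)]] by simp
  then show "col w = col w \<rhd> q" using act_idem[OF corner_Q[OF w]] v(3) by simp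
 qed (use corner_Q[OF w] in simp_all)
 then show ?thesis unfolding flat_at_def using e(1) by blast
qed

text \<open>The germ is prescribed at \<open>a\<close> only; the values along the old sides and the
  germ at \<open>b\<close> are consequences.\<close>

definition "membrane S \<longleftrightarrow> flat \<Delta> sh \<kappa>O S \<and> agree_at \<Delta> sh S (\<lambda>_. col a) (fst a)"

lemma membrane_exists: "\<exists>S. membrane S"
 unfolding membrane_def
 by (rule monodromy[OF convex_\<Delta> good_everywhere corners_in(1)]) (use start_flat in simp_all)

text \<open>A side lies at level 0, so exactly the strands of \<open>Ov\<close> can cover its
  points, and passing under means projecting into the shadow. The covering point is simple because
  the link that contains the side is regular: neither a vertex nor a third point shares the
  projection.\<close>

lemma side_under:
 assumes R: "regular_position (ZE \<union> E)" and E: "edge_union E \<subseteq> T" "a \<in> \<Union>(ZE \<union> E)" "b \<in> \<Union>(ZE \<union> E)"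
  and x: "x \<in> edge_union E" "x \<noteq> a" "x \<noteq> b"
 shows "x \<in> under_points (ZE \<union> E) \<longleftrightarrow> fst x \<in> sh"
  and "x \<in> under_points (ZE \<union> E) \<Longrightarrow> simple (over (ZE \<union> E) x) \<and> fst (over (ZE \<union> E) x) = fst x"
proof -
 have xT: "x \<in> T" using E(1) x by blast
 then have x\<Delta>: "fst x \<in> \<Delta>" "level x = 0" by (simp_all add: T_iff)
 have xX: "x \<in> edge_union (ZE \<union> E)" using x by (simp add: edge_union_Un)
 have xZ: "x \<notin> Z" using disj xT x(2,3) unfolding T_def Z_def by blast
 have above: "w \<in> Ov" if w: "w \<in> edge_union (ZE \<union> E)" "fst w = fst x" "snd x < snd w" for w
 proof -
  have l: "level w > 0" using level_fst[OF w(2)] w(3) x\<Delta> by simp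
  then have "w \<notin> T" by (simp add: T_iff)
  then have "w \<in> Z" using w(1) E(1) by (auto simp: edge_union_Un Z_def)
  then show ?thesis using l w(2) x\<Delta> by (simp add: Ov_def)
 qed
 show 1: "x \<in> under_points (ZE \<union> E) \<longleftrightarrow> fst x \<in> sh"
 proof
  assume "x \<in> under_points (ZE \<union> E)"
  then obtain w where w: "w \<in> edge_union (ZE \<union> E)" "fst w = fst x" "snd x < snd w" by (rule under_pointE[OF R])
  then show "fst x \<in> sh" using above[OF w] unfolding sh_def by (metis imageI)
 next
  assume "fst x \<in> sh"
  then obtain y where y: "y \<in> Ov" "fst y = fst x" unfolding sh_def by (metis imageE)
  have yX: "y \<in> edge_union (ZE \<union> E)" using OD(1)[OF y(1)] by (simp add: edge_union_Un Z_def)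
  have "y \<noteq> x" using OD(1)[OF y(1)] xZ by blast
  then have "snd y \<noteq> snd x" using y(2) by (metis prod_eq_iff)
  moreover have "snd y \<ge> snd x" using level_fst[OF y(2)] OD(3)[OF y(1)] x\<Delta> by simp
  ultimately show "x \<in> under_points (ZE \<union> E)" using under_pointI[OF xX yX y(2)] by simp
 qed
 assume "x \<in> under_points (ZE \<union> E)"
 then obtain w where w: "over (ZE \<union> E) x = w" "w \<in> edge_union (ZE \<union> E)" "fst w = fst x" "snd x < snd w" by (rule under_pointE[OF R])
 have wO: "w \<in> Ov" using above[OF w(2-4)] .
 have wx: "w \<noteq> x" using w(4) by auto
 have wn: "w \<notin> \<Union>(ZE \<union> E)" using crossing_nonvertex[OF R w(2) xX w(3) wx] .
 then have "w \<noteq> a" "w \<noteq> b" "flat_pt w" using E unfolding flat_pt_def by blast+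
 moreover have "v = w" if v: "v \<in> Ov" "fst v = fst w" for v
 proof -
  have "v \<in> edge_union (ZE \<union> E)" using OD(1)[OF v(1)] by (simp add: edge_union_Un Z_def)
  moreover have "v \<noteq> x" using OD(1)[OF v(1)] xZ by blast
  ultimately show ?thesis using regular_triple[OF R _ w(2) xX v(2) w(3)] wx by blast
 qed
 ultimately have "simple w" using wO unfolding simple_def by blast
 then show "simple (over (ZE \<union> E) x) \<and> fst (over (ZE \<union> E) x) = fst x" using w by simp
qed

lemmas side_underA = side_under[OF RA sides_in_T(1) ends_vertices(1,2)]
lemmas side_underB = side_under[OF RB sides_in_T(2) ends_vertices(3,4)]

lemma T_fst: "x \<in> T \<Longrightarrow> fst x \<in> \<Delta>"
 by (simp add: T_iff)

lemma alpha_flat: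
 assumes S: "flat \<Delta> sh \<kappa>O S" and D: "convex D" "D \<subseteq> edge_union EA" "a \<notin> D" "b \<notin> D"
 shows "flat D U (Some \<circ> col \<circ> over K) (\<lambda>x. S (fst x))"
proof (rule flat_fst[OF S D(1)])
 have DT: "D \<subseteq> T" using D(2) sides_in_T(1) by blast
 show "fst ` D \<subseteq> \<Delta>" using DT T_fst by blast
 show "inj_on fst D" using T_inj DT by (meson inj_onI subsetD)
 fix x assume x: "x \<in> D"
 then have x': "x \<in> edge_union EA" "x \<noteq> a" "x \<noteq> b" using D by blast+
 show "x \<in> U \<longleftrightarrow> fst x \<in> sh" by (rule side_underA(1)[OF x'])
 assume "x \<in> U"
 then have "simple (over K x) \<and> fst (over K x) = fst x" by (rule side_underA(2)[OF x'])
 then show "(Some \<circ> col \<circ> over K) x = \<kappa>O (fst x)" using \<kappa>_simple[of "over K x"] by simp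
qed

text \<open>Along an old side the membrane and the old coloring are flat for the same wall with the
  same wall colors, so agreement at one point propagates.\<close>

lemma alpha_agree:
 assumes S: "flat \<Delta> sh \<kappa>O S" and D: "convex D" "D \<subseteq> seg p q" "{p, q} \<in> EA" "a \<notin> D" "b \<notin> D"
  and s: "s \<in> D" "s \<notin> U" "S (fst s) = col s" and x: "x \<in> D" "x \<notin> U"
 shows "S (fst x) = col x"
proof (cases "x = s")
 case False
 have e: "{p, q} \<in> K" using D(3) by simp
 have DE: "D \<subseteq> edge_union EA" using D(2) edge_hull_subset[OF D(3)] by (simp add: edge_hull)
 have good: "good D U (Some \<circ> col \<circ> over K) t" if "t \<in> D" for t
 proof -
  obtain z where z: "z \<in> D" "z \<noteq> t" using False x(1) s(1) by metis
  show ?thesis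
  proof (rule segment_good[OF D(1,2) _ _ that z])
   show "finite (D \<inter> U)" using finite_under_points[OF KA RA] by simp
   fix y assume "y \<in> D" "y \<in> U"
   from this(2) obtain v where v: "over K y = v" "v \<in> edge_union K" "v \<notin> U" by (rule under_pointE[OF RA])
   then show "\<exists>q\<in>Q. (Some \<circ> col \<circ> over K) y = Some q" using point_coloring_in[OF col v(2,3)] by simp
  qed
 qed
 have fc: "flat D U (Some \<circ> col \<circ> over K) col"
  by (rule flat_mono[OF point_coloring_flat[OF col e]]) (use D(2) in \<open>simp add: edge_hull\<close>)
 show ?thesis
  by (rule flat_unique_point[OF D(1) good alpha_flat[OF S D(1) DE D(4,5)] fc s x])
qed (use s in simp)

lemma membrane_near_end:
 assumes S: "membrane S" and w: "w \<in> {a, b}" and ag: "agree_at \<Delta> sh S (\<lambda>_. col w) (fst w)"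
 obtains \<delta> where "\<delta> > 0" "\<And>x. x \<in> T \<Longrightarrow> dist w x < \<delta> \<Longrightarrow> fst x \<notin> sh \<Longrightarrow> S (fst x) = col w"
proof -
 obtain \<epsilon> where e: "\<epsilon> > 0" "\<forall>y\<in>\<Delta> \<inter> ball (fst w) \<epsilon> - sh. S y = col w" using ag unfolding agree_at_def by blast
 show ?thesis
 proof (rule that[OF e(1)])
  fix x assume x: "x \<in> T" "dist w x < \<epsilon>" "fst x \<notin> sh"
  have "dist (fst w) (fst x) < \<epsilon>" using dist_fst_le[of w x] x(2) by linarith
  then have "fst x \<in> \<Delta> \<inter> ball (fst w) \<epsilon> - sh" using x T_fst by simp
  then show "S (fst x) = col w" using e(2) by blast
 qed
qed

text \<open>Near \<open>a\<close> the membrane, by its prescribed germ, and the coloring both have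
  the value \<open>col a\<close>. The point is taken inside the side, as the corner itself projects
  into the shadow, where the membrane is not controlled.\<close>

lemma start_point:
 assumes S: "membrane S" and e: "{a, q} \<in> EA"
 obtains s where "s \<in> open_segment a q" "s \<notin> U" "S (fst s) = col s"
proof -
 have aq: "a \<noteq> q" using sides e distinct_ends by (elim disjE conjE) (auto simp: doubleton_eq_iff)
 have hull: "conv {a, q} = seg a q" by (rule edge_hull)
 have "a \<notin> U" using vertex_not_crossing[OF RA ends_vertices(1)] under_points_crossing by blast
 from col_near[OF Z_in_K[OF ends_in_Z(1)] this] obtain \<delta>1 where d1: "\<delta>1 > 0"
  "\<And>e y. e \<in> K \<Longrightarrow> a \<in> conv e \<Longrightarrow> y \<in> conv e \<Longrightarrow> dist a y < \<delta>1 \<Longrightarrow> y \<notin> U \<and> col y = col a" by blast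
 obtain \<delta>2 where d2: "\<delta>2 > 0" "\<And>x. x \<in> T \<Longrightarrow> dist a x < \<delta>2 \<Longrightarrow> fst x \<notin> sh \<Longrightarrow> S (fst x) = col a"
  using membrane_near_end[OF S, of a] S unfolding membrane_def by blast
 obtain s where s: "s \<in> open_segment q a" "dist a s < min \<delta>1 \<delta>2"
  using open_segment_near[of q a "min \<delta>1 \<delta>2"] aq d1 d2 by (metis min_less_iff_conj)
 have sc: "s \<in> seg a q" "s \<noteq> a" using s(1) by (auto simp: open_segment_def closed_segment_commute)
 have sE: "s \<in> edge_union EA" using edge_hull_subset[OF e] sc(1) unfolding hull by blast
 have U: "s \<notin> U \<and> col s = col a" using d1(2)[of "{a, q}" s] e s(2) sc(1) unfolding hull by simp
 have "s \<noteq> b"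
 proof
  assume "s = b"
  then show False using s(1) sides e distinct_ends
  proof (elim disjE conjE)
   assume "EA = {{a, b}}" then have "q = b" using e aq by (auto simp: doubleton_eq_iff)
   then show False using s(1) \<open>s = b\<close> by (simp add: open_segment_def)
  next
   assume "EA = {{a, c}, {c, b}}" then have "q = c" using e aq distinct_ends by (auto simp: doubleton_eq_iff)
   then have "b \<in> seg a c" using sc(1) \<open>s = b\<close> by simp
   then obtain u where u: "0 \<le> u" "b = a + u *\<^sub>R (c - a)" by (rule closed_segment_paramE)
   then have "bb (fst b) = u * 0" using bary_affine(1)[of "fst a" u "fst c"] bary_vertex by simp
   then show False using bary_vertex by simp
  qed
 qed
 then have "fst s \<notin> sh" using side_underA(1)[OF sE sc(2)] U by blast
 moreover have "s \<in> T" using sE sides_in_T(1) by blast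
 ultimately have "S (fst s) = col s" using d2(2)[of s] s(2) U by simp
 moreover have "s \<in> open_segment a q" using s(1) by (simp add: open_segment_commute)
 ultimately show ?thesis using that U by blast
qed

lemma not_on_sides: "b \<notin> seg a c" "a \<notin> seg c b" "c \<notin> seg a b"
 using bary_sides[of b] bary_sides[of a] bary_sides[of c] bary_vertex by auto

text \<open>If the old path is the broken one, agreement is carried to \<open>c\<close>, which is a
  vertex and so no under point, and from there along the other side.\<close>

lemma membrane_on_alpha:
 assumes S: "membrane S" and x: "x \<in> edge_union EA" "x \<notin> U" "x \<noteq> a" "x \<noteq> b"
 shows "S (fst x) = col x"
proof -
 have flat: "flat \<Delta> sh \<kappa>O S" using S unfolding membrane_def by blast
 from sides show ?thesis
 proof (elim disjE conjE)
  assume EA: "EA = {{a, b}}"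
  then have e: "{a, b} \<in> EA" by simp
  obtain s where s: "s \<in> open_segment a b" "s \<notin> U" "S (fst s) = col s" by (rule start_point[OF S e])
  have "x \<in> open_segment a b" using x unfolding EA edge_union_def by (simp add: edge_hull open_segment_def)
  then show ?thesis
   by (intro alpha_agree[OF flat convex_open_segment _ e _ _ s _ x(2)]) (auto simp: open_segment_def)
 next
  assume EA: "EA = {{a, c}, {c, b}}"
  then have e: "{a, c} \<in> EA" "{c, b} \<in> EA" by simp_all
  obtain s where s: "s \<in> open_segment a c" "s \<notin> U" "S (fst s) = col s" by (rule start_point[OF S e(1)])
  have first: "S (fst y) = col y" if "y \<in> seg a c - {a}" "y \<notin> U" for y
  proof (rule alpha_agree[OF flat convex_minus_end(1) _ e(1) _ _ _ s(2,3) that])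
   show "s \<in> seg a c - {a}" using s(1) by (simp add: open_segment_def)
  qed (use not_on_sides in auto)
  have "c \<in> \<Union>K" using EA by blast
  then have cU: "c \<notin> U" using vertex_not_crossing[OF RA] under_points_crossing by blast
  then have "S (fst c) = col c" using first distinct_ends by simp
  then have second: "S (fst y) = col y" if "y \<in> seg c b - {b}" "y \<notin> U" for y
   by (intro alpha_agree[OF flat convex_minus_end(2) _ e(2) _ _ _ cU _ that]) (use not_on_sides distinct_ends in auto)
  have "x \<in> seg a c \<or> x \<in> seg c b" using x(1) unfolding EA edge_union_def by (simp add: edge_hull)
  then show ?thesis using first second x by blast
 qed
qed

text \<open>Uniqueness of germs leaves agreement with \<open>col b\<close> or complete disagreement;
  points of the old path close to \<open>b\<close> rule out the latter.\<close>

lemma membrane_at_b: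
 assumes S: "membrane S"
 shows "agree_at \<Delta> sh S (\<lambda>_. col b) (fst b)"
proof -
 have flat: "flat \<Delta> sh \<kappa>O S" using S unfolding membrane_def by blast
 have fl: "flat_at \<Delta> sh \<kappa>O (fst b) S" unfolding flat_at_def by (intro exI[of _ 1] conjI flat_mono[OF flat]) auto
 have b: "b \<in> {a, b}" by simp
 have "\<exists>q. {q, b} \<in> EA \<and> q \<noteq> b \<and> (q = a \<or> (q = c \<and> a \<notin> seg q b))"
  using sides
 proof (elim disjE conjE)
  assume "EA = {{a, b}}" then show ?thesis using distinct_ends by (intro exI[of _ a]) simp
 next
  assume "EA = {{a, c}, {c, b}}" then show ?thesis using distinct_ends not_on_sides by (intro exI[of _ c]) simp
 qed
 then obtain q where q: "{q, b} \<in> EA" "q \<noteq> b" "q = a \<or> (q = c \<and> a \<notin> seg q b)" by blast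
 have hull: "conv {q, b} = seg q b" by (rule edge_hull)
 have "b \<notin> U" using vertex_not_crossing[OF RA ends_vertices(2)] under_points_crossing by blast
 from col_near[OF Z_in_K[OF ends_in_Z(2)] this] obtain \<delta>1 where d1: "\<delta>1 > 0"
  "\<And>e y. e \<in> K \<Longrightarrow> b \<in> conv e \<Longrightarrow> y \<in> conv e \<Longrightarrow> dist b y < \<delta>1 \<Longrightarrow> y \<notin> U \<and> col y = col b" by blast
 have "\<not> (\<exists>\<epsilon>>0. \<forall>y\<in>\<Delta> \<inter> ball (fst b) \<epsilon> - sh. S y \<noteq> col b)"
 proof
  assume "\<exists>\<epsilon>>0. \<forall>y\<in>\<Delta> \<inter> ball (fst b) \<epsilon> - sh. S y \<noteq> col b"
  then obtain \<epsilon> where e: "\<epsilon> > 0" "\<forall>y\<in>\<Delta> \<inter> ball (fst b) \<epsilon> - sh. S y \<noteq> col b" by blast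
  obtain s where s: "s \<in> open_segment q b" "dist b s < min \<delta>1 \<epsilon>"
   using open_segment_near[of q b "min \<delta>1 \<epsilon>"] q(2) d1 e by (metis min_less_iff_conj)
  have sc: "s \<in> seg q b" "s \<noteq> b" "s \<noteq> q" using s(1) by (auto simp: open_segment_def)
  have sE: "s \<in> edge_union EA" using edge_hull_subset[OF q(1)] sc(1) unfolding hull by blast
  have sa: "s \<noteq> a" using q(3) sc by auto
  have U: "s \<notin> U \<and> col s = col b" using d1(2)[of "{q, b}" s] q(1) s(2) sc(1) unfolding hull by simp
  then have "S (fst s) = col b" using membrane_on_alpha[OF S sE _ sa sc(2)] by simp
  moreover have "fst s \<notin> sh" using side_underA(1)[OF sE sa sc(2)] U by blast
  moreover have "fst s \<in> \<Delta>" using sE sides_in_T(1) T_fst by blast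
  moreover have "dist (fst b) (fst s) < \<epsilon>" using dist_fst_le[of b s] s(2) by linarith
  ultimately show False using e(2) by auto
 qed
 then show ?thesis using agree_or_disagree[OF good_everywhere[OF corners_in(2)] fl start_flat[OF b]] by blast
qed

lemma ends_not_under: "w \<in> {a, b} \<Longrightarrow> w \<notin> U" "w \<in> {a, b} \<Longrightarrow> w \<notin> U'"
 using vertex_not_crossing[OF RA, of w] vertex_not_crossing[OF RB, of w] under_points_crossing ends_vertices by blast+

lemma below_not_sh':
 assumes "y \<in> Z" "fst y \<in> \<Delta>" "level y < 0" "y \<notin> U" shows "fst y \<notin> sh"
proof
 assume "fst y \<in> sh"
 then obtain w where w: "w \<in> Ov" "fst w = fst y" unfolding sh_def by (metis imageE)
 have "snd w > snd y" using level_fst[OF w(2)] OD(3)[OF w(1)] assms(3) by linarith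
 then show False using under_pointI[OF Z_in_K[OF assms(1)] Ov_in_K[OF w(1)] w(2)] assms(4) by blast
qed

lemma simple_not_under:
 assumes "simple v" shows "v \<in> Z" "v \<notin> U" "v \<notin> U'" "level v > 0"
proof -
 have v: "v \<in> Ov" "v \<in> Z" using simpleD(1)[OF assms] OD(1) by blast+
 then show "v \<in> Z" by simp
 show "v \<notin> U" by (rule unique_not_under[OF v(1)]) (rule simpleD(2)[OF assms])
 show "level v > 0" using O_level_pos[OF v(1)] simpleD(3,4)[OF assms] by blast
 show "v \<notin> U'"
 proof
  assume "v \<in> U'"
  then obtain w where w: "w \<in> edge_union K'" "fst w = fst v" "snd v < snd w" by (rule under_pointE[OF RB])
  have l: "level w > 0" using level_fst[OF w(2)] w(3) OD(3)[OF v(1)] by simp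
  have "w \<notin> T" using l by (simp add: T_iff)
  then have "w \<in> Z" using w(1) sides_in_T(2) by (auto simp: edge_union_Un Z_def)
  then have "w \<in> Ov" using l w(2) OD(2)[OF v(1)] by (simp add: Ov_def)
  then show False using simpleD(2)[OF assms _ w(2)] w(3) by auto
 qed
qed

end

context kei
begin

lemma flat_two_sided:
 assumes D: "convex D" "\<And>s. s \<in> D \<Longrightarrow> s \<in> B \<Longrightarrow> s = p"
  and Q: "\<And>x. x \<in> D \<Longrightarrow> x \<notin> B \<Longrightarrow> f x \<in> Q"
  and const: "\<And>x y. x \<in> D \<Longrightarrow> x \<notin> B \<Longrightarrow> y \<in> D \<Longrightarrow> y \<notin> B \<Longrightarrow> p \<notin> seg x y \<or> p \<notin> B \<Longrightarrow> f y = f x"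
  and cross: "\<And>x y q. x \<in> D \<Longrightarrow> x \<notin> B \<Longrightarrow> y \<in> D \<Longrightarrow> y \<notin> B \<Longrightarrow> p \<in> seg x y \<Longrightarrow> p \<in> B \<Longrightarrow>
   \<kappa> p = Some q \<Longrightarrow> f y = f x \<rhd> q"
 shows "flat D B \<kappa> f"
proof (rule flatI[OF Q])
 fix x y assume xy: "x \<in> D" "x \<notin> B" "y \<in> D" "y \<notin> B" and "seg x y \<inter> B = {}"
 then show "f y = f x" using const[OF xy] by blast
next
 fix x y s q assume xy: "x \<in> D" "x \<notin> B" "y \<in> D" "y \<notin> B" and s: "seg x y \<inter> B = {s}" "\<kappa> s = Some q"
 have "s \<in> seg x y" "s \<in> B" using s(1) by blast+
 moreover from this have "s = p" using D(2) closed_segment_subset[OF xy(1,3) D(1)] by blast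
 ultimately show "f y = f x \<rhd> q" using cross[OF xy] s(2) by blast
qed

lemma flat_constant:
 assumes D: "convex D" "D \<inter> B = {}" "q \<in> Q" "\<And>x. x \<in> D \<Longrightarrow> f x = q"
 shows "flat D B \<kappa> f"
proof (rule flat_two_sided[OF D(1), where p = undefined])
 show "s = undefined" if "s \<in> D" "s \<in> B" for s using that D(2) by blast
 show "f y = f x \<rhd> q'" if "x \<in> D" "y \<in> D" "undefined \<in> seg x y" "undefined \<in> B" for x y q'
  using closed_segment_subset[OF that(1,2) D(1)] that(3,4) D(2) by blast
qed (simp_all add: D(3,4))

end

section \<open>The coloring of the new link\<close>

locale membrane_swap = colored_swap ZE EA EB a b c g Q act col
 for ZE EA EB :: "space set set" and a b c :: space and g :: "plane \<Rightarrow> real"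
  and Q :: "'q set" and act :: "'q \<Rightarrow> 'q \<Rightarrow> 'q" (infixl "\<rhd>" 70) and col +
 fixes S :: "plane \<Rightarrow> 'q"
 assumes S: "membrane S"
begin

definition "below p \<longleftrightarrow> fst p \<in> \<Delta> \<and> level p < 0"
definition "shift p = (if below p then col p \<rhd> S (fst p) else col p)"

text \<open>The color that a strand passing under the side \<open>EA\<close> has outside of the triangle.\<close>

definition "outval p = (SOME q. \<exists>\<delta>>0. \<forall>w\<in>Z. dist p w < \<delta> \<longrightarrow> fst w \<notin> \<Delta> \<longrightarrow> col w = q)"

text \<open>A point of \<open>Z\<close> in \<open>U\<close> but not in \<open>U'\<close> passed
  under an old side and has no old color; continuity with the unchanged part outside of the triangle
  dictates \<open>outval\<close> there.\<close>

definition "col' = (\<lambda>p\<in>edge_union K' - U'. if p \<in> Z then (if p \<in> U then outval p else shift p) else S (fst p))"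

lemma S_flat: "flat \<Delta> sh \<kappa>O S"
 using S unfolding membrane_def by blast

lemma S_end: "w \<in> {a, b} \<Longrightarrow> agree_at \<Delta> sh S (\<lambda>_. col w) (fst w)"
 using S membrane_at_b[OF S] unfolding membrane_def by blast

lemma col'_Z: "p \<in> Z \<Longrightarrow> p \<notin> U' \<Longrightarrow> p \<notin> U \<Longrightarrow> col' p = shift p"
 using Z_sub(2) unfolding col'_def by auto

lemma Z_side: "x \<in> edge_union EA \<union> edge_union EB \<Longrightarrow> x \<in> Z \<Longrightarrow> x = a \<or> x = b"
 using Z_level_0[of x] sides_in_T T_iff[of x] by blast

lemma col'_EB: "x \<in> edge_union EB \<Longrightarrow> x \<notin> U' \<Longrightarrow> x \<noteq> a \<Longrightarrow> x \<noteq> b \<Longrightarrow> col' x = S (fst x)"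
 using Z_side[of x] unfolding col'_def by (auto simp: edge_union_Un)

lemma below_not_sh: "y \<in> Z \<Longrightarrow> below y \<Longrightarrow> y \<notin> U \<Longrightarrow> fst y \<notin> sh"
 using below_not_sh' unfolding below_def by blast

lemma side_zero:
 assumes "w \<in> edge_union EA \<union> edge_union EB"
 shows "ba (fst w) = 0 \<or> bb (fst w) = 0 \<or> bc (fst w) = 0"
proof -
 have "w \<in> seg a b \<or> w \<in> seg a c \<or> w \<in> seg c b"
  using assms sides unfolding edge_union_def by (elim disjE conjE) (simp_all add: edge_hull, blast+)
 then show ?thesis using bary_sides by blast
qed

lemma side_disjoint:
 assumes "w \<in> edge_union EA" "w \<in> edge_union EB" shows "w = a \<or> w = b"
proof -
 have "w \<in> seg a b \<and> (w \<in> seg a c \<or> w \<in> seg c b)"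
  using assms sides unfolding edge_union_def by (elim disjE conjE) (simp_all add: edge_hull)
 then have "bc (fst w) = 0" "bb (fst w) = 0 \<or> ba (fst w) = 0" using bary_sides by blast+
 then have "fst w = fst a \<or> fst w = fst b"
  using bary_inj[of "fst w" "fst a"] bary_inj[of "fst w" "fst b"] bary_vertex by (auto simp: ba_def)
 then show ?thesis using T_inj ends_T assms(1) sides_in_T(1) by blast
qed

lemma same_under:
 assumes y: "y \<in> Z" and no: "\<And>w. w \<in> edge_union EA \<union> edge_union EB \<Longrightarrow> fst w = fst y \<Longrightarrow> snd w \<le> snd y"
 shows "y \<in> U \<longleftrightarrow> y \<in> U'" and "y \<in> U \<Longrightarrow> over K' y = over K y \<and> over K y \<in> Z"
proof -
 have inZ: "w \<in> Z" if w: "w \<in> edge_union K \<union> edge_union K'" "fst w = fst y" "snd y < snd w" for w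
  using no[of w] w by (auto simp: edge_union_Un Z_def)
 have yK: "y \<in> edge_union K" "y \<in> edge_union K'" using y Z_sub by blast+
 show "y \<in> U \<longleftrightarrow> y \<in> U'"
 proof
  assume "y \<in> U"
  then obtain w where "w \<in> edge_union K" "fst w = fst y" "snd y < snd w" by (rule under_pointE[OF RA])
  then show "y \<in> U'" using under_pointI[OF yK(2), of w] inZ[of w] Z_sub by blast
 next
  assume "y \<in> U'"
  then obtain w where "w \<in> edge_union K'" "fst w = fst y" "snd y < snd w" by (rule under_pointE[OF RB])
  then show "y \<in> U" using under_pointI[OF yK(1), of w] inZ[of w] Z_sub by blast
 qed
 assume "y \<in> U"
 then obtain w where w: "over K y = w" "w \<in> edge_union K" "fst w = fst y" "snd y < snd w" by (rule under_pointE[OF RA])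
 have wZ: "w \<in> Z" using inZ[of w] w by blast
 have "over K' y = w" by (rule over_eq[OF RB yK(2) _ w(3,4)]) (use wZ Z_sub in blast)
 then show "over K' y = over K y \<and> over K y \<in> Z" using w(1) wZ by simp
qed

lemma no_side_above:
 assumes "fst y \<notin> \<Delta> \<or> level y > 0 \<or> (ba (fst y) > 0 \<and> bb (fst y) > 0 \<and> bc (fst y) > 0)"
  and w: "w \<in> edge_union EA \<union> edge_union EB" "fst w = fst y"
 shows "snd w \<le> snd y"
proof -
 have "w \<in> T" using w(1) sides_in_T by blast
 then have wT: "fst w \<in> \<Delta>" "level w = 0" by (simp_all add: T_iff)
 have "level y > 0" using assms(1) wT(1) w(2) side_zero[OF w(1)] by auto
 then show ?thesis using level_fst[OF w(2)] wT(2) by simp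
qed

lemma same_under_away:
 assumes "y \<in> Z" "fst y \<notin> \<Delta> \<or> level y > 0 \<or> (ba (fst y) > 0 \<and> bb (fst y) > 0 \<and> bc (fst y) > 0)"
 shows "y \<in> U \<longleftrightarrow> y \<in> U'" and "y \<in> U \<Longrightarrow> over K' y = over K y \<and> over K y \<in> Z"
 using same_under[OF assms(1) no_side_above[OF assms(2)]] by blast+

lemma isolated:
 obtains \<delta> where "\<delta> > 0" "\<And>y. y \<in> U \<Longrightarrow> dist p y < \<delta> \<Longrightarrow> y = p" "\<And>y. y \<in> U' \<Longrightarrow> dist p y < \<delta> \<Longrightarrow> y = p"
proof -
 have "finite (U \<union> U')" using finite_under_points[OF KA RA] finite_under_points[OF KB RB] by simp
 from isolated_from_finite[OF this, of p] obtain \<delta> where "\<delta> > 0" "\<And>y. y \<in> U \<union> U' \<Longrightarrow> dist p y < \<delta> \<Longrightarrow> y = p" by blast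
 then show ?thesis using that[of \<delta>] by blast
qed

lemma S_near:
 assumes "t \<in> \<Delta>" "t \<notin> sh"
 obtains \<epsilon> where "\<epsilon> > 0" "\<And>x. x \<in> \<Delta> \<Longrightarrow> dist t x < \<epsilon> \<Longrightarrow> x \<notin> sh \<and> S x = S t"
proof -
 have "compact sh" unfolding sh_def by (intro compact_continuous_image continuous_intros compact_Ov)
 then have "open (- sh)" by (simp add: compact_imp_closed open_Compl)
 then obtain \<epsilon> where e: "\<epsilon> > 0" "ball t \<epsilon> \<subseteq> - sh" using openE[of "- sh" t] assms(2) by blast
 show ?thesis
 proof (rule that[OF e(1)])
  fix x assume x: "x \<in> \<Delta>" "dist t x < \<epsilon>"
  have "seg t x \<subseteq> ball t \<epsilon>" using x e(1) by (intro closed_segment_subset) auto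
  then have "seg t x \<inter> sh = {}" using e(2) by blast
  then show "x \<notin> sh \<and> S x = S t" using flat_const[OF S_flat assms(1) x(1)] ends_in_segment(2)[of x t] by blast
 qed
qed

lemma S_Q: "x \<in> \<Delta> \<Longrightarrow> x \<notin> sh \<Longrightarrow> S x \<in> Q"
 using flat_in[OF S_flat] .

lemma edge_Z: "e \<in> ZE \<Longrightarrow> y \<in> conv e \<Longrightarrow> y \<in> Z"
 using edge_hull_subset unfolding Z_def by blast

abbreviation "flat_near' e p \<equiv> \<exists>\<epsilon>>0. flat (conv e \<inter> ball p \<epsilon>) U' (Some \<circ> col' \<circ> over K') col'"

lemma convex_piece: "convex (conv e \<inter> ball p \<epsilon>)" for e :: "space set"
 by (intro convex_Int convex_convex_hull convex_ball)

lemma col_piece: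
 assumes e: "e \<in> ZE" and iso: "\<And>y. y \<in> U \<Longrightarrow> dist p y < \<epsilon> \<Longrightarrow> y = p"
  and x: "x \<in> conv e \<inter> ball p \<epsilon>" "x \<notin> U" and y: "y \<in> conv e \<inter> ball p \<epsilon>" "y \<notin> U"
 shows "p \<notin> seg x y \<or> p \<notin> U \<Longrightarrow> col y = col x"
  "p \<in> seg x y \<Longrightarrow> p \<in> U \<Longrightarrow> col y = col x \<rhd> col (over K p)"
proof -
 have fl: "flat (conv e) U (Some \<circ> col \<circ> over K) col" using point_coloring_flat[OF col] e by blast
 have sub: "s = p" if "s \<in> seg x y" "s \<in> U" for s
  using closed_segment_subset[OF x(1) y(1) convex_piece] iso[of s] that by auto
 have xe: "x \<in> conv e" "y \<in> conv e" using x y by simp_all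
 show "col y = col x" if np: "p \<notin> seg x y \<or> p \<notin> U"
 proof (rule flat_const[OF fl xe])
  have "s \<notin> U" if "s \<in> seg x y" for s
  proof
   assume "s \<in> U"
   then have "s = p" by (rule sub[OF that])
   then show False using np that \<open>s \<in> U\<close> by simp
  qed
  then show "seg x y \<inter> U = {}" by (simp add: disjoint_iff)
 qed
 show "col y = col x \<rhd> col (over K p)" if pp: "p \<in> seg x y" "p \<in> U"
 proof (rule flat_cross[OF fl xe(1) x(2) xe(2) y(2)])
  show "seg x y \<inter> U = {p}"
  proof (rule subset_antisym)
   show "seg x y \<inter> U \<subseteq> {p}" using sub by (simp add: subset_iff del: split_paired_All)
  qed (use pp in simp)
 qed simp
qed

text \<open>No side of the triangle lies above such a point, so nearby the under points, the over
  points and the colors are the same in both links.\<close>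

lemma flat_away:
 assumes e: "e \<in> ZE" "p \<in> conv e" and p: "fst p \<notin> \<Delta> \<or> level p > 0"
 shows "flat_near' e p"
proof -
 have "\<exists>\<delta>>0. \<forall>y. dist p y < \<delta> \<longrightarrow> fst y \<notin> \<Delta> \<or> level y > 0"
  using p
 proof
  assume "fst p \<notin> \<Delta>"
  moreover have "open (- \<Delta>)" using closed_\<Delta> by (rule open_Compl)
  ultimately obtain \<delta> where "\<delta> > 0" "ball (fst p) \<delta> \<subseteq> - \<Delta>" using openE[of "- \<Delta>" "fst p"] by blast
  moreover have "fst y \<in> ball (fst p) \<delta>" if "dist p y < \<delta>" for y using dist_fst_le[of p y] that by simp
  ultimately show ?thesis by blast
 next
  assume "level p > 0"
  then obtain \<delta> where "\<delta> > 0" "\<And>y. dist p y < \<delta> \<Longrightarrow> level y > 0" using level_pos_near by blast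
  then show ?thesis by blast
 qed
 then obtain \<delta> where d: "\<delta> > 0" "\<And>y. dist p y < \<delta> \<Longrightarrow> fst y \<notin> \<Delta> \<or> level y > 0" by blast
 let ?D = "conv e \<inter> ball p \<delta>"
 have D: "y \<in> Z" "fst y \<notin> \<Delta> \<or> level y > 0" if "y \<in> ?D" for y
  using that edge_Z[OF e(1)] d(2)[of y] by simp_all
 have un: "y \<in> U \<longleftrightarrow> y \<in> U'" "y \<in> U \<Longrightarrow> over K' y = over K y \<and> over K y \<in> Z" if "y \<in> ?D" for y
  using same_under_away[OF D(1)[OF that]] D(2)[OF that] by blast+
 have nb: "\<not> below y" if "y \<in> ?D" for y using D(2)[OF that] unfolding below_def by auto
 have "flat ?D U' (Some \<circ> col' \<circ> over K') col'"
 proof (rule flat_cong_barrier[where B = U and \<kappa> = "Some \<circ> col \<circ> over K" and f = col])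
  show "flat ?D U (Some \<circ> col \<circ> over K) col"
   using flat_mono[OF point_coloring_flat[OF col]] e(1) by blast
  show "?D \<inter> U = ?D \<inter> U'" using un(1) by blast
  show "col' x = col x" if "x \<in> ?D" "x \<notin> U" for x
   using col'_Z[OF D(1)[OF that(1)]] un(1)[OF that(1)] that(2) nb[OF that(1)] unfolding shift_def by simp
  fix x assume x: "x \<in> ?D \<inter> U"
  then have xD: "x \<in> ?D" "x \<in> U" "x \<in> U'" using un(1) by blast+
  obtain v where v: "over K x = v" "v \<notin> U" "fst v = fst x" "snd x < snd v" by (rule under_pointE[OF RA xD(2)])
  obtain v' where v': "over K' x = v'" "v' \<notin> U'" by (rule under_pointE[OF RB xD(3)])
  have vv: "v' = v" "v \<in> Z" using un(2)[OF xD(1,2)] v(1) v'(1) by simp_all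
  have "\<not> below v" using D(2)[OF xD(1)] v(3,4) level_fst[OF v(3)] unfolding below_def by auto
  then have "col' v = col v" using col'_Z[OF vv(2) _ v(2)] v'(2) vv(1) unfolding shift_def by simp
  then show "(Some \<circ> col' \<circ> over K') x = (Some \<circ> col \<circ> over K) x" using v(1) v'(1) vv(1) by simp
 qed (rule convex_piece)
 then show ?thesis using d(1) by blast
qed

text \<open>Near a corner the strand and the membrane both have the color of the corner, so the
  shift changes nothing by idempotence and the new coloring is constant.\<close>

lemma flat_end:
 assumes e: "e \<in> ZE" "p \<in> conv e" and p: "p \<in> {a, b}"
 shows "flat_near' e p"
proof -
 have pZ: "p \<in> Z" using p ends_in_Z by blast
 have eK: "e \<in> K" using e by blast
 obtain \<delta>1 where d1: "\<delta>1 > 0" "\<And>y. y \<in> U \<Longrightarrow> dist p y < \<delta>1 \<Longrightarrow> y = p" "\<And>y. y \<in> U' \<Longrightarrow> dist p y < \<delta>1 \<Longrightarrow> y = p"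
  by (rule isolated[of p]) blast
 obtain \<delta>2 where d2: "\<delta>2 > 0" "\<forall>x\<in>\<Delta> \<inter> ball (fst p) \<delta>2 - sh. S x = col p"
  using S_end[OF p] unfolding agree_at_def by blast
 from col_near[OF Z_in_K[OF pZ] ends_not_under(1)[OF p]] obtain \<delta>3 where d3: "\<delta>3 > 0"
  "\<And>e y. e \<in> K \<Longrightarrow> p \<in> conv e \<Longrightarrow> y \<in> conv e \<Longrightarrow> dist p y < \<delta>3 \<Longrightarrow> y \<notin> U \<and> col y = col p" by blast
 define \<delta> where "\<delta> = min \<delta>1 (min \<delta>2 \<delta>3)"
 let ?D = "conv e \<inter> ball p \<delta>"
 have un: "y \<notin> U \<and> y \<notin> U'" if "y \<in> ?D" for y
  using that d1(2,3)[of y] ends_not_under[OF p] by (auto simp: \<delta>_def)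
 have "flat ?D U' (Some \<circ> col' \<circ> over K') col'"
 proof (rule flat_constant[OF convex_piece _ corner_Q[OF p]])
  show "?D \<inter> U' = {}" using un by blast
  fix y assume y: "y \<in> ?D"
  then have yZ: "y \<in> Z" using edge_Z[OF e(1)] by blast
  have cy: "col y = col p" using d3(2)[OF eK e(2), of y] y by (simp add: \<delta>_def)
  have "shift y = col p"
  proof (cases "below y")
   case True
   have "dist (fst p) (fst y) < \<delta>2" using dist_fst_le[of p y] y by (simp add: \<delta>_def)
   then have "fst y \<in> \<Delta> \<inter> ball (fst p) \<delta>2 - sh" using below_not_sh[OF yZ True] un[OF y] True unfolding below_def by simp
   then have "S (fst y) = col p" using d2(2) by blast
   then show ?thesis using cy act_idem[OF corner_Q[OF p]] True unfolding shift_def by simp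
  qed (simp add: shift_def cy)
  then show "col' y = col p" using col'_Z[OF yZ] un[OF y] by simp
 qed
 moreover have "\<delta> > 0" using d1 d2 d3 by (simp add: \<delta>_def)
 ultimately show ?thesis by blast
qed

text \<open>Below the open triangle the under points stay the same and every color is acted on by
  the membrane. A crossing survives by self-distributivity, in one of two ways: an over strand that
  is also below the triangle is shifted by the same membrane value; an over strand above it is not
  shifted, but the membrane value changes at its shadow.\<close>

lemma flat_interior:
 assumes e: "e \<in> ZE" "p \<in> conv e" and p: "level p < 0" "ba (fst p) > 0" "bb (fst p) > 0" "bc (fst p) > 0"
 shows "flat_near' e p"
proof -
 have pZ: "p \<in> Z" using edge_Z e by blast
 obtain \<delta>1 where d1: "\<delta>1 > 0" "\<And>y. y \<in> U \<Longrightarrow> dist p y < \<delta>1 \<Longrightarrow> y = p" "\<And>y. y \<in> U' \<Longrightarrow> dist p y < \<delta>1 \<Longrightarrow> y = p"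
  by (rule isolated[of p]) blast
 obtain \<delta>2 where d2: "\<delta>2 > 0" "\<And>y. dist p y < \<delta>2 \<Longrightarrow> level y < 0" using level_neg_near[OF p(1)] by blast
 obtain \<delta>3 where d3: "\<delta>3 > 0" "\<And>x. dist (fst p) x < \<delta>3 \<Longrightarrow> ba x > 0 \<and> bb x > 0 \<and> bc x > 0" using interior_ball[OF p(2-4)] by blast
 define \<delta> where "\<delta> = min \<delta>1 (min \<delta>2 \<delta>3)"
 have dpos: "\<delta> > 0" using d1 d2 d3 by (simp add: \<delta>_def)
 let ?D = "conv e \<inter> ball p \<delta>"
 have iso: "y = p" if "y \<in> U" "dist p y < \<delta>" for y using d1(2)[OF that(1)] that(2) by (simp add: \<delta>_def)
 have inn: "ba (fst y) > 0 \<and> bb (fst y) > 0 \<and> bc (fst y) > 0" "level y < 0" if "dist p y < \<delta>" for y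
 proof -
  have "dist (fst p) (fst y) < \<delta>3" using dist_fst_le[of p y] that by (simp add: \<delta>_def)
  then show "ba (fst y) > 0 \<and> bb (fst y) > 0 \<and> bc (fst y) > 0" by (rule d3(2))
  show "level y < 0" using d2(2)[of y] that by (simp add: \<delta>_def)
 qed
 have bel: "below y" if "dist p y < \<delta>" for y using inn[OF that] unfolding below_def \<Delta>_iff by auto
 have un: "y \<in> U \<longleftrightarrow> y \<in> U'" "y \<in> U \<Longrightarrow> over K' y = over K y \<and> over K y \<in> Z" if "y \<in> ?D" for y
 proof -
  have "y \<in> conv e" "dist p y < \<delta>" using that by simp_all
  then show "y \<in> U \<longleftrightarrow> y \<in> U'" "y \<in> U \<Longrightarrow> over K' y = over K y \<and> over K y \<in> Z"
   using same_under_away[OF edge_Z[OF e(1)]] inn(1) by blast+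
 qed
 have f: "col' y = col y \<rhd> S (fst y)" "col y \<in> Q" "S (fst y) \<in> Q" "fst y \<notin> sh" "fst y \<in> \<Delta>" if y: "y \<in> ?D" "y \<notin> U'" for y
 proof -
  have yZ: "y \<in> Z" using edge_Z[OF e(1)] y by blast
  have yU: "y \<notin> U" using un(1)[OF y(1)] y(2) by blast
  have bly: "below y" using bel y by simp
  show "col' y = col y \<rhd> S (fst y)" using col'_Z[OF yZ y(2) yU] bly by (simp add: shift_def)
  show "col y \<in> Q" using point_coloring_in[OF col Z_in_K[OF yZ] yU] .
  show ns: "fst y \<notin> sh" using below_not_sh[OF yZ bly yU] .
  show "fst y \<in> \<Delta>" using bly unfolding below_def by blast
  then show "S (fst y) \<in> Q" using S_Q ns by blast
 qed
 have pD: "p \<in> ?D" using e(2) dpos by simp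
 \<comment> \<open>A point below the triangle that projects into the shadow is an under point, and
   the ball contains none besides \<open>p\<close>.\<close>
 have shp: "fst s = fst p" if "s \<in> ?D" "fst s \<in> sh" for s
  using f(4)[OF that(1)] iso[of s] un(1)[OF that(1)] that by auto
 have segsh: "seg (fst x) (fst y) \<inter> sh \<subseteq> {fst p}" if "x \<in> ?D" "y \<in> ?D" for x y
  using closed_segment_subset[OF that convex_piece] shp unfolding fst_closed_segment[symmetric] by blast
 have inj: "inj_on fst (conv e)" using edge_inj[OF KA RA] e(1) by blast
 have Sconst: "S (fst y) = S (fst x)" if xy: "x \<in> ?D" "x \<notin> U'" "y \<in> ?D" "y \<notin> U'" and "p \<notin> seg x y \<or> fst p \<notin> sh" for x y
 proof (rule flat_const[OF S_flat f(5)[OF xy(1,2)] f(5)[OF xy(3,4)]])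
  have "fst p \<notin> seg (fst x) (fst y) \<or> fst p \<notin> sh"
  proof (rule ccontr)
   assume "\<not> ?thesis"
   then obtain s where s: "s \<in> seg x y" "fst s = fst p" "fst p \<in> sh" unfolding fst_closed_segment[symmetric] by auto
   have "s \<in> conv e" using closed_segment_subset[OF xy(1,3) convex_piece] s(1) by blast
   then have "s = p" using inj_onD[OF inj s(2)] e(2) by blast
   then show False using that(5) s by blast
  qed
  then show "seg (fst x) (fst y) \<inter> sh = {}" using segsh[OF xy(1,3)] by blast
 qed
 have "flat ?D U' (Some \<circ> col' \<circ> over K') col'"
 proof (rule flat_two_sided[OF convex_piece, where p = p])
  show "s = p" if "s \<in> ?D" "s \<in> U'" for s using iso[of s] un(1)[OF that(1)] that by simp
  show "col' x \<in> Q" if "x \<in> ?D" "x \<notin> U'" for x using f(1-3)[OF that] act_closed by simp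
 next
  fix x y assume xy: "x \<in> ?D" "x \<notin> U'" "y \<in> ?D" "y \<notin> U'" and np: "p \<notin> seg x y \<or> p \<notin> U'"
  have xyU: "x \<notin> U" "y \<notin> U" using un(1)[OF xy(1)] un(1)[OF xy(3)] xy by simp_all
  have "col y = col x" using col_piece(1)[OF e(1) iso xy(1) xyU(1) xy(3) xyU(2)] np un(1)[OF pD] by blast
  moreover have "S (fst y) = S (fst x)" using Sconst[OF xy] np f(4)[OF pD] by blast
  ultimately show "col' y = col' x" using f(1)[OF xy(1,2)] f(1)[OF xy(3,4)] by simp
 next
  fix x y q assume xy: "x \<in> ?D" "x \<notin> U'" "y \<in> ?D" "y \<notin> U'" and pp: "p \<in> seg x y" "p \<in> U'"
   and q: "(Some \<circ> col' \<circ> over K') p = Some q"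
  have pU: "p \<in> U" using un(1)[OF pD] pp(2) by blast
  have xyU: "x \<notin> U" "y \<notin> U" using un(1)[OF xy(1)] un(1)[OF xy(3)] xy by simp_all
  obtain v where v: "over K p = v" "v \<in> edge_union K" "v \<notin> U" "fst v = fst p" "snd p < snd v" by (rule under_pointE[OF RA pU])
  obtain v' where v': "over K' p = v'" "v' \<notin> U'" by (rule under_pointE[OF RB pp(2)])
  have vv: "v' = v" "v \<in> Z" using un(2)[OF pD pU] v(1) v'(1) by simp_all
  have qv: "q = col' v" using q v' vv by simp
  have cv: "col' v = shift v" using col'_Z[OF vv(2) _ v(3)] v'(2) vv(1) by simp
  have colv: "col v \<in> Q" using point_coloring_in[OF col v(2,3)] .
  have cc: "col y = col x \<rhd> col v" using col_piece(2)[OF e(1) iso xy(1) xyU(1) xy(3) xyU(2) pp(1) pU] v(1) by simp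
  note fx = f[OF xy(1,2)] and fy = f[OF xy(3,4)]
  show "col' y = col' x \<rhd> q"
  proof (cases "level v < 0")
   case True
   have bv: "below v" using True bel[of p] dpos v(4) unfolding below_def by simp
   have "fst p \<notin> sh" using below_not_sh[OF vv(2) bv v(3)] v(4) by simp
   then have S1: "S (fst y) = S (fst x)" using Sconst[OF xy] by blast
   have S2: "S (fst v) = S (fst x)"
   proof -
    have "p \<notin> seg x x" using xy(2) pp(2) by auto
    have "seg (fst x) (fst p) \<inter> sh = {}"
     using segsh[OF xy(1) pD] \<open>fst p \<notin> sh\<close> by blast
    then show ?thesis using flat_const[OF S_flat fx(5), of "fst p"] bv v(4) unfolding below_def by simp
   qed
   \<comment> \<open>Both strands are below the triangle: acting by their common membrane value
     preserves the operation.\<close>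
   have "col' y = (col x \<rhd> col v) \<rhd> S (fst x)" using fy(1) cc S1 by simp
   also have "\<dots> = (col x \<rhd> S (fst x)) \<rhd> (col v \<rhd> S (fst x))" using act_distrib fx colv by simp
   also have "\<dots> = col' x \<rhd> q" using fx(1) qv cv bv S2 unfolding shift_def by simp
   finally show ?thesis .
  next
   case False
   have vO: "v \<in> Ov" using vv(2) False v(4) bel[of p] dpos unfolding Ov_def below_def by simp
   have "p \<notin> Ov" using OD(3)[of p] p(1) by auto
   then have "v \<noteq> p" using vO by blast
   have vn: "v \<notin> \<Union>K" using crossing_nonvertex[OF RA v(2) Z_in_K[OF pZ] v(4) \<open>v \<noteq> p\<close>] .
   have "simple v"
   proof (rule simpleI[OF vO vn])
    fix w assume w: "w \<in> Ov" "fst w = fst v"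
    have "w \<noteq> p" using w(1) \<open>p \<notin> Ov\<close> by blast
    then show "w = v" using regular_triple[OF RA Ov_in_K[OF w(1)] v(2) Z_in_K[OF pZ] w(2) v(4)] \<open>v \<noteq> p\<close> by blast
   qed
   then have k: "\<kappa>O (fst p) = Some (col v)" using \<kappa>_simple v(4) by metis
   have "fst p \<in> sh" using vO v(4) unfolding sh_def by (metis imageI)
   moreover have "fst p \<in> seg (fst x) (fst y)" using pp(1) unfolding fst_closed_segment[symmetric] by blast
   ultimately have i: "seg (fst x) (fst y) \<inter> sh = {fst p}" using segsh[OF xy(1,3)] by blast
   \<comment> \<open>The over strand is above the triangle, so the membrane value is itself acted on
     by \<open>col v\<close> between \<open>x\<close> and \<open>y\<close>.\<close>
   have S1: "S (fst y) = S (fst x) \<rhd> col v" by (rule flat_cross[OF S_flat fx(5,4) fy(5,4) i k])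
   have "col' y = (col x \<rhd> col v) \<rhd> (S (fst x) \<rhd> col v)" using fy(1) cc S1 by simp
   also have "\<dots> = (col x \<rhd> S (fst x)) \<rhd> col v" using act_distrib[OF fx(2,3) colv] by simp
   also have "\<dots> = col' x \<rhd> q" using fx(1) qv cv False unfolding shift_def below_def by simp
   finally show ?thesis .
  qed
 qed
 then show ?thesis using dpos by blast
qed

end

context swap
begin

lemma bary_diff:
 "bc y - bc x = det2 (fst b - fst a) (y - x) / det2 (fst b - fst a) (fst c - fst a)"
 "bb y - bb x = det2 (y - x) (fst c - fst a) / det2 (fst b - fst a) (fst c - fst a)"
 "ba y - ba x = det2 (y - x) (fst b - fst c) / det2 (fst b - fst a) (fst c - fst a)"
proof -
 show 1: "bc y - bc x = det2 (fst b - fst a) (y - x) / det2 (fst b - fst a) (fst c - fst a)"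
  unfolding bc_def diff_divide_distrib[symmetric] by (simp add: det2_def algebra_simps)
 show 2: "bb y - bb x = det2 (y - x) (fst c - fst a) / det2 (fst b - fst a) (fst c - fst a)"
  unfolding bb_def diff_divide_distrib[symmetric] by (simp add: det2_def algebra_simps)
 have "ba y - ba x = - ((bb y - bb x) + (bc y - bc x))" by (simp add: ba_def)
 also have "\<dots> = det2 (y - x) (fst b - fst c) / det2 (fst b - fst a) (fst c - fst a)"
  unfolding 1 2 add_divide_distrib[symmetric] minus_divide_left by (simp add: det2_def algebra_simps)
 finally show "ba y - ba x = det2 (y - x) (fst b - fst c) / det2 (fst b - fst a) (fst c - fst a)" .
qed

text \<open>The barycentric coordinate that vanishes on a side tells the inside of the triangle from the outside
 along an edge that passes below this side.\<close>

lemma boundary_coordinate: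
 assumes w: "w \<in> seg p' q'" "{p', q'} \<in> EA \<union> EB" "w \<in> T" "fst w \<noteq> fst a" "fst w \<noteq> fst b" "fst w \<noteq> fst c"
  and det: "det2 d (fst q' - fst p') \<noteq> 0"
 obtains \<beta> \<delta> where "\<beta> \<in> {ba, bb, bc}" "\<beta> (fst w) = 0" "\<And>x. \<beta> (x + d) \<noteq> \<beta> x" "\<delta> > 0"
  "\<And>x. dist (fst w) x < \<delta> \<Longrightarrow> x \<in> \<Delta> \<longleftrightarrow> \<beta> x \<ge> 0"
proof -
 let ?t = "fst w"
 have nn: "ba ?t \<ge> 0" "bb ?t \<ge> 0" "bc ?t \<ge> 0" using w(3) by (simp_all add: T_iff \<Delta>_iff)
 have corner: "\<not> (bb ?t = 0 \<and> bc ?t = 0)" "\<not> (ba ?t = 0 \<and> bc ?t = 0)" "\<not> (ba ?t = 0 \<and> bb ?t = 0)"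
  using bary_inj[of ?t "fst a"] bary_inj[of ?t "fst b"] bary_inj[of ?t "fst c"] w(4-6) bary_vertex
  by (auto simp: ba_def)
 have near: "\<exists>\<delta>>0. \<forall>x. dist ?t x < \<delta> \<longrightarrow> f x > 0 \<and> h x > 0"
  if f: "f ?t > 0" "continuous_on UNIV f" and h: "h ?t > 0" "continuous_on UNIV h" for f h :: "plane \<Rightarrow> real"
 proof -
  have "open ({x. 0 < f x} \<inter> {x. 0 < h x})" using f(2) h(2) by (intro open_Int open_Collect_less continuous_on_const)
  then obtain \<delta> where "\<delta> > 0" "ball ?t \<delta> \<subseteq> {x. 0 < f x} \<inter> {x. 0 < h x}"
   using openE[of "{x. 0 < f x} \<inter> {x. 0 < h x}" ?t] f(1) h(1) by blast
  then show ?thesis by (intro exI[of _ \<delta>]) (simp add: subset_iff)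
 qed
 have "{p', q'} = {a, b} \<or> {p', q'} = {a, c} \<or> {p', q'} = {c, b}" using w(2) sides by (elim disjE conjE; simp; argo)
 then show ?thesis
 proof (elim disjE)
  assume "{p', q'} = {a, b}"
  then have pq: "(p' = a \<and> q' = b) \<or> (p' = b \<and> q' = a)" by (simp add: doubleton_eq_iff)
  have z: "bc ?t = 0" using bary_sides(1)[of w] w(1) pq by (auto simp: closed_segment_commute)
  have "bb ?t > 0" "ba ?t > 0" using nn corner z by linarith+
  then obtain \<delta> where d: "\<delta> > 0" "\<forall>x. dist ?t x < \<delta> \<longrightarrow> bb x > 0 \<and> ba x > 0" using near[of bb ba] bary_continuous by blast
  have "det2 (fst b - fst a) d \<noteq> 0" using det pq by (auto simp: det2_def algebra_simps)
  then have ne: "bc (x + d) \<noteq> bc x" for x using bary_diff(1)[of "x + d" x] noncol by auto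
  have "x \<in> \<Delta> \<longleftrightarrow> bc x \<ge> 0" if "dist ?t x < \<delta>" for x using d(2)[rule_format, OF that] by (auto simp: \<Delta>_iff)
  then show ?thesis using that[of bc \<delta>] z ne d(1) by blast
 next
  assume "{p', q'} = {a, c}"
  then have pq: "(p' = a \<and> q' = c) \<or> (p' = c \<and> q' = a)" by (simp add: doubleton_eq_iff)
  have z: "bb ?t = 0" using bary_sides(2)[of w] w(1) pq by (auto simp: closed_segment_commute)
  have "bc ?t > 0" "ba ?t > 0" using nn corner z by linarith+
  then obtain \<delta> where d: "\<delta> > 0" "\<forall>x. dist ?t x < \<delta> \<longrightarrow> bc x > 0 \<and> ba x > 0" using near[of bc ba] bary_continuous by blast
  have "det2 d (fst c - fst a) \<noteq> 0" using det pq by (auto simp: det2_def algebra_simps)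
  then have ne: "bb (x + d) \<noteq> bb x" for x using bary_diff(2)[of "x + d" x] noncol by auto
  have "x \<in> \<Delta> \<longleftrightarrow> bb x \<ge> 0" if "dist ?t x < \<delta>" for x using d(2)[rule_format, OF that] by (auto simp: \<Delta>_iff)
  then show ?thesis using that[of bb \<delta>] z ne d(1) by blast
 next
  assume "{p', q'} = {c, b}"
  then have pq: "(p' = c \<and> q' = b) \<or> (p' = b \<and> q' = c)" by (simp add: doubleton_eq_iff)
  have z: "ba ?t = 0" using bary_sides(3)[of w] w(1) pq by (auto simp: closed_segment_commute)
  have "bb ?t > 0" "bc ?t > 0" using nn corner z by linarith+
  then obtain \<delta> where d: "\<delta> > 0" "\<forall>x. dist ?t x < \<delta> \<longrightarrow> bb x > 0 \<and> bc x > 0" using near[of bb bc] bary_continuous by blast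
  have "det2 d (fst b - fst c) \<noteq> 0" using det pq by (auto simp: det2_def algebra_simps)
  then have ne: "ba (x + d) \<noteq> ba x" for x using bary_diff(3)[of "x + d" x] noncol by auto
  have "x \<in> \<Delta> \<longleftrightarrow> ba x \<ge> 0" if "dist ?t x < \<delta>" for x using d(2)[rule_format, OF that] by (auto simp: \<Delta>_iff)
  then show ?thesis using that[of ba \<delta>] z ne d(1) by blast
 qed
qed

text \<open>One barycentric coordinate vanishes at the projection of \<open>p\<close>. It is affine
  and not constant along the edge, because the edge crosses the side transversally, so it changes
  sign exactly at \<open>p\<close>; near \<open>p\<close> its sign decides membership in the
  triangle.\<close>

lemma boundary_structure:
 assumes e: "e \<in> ZE" "p \<in> conv e" and p: "level p < 0" "fst p \<in> \<Delta>" "ba (fst p) = 0 \<or> bb (fst p) = 0 \<or> bc (fst p) = 0"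
 obtains w \<delta> where "w \<in> edge_union EA \<union> edge_union EB" "w \<in> T" "fst w = fst p" "w \<noteq> a" "w \<noteq> b" "\<delta> > 0"
  "\<And>x y. x \<in> conv e \<Longrightarrow> y \<in> conv e \<Longrightarrow> dist p x < \<delta> \<Longrightarrow> dist p y < \<delta> \<Longrightarrow> x \<noteq> p \<Longrightarrow> y \<noteq> p \<Longrightarrow>
    (fst x \<in> \<Delta> \<longleftrightarrow> fst y \<in> \<Delta>) \<longleftrightarrow> p \<notin> seg x y"
  "\<And>r. r > 0 \<Longrightarrow> \<exists>x. x \<in> conv e \<and> dist p x < r \<and> x \<noteq> p \<and> fst x \<notin> \<Delta>"
proof -
 obtain w where w: "w \<in> edge_union EA \<union> edge_union EB" "w \<in> T" "fst w = fst p" by (rule on_boundary[OF p(2,3)])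
 have lw: "level w = 0" using w(2) by (simp add: T_iff)
 then have wp: "w \<noteq> p" using p(1) by auto
 have pZ: "p \<in> Z" using edge_hull_subset[OF e(1)] e(2) unfolding Z_def by blast
 have pK: "p \<in> edge_union (ZE \<union> EA)" using pZ Z_sub by blast
 have "p \<noteq> a" "p \<noteq> b" using p(1) level_vertex by auto
 then have nc: "fst w \<noteq> fst a" "fst w \<noteq> fst b" "fst w \<noteq> fst c" using over_end[OF pK] fst_c_notin[OF pZ] w(3) by auto
 obtain s where s: "s \<in> EA \<union> EB" "w \<in> conv s" using w(1) by (auto simp: edge_union_def)
 \<comment> \<open>The side belongs to one of the two links, and the regularity of this link
   supplies the transversality.\<close>
 obtain E where E: "E = EA \<or> E = EB" "s \<in> E" using s(1) by blast
 have PR: "polygonal_link (ZE \<union> E)" "regular_position (ZE \<union> E)" using E(1) KA KB RA RB by auto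
 obtain e1 e2 where e12: "e = {e1, e2}" "e1 \<noteq> e2" "conv e = seg e1 e2" using edgeE[OF PR(1), of e] e(1) by blast
 obtain p' q' where pq: "s = {p', q'}" "p' \<noteq> q'" "conv s = seg p' q'" using edgeE[OF PR(1), of s] E(2) by blast
 have X: "p \<in> edge_union (ZE \<union> E)" "w \<in> edge_union (ZE \<union> E)" using pZ w(1) s(2) E(2) edge_hull_subset[of s "ZE \<union> E"] by (auto simp: Z_def edge_union_Un)
 have det: "det2 (fst e2 - fst e1) (fst q' - fst p') \<noteq> 0"
  using crossing_transversal[OF PR, of e1 e2 p' q' p w] e(1) E(2) e12 pq e(2) s(2) w(3) wp by auto
 obtain \<beta> \<delta> where b: "\<beta> \<in> {ba, bb, bc}" "\<beta> (fst w) = 0" "\<And>x. \<beta> (x + (fst e2 - fst e1)) \<noteq> \<beta> x" "\<delta> > 0"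
  "\<And>x. dist (fst w) x < \<delta> \<Longrightarrow> x \<in> \<Delta> \<longleftrightarrow> \<beta> x \<ge> 0"
  using boundary_coordinate[of w p' q' "fst e2 - fst e1"] s pq w(2) nc det by metis
 have aff: "\<beta> (x + u *\<^sub>R (y - x)) = \<beta> x + u * (\<beta> y - \<beta> x)" for x y u using b(1) by (elim insertE emptyE) (simp_all only: bary_affine)
 have pn: "p \<notin> \<Union>(ZE \<union> E)" using crossing_nonvertex[OF PR(2) X] w(3) wp by auto
 have po: "p \<in> open_segment e1 e2" using nonvertex_interior[OF PR(1), of e1 e2 p] e e12 pn by auto
 have b0: "\<beta> (fst p) = 0" using b(2) w(3) by simp
 have k: "\<beta> (fst e2) \<noteq> \<beta> (fst e1)" using b(3)[of "fst e1"] by simp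
 have zero: "x = p" if "x \<in> conv e" "\<beta> (fst x) = 0" for x
 proof -
  obtain u where u: "x = e1 + u *\<^sub>R (e2 - e1)" using \<open>x \<in> conv e\<close> unfolding e12(3) by (rule closed_segment_paramE)
  obtain v where v: "p = e1 + v *\<^sub>R (e2 - e1)" using e(2) unfolding e12(3) by (rule closed_segment_paramE)
  have "\<beta> (fst e1) + u * (\<beta> (fst e2) - \<beta> (fst e1)) = 0" "\<beta> (fst e1) + v * (\<beta> (fst e2) - \<beta> (fst e1)) = 0"
   using that(2) b0 aff[of "fst e1" u "fst e2"] aff[of "fst e1" v "fst e2"] unfolding u v by simp_all
  then have "(u - v) * (\<beta> (fst e2) - \<beta> (fst e1)) = 0" by algebra
  then show ?thesis using k u v by simp
 qed
 have inD: "fst x \<in> \<Delta> \<longleftrightarrow> \<beta> (fst x) > 0" if x: "x \<in> conv e" "dist p x < \<delta>" "x \<noteq> p" for x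
 proof -
  have "dist (fst w) (fst x) < \<delta>" using dist_fst_le[of p x] x(2) w(3) by simp
  then have "fst x \<in> \<Delta> \<longleftrightarrow> \<beta> (fst x) \<ge> 0" by (rule b(5))
  moreover have "\<beta> (fst x) \<noteq> 0" using zero[OF x(1)] x(3) by blast
  ultimately show ?thesis by linarith
 qed
 have iff: "(fst x \<in> \<Delta> \<longleftrightarrow> fst y \<in> \<Delta>) \<longleftrightarrow> p \<notin> seg x y"
  if x: "x \<in> conv e" and y: "y \<in> conv e" and d: "dist p x < \<delta>" "dist p y < \<delta>" "x \<noteq> p" "y \<noteq> p" for x y
 proof -
  have nx: "\<beta> (fst x) \<noteq> 0" "\<beta> (fst y) \<noteq> 0" using zero x y d by blast+
  have sg: "\<exists>s\<in>seg x y. \<beta> (fst s) = 0" if "\<beta> (fst x) > 0 \<longleftrightarrow> \<not> \<beta> (fst y) > 0"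
  proof -
   define u where "u = \<beta> (fst x) / (\<beta> (fst x) - \<beta> (fst y))"
   have ne: "\<beta> (fst x) - \<beta> (fst y) \<noteq> 0" using that by auto
   have "0 \<le> u" "u \<le> 1" using that nx by (auto simp: u_def divide_simps)
   moreover have "\<beta> (fst (x + u *\<^sub>R (y - x))) = 0"
    using aff[of "fst x" u "fst y"] ne by (simp add: u_def field_simps)
   ultimately show ?thesis using in_segment_param[of u x y] by blast
  qed
  have op: "\<beta> (fst x) > 0 \<longleftrightarrow> \<not> \<beta> (fst y) > 0" if "p \<in> seg x y"
  proof -
   obtain u where u: "0 \<le> u" "u \<le> 1" "p = x + u *\<^sub>R (y - x)" using \<open>p \<in> seg x y\<close> by (rule closed_segment_paramE)
   have u01: "u \<noteq> 0" "u \<noteq> 1" using u(3) d(3,4) by auto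
   have "(1 - u) * \<beta> (fst x) + u * \<beta> (fst y) = 0" using aff[of "fst x" u "fst y"] b0 u(3) by (simp add: algebra_simps)
   moreover have "\<not> (\<beta> (fst x) > 0 \<and> \<beta> (fst y) > 0 \<and> (1 - u) * \<beta> (fst x) + u * \<beta> (fst y) = 0)"
    using u u01 by (smt (verit) mult_pos_pos)
   moreover have "\<not> (\<beta> (fst x) < 0 \<and> \<beta> (fst y) < 0 \<and> (1 - u) * \<beta> (fst x) + u * \<beta> (fst y) = 0)"
    using u u01 by (smt (verit) mult_pos_neg)
   ultimately show ?thesis using nx by linarith
  qed
  have "p \<in> seg x y" if "\<beta> (fst x) > 0 \<longleftrightarrow> \<not> \<beta> (fst y) > 0"
  proof -
   obtain s where s: "s \<in> seg x y" "\<beta> (fst s) = 0" using sg \<open>\<beta> (fst x) > 0 \<longleftrightarrow> \<not> \<beta> (fst y) > 0\<close> by blast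
   have "s \<in> conv e" using closed_segment_subset[OF x y convex_convex_hull] s(1) by blast
   then show ?thesis using zero s by blast
  qed
  then show ?thesis using op inD[OF x d(1,3)] inD[OF y d(2,4)] by blast
 qed
 have out: "\<exists>x. x \<in> conv e \<and> dist p x < r \<and> x \<noteq> p \<and> fst x \<notin> \<Delta>" if r: "r > 0" for r
 proof -
  have "e1 \<noteq> p" "e2 \<noteq> p" using po by (auto simp: open_segment_def)
  have mn: "min r \<delta> > 0" using r b(4) by simp
  obtain x where x: "x \<in> open_segment e1 p" "dist p x < min r \<delta>" using open_segment_near[OF \<open>e1 \<noteq> p\<close> mn] by blast
  obtain y where y: "y \<in> open_segment e2 p" "dist p y < min r \<delta>" using open_segment_near[OF \<open>e2 \<noteq> p\<close> mn] by blast
  note sg = segment_points_around[OF po x(1) y(1)]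
  have h: "x \<in> conv e" "y \<in> conv e" using sg(1,2) e12(3) by simp_all
  have n: "x \<noteq> p" "y \<noteq> p" using x(1) y(1) by (auto simp: open_segment_def)
  have "fst x \<notin> \<Delta> \<or> fst y \<notin> \<Delta>" using iff[OF h _ _ n] x(2) y(2) sg(5) by auto
  moreover have "dist p x < r" "dist p y < r" using x(2) y(2) by simp_all
  ultimately show ?thesis using h n by blast
 qed
 have "w \<noteq> a" "w \<noteq> b" using nc by auto
 then show ?thesis using that[OF w _ _ b(4) iff out] by blast
qed

end

context membrane_swap
begin

text \<open>If the side over \<open>p\<close> is an old one, the old coloring jumps by the color of
  the side, and the shift of the inner part jumps by the equal membrane value, so the two cancel and
  the crossing disappears. If the side is new, the old coloring is constant and the shift alone
  produces the new crossing.\<close>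

lemma flat_boundary:
 assumes e: "e \<in> ZE" "p \<in> conv e" and p: "level p < 0" "fst p \<in> \<Delta>" "ba (fst p) = 0 \<or> bb (fst p) = 0 \<or> bc (fst p) = 0"
 shows "flat_near' e p"
proof -
 have eK: "e \<in> K" using e by blast
 have pZ: "p \<in> Z" using edge_Z e by blast
 have pX: "p \<in> edge_union K" "p \<in> edge_union K'" using pZ Z_sub by blast+
 obtain w \<delta>0 where w: "w \<in> edge_union EA \<union> edge_union EB" "w \<in> T" "fst w = fst p" "w \<noteq> a" "w \<noteq> b" and d0: "\<delta>0 > 0"
  and io: "\<And>x y. x \<in> conv e \<Longrightarrow> y \<in> conv e \<Longrightarrow> dist p x < \<delta>0 \<Longrightarrow> dist p y < \<delta>0 \<Longrightarrow> x \<noteq> p \<Longrightarrow> y \<noteq> p \<Longrightarrow>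
    (fst x \<in> \<Delta> \<longleftrightarrow> fst y \<in> \<Delta>) \<longleftrightarrow> p \<notin> seg x y"
  and out: "\<And>r. r > 0 \<Longrightarrow> \<exists>x. x \<in> conv e \<and> dist p x < r \<and> x \<noteq> p \<and> fst x \<notin> \<Delta>"
  by (rule boundary_structure[OF e p]) (rule that; assumption)
 have lw: "level w = 0" using w(2) by (simp add: T_iff)
 have pw: "snd p < snd w" using level_fst[OF w(3)] lw p(1) by simp
 have wZ: "w \<notin> Z" using Z_side[OF w(1)] w(4,5) by blast
 obtain \<delta>1 where d1: "\<delta>1 > 0" "\<And>y. y \<in> U \<Longrightarrow> dist p y < \<delta>1 \<Longrightarrow> y = p" "\<And>y. y \<in> U' \<Longrightarrow> dist p y < \<delta>1 \<Longrightarrow> y = p"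
  by (rule isolated[of p]) blast
 obtain \<delta>2 where d2: "\<delta>2 > 0" "\<And>y. dist p y < \<delta>2 \<Longrightarrow> level y < 0" using level_neg_near[OF p(1)] by blast
 show ?thesis
 proof (cases "w \<in> edge_union EA")
  case True
  have wX: "w \<in> edge_union K" using True by (simp add: edge_union_Un)
  have pU: "p \<in> U" "over K p = w" using under_pointI[OF pX(1) wX w(3) pw] over_eq[OF RA pX(1) wX w(3) pw] by simp_all
  have wU: "w \<notin> U" using under_pointE[OF RA pU(1)] pU(2) by metis
  have wEB: "w \<notin> edge_union EB" using side_disjoint[OF True] w(4,5) by blast
  \<comment> \<open>Anything above \<open>p\<close> in the new link would be a third point with this
    projection, or would lie on an old and a new side at once.\<close>
  have pU': "p \<notin> U'"
  proof
   assume "p \<in> U'"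
   then obtain z where z: "z \<in> edge_union K'" "fst z = fst p" "snd p < snd z" by (rule under_pointE[OF RB])
   have "z = w"
   proof (cases "z \<in> Z")
    case T: True
    show ?thesis using regular_triple[OF RA pX(1) wX Z_in_K[OF T]] w(3) z(2,3) pw by auto
   next
    case False
    then have "z \<in> T" using z(1) sides_in_T(2) by (auto simp: edge_union_Un Z_def)
    then show ?thesis using T_inj w(2,3) z(2) by metis
   qed
   then have "z \<in> Z \<or> z \<in> edge_union EB" "z = w" using z(1) by (auto simp: edge_union_Un Z_def)
   then show False using wZ wEB by blast
  qed
  have tsh: "fst p \<notin> sh" using side_underA(1)[OF True w(4,5)] wU w(3) by simp
  have St: "S (fst p) = col w" using membrane_on_alpha[OF S True wU w(4,5)] w(3) by simp
  have wQ: "col w \<in> Q" using point_coloring_in[OF col wX wU] .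
  obtain \<delta>3 where d3: "\<delta>3 > 0" "\<And>x. x \<in> \<Delta> \<Longrightarrow> dist (fst p) x < \<delta>3 \<Longrightarrow> x \<notin> sh \<and> S x = S (fst p)"
   by (rule S_near[OF p(2) tsh]) blast
  define \<delta> where "\<delta> = min (min \<delta>0 \<delta>1) (min \<delta>2 \<delta>3)"
  have dpos: "\<delta> > 0" using d0 d1 d2 d3 by (simp add: \<delta>_def)
  let ?D = "conv e \<inter> ball p \<delta>"
  have iso: "y = p" if "y \<in> U" "dist p y < \<delta>" for y using d1(2)[OF that(1)] that(2) by (simp add: \<delta>_def)
  obtain x0 where x0: "x0 \<in> conv e" "dist p x0 < \<delta>" "x0 \<noteq> p" "fst x0 \<notin> \<Delta>" using out[OF dpos] by blast
  have x0U: "x0 \<notin> U" using iso x0 by blast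
  have q0: "col x0 \<in> Q" using point_coloring_in[OF col Z_in_K[OF edge_Z[OF e(1) x0(1)]] x0U] .
  have x0D: "x0 \<in> ?D" using x0(1,2) by simp
  note cp = col_piece[OF e(1) iso x0D x0U]
  have yU: "y \<notin> U" if "y \<in> ?D" "y \<noteq> p" for y using iso[of y] that by auto
  have outer: "col y = col x0" if y: "y \<in> ?D" "y \<noteq> p" "fst y \<notin> \<Delta>" for y
  proof -
   have "p \<notin> seg x0 y" using io[of x0 y] x0 y by (simp add: \<delta>_def)
   then show ?thesis using cp(1)[OF _ _ y(1) yU[OF y(1,2)]] by blast
  qed
  have inner: "col y = col x0 \<rhd> col w" if y: "y \<in> ?D" "y \<noteq> p" "fst y \<in> \<Delta>" for y
  proof -
   have "p \<in> seg x0 y" using io[of x0 y] x0 y by (simp add: \<delta>_def)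
   then show ?thesis using cp(2)[OF _ _ y(1) yU[OF y(1,2)]] pU by metis
  qed
  have near: "col z = col x0" if z: "z \<in> Z" "dist p z < \<delta>'" "fst z \<notin> \<Delta>" "\<delta>' \<le> \<delta>" "\<And>h y. h \<in> K \<Longrightarrow> y \<in> conv h \<Longrightarrow> dist p y < \<delta>' \<Longrightarrow> p \<in> conv h" for z \<delta>'
  proof -
   obtain h where h: "h \<in> ZE" "z \<in> conv h" using z(1) unfolding Z_def by (rule edge_unionE)
   have hK: "h \<in> K" using h by blast
   have "p \<notin> \<Union>K" using crossing_nonvertex[OF RA pX(1) wX] w(3) pw by auto
   then have "h = e" using nonvertex_edge_unique[OF KA hK eK _ z(5)[OF hK h(2) z(2)] e(2)] by blast
   then show ?thesis using outer[of z] z h(2) p(2) by auto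
  qed
  \<comment> \<open>\<open>col x0\<close> has the property that defines \<open>outval p\<close>, and
    the value chosen by \<open>SOME\<close> must agree with it because points of the edge outside of
    the triangle occur arbitrarily close to \<open>p\<close>.\<close>
  have ov: "outval p = col x0"
  proof -
   obtain \<delta>' where d': "\<delta>' > 0" "\<And>h y. h \<in> K \<Longrightarrow> y \<in> conv h \<Longrightarrow> dist p y < \<delta>' \<Longrightarrow> p \<in> conv h"
    using edges_near[OF KA subset_refl, of p] by blast
   let ?P = "\<lambda>q. \<exists>\<delta>>0. \<forall>w\<in>Z. dist p w < \<delta> \<longrightarrow> fst w \<notin> \<Delta> \<longrightarrow> col w = q"
   have "?P (col x0)"
   proof (intro exI[of _ "min \<delta> \<delta>'"] conjI ballI impI)
    fix z assume z: "z \<in> Z" "dist p z < min \<delta> \<delta>'" "fst z \<notin> \<Delta>"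
    show "col z = col x0" by (rule near[OF z]) (use d'(2) in auto)
   qed (use dpos d' in simp)
   then have "?P (outval p)" unfolding outval_def by (rule someI)
   then obtain r where r: "r > 0" "\<forall>w\<in>Z. dist p w < r \<longrightarrow> fst w \<notin> \<Delta> \<longrightarrow> col w = outval p" by blast
   have "min r \<delta> > 0" using r dpos by simp
   then obtain x where x: "x \<in> conv e" "dist p x < min r \<delta>" "x \<noteq> p" "fst x \<notin> \<Delta>" using out by blast
   then have "col x = outval p" using r(2) edge_Z[OF e(1) x(1)] by simp
   then show ?thesis using outer[of x] x by simp
  qed
  have "flat ?D U' (Some \<circ> col' \<circ> over K') col'"
  proof (rule flat_constant[OF convex_piece _ q0])
   have nU': "y \<notin> U'" if "y \<in> ?D" for y using d1(3)[of y] that pU' by (auto simp: \<delta>_def)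
   then show "?D \<inter> U' = {}" by blast
   fix y assume y: "y \<in> ?D"
   have yZ: "y \<in> Z" using edge_Z[OF e(1)] y by blast
   show "col' y = col x0"
   proof (cases "y = p")
    case True
    then show ?thesis using pU pU' pZ pX ov unfolding col'_def by simp
   next
    case False
    then have yU: "y \<notin> U" using yU[OF y] by blast
    have cy: "col' y = shift y" using col'_Z[OF yZ nU'[OF y] yU] .
    show ?thesis
    proof (cases "fst y \<in> \<Delta>")
     case i: True
     have "level y < 0" using d2(2)[of y] y by (simp add: \<delta>_def)
     moreover have "S (fst y) = col w" using d3(2)[OF i] dist_fst_le[of p y] y St by (simp add: \<delta>_def)
     \<comment> \<open>Inside, the strand was already acted on by the old side and is now acted on
       by the membrane, both of color \<open>col w\<close>.\<close>
     ultimately have "shift y = (col x0 \<rhd> col w) \<rhd> col w" using inner[OF y False i] i unfolding shift_def below_def by simp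
     then show ?thesis using act_invol[OF q0 wQ] cy by simp
    next
     case o: False
     then show ?thesis using outer[OF y False o] cy unfolding shift_def below_def by simp
    qed
   qed
  qed
  then show ?thesis using dpos by blast
 next
  case False
  then have wB: "w \<in> edge_union EB" using w(1) by blast
  have wX: "w \<in> edge_union K'" using wB by (simp add: edge_union_Un)
  have pU': "p \<in> U'" "over K' p = w" using under_pointI[OF pX(2) wX w(3) pw] over_eq[OF RB pX(2) wX w(3) pw] by simp_all
  have wU': "w \<notin> U'" using under_pointE[OF RB pU'(1)] pU'(2) by metis
  have pU: "p \<notin> U"
  proof
   assume "p \<in> U"
   then obtain z where z: "z \<in> edge_union K" "fst z = fst p" "snd p < snd z" by (rule under_pointE[OF RA])
   have "z = w"
   proof (cases "z \<in> Z")
    case T: True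
    show ?thesis using regular_triple[OF RB pX(2) wX subsetD[OF Z_sub(2) T]] w(3) z(2,3) pw by auto
   next
    case F: False
    then have "z \<in> T" using z(1) sides_in_T(1) by (auto simp: edge_union_Un Z_def)
    then show ?thesis using T_inj w(2,3) z(2) by metis
   qed
   then have "z \<in> Z \<or> z \<in> edge_union EA" "z = w" using z(1) by (auto simp: edge_union_Un Z_def)
   then show False using wZ False by blast
  qed
  have tsh: "fst p \<notin> sh" using side_underB(1)[OF wB w(4,5)] wU' w(3) by simp
  have cw: "col' w = S (fst p)" using col'_EB[OF wB wU' w(4,5)] w(3) by simp
  have SQ: "S (fst p) \<in> Q" using S_Q[OF p(2) tsh] .
  obtain \<delta>3 where d3: "\<delta>3 > 0" "\<And>x. x \<in> \<Delta> \<Longrightarrow> dist (fst p) x < \<delta>3 \<Longrightarrow> x \<notin> sh \<and> S x = S (fst p)"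
   by (rule S_near[OF p(2) tsh]) blast
  define \<delta> where "\<delta> = min (min \<delta>0 \<delta>1) (min \<delta>2 \<delta>3)"
  have dpos: "\<delta> > 0" using d0 d1 d2 d3 by (simp add: \<delta>_def)
  let ?D = "conv e \<inter> ball p \<delta>"
  have iso: "y = p" if "y \<in> U" "dist p y < \<delta>" for y using d1(2)[OF that(1)] that(2) by (simp add: \<delta>_def)
  have nU: "y \<notin> U" if "y \<in> ?D" for y using iso[of y] that pU by auto
  have pD: "p \<in> ?D" using e(2) dpos by simp
  have pQ: "col p \<in> Q" using point_coloring_in[OF col pX(1) pU] .
  have const: "col y = col p" if y: "y \<in> ?D" for y
   using col_piece(1)[OF e(1) iso pD pU y nU[OF y]] pU by blast
  have val: "col' y = (if fst y \<in> \<Delta> then col p \<rhd> S (fst p) else col p)" if y: "y \<in> ?D" "y \<notin> U'" for y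
  proof -
   have yZ: "y \<in> Z" using edge_Z[OF e(1)] y by blast
   have "level y < 0" using d2(2)[of y] y by (simp add: \<delta>_def)
   moreover have "S (fst y) = S (fst p)" if "fst y \<in> \<Delta>" using d3(2)[OF that] dist_fst_le[of p y] y by (simp add: \<delta>_def)
   ultimately show ?thesis using col'_Z[OF yZ y(2) nU[OF y(1)]] const[OF y(1)] unfolding shift_def below_def by simp
  qed
  have side: "(fst x \<in> \<Delta> \<longleftrightarrow> fst y \<in> \<Delta>) \<longleftrightarrow> p \<notin> seg x y"
   if x: "x \<in> ?D" "x \<notin> U'" and y: "y \<in> ?D" "y \<notin> U'" for x y
  proof -
   have "x \<noteq> p" "y \<noteq> p" using x y pU'(1) by auto
   then show ?thesis using io[of x y] x(1) y(1) by (simp add: \<delta>_def)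
  qed
  have "flat ?D U' (Some \<circ> col' \<circ> over K') col'"
  proof (rule flat_two_sided[OF convex_piece, where p = p])
   show "s = p" if "s \<in> ?D" "s \<in> U'" for s using d1(3)[OF that(2)] that(1) by (simp add: \<delta>_def)
   show "col' x \<in> Q" if "x \<in> ?D" "x \<notin> U'" for x using val[OF that] pQ SQ act_closed by simp
   show "col' y = col' x" if "x \<in> ?D" "x \<notin> U'" "y \<in> ?D" "y \<notin> U'" "p \<notin> seg x y \<or> p \<notin> U'" for x y
    using val[OF that(1,2)] val[OF that(3,4)] side[OF that(1-4)] that(5) pU'(1) by simp
   show "col' y = col' x \<rhd> q" if "x \<in> ?D" "x \<notin> U'" "y \<in> ?D" "y \<notin> U'" "p \<in> seg x y" "p \<in> U'"
    "(Some \<circ> col' \<circ> over K') p = Some q" for x y q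
   proof -
    have q: "q = S (fst p)" using that(7) pU'(2) cw by simp
    have "fst x \<in> \<Delta> \<longleftrightarrow> fst y \<notin> \<Delta>" using side[OF that(1-4)] that(5) by blast
    then show ?thesis using val[OF that(1,2)] val[OF that(3,4)] q act_invol[OF pQ SQ] by auto
   qed
  qed
  then show ?thesis using dpos by blast
 qed
qed

lemma flat_old_edges:
 assumes e: "e \<in> ZE" shows "flat (conv e) U' (Some \<circ> col' \<circ> over K') col'"
proof (rule flat_local_to_global[OF convex_convex_hull])
 fix p assume p: "p \<in> conv e"
 have pZ: "p \<in> Z" using edge_Z[OF e p] .
 show "flat_near' e p"
 proof (cases "fst p \<notin> \<Delta> \<or> level p > 0")
  case True
  then show ?thesis by (rule flat_away[OF e p])
 next
  case False
  show ?thesis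
  proof (cases "level p = 0")
   case True
   then show ?thesis using flat_end[OF e p] Z_level_0[OF pZ] False by blast
  next
   case l: False
   then have "level p < 0" "fst p \<in> \<Delta>" using False by auto
   then show ?thesis using flat_boundary[OF e p] flat_interior[OF e p] unfolding \<Delta>_iff
    by (metis less_eq_real_def)
  qed
 qed
qed

lemma col'_simple: "simple v \<Longrightarrow> col' v = col v"
 using col'_Z[of v] simple_not_under[of v] unfolding shift_def below_def by simp

text \<open>On a new side the coloring is the pulled-back membrane, and the points covering it are
  simple, hence keep their color. The ends are treated separately, since they project into the
  shadow without being under points.\<close>

lemma flat_new_edges:
 assumes e: "e \<in> EB" shows "flat (conv e) U' (Some \<circ> col' \<circ> over K') col'"
proof (rule flat_local_to_global[OF convex_convex_hull])
 fix p assume p: "p \<in> conv e"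
 have sub: "y \<in> edge_union EB" if "y \<in> conv e" for y using edge_hull_subset[OF e] that by blast
 show "flat_near' e p"
 proof (cases "p = a \<or> p = b")
  case False
  define \<delta> where "\<delta> = min (dist p a) (dist p b)"
  have dpos: "\<delta> > 0" using False by (simp add: \<delta>_def)
  let ?D = "conv e \<inter> ball p \<delta>"
  have y: "y \<in> edge_union EB" "y \<noteq> a" "y \<noteq> b" "y \<in> T" if "y \<in> ?D" for y
  proof -
   show 1: "y \<in> edge_union EB" using that sub by simp
   then show "y \<in> T" using sides_in_T(2) by blast
   show "y \<noteq> a" "y \<noteq> b" using that by (auto simp: \<delta>_def)
  qed
  have "flat ?D U' (Some \<circ> col' \<circ> over K') (\<lambda>x. S (fst x))"
  proof (rule flat_fst[OF S_flat convex_piece])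
   show "fst ` ?D \<subseteq> \<Delta>" using y(4) T_fst by blast
   show "inj_on fst ?D" using y(4) T_inj by (meson inj_onI)
   fix x assume x: "x \<in> ?D"
   show "x \<in> U' \<longleftrightarrow> fst x \<in> sh" by (rule side_underB(1)[OF y(1-3)[OF x]])
   assume "x \<in> U'"
   then have "simple (over K' x) \<and> fst (over K' x) = fst x" by (rule side_underB(2)[OF y(1-3)[OF x]])
   then show "(Some \<circ> col' \<circ> over K') x = \<kappa>O (fst x)" using \<kappa>_simple[of "over K' x"] col'_simple by simp
  qed
  then have "flat ?D U' (Some \<circ> col' \<circ> over K') col'"
   by (rule flat_cong) (rule col'_EB[OF y(1) _ y(2,3)])
  then show ?thesis using dpos by blast
 next
  case True
  then have pw: "p \<in> {a, b}" by blast
  obtain \<delta>1 where d1: "\<delta>1 > 0" "\<And>y. y \<in> U \<Longrightarrow> dist p y < \<delta>1 \<Longrightarrow> y = p" "\<And>y. y \<in> U' \<Longrightarrow> dist p y < \<delta>1 \<Longrightarrow> y = p"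
   by (rule isolated[of p]) blast
  obtain \<delta>2 where d2: "\<delta>2 > 0" "\<And>x. x \<in> T \<Longrightarrow> dist p x < \<delta>2 \<Longrightarrow> fst x \<notin> sh \<Longrightarrow> S (fst x) = col p"
   by (rule membrane_near_end[OF S pw S_end[OF pw]]) blast
  define \<delta> where "\<delta> = min (dist a b) (min \<delta>1 \<delta>2)"
  have dpos: "\<delta> > 0" using distinct_ends d1 d2 by (simp add: \<delta>_def)
  let ?D = "conv e \<inter> ball p \<delta>"
  have un: "y \<notin> U'" if "y \<in> ?D" for y
   using that d1(3)[of y] ends_not_under[OF pw] by (auto simp: \<delta>_def)
  have "flat ?D U' (Some \<circ> col' \<circ> over K') col'"
  proof (rule flat_constant[OF convex_piece _ corner_Q[OF pw]])
   show "?D \<inter> U' = {}" using un by blast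
   fix y assume y: "y \<in> ?D"
   show "col' y = col p"
   proof (cases "y = p")
    case True
    have "p \<in> Z" using pw ends_in_Z by blast
    moreover have "\<not> below p" using level_corner[OF pw] by (simp add: below_def)
    ultimately show ?thesis using True col'_Z[of p] ends_not_under[OF pw] unfolding shift_def by simp
   next
    case False
    have yE: "y \<in> edge_union EB" using y sub by blast
    have ab: "y \<noteq> a" "y \<noteq> b" using y False pw by (auto simp: \<delta>_def dist_commute)
    have "fst y \<notin> sh" using side_underB(1)[OF yE ab] un[OF y] by simp
    moreover have "y \<in> T" using yE sides_in_T(2) by blast
    ultimately have "S (fst y) = col p" using d2(2)[of y] y by (simp add: \<delta>_def)
    then show ?thesis using col'_EB[OF yE un[OF y] ab] by simp
   qed
  qed
  then show ?thesis using dpos by blast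
 qed
qed

lemma flat_new: "e \<in> K' \<Longrightarrow> flat (conv e) U' (Some \<circ> col' \<circ> over K') col'"
 using flat_old_edges flat_new_edges by blast

theorem col'_coloring: "col' \<in> point_colorings K'"
proof -
 have "col' x \<in> Q" if x: "x \<in> edge_union K'" "x \<notin> U'" for x
 proof -
  obtain e where e: "e \<in> K'" "x \<in> conv e" using x(1) by (rule edge_unionE)
  show ?thesis by (rule flat_in[OF flat_new[OF e(1)] e(2) x(2)])
 qed
 then have "col' \<in> (edge_union K' - U') \<rightarrow>\<^sub>E Q"
 proof (intro PiE_I)
  show "col' x = undefined" if "x \<notin> edge_union K' - U'" for x
   unfolding col'_def restrict_def using that by (simp only: if_False)
 qed simp
 then show ?thesis using flat_new unfolding point_colorings_def by blast
qed

end

section \<open>From related colorings to a natural bijection\<close>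

context kei
begin

definition endo :: "('q \<Rightarrow> 'q) \<Rightarrow> bool" where
 "endo h \<longleftrightarrow> h \<in> Q \<rightarrow> Q \<and> (\<forall>x\<in>Q. \<forall>y\<in>Q. h (x \<rhd> y) = h x \<rhd> h y)"

definition recolor :: "space set set \<Rightarrow> ('q \<Rightarrow> 'q) \<Rightarrow> (space \<Rightarrow> 'q) \<Rightarrow> space \<Rightarrow> 'q" where
 "recolor K h c = (\<lambda>x\<in>edge_union K - under_points K. h (c x))"

text \<open>Constant maps are endomorphisms, hence isomorphic colorings are simultaneously trivial.\<close>

definition coloring_iso :: "space set set \<Rightarrow> space set set \<Rightarrow> bool" where
 "coloring_iso K K' \<longleftrightarrow> (\<exists>\<Phi>. bij_betw \<Phi> (point_colorings K) (point_colorings K') \<and>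
   (\<forall>c\<in>point_colorings K. \<forall>h. endo h \<longrightarrow> \<Phi> (recolor K h c) = recolor K' h (\<Phi> c)))"

lemma endo_in: "endo h \<Longrightarrow> x \<in> Q \<Longrightarrow> h x \<in> Q"
 unfolding endo_def by blast

lemma endo_act: "endo h \<Longrightarrow> x \<in> Q \<Longrightarrow> y \<in> Q \<Longrightarrow> h (x \<rhd> y) = h x \<rhd> h y"
 unfolding endo_def by blast

lemma flat_endo:
 assumes f: "flat C B \<kappa> f" and h: "endo h" and C: "convex C" and \<kappa>: "\<And>s q. s \<in> C \<Longrightarrow> s \<in> B \<Longrightarrow> \<kappa>' s = Some q \<Longrightarrow> \<exists>r\<in>Q. \<kappa> s = Some r \<and> q = h r"
 shows "flat C B \<kappa>' (\<lambda>x. h (f x))"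
proof (rule flatI)
 show "h (f x) \<in> Q" if "x \<in> C" "x \<notin> B" for x using flat_in[OF f that] endo_in[OF h] by blast
 show "h (f y) = h (f x)" if "x \<in> C" "x \<notin> B" "y \<in> C" "y \<notin> B" "seg x y \<inter> B = {}" for x y
  using flat_const[OF f that(1,3,5)] by simp
next
 fix x y s q assume xy: "x \<in> C" "x \<notin> B" "y \<in> C" "y \<notin> B" and s: "seg x y \<inter> B = {s}" "\<kappa>' s = Some q"
 have "s \<in> seg x y" "s \<in> B" using s(1) by blast+
 then have "\<exists>r\<in>Q. \<kappa> s = Some r \<and> q = h r" using \<kappa>[OF _ _ s(2)] closed_segment_subset[OF xy(1,3) C] by blast
 then obtain r where r: "r \<in> Q" "\<kappa> s = Some r" "q = h r" by blast
 show "h (f y) = h (f x) \<rhd> q"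
  using flat_cross[OF f xy s(1) r(2)] endo_act[OF h flat_in[OF f xy(1,2)] r(1)] r(3) by simp
qed

lemma recolor_apply: "x \<in> edge_union K \<Longrightarrow> x \<notin> under_points K \<Longrightarrow> recolor K h c x = h (c x)"
 by (simp add: recolor_def)

lemma recolor_coloring:
 assumes R: "regular_position K" and c: "c \<in> point_colorings K" and h: "endo h"
 shows "recolor K h c \<in> point_colorings K"
proof -
 have "recolor K h c \<in> (edge_union K - under_points K) \<rightarrow>\<^sub>E Q"
 proof (intro PiE_I)
  show "recolor K h c x \<in> Q" if "x \<in> edge_union K - under_points K" for x
   using that point_coloring_in[OF c, of x] endo_in[OF h] by (simp add: recolor_apply)
  show "recolor K h c x = undefined" if "x \<notin> edge_union K - under_points K" for x
   unfolding recolor_def restrict_def using that by (simp only: if_False)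
 qed
 moreover have "flat (conv e) (under_points K) (Some \<circ> recolor K h c \<circ> over K) (recolor K h c)" if e: "e \<in> K" for e
 proof (rule flat_cong[OF flat_endo[OF point_coloring_flat[OF c e] h convex_convex_hull]])
  show "recolor K h c x = h (c x)" if "x \<in> conv e" "x \<notin> under_points K" for x
   using edge_hull_subset[OF e] that by (intro recolor_apply) blast+
  fix s q assume s: "s \<in> under_points K" and q: "(Some \<circ> recolor K h c \<circ> over K) s = Some q"
  obtain v where v: "over K s = v" "v \<in> edge_union K" "v \<notin> under_points K" by (rule under_pointE[OF R s])
  then show "\<exists>r\<in>Q. (Some \<circ> c \<circ> over K) s = Some r \<and> q = h r"
   using q point_coloring_in[OF c v(2,3)] by (simp add: recolor_apply)
 qed
 ultimately show ?thesis unfolding point_colorings_def by blast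
qed

text \<open>Every point has others arbitrarily near on the same strand, so a coloring is determined
  by its values off a finite set. Formulas for a coloring may therefore omit the under points of
  another link.\<close>

lemma coloring_eqI:
 assumes K: "polygonal_link K" "regular_position K" and c: "c \<in> point_colorings K" "d \<in> point_colorings K"
  and F: "finite F" and eq: "\<And>x. x \<in> edge_union K \<Longrightarrow> x \<notin> under_points K \<Longrightarrow> x \<notin> F \<Longrightarrow> c x = d x"
 shows "c = d"
proof
 fix x
 show "c x = d x"
 proof (cases "x \<in> edge_union K \<and> x \<notin> under_points K")
  case True
  then obtain e where e: "e \<in> K" "x \<in> conv e" by (blast elim: edge_unionE)
  obtain p q where pq: "e = {p, q}" "p \<noteq> q" "conv e = seg p q" by (rule edgeE[OF K(1) e(1)])
  have "p \<in> conv e" "q \<in> conv e" using pq(3) ends_in_segment by simp_all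
  then obtain z where z: "z \<in> conv e" "z \<noteq> x" using pq(2) by (cases "x = p") blast+
  have "finite (under_points K \<union> F)" using finite_under_points[OF K] F by simp
  from isolated_from_finite[OF this, of x] obtain \<epsilon> where eps: "\<epsilon> > 0" "\<And>y. y \<in> under_points K \<union> F \<Longrightarrow> dist x y < \<epsilon> \<Longrightarrow> y = x" by blast
  obtain y where y: "y \<in> open_segment z x" "dist x y < \<epsilon>" by (rule open_segment_near[OF z(2) eps(1)])
  have yx: "y \<noteq> x" "y \<in> conv e"
   using y(1) closed_segment_subset[OF z(1) e(2) convex_convex_hull] by (auto simp: open_segment_def)
  have n: "y \<notin> under_points K" "y \<notin> F" using eps(2)[of y] y(2) yx(1) by blast+
  have "s \<notin> under_points K" if "s \<in> seg x y" for s
  proof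
   assume "s \<in> under_points K"
   moreover have "seg x y \<subseteq> ball x \<epsilon>" using y(2) eps(1) by (intro closed_segment_subset) auto
   then have "dist x s < \<epsilon>" using that by (simp add: subset_iff del: split_paired_All)
   ultimately have "s = x" using eps(2)[of s] by blast
   then show False using True \<open>s \<in> under_points K\<close> by blast
  qed
  then have dj: "seg x y \<inter> under_points K = {}" by blast
  have "c y = d y" using eq[OF _ n] edge_hull_subset[OF e(1)] yx(2) by blast
  then show ?thesis
   using flat_const[OF point_coloring_flat[OF c(1) e(1)] e(2) yx(2) dj] flat_const[OF point_coloring_flat[OF c(2) e(1)] e(2) yx(2) dj] by simp
 next
  case False
  then have "x \<notin> edge_union K - under_points K" by blast
  moreover have "c \<in> edge_union K - under_points K \<rightarrow>\<^sub>E Q" "d \<in> edge_union K - under_points K \<rightarrow>\<^sub>E Q" using c unfolding point_colorings_def by blast+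
  ultimately show ?thesis by (metis PiE_arb)
 qed
qed

end

context colored_swap
begin

text \<open>The construction as a relation that avoids the exceptional value \<open>outval\<close>
  by speaking, on \<open>Z\<close>, only of points that are under points of neither link. In this
  form it can be reversed.\<close>

definition "rel col2 \<longleftrightarrow> col2 \<in> point_colorings K' \<and> (\<exists>S. membrane S \<and>
 (\<forall>p\<in>Z. p \<notin> U \<longrightarrow> p \<notin> U' \<longrightarrow> col2 p = (if fst p \<in> \<Delta> \<and> level p < 0 then col p \<rhd> S (fst p) else col p)) \<and>
 (\<forall>x\<in>edge_union EB. x \<notin> U' \<longrightarrow> x \<noteq> a \<longrightarrow> x \<noteq> b \<longrightarrow> col2 x = S (fst x)))"

lemma rel_exists: "\<exists>col2. rel col2"
proof -
 obtain S where S: "membrane S" using membrane_exists by blast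
 interpret membrane_swap ZE EA EB a b c g Q act col S by unfold_locales (rule S)
 have "rel col'" unfolding rel_def
 proof (intro conjI exI[of _ S] S ballI impI col'_coloring)
  show "col' p = (if fst p \<in> \<Delta> \<and> level p < 0 then col p \<rhd> S (fst p) else col p)" if "p \<in> Z" "p \<notin> U" "p \<notin> U'" for p
   using col'_Z[OF that(1,3,2)] unfolding shift_def below_def .
  show "col' x = S (fst x)" if "x \<in> edge_union EB" "x \<notin> U'" "x \<noteq> a" "x \<noteq> b" for x
   by (rule col'_EB[OF that])
 qed
 then show ?thesis by blast
qed

lemma membrane_unique:
 assumes "membrane S" "membrane S'" "x \<in> \<Delta>" "x \<notin> sh"
 shows "S x = S' x"
proof -
 have 1: "flat \<Delta> sh \<kappa>O S" "agree_at \<Delta> sh S (\<lambda>_. col a) (fst a)" using assms(1) unfolding membrane_def by blast+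
 have 2: "flat \<Delta> sh \<kappa>O S'" "agree_at \<Delta> sh S' (\<lambda>_. col a) (fst a)" using assms(2) unfolding membrane_def by blast+
 show ?thesis by (rule flat_unique[OF convex_\<Delta> good_everywhere 1(1) 2(1) corners_in(1) agree_at_trans[OF 1(2) agree_at_sym[OF 2(2)]] assms(3,4)])
qed

lemma rel_unique:
 assumes "rel col2" "rel col3" shows "col2 = col3"
proof -
 obtain S where S: "membrane S"
  "\<forall>p\<in>Z. p \<notin> U \<longrightarrow> p \<notin> U' \<longrightarrow> col2 p = (if fst p \<in> \<Delta> \<and> level p < 0 then col p \<rhd> S (fst p) else col p)"
  "\<forall>x\<in>edge_union EB. x \<notin> U' \<longrightarrow> x \<noteq> a \<longrightarrow> x \<noteq> b \<longrightarrow> col2 x = S (fst x)"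
  using assms(1) unfolding rel_def by blast
 obtain S' where S': "membrane S'"
  "\<forall>p\<in>Z. p \<notin> U \<longrightarrow> p \<notin> U' \<longrightarrow> col3 p = (if fst p \<in> \<Delta> \<and> level p < 0 then col p \<rhd> S' (fst p) else col p)"
  "\<forall>x\<in>edge_union EB. x \<notin> U' \<longrightarrow> x \<noteq> a \<longrightarrow> x \<noteq> b \<longrightarrow> col3 x = S' (fst x)"
  using assms(2) unfolding rel_def by blast
 have c: "col2 \<in> point_colorings K'" "col3 \<in> point_colorings K'" using assms unfolding rel_def by blast+
 show ?thesis
 proof (rule coloring_eqI[OF KB RB c finite_under_points[OF KA RA]])
  fix x assume x: "x \<in> edge_union K'" "x \<notin> U'" "x \<notin> U"
  show "col2 x = col3 x"
  proof (cases "x \<in> Z")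
   case True
   have "S (fst x) = S' (fst x)" if "fst x \<in> \<Delta>" "level x < 0"
    using membrane_unique[OF S(1) S'(1) that(1) below_not_sh'[OF True that x(3)]] .
   then show ?thesis using S(2)[rule_format, OF True x(3,2)] S'(2)[rule_format, OF True x(3,2)] by auto
  next
   case False
   then have xE: "x \<in> edge_union EB" "x \<noteq> a" "x \<noteq> b" using x(1) ends_in_Z by (auto simp: edge_union_Un Z_def)
   have "fst x \<in> \<Delta>" using xE(1) sides_in_T(2) T_fst by blast
   then have "S (fst x) = S' (fst x)"
    using membrane_unique[OF S(1) S'(1)] side_underB(1)[OF xE] x(2) by blast
   then show ?thesis using S(3)[rule_format, OF xE(1) x(2) xE(2,3)] S'(3)[rule_format, OF xE(1) x(2) xE(2,3)] by simp
  qed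
 qed
qed

text \<open>The same membrane works in the opposite direction: simple points keep their color, so
  the colored shadow is unchanged, and acting twice by the membrane is the identity. That it returns
  the old colors on the old sides is \<open>membrane_on_alpha\<close>.\<close>

lemma rel_sym:
 assumes "rel col2"
 shows "colored_swap.rel ZE EB EA a b c g Q act col2 col"
proof -
 have c2: "col2 \<in> point_colorings K'" using assms unfolding rel_def by blast
 interpret sw: swap ZE EB EA a b c g by (rule swap_sym)
 interpret sw: colored_swap ZE EB EA a b c g Q act col2 by unfold_locales (rule c2)
 obtain S where S: "membrane S"
  and SZ: "\<forall>p\<in>Z. p \<notin> U \<longrightarrow> p \<notin> U' \<longrightarrow> col2 p = (if fst p \<in> \<Delta> \<and> level p < 0 then col p \<rhd> S (fst p) else col p)"
  and SB: "\<forall>x\<in>edge_union EB. x \<notin> U' \<longrightarrow> x \<noteq> a \<longrightarrow> x \<noteq> b \<longrightarrow> col2 x = S (fst x)"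
  using assms unfolding rel_def by blast
 have k: "sw.\<kappa>O s = \<kappa>O s" for s
 proof (cases "\<exists>v. simple v \<and> fst v = s")
  case True
  then obtain v where v: "simple v" "fst v = s" by blast
  have "col2 v = col v" using SZ simple_not_under[OF v(1)] by auto
  then show ?thesis using \<kappa>_simple[OF v(1)] sw.\<kappa>_simple[OF v(1)] v(2) by simp
 next
  case False
  then show ?thesis using \<kappa>_None[of s] sw.\<kappa>_None[of s] by metis
 qed
 have aZ: "a \<in> Z" using ends_in_Z by blast
 have "col2 a = col a" using SZ[rule_format, OF aZ] ends_not_under[of a] level_vertex by simp
 then have mem: "sw.membrane S" using S k unfolding membrane_def sw.membrane_def by (simp add: fun_eq_iff[symmetric] ext[of sw.\<kappa>O \<kappa>O, OF k])
 show ?thesis unfolding sw.rel_def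
 proof (intro conjI exI[of _ S] mem col ballI impI)
  fix p assume p: "p \<in> Z" "p \<notin> U'" "p \<notin> U"
  have cp: "col p \<in> Q" using point_coloring_in[OF col Z_in_K[OF p(1)] p(3)] .
  show "col p = (if fst p \<in> \<Delta> \<and> level p < 0 then col2 p \<rhd> S (fst p) else col2 p)"
  proof (cases "fst p \<in> \<Delta> \<and> level p < 0")
   case True
   have "S (fst p) \<in> Q" using S True below_not_sh'[OF p(1) _ _ p(3)] flat_in unfolding membrane_def by blast
   then show ?thesis using SZ[rule_format, OF p(1,3,2)] True act_invol[OF cp] by simp
  next
   case False
   show ?thesis using SZ[rule_format, OF p(1,3,2)] unfolding if_not_P[OF False] by (rule sym)
  qed
 next
  fix x assume "x \<in> edge_union EA" "x \<notin> U" "x \<noteq> a" "x \<noteq> b"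
  then show "col x = S (fst x)" using membrane_on_alpha[OF S] by simp
 qed
qed

text \<open>An endomorphism carries the membrane of a coloring to the membrane of the recolored one
  and commutes with the shift.\<close>

lemma rel_natural:
 assumes r: "rel col2" and h: "endo h"
 shows "colored_swap.rel ZE EA EB a b c g Q act (recolor K h col) (recolor K' h col2)"
proof -
 have c2: "col2 \<in> point_colorings K'" using r unfolding rel_def by blast
 have hc: "recolor K h col \<in> point_colorings K" by (rule recolor_coloring[OF RA col h])
 interpret hc: colored_swap ZE EA EB a b c g Q act "recolor K h col" by unfold_locales (rule hc)
 obtain S where S: "membrane S"
  and SZ: "\<forall>p\<in>Z. p \<notin> U \<longrightarrow> p \<notin> U' \<longrightarrow> col2 p = (if fst p \<in> \<Delta> \<and> level p < 0 then col p \<rhd> S (fst p) else col p)"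
  and SB: "\<forall>x\<in>edge_union EB. x \<notin> U' \<longrightarrow> x \<noteq> a \<longrightarrow> x \<noteq> b \<longrightarrow> col2 x = S (fst x)"
  using r unfolding rel_def by blast
 have fl: "flat \<Delta> sh \<kappa>O S" and ag: "agree_at \<Delta> sh S (\<lambda>_. col a) (fst a)" using S unfolding membrane_def by blast+
 have zK: "p \<in> edge_union K" "p \<in> edge_union K'" if "p \<in> Z" for p using that Z_sub by blast+
 have "flat \<Delta> sh hc.\<kappa>O (\<lambda>x. h (S x))"
 proof (rule flat_endo[OF fl h convex_\<Delta>])
  fix s q assume "hc.\<kappa>O s = Some q"
  then obtain v where v: "simple v" "fst v = s" "q = recolor K h col v" by (rule hc.\<kappa>_SomeD)
  note n = simple_not_under[OF v(1)]
  show "\<exists>r\<in>Q. \<kappa>O s = Some r \<and> q = h r"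
   using \<kappa>_simple[OF v(1)] v(2,3) recolor_apply[OF zK(1)[OF n(1)] n(2)] point_coloring_in[OF col zK(1)[OF n(1)] n(2)] by auto
 qed
 moreover have "recolor K h col a = h (col a)"
  using recolor_apply[OF zK(1)[OF ends_in_Z(1)]] ends_not_under[of a] by simp
 then have "agree_at \<Delta> sh (\<lambda>x. h (S x)) (\<lambda>_. recolor K h col a) (fst a)"
 proof -
  assume r: "recolor K h col a = h (col a)"
  obtain \<epsilon> where eps: "\<epsilon> > 0" "\<forall>y\<in>\<Delta> \<inter> ball (fst a) \<epsilon> - sh. S y = col a" using ag unfolding agree_at_def by blast
  show ?thesis unfolding agree_at_def r using eps by (intro exI[of _ \<epsilon>]) simp
 qed
 ultimately have mem: "hc.membrane (\<lambda>x. h (S x))" unfolding hc.membrane_def by blast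
 show ?thesis unfolding hc.rel_def
 proof (intro conjI exI[of _ "\<lambda>x. h (S x)"] mem recolor_coloring[OF RB c2 h] ballI impI)
  fix p assume p: "p \<in> Z" "p \<notin> U" "p \<notin> U'"
  have cp: "col p \<in> Q" using point_coloring_in[OF col Z_in_K[OF p(1)] p(2)] .
  have "h (col p \<rhd> S (fst p)) = h (col p) \<rhd> h (S (fst p))" if "fst p \<in> \<Delta> \<and> level p < 0"
   using endo_act[OF h cp] flat_in[OF fl] below_not_sh'[OF p(1) _ _ p(2)] that by blast
  then show "recolor K' h col2 p = (if fst p \<in> \<Delta> \<and> level p < 0 then recolor K h col p \<rhd> h (S (fst p)) else recolor K h col p)"
   using SZ[rule_format, OF p] recolor_apply[OF zK(1)[OF p(1)] p(2)] recolor_apply[OF zK(2)[OF p(1)] p(3)] by simp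
 next
  fix x assume x: "x \<in> edge_union EB" "x \<notin> U'" "x \<noteq> a" "x \<noteq> b"
  have "x \<in> edge_union K'" using x(1) by (simp add: edge_union_Un)
  then show "recolor K' h col2 x = h (S (fst x))" using SB[rule_format, OF x] recolor_apply[of x K' h col2] x(2) by simp
 qed
qed

end

text \<open>Existence and uniqueness make \<open>rel\<close> the graph of a map. By symmetry the
  relation with the roles of the links exchanged is the graph of its inverse.\<close>

lemma (in kei) swap_iso:
 assumes sw: "swap ZE EA EB a b c g"
 shows "coloring_iso (ZE \<union> EA) (ZE \<union> EB)"
proof -
 let ?K = "ZE \<union> EA" and ?K' = "ZE \<union> EB"
 let ?R = "colored_swap.rel ZE EA EB a b c g Q act" and ?R' = "colored_swap.rel ZE EB EA a b c g Q act"
 have sw': "swap ZE EB EA a b c g" by (rule swap.swap_sym[OF sw])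
 have cs: "colored_swap ZE EA EB a b c g Q act col" if "col \<in> point_colorings ?K" for col
  using sw that by (simp add: colored_swap_def colored_swap_axioms_def kei_axioms)
 have cs': "colored_swap ZE EB EA a b c g Q act col" if "col \<in> point_colorings ?K'" for col
  using sw' that by (simp add: colored_swap_def colored_swap_axioms_def kei_axioms)
 have Rin: "col2 \<in> point_colorings ?K'" if "col \<in> point_colorings ?K" "?R col col2" for col col2
  using that(2) colored_swap.rel_def[OF cs[OF that(1)]] by simp
 have R'in: "col \<in> point_colorings ?K" if "col2 \<in> point_colorings ?K'" "?R' col2 col" for col col2
  using that(2) colored_swap.rel_def[OF cs'[OF that(1)]] by simp
 have sym: "?R col col2 \<longleftrightarrow> ?R' col2 col" if "col \<in> point_colorings ?K" "col2 \<in> point_colorings ?K'" for col col2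
  using colored_swap.rel_sym[OF cs[OF that(1)]] colored_swap.rel_sym[OF cs'[OF that(2)]] by blast
 define \<Phi> where "\<Phi> col = (SOME col2. ?R col col2)" for col
 have R\<Phi>: "?R col (\<Phi> col)" if "col \<in> point_colorings ?K" for col
  unfolding \<Phi>_def by (rule someI_ex[OF colored_swap.rel_exists[OF cs[OF that]]])
 have uniq: "\<Phi> col = col2" if "col \<in> point_colorings ?K" "?R col col2" for col col2
  by (rule colored_swap.rel_unique[OF cs[OF that(1)] R\<Phi>[OF that(1)] that(2)])
 have "bij_betw \<Phi> (point_colorings ?K) (point_colorings ?K')"
 proof (rule bij_betwI')
  show "\<Phi> c1 = \<Phi> c2 \<longleftrightarrow> c1 = c2" if c: "c1 \<in> point_colorings ?K" "c2 \<in> point_colorings ?K" for c1 c2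
  proof
   assume eq: "\<Phi> c1 = \<Phi> c2"
   have in': "\<Phi> c1 \<in> point_colorings ?K'" by (rule Rin[OF c(1) R\<Phi>[OF c(1)]])
   have "?R' (\<Phi> c1) c1" "?R' (\<Phi> c1) c2" using sym[OF c(1) in'] sym[OF c(2) in'] R\<Phi>[OF c(1)] R\<Phi>[OF c(2)] eq by simp_all
   then show "c1 = c2" by (rule colored_swap.rel_unique[OF cs'[OF in']])
  qed simp
  show "\<Phi> c1 \<in> point_colorings ?K'" if "c1 \<in> point_colorings ?K" for c1 by (rule Rin[OF that R\<Phi>[OF that]])
  show "\<exists>c1\<in>point_colorings ?K. c2 = \<Phi> c1" if c2: "c2 \<in> point_colorings ?K'" for c2
  proof -
   obtain c1 where c1: "?R' c2 c1" using colored_swap.rel_exists[OF cs'[OF c2]] by blast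
   have "c1 \<in> point_colorings ?K" by (rule R'in[OF c2 c1])
   then show ?thesis using uniq[of c1 c2] sym[OF _ c2] c1 by blast
  qed
 qed
 moreover have "\<Phi> (recolor ?K h c1) = recolor ?K' h (\<Phi> c1)" if c1: "c1 \<in> point_colorings ?K" and h: "endo h" for c1 h
 proof (rule uniq)
  show "recolor ?K h c1 \<in> point_colorings ?K" using recolor_coloring[OF _ c1 h] sw unfolding swap_def by blast
  show "?R (recolor ?K h c1) (recolor ?K' h (\<Phi> c1))" by (rule colored_swap.rel_natural[OF cs[OF c1] R\<Phi>[OF c1] h])
 qed
 ultimately show ?thesis unfolding coloring_iso_def by blast
qed

context kei
begin

lemma coloring_iso_refl: "coloring_iso K K"
 unfolding coloring_iso_def by (intro exI[of _ id]) simp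

lemma coloring_iso_trans:
 assumes "coloring_iso K K'" "coloring_iso K' K''" shows "coloring_iso K K''"
proof -
 obtain \<Phi> where 1: "bij_betw \<Phi> (point_colorings K) (point_colorings K')"
  "\<And>c h. c \<in> point_colorings K \<Longrightarrow> endo h \<Longrightarrow> \<Phi> (recolor K h c) = recolor K' h (\<Phi> c)"
  using assms(1) unfolding coloring_iso_def by blast
 obtain \<Psi> where 2: "bij_betw \<Psi> (point_colorings K') (point_colorings K'')"
  "\<And>c h. c \<in> point_colorings K' \<Longrightarrow> endo h \<Longrightarrow> \<Psi> (recolor K' h c) = recolor K'' h (\<Psi> c)"
  using assms(2) unfolding coloring_iso_def by blast
 show ?thesis unfolding coloring_iso_def
 proof (intro exI[of _ "\<Psi> \<circ> \<Phi>"] conjI ballI allI impI)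
  show "bij_betw (\<Psi> \<circ> \<Phi>) (point_colorings K) (point_colorings K'')" by (rule bij_betw_trans[OF 1(1) 2(1)])
  show "(\<Psi> \<circ> \<Phi>) (recolor K h c) = recolor K'' h ((\<Psi> \<circ> \<Phi>) c)" if "c \<in> point_colorings K" "endo h" for c h
   using 1(2)[OF that] 2(2)[OF _ that(2)] bij_betwE[OF 1(1)] that(1) by simp
 qed
qed

lemma coloring_iso_sym:
 assumes R: "regular_position K" and "coloring_iso K K'" shows "coloring_iso K' K"
proof -
 obtain \<Phi> where 1: "bij_betw \<Phi> (point_colorings K) (point_colorings K')"
  "\<And>c h. c \<in> point_colorings K \<Longrightarrow> endo h \<Longrightarrow> \<Phi> (recolor K h c) = recolor K' h (\<Phi> c)"
  using assms(2) unfolding coloring_iso_def by blast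
 let ?\<Psi> = "the_inv_into (point_colorings K) \<Phi>"
 have b: "bij_betw ?\<Psi> (point_colorings K') (point_colorings K)" by (rule bij_betw_the_inv_into[OF 1(1)])
 show ?thesis unfolding coloring_iso_def
 proof (intro exI[of _ ?\<Psi>] conjI ballI allI impI b)
  fix c h assume c: "c \<in> point_colorings K'" and h: "endo h"
  have i: "?\<Psi> c \<in> point_colorings K" using bij_betwE[OF b] c by blast
  have "\<Phi> (recolor K h (?\<Psi> c)) = recolor K' h c"
   using 1(2)[OF i h] f_the_inv_into_f_bij_betw[OF 1(1)] c by simp
  moreover have "recolor K h (?\<Psi> c) \<in> point_colorings K" by (rule recolor_coloring[OF R i h])
  ultimately show "?\<Psi> (recolor K' h c) = recolor K h (?\<Psi> c)"
   using the_inv_into_f_f[OF bij_betw_imp_inj_on[OF 1(1)]] by metis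
 qed
qed

end

lemma linear_interpolation:
 assumes "det2 x y \<noteq> 0"
 obtains g :: "plane \<Rightarrow> real" where "linear g" "g x = h" "g y = k"
proof
 let ?g = "\<lambda>z. (h * det2 z y + k * det2 x z) / det2 x y"
 show "linear ?g" by (intro linearI) (simp_all add: det2_def algebra_simps add_divide_distrib diff_divide_distrib)
 show "?g x = h" "?g y = k" using assms by (simp_all add: det2_self)
qed

lemma vertex_other_edge:
 assumes K: "polygonal_link K" and e: "e \<in> K" "v \<in> e"
 obtains f where "f \<in> K" "f \<noteq> e" "v \<in> f"
proof -
 have "card {e \<in> K. v \<in> e} = 2" using K e unfolding polygonal_link_def by blast
 moreover have "card {e} = 1" by simp
 ultimately have "{e \<in> K. v \<in> e} \<noteq> {e}" by (metis numeral_eq_one_iff verit_eq_simplify(10))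
 then show ?thesis using that e by blast
qed

text \<open>Separates the common part from the sides. The triangle is nondegenerate even in the
  projection, so its plane is the graph of an affine function, which provides
  \<open>g\<close>.\<close>

lemma (in kei) move_iso:
 assumes K: "polygonal_link K" "regular_position K" "polygonal_link K'" "regular_position K'"
  and ab: "{a, b} \<in> K" and hull: "conv {a, b, c} \<inter> edge_union K = seg a b"
  and K': "K' = (K - {{a, b}}) \<union> {{a, c}, {c, b}}"
  and nc: "det2 (fst b - fst a) (fst c - fst a) \<noteq> 0"
 shows "coloring_iso K K'"
proof -
 let ?Z = "K - {{a, b}}"
 obtain g :: "plane \<Rightarrow> real" where g: "linear g" "g (fst b - fst a) = snd b - snd a" "g (fst c - fst a) = snd c - snd a"
  by (rule linear_interpolation[OF nc])
 have KZ: "K = ?Z \<union> {{a, b}}" using ab by blast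
 have disj: "conv {a, b, c} \<inter> edge_union ?Z = {a, b}"
 proof
  show "conv {a, b, c} \<inter> edge_union ?Z \<subseteq> {a, b}"
  proof
   fix x assume x: "x \<in> conv {a, b, c} \<inter> edge_union ?Z"
   then have "x \<in> edge_union ?Z" by blast
   then obtain f where f: "f \<in> ?Z" "x \<in> conv f" by (rule edge_unionE)
   have "x \<in> edge_union K" using f edge_hull_subset[of f K] by blast
   then have "x \<in> conv {a, b}" using x hull edge_hull[of a b] by blast
   then have "x \<in> f \<inter> {a, b}" using edges_meet[OF K(1) _ ab] f by blast
   then show "x \<in> {a, b}" by blast
  qed
  have "v \<in> edge_union ?Z" if v: "v \<in> {a, b}" for v
  proof -
   obtain f where f: "f \<in> K" "f \<noteq> {a, b}" "v \<in> f" by (rule vertex_other_edge[OF K(1) ab v])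
   then have "v \<in> conv f" by (intro hull_inc)
   then show ?thesis using f edge_hull_subset[of f ?Z] by blast
  qed
  moreover have "{a, b} \<subseteq> conv {a, b, c}" using hull_subset[of "{a, b, c}" convex] by blast
  ultimately show "{a, b} \<subseteq> conv {a, b, c} \<inter> edge_union ?Z" by blast
 qed
 have "swap ?Z {{a, b}} {{a, c}, {c, b}} a b c g"
 proof
  show "polygonal_link (?Z \<union> {{a, b}})" "regular_position (?Z \<union> {{a, b}})" using K(1,2) KZ by simp_all
  show "polygonal_link (?Z \<union> {{a, c}, {c, b}})" "regular_position (?Z \<union> {{a, c}, {c, b}})" using K(3,4) K' by simp_all
 qed (simp_all only: disj nc g linear_add[OF g(1)] linear_scale[OF g(1)], simp_all)
 from swap_iso[OF this] show ?thesis using KZ K' by simp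
qed


section \<open>Generic shears\<close>

definition shear :: "plane \<Rightarrow> space \<Rightarrow> space" where
 "shear w x = (fst x + snd x *\<^sub>R w, snd x)"

text \<open>The direction that \<open>shear w\<close> makes vertical: two points get the same
  projection exactly if their difference is a multiple of \<open>slope w\<close>.\<close>

definition slope :: "plane \<Rightarrow> space" where
 "slope w = (- w, 1)"

definition shear_link :: "plane \<Rightarrow> space set set \<Rightarrow> space set set" where
 "shear_link w K = (`) (shear w) ` K"

lemma linear_shear: "linear (shear w)"
 by (intro linearI) (simp_all add: shear_def algebra_simps prod_eq_iff)

lemma inj_shear: "inj (shear w)"
 by (rule injI) (auto simp add: shear_def prod_eq_iff)

lemma shear_eq_iff: "shear w x = shear w y \<longleftrightarrow> x = y"
 using inj_eq[OF inj_shear] .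

lemma snd_shear: "snd (shear w x) = snd x"
 by (simp add: shear_def)

lemma hull_shear: "conv (shear w ` e) = shear w ` (conv e)"
 by (rule convex_hull_linear_image[OF linear_shear, symmetric])

lemma edge_union_shear: "edge_union (shear_link w K) = shear w ` edge_union K"
 unfolding edge_union_def shear_link_def image_image hull_shear by blast

lemma image_shear_eq_iff: "shear w ` A = shear w ` B \<longleftrightarrow> A = B"
 by (rule inj_image_eq_iff[OF inj_shear])

lemma mem_shear_iff: "shear w x \<in> shear w ` A \<longleftrightarrow> x \<in> A"
 by (rule inj_image_mem_iff[OF inj_shear])

lemma polygonal_shear:
 assumes K: "polygonal_link K" shows "polygonal_link (shear_link w K)"
 unfolding polygonal_link_def
proof (intro conjI ballI impI)
 show "finite (shear_link w K)" "shear_link w K \<noteq> {}" using K unfolding polygonal_link_def shear_link_def by simp_all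
next
 fix e assume "e \<in> shear_link w K"
 then obtain e0 where "e0 \<in> K" "e = shear w ` e0" unfolding shear_link_def by blast
 then show "card e = 2" using K card_image[OF inj_on_subset[OF inj_shear subset_UNIV]] unfolding polygonal_link_def by simp
next
 fix v assume "v \<in> \<Union>(shear_link w K)"
 then obtain v0 where v0: "v0 \<in> \<Union>K" "v = shear w v0" unfolding shear_link_def by blast
 have "{e \<in> shear_link w K. v \<in> e} = (`) (shear w) ` {e \<in> K. v0 \<in> e}"
 proof -
  have "{y \<in> f ` A. P y} = f ` {x \<in> A. P (f x)}" for f :: "space set \<Rightarrow> space set" and A P by blast
  then show ?thesis unfolding shear_link_def v0(2) by (simp only: mem_shear_iff)
 qed
 moreover have "inj_on ((`) (shear w)) {e \<in> K. v0 \<in> e}" by (rule inj_onI) (simp only: image_shear_eq_iff)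
 moreover have "card {e \<in> K. v0 \<in> e} = 2" using K v0(1) unfolding polygonal_link_def by blast
 ultimately show "card {e \<in> shear_link w K. v \<in> e} = 2" by (simp only: card_image)
next
 fix e f assume "e \<in> shear_link w K" "f \<in> shear_link w K" and ne: "e \<noteq> f"
 then obtain e0 f0 where ef: "e0 \<in> K" "e = shear w ` e0" "f0 \<in> K" "f = shear w ` f0" unfolding shear_link_def by blast
 then have "conv e0 \<inter> conv f0 = e0 \<inter> f0" using K ne unfolding polygonal_link_def by blast
 then show "conv e \<inter> conv f = e \<inter> f" unfolding ef(2,4) hull_shear by (metis image_Int[OF inj_shear])
qed

lemma same_shadow:
 assumes "fst (shear w p) = fst (shear w q)" "p \<noteq> q"
 obtains k where "k \<noteq> 0" "k *\<^sub>R slope w = q - p"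
proof
 have f: "fst q - fst p = (snd p - snd q) *\<^sub>R w" using assms(1) by (simp add: shear_def algebra_simps)
 then show "(snd q - snd p) *\<^sub>R slope w = q - p" by (simp add: slope_def prod_eq_iff algebra_simps)
 show "snd q - snd p \<noteq> 0" using f assms(2) by (auto simp: prod_eq_iff)
qed

lemma in_span2I:
 fixes x y d :: "'v::real_vector"
 assumes "k *\<^sub>R d = s *\<^sub>R x + t *\<^sub>R y" "k \<noteq> 0"
 shows "d \<in> span {x, y}"
proof -
 have "k *\<^sub>R d \<in> span {x, y}" unfolding assms(1) by (intro span_add span_scale span_base) simp_all
 from span_scale[OF this, of "inverse k"] show ?thesis using assms(2) by simp
qed

text \<open>Used for difference vectors of vertices. A projection line through a vertex and a point
  of another edge, for instance, has such a direction.\<close>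

definition slopes_in_planes :: "space set \<Rightarrow> plane set" where
 "slopes_in_planes V = (\<Union>(x, y)\<in>V \<times> V. {w. slope w \<in> span {x, y}})"

lemma slopes_in_planesI:
 assumes "x \<in> V" "y \<in> V" "k *\<^sub>R slope w = s *\<^sub>R x + t *\<^sub>R y" "k \<noteq> 0"
 shows "w \<in> slopes_in_planes V"
 unfolding slopes_in_planes_def using in_span2I[OF assms(3,4)] assms(1,2) by blast

text \<open>Empty interior alone is not preserved by finite unions; together with closedness it
  is.\<close>

definition nowhere_dense_closed :: "'v::topological_space set \<Rightarrow> bool" where
 "nowhere_dense_closed S \<longleftrightarrow> closed S \<and> interior S = {}"

lemma nowhere_dense_closed_Union:
 assumes "finite I" "\<And>i. i \<in> I \<Longrightarrow> nowhere_dense_closed (S i)"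
 shows "nowhere_dense_closed (\<Union>i\<in>I. S i)"
 using assms
proof (induction I rule: finite_induct)
 case empty
 then show ?case by (simp add: nowhere_dense_closed_def)
next
 case (insert i I)
 then show ?case unfolding nowhere_dense_closed_def by (auto simp: interior_closed_Un_empty_interior closed_Un)
qed

text \<open>A nonzero normal \<open>n\<close> of the plane turns membership into an affine equation
  in \<open>w\<close>. If it held on a ball, moving \<open>w\<close> along \<open>fst n\<close>
  would force \<open>n\<close> to vanish.\<close>

lemma nowhere_dense_slopes:
 assumes "finite V" shows "nowhere_dense_closed (slopes_in_planes V)"
 unfolding slopes_in_planes_def
proof (rule nowhere_dense_closed_Union)
 show "finite (V \<times> V)" using assms by simp
 fix xy :: "space \<times> space"
 obtain x y where xy: "xy = (x, y)" by (cases xy)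
 let ?A = "{w. slope w \<in> span {x, y}}"
 have "closed (slope -` span {x, y})"
  by (intro closed_vimage[OF closed_span]) (auto intro!: continuous_intros simp: slope_def)
 then have "closed ?A" by (simp add: vimage_def)
 moreover have "interior ?A = {}"
 proof (rule ccontr)
  assume "interior ?A \<noteq> {}"
  then obtain w where "w \<in> interior ?A" by blast
  then obtain e where e: "e > 0" "ball w e \<subseteq> ?A" by (metis mem_interior)
  have "dim {x, y} < DIM(space)"
  proof -
   have "dim {x, y} \<le> card {x, y}" by (rule dim_le_card') simp
   also have "\<dots> \<le> 2" by (simp add: card_insert_if)
   finally show ?thesis by simp
  qed
  then obtain n where n: "n \<noteq> 0" "\<And>z. z \<in> span {x, y} \<Longrightarrow> orthogonal n z" by (rule orthogonal_to_subspace_exists) blast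
  define s where "s = e / (2 * (norm (fst n) + 1))"
  have np: "norm (fst n) + 1 > 0" using norm_ge_zero[of "fst n"] by linarith
  have s: "s > 0" using e(1) np by (simp add: s_def)
  have "s * norm (fst n) < e" using e(1) np by (simp add: s_def field_simps) (smt (verit) mult_nonneg_nonneg norm_ge_zero)
  then have "w + s *\<^sub>R fst n \<in> ball w e" using s by (simp add: dist_norm)
  then have "n \<bullet> slope w = 0" "n \<bullet> slope (w + s *\<^sub>R fst n) = 0"
   using n(2)[of "slope w"] n(2)[of "slope (w + s *\<^sub>R fst n)"] e centre_in_ball[of w e]
   unfolding orthogonal_def by blast+
  then have "s * (fst n \<bullet> fst n) = 0" "- (fst n \<bullet> w) + snd n = 0" by (simp_all add: slope_def inner_prod_def inner_simps algebra_simps)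
  then have "fst n = 0" "snd n = 0" using s by simp_all
  then show False using n(1) prod_eq_iff[of n 0] by simp
 qed
 ultimately show "nowhere_dense_closed (case xy of (x, y) \<Rightarrow> {w. slope w \<in> span {x, y}})"
  by (simp add: xy nowhere_dense_closed_def)
qed

text \<open>The directions of lines that meet all three sets; the points may coincide.\<close>

definition triple_shadow :: "space set \<Rightarrow> space set \<Rightarrow> space set \<Rightarrow> plane set" where
 "triple_shadow e f g = {w. \<exists>p\<in>e. \<exists>q\<in>f. \<exists>r\<in>g. fst (shear w p) = fst (shear w q) \<and> fst (shear w q) = fst (shear w r)}"

lemma closed_triple_shadow:
 assumes "compact e" "compact f" "compact g" shows "closed (triple_shadow e f g)"
proof -
 let ?S = "e \<times> f \<times> g"
 let ?T = "{z. fst z \<in> ?S \<and> fst (shear (snd z) (fst (fst z))) = fst (shear (snd z) (fst (snd (fst z)))) \<and>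
  fst (shear (snd z) (fst (snd (fst z)))) = fst (shear (snd z) (snd (snd (fst z))))}"
 have S: "compact ?S" using assms by (intro compact_Times)
 have "closed ?T"
 proof -
  have c: "closed {z :: (space \<times> space \<times> space) \<times> plane. fst z \<in> ?S}"
   using closed_Times[OF compact_imp_closed[OF S] closed_UNIV] by (rule back_subst) auto
  show ?thesis by (intro closed_Collect_conj c closed_Collect_eq) (auto intro!: continuous_intros simp: shear_def)
 qed
 from closed_compact_projection[OF S this] show ?thesis
  by (rule back_subst[where P = closed]) (simp add: triple_shadow_def set_eq_iff Bex_def, blast)
qed

text \<open>Common transversals of three lines in general position form a one-parameter family, so
  their directions cannot fill an open set. Concretely, one transversal is compared with another one
  that starts at the same point of the first segment and meets the second segment elsewhere. The
  line of the third segment has to meet both, which forces a coplanarity that \<open>W\<close>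
  excludes.\<close>

lemma triple_shadow_nowhere:
 assumes V: "finite V" "(\<lambda>(x, y). x - y) ` ({a, a', b, b', c, c'} \<times> {a, a', b, b', c, c'}) \<subseteq> V"
  and ne: "b \<noteq> b'"
  and dj: "seg a a' \<inter> seg b b' = {}" "seg b b' \<inter> seg c c' = {}" "seg a a' \<inter> seg c c' = {}"
  and W: "open W" "w0 \<in> W" "W \<inter> slopes_in_planes V = {}"
  and sub: "W \<subseteq> triple_shadow (seg a a') (seg b b') (seg c c')"
 shows False
proof -
 define E F G where EFG: "E = a' - a" "F = b' - b" "G = c' - c"
 have inV: "E \<in> V" "F \<in> V" "G \<in> V" "b - a \<in> V" "c - b \<in> V"
  using V(2) unfolding EFG by (auto simp: image_subset_iff simp del: split_paired_All)
 have no: False if "w \<in> W" "x \<in> V" "y \<in> V" "k *\<^sub>R slope w = s *\<^sub>R x + t *\<^sub>R y" "k \<noteq> 0" for w x y k s t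
  using slopes_in_planesI[OF that(2-5)] that(1) W(3) by blast
 have ex: "\<exists>s t u k l. a + s *\<^sub>R E \<in> seg a a' \<and> b + t *\<^sub>R F \<in> seg b b' \<and> c + u *\<^sub>R G \<in> seg c c' \<and>
   k \<noteq> 0 \<and> l \<noteq> 0 \<and> k *\<^sub>R slope w = (b + t *\<^sub>R F) - (a + s *\<^sub>R E) \<and> l *\<^sub>R slope w = (c + u *\<^sub>R G) - (b + t *\<^sub>R F) \<and>
   (\<exists>m. m \<noteq> 0 \<and> m *\<^sub>R slope w = (c + u *\<^sub>R G) - (a + s *\<^sub>R E))" if w: "w \<in> W" for w
 proof -
  obtain p q r where m: "p \<in> seg a a'" "q \<in> seg b b'" "r \<in> seg c c'"
   and sh: "fst (shear w p) = fst (shear w q)" "fst (shear w q) = fst (shear w r)"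
   using sub w unfolding triple_shadow_def by blast
  have d: "p \<noteq> q" "q \<noteq> r" "p \<noteq> r" using m dj by blast+
  obtain s where s: "p = a + s *\<^sub>R E" using closed_segment_paramE[OF m(1)] unfolding EFG by metis
  obtain t where t: "q = b + t *\<^sub>R F" using closed_segment_paramE[OF m(2)] unfolding EFG by metis
  obtain u where u: "r = c + u *\<^sub>R G" using closed_segment_paramE[OF m(3)] unfolding EFG by metis
  obtain k where k: "k \<noteq> 0" "k *\<^sub>R slope w = q - p" by (rule same_shadow[OF sh(1) d(1)])
  obtain l where l: "l \<noteq> 0" "l *\<^sub>R slope w = r - q" by (rule same_shadow[OF sh(2) d(2)])
  obtain n where n: "n \<noteq> 0" "n *\<^sub>R slope w = r - p" by (rule same_shadow[OF trans[OF sh] d(3)])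
  show ?thesis using m k l n unfolding s t u by blast
 qed
 obtain s0 t0 u0 k0 l0 n0 where 0: "a + s0 *\<^sub>R E \<in> seg a a'" "b + t0 *\<^sub>R F \<in> seg b b'" "c + u0 *\<^sub>R G \<in> seg c c'"
  "k0 \<noteq> 0" "l0 \<noteq> 0" "n0 \<noteq> 0" "k0 *\<^sub>R slope w0 = (b + t0 *\<^sub>R F) - (a + s0 *\<^sub>R E)" "l0 *\<^sub>R slope w0 = (c + u0 *\<^sub>R G) - (b + t0 *\<^sub>R F)"
  "n0 *\<^sub>R slope w0 = (c + u0 *\<^sub>R G) - (a + s0 *\<^sub>R E)" using ex[OF W(2)] by (elim exE conjE) (rule that)
 define p0 q0 where pq0: "p0 = a + s0 *\<^sub>R E" "q0 = b + t0 *\<^sub>R F"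
 \<comment> \<open>\<open>dir y\<close> is the shear whose slope is parallel to the line from
   \<open>p0\<close> to \<open>y\<close>.\<close>
 define dir where "dir y = - (fst (y - p0) /\<^sub>R snd (y - p0))" for y :: space
 have q0p0: "snd (q0 - p0) = k0" "fst (q0 - p0) = - (k0 *\<^sub>R w0)" using 0(7) unfolding pq0 slope_def by (metis fst_conv snd_conv scaleR_Pair mult.right_neutral real_scaleR_def scaleR_minus_right)+
 have dir0: "dir q0 = w0" using 0(4) unfolding dir_def q0p0 by simp
 have "isCont dir q0" unfolding dir_def using 0(4) q0p0(1) by (intro continuous_intros) simp_all
 then obtain S where S: "open S" "q0 \<in> S" "\<forall>y\<in>S. dir y \<in> W"
  unfolding continuous_at_open using W(1,2) dir0 by metis
 have "isCont (\<lambda>y. snd (y - p0)) q0" by (intro continuous_intros)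
 then obtain S' where S': "open S'" "q0 \<in> S'" "\<forall>y\<in>S'. snd (y - p0) \<in> - {0}"
  unfolding continuous_at_open using 0(4) q0p0(1) open_Compl[OF closed_singleton[of "0::real"]] by (metis Compl_iff singletonD)
 have "open (S \<inter> S')" "q0 \<in> S \<inter> S'" using S(1,2) S'(1,2) by blast+
 then obtain e where e: "e > 0" "ball q0 e \<subseteq> S \<inter> S'" by (metis open_contains_ball)
 \<comment> \<open>\<open>q0\<close> may itself be an end point; moving towards an end different
   from \<open>q0\<close> stays in the segment.\<close>
 obtain z where z: "z \<in> {b, b'}" "z \<noteq> q0" using ne by blast
 obtain q1 where q1: "q1 \<in> open_segment z q0" "dist q0 q1 < e" by (rule open_segment_near[OF z(2) e(1)])
 have "seg z q0 \<subseteq> seg b b'" using z(1) 0(2) ends_in_segment unfolding pq0 by (intro closed_segment_subset) blast+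
 then have "q1 \<in> seg b b'" "q1 \<noteq> q0" using q1(1) unfolding open_segment_def by blast+
 then obtain t1 where t1: "q1 = b + t1 *\<^sub>R F" "t1 \<noteq> t0" using closed_segment_paramE[of q1 b b'] EFG(2) pq0(2) by metis
 define w1 k1 where w1: "w1 = dir q1" "k1 = snd (q1 - p0)"
 have w1W: "w1 \<in> W" and k1: "k1 \<noteq> 0" using e(2) S(3) S'(3) q1(2) unfolding w1 by (auto simp only: subset_iff mem_ball)
 have eq1: "k1 *\<^sub>R slope w1 = q1 - p0" using k1 unfolding w1 dir_def slope_def by (simp add: prod_eq_iff)
 obtain s t u k n where 1: "k \<noteq> 0" "n \<noteq> 0" "k *\<^sub>R slope w1 = (b + t *\<^sub>R F) - (a + s *\<^sub>R E)"
  "n *\<^sub>R slope w1 = (c + u *\<^sub>R G) - (a + s *\<^sub>R E)" using ex[OF w1W] by (elim exE conjE) (rule that)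
 \<comment> \<open>Two vectors of direction \<open>slope w1\<close> run between the lines of the
   first two segments. If they had different lengths, this direction would lie in the plane of
   \<open>E\<close> and \<open>F\<close>.\<close>
 have "k = k1"
 proof (rule ccontr)
  assume "k \<noteq> k1"
  moreover have "(k - k1) *\<^sub>R slope w1 = (t - t1) *\<^sub>R F + (s0 - s) *\<^sub>R E"
   unfolding scaleR_diff_left[of k] 1(3) eq1 t1(1) pq0 by (simp add: algebra_simps)
  ultimately show False using no[OF w1W inV(2,1), of "k - k1"] by (metis right_minus_eq)
 qed
 then have eqs: "(t - t1) *\<^sub>R F = (s - s0) *\<^sub>R E" using 1(3) eq1 unfolding t1(1) pq0 by (simp add: algebra_simps)
 \<comment> \<open>Different starting points would make \<open>E\<close> a multiple of
   \<open>F\<close>, and then the direction would lie in the plane of \<open>b - a\<close> and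
   \<open>F\<close>.\<close>
 have "s = s0"
 proof (rule ccontr)
  assume s: "s \<noteq> s0"
  define m where "m = (t - t1) / (s - s0)"
  have "E = m *\<^sub>R F" using arg_cong[OF eqs, of "\<lambda>x. x /\<^sub>R (s - s0)"] s by (simp add: m_def divide_inverse mult.commute)
  then have "k1 *\<^sub>R slope w1 = 1 *\<^sub>R (b - a) + (t1 - s0 * m) *\<^sub>R F" unfolding eq1 t1(1) pq0 by (simp add: algebra_simps)
  then show False using no[OF w1W inV(4,2)] k1 by blast
 qed
 \<comment> \<open>So the second transversal also leaves from \<open>p0\<close>, and comparing the two puts \<open>G\<close> into the plane of \<open>F\<close> and the first slope.\<close>
 define m al be where mab: "m = n / k1" "al = m * k0 - n0" "be = m * (t1 - t0)"
 have be: "be \<noteq> 0" using 1(2) k1 t1(2) by (simp add: mab)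
 have "n *\<^sub>R slope w1 = m *\<^sub>R (k1 *\<^sub>R slope w1)" using k1 by (simp add: mab)
 then have u: "c + u *\<^sub>R G - p0 = m *\<^sub>R (q1 - p0)" unfolding 1(4) eq1 \<open>s = s0\<close> pq0 .
 have q1': "q1 - p0 = k0 *\<^sub>R slope w0 + (t1 - t0) *\<^sub>R F" unfolding 0(7) t1(1) pq0 by (simp add: algebra_simps)
 have u0: "c + u0 *\<^sub>R G - p0 = n0 *\<^sub>R slope w0" unfolding 0(9) pq0 ..
 have "(u - u0) *\<^sub>R G = (c + u *\<^sub>R G - p0) - (c + u0 *\<^sub>R G - p0)" by (simp add: algebra_simps)
 also have "\<dots> = al *\<^sub>R slope w0 + be *\<^sub>R F" unfolding u u0 q1' mab by (simp add: algebra_simps diff_divide_distrib)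
 finally have key: "(u - u0) *\<^sub>R G = al *\<^sub>R slope w0 + be *\<^sub>R F" .
 show False
 \<comment> \<open>If the first slope drops out of \<open>key\<close>, then \<open>F\<close> is a
   multiple of \<open>G\<close>, and the first transversal has a direction in the plane of
   \<open>c - b\<close> and \<open>G\<close>.\<close>
 proof (cases "al = 0")
  case False
  have "al *\<^sub>R slope w0 = (u - u0) *\<^sub>R G + (- be) *\<^sub>R F" using key by simp
  then show False using no[OF W(2) inV(3,2)] False by blast
 next
  case True
  then have "F = ((u - u0) / be) *\<^sub>R G" using arg_cong[OF key, of "\<lambda>x. x /\<^sub>R be"] be by (simp add: divide_inverse mult.commute)
  then have "l0 *\<^sub>R slope w0 = 1 *\<^sub>R (c - b) + (u0 - t0 * ((u - u0) / be)) *\<^sub>R G" unfolding 0(8) by (simp add: algebra_simps)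
  then show False using no[OF W(2) inV(5,3)] 0(5) by blast
 qed
qed

definition differences :: "'v::ab_group_add set \<Rightarrow> 'v set" where
 "differences V = (\<lambda>(x, y). x - y) ` (V \<times> V)"

lemma differencesI: "x \<in> V \<Longrightarrow> y \<in> V \<Longrightarrow> x - y \<in> differences V"
 unfolding differences_def by (rule image_eqI[of _ _ "(x, y)"]) simp_all

text \<open>Only pairwise disjoint edges are listed: points on edges with a common vertex get equal
  projections only for directions in \<open>slopes_in_planes\<close>.\<close>

definition bad_shears :: "space set set \<Rightarrow> plane set" where
 "bad_shears K = (\<Union>(e, f, g)\<in>{(e, f, g) \<in> K \<times> K \<times> K. e \<inter> f = {} \<and> f \<inter> g = {} \<and> e \<inter> g = {}}.
   triple_shadow (conv e) (conv f) (conv g))"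

text \<open>\<open>triple_shadow_nowhere\<close> speaks only of open sets that avoid the slopes in
  planes. Each triple is therefore joined with the set of these slopes before the union is
  taken.\<close>

lemma nowhere_dense_bad:
 assumes K: "polygonal_link K" and V: "finite V" "\<Union>K \<subseteq> V"
 shows "nowhere_dense_closed (bad_shears K \<union> slopes_in_planes (differences V))"
proof -
 let ?S = "slopes_in_planes (differences V)"
 let ?I = "{(e, f, g) \<in> K \<times> K \<times> K. e \<inter> f = {} \<and> f \<inter> g = {} \<and> e \<inter> g = {}}"
 let ?b = "\<lambda>(e, f, g). triple_shadow (conv e) (conv f) (conv g) \<union> ?S"
 have fin: "finite (differences V)" using V(1) by (simp add: differences_def)
 note S = nowhere_dense_slopes[OF fin, unfolded nowhere_dense_closed_def]
 have "nowhere_dense_closed (\<Union>i\<in>?I. ?b i)"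
 proof (rule nowhere_dense_closed_Union)
  show "finite ?I" by (rule finite_subset[of _ "K \<times> K \<times> K"]) (use finite_link[OF K] in auto)
  fix i assume i: "i \<in> ?I"
  then obtain e f g where efg: "i = (e, f, g)" "e \<in> K" "f \<in> K" "g \<in> K" "e \<inter> f = {}" "f \<inter> g = {}" "e \<inter> g = {}" by blast
  obtain a a' where a: "e = {a, a'}" "a \<noteq> a'" "conv e = seg a a'" by (rule edgeE[OF K efg(2)])
  obtain b b' where b: "f = {b, b'}" "b \<noteq> b'" "conv f = seg b b'" by (rule edgeE[OF K efg(3)])
  obtain c c' where c: "g = {c, c'}" "c \<noteq> c'" "conv g = seg c c'" by (rule edgeE[OF K efg(4)])
  have ne: "e \<noteq> f" "f \<noteq> g" "e \<noteq> g" using efg(5-7) a(1) b(1) by blast+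
  have dj: "seg a a' \<inter> seg b b' = {}" "seg b b' \<inter> seg c c' = {}" "seg a a' \<inter> seg c c' = {}"
   using edges_meet[OF K efg(2,3) ne(1)] edges_meet[OF K efg(3,4) ne(2)] edges_meet[OF K efg(2,4) ne(3)] efg(5-7) unfolding a(3) b(3) c(3) by simp_all
  let ?T = "triple_shadow (seg a a') (seg b b') (seg c c')"
  have cl: "closed ?T" by (intro closed_triple_shadow compact_segment)
  have "{a, a', b, b', c, c'} \<subseteq> V" using efg(2-4) a(1) b(1) c(1) V(2) by blast
  then have sub: "(\<lambda>(x, y). x - y) ` ({a, a', b, b', c, c'} \<times> {a, a', b, b', c, c'}) \<subseteq> differences V"
   unfolding differences_def by (intro image_mono Sigma_mono)
  have "interior (?T \<union> ?S) = {}"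
  proof (rule ccontr)
   assume n: "interior (?T \<union> ?S) \<noteq> {}"
   let ?W = "interior (?T \<union> ?S) - ?S"
   have "\<not> interior (?T \<union> ?S) \<subseteq> ?S" using S n interior_maximal[OF _ open_interior] by blast
   then obtain w0 where w0: "w0 \<in> ?W" by blast
   have "open ?W" using S by (intro open_Diff open_interior) simp
   moreover have "?W \<subseteq> ?T" using interior_subset by blast
   ultimately show False using triple_shadow_nowhere[OF fin sub b(2) dj, of ?W w0] w0 by blast
  qed
  then show "nowhere_dense_closed (?b i)" using cl S by (simp add: nowhere_dense_closed_def efg(1) a(3) b(3) c(3) closed_Un)
 qed
 then have "nowhere_dense_closed (\<Union>i\<in>?I \<union> ?I. ?b i) \<and> nowhere_dense_closed ?S" using nowhere_dense_slopes[OF fin] by simp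
 moreover have "bad_shears K \<union> ?S = (\<Union>i\<in>?I. ?b i) \<union> ?S" unfolding bad_shears_def by blast
 ultimately show ?thesis unfolding nowhere_dense_closed_def by (simp add: closed_Un interior_closed_Un_empty_interior)
qed

lemma edges_at_vertex_shadow:
 assumes v: "v \<in> V" "a \<in> V" "b \<in> V" and w: "w \<notin> slopes_in_planes (differences V)"
  and p: "p \<in> seg v a" "q \<in> seg v b" "fst (shear w p) = fst (shear w q)"
 shows "p = q"
proof (rule ccontr)
 assume "p \<noteq> q"
 then obtain k where k: "k \<noteq> 0" "k *\<^sub>R slope w = q - p" using same_shadow[OF p(3)] by metis
 obtain s t where "p = v + s *\<^sub>R (a - v)" "q = v + t *\<^sub>R (b - v)" using closed_segment_paramE[OF p(1)] closed_segment_paramE[OF p(2)] by metis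
 then have "k *\<^sub>R slope w = t *\<^sub>R (b - v) + (- s) *\<^sub>R (a - v)" unfolding k(2) by simp
 then show False using slopes_in_planesI[OF differencesI[OF v(3,1)] differencesI[OF v(2,1)] _ k(1)] w by blast
qed

text \<open>A vertex and another point with equal projections would give a direction in the plane
  spanned by the edge of that point and a difference of vertices. Three points with one projection
  lie on pairwise disjoint edges, which \<open>bad_shears\<close> excludes.\<close>

lemma regular_shear:
 assumes K: "polygonal_link K" and V: "\<Union>K \<subseteq> V" and w: "w \<notin> bad_shears K" "w \<notin> slopes_in_planes (differences V)"
 shows "regular_position (shear_link w K)"
proof -
 have disjoint: "e \<inter> f = {}" if e: "e \<in> K" "f \<in> K" "p \<in> conv e" "q \<in> conv f" "fst (shear w p) = fst (shear w q)" "p \<noteq> q" for e f p q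
 proof (rule ccontr)
  assume "e \<inter> f \<noteq> {}"
  then obtain v where v: "v \<in> e" "v \<in> f" by blast
  obtain a a' where a: "e = {a, a'}" by (rule edgeE[OF K e(1)])
  obtain b b' where b: "f = {b, b'}" by (rule edgeE[OF K e(2)])
  obtain a0 where a0: "e = {v, a0}" using v(1) a by blast
  obtain b0 where b0: "f = {v, b0}" using v(2) b by blast
  have "v \<in> V" "a0 \<in> V" "b0 \<in> V" using V e(1,2) a0 b0 by blast+
  from edges_at_vertex_shadow[OF this w(2) _ _ e(5)] show False using e(3,4,6) unfolding a0 b0 edge_hull by blast
 qed
 show ?thesis unfolding regular_position_def edge_union_shear
 proof (intro conjI ballI impI)
  fix v p assume "v \<in> \<Union>(shear_link w K)" "p \<in> shear w ` edge_union K" and eq: "fst p = fst v"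
  then obtain v0 p0 where vp: "v = shear w v0" "v0 \<in> \<Union>K" "p = shear w p0" "p0 \<in> edge_union K" unfolding shear_link_def by blast
  obtain f where f: "f \<in> K" "p0 \<in> conv f" using vp(4) by (rule edge_unionE)
  obtain q r where q: "f = {q, r}" "conv f = seg q r" by (rule edgeE[OF K f(1)])
  have in_V: "v0 \<in> V" "q \<in> V" "r \<in> V" using V vp(2) f(1) q(1) by blast+
  have sh: "fst (shear w v0) = fst (shear w p0)" using eq vp by simp
  have "v0 = p0"
  proof (rule ccontr)
   assume "v0 \<noteq> p0"
   then obtain k where k: "k \<noteq> 0" "k *\<^sub>R slope w = p0 - v0" using same_shadow[OF sh] by metis
   obtain t where "p0 = q + t *\<^sub>R (r - q)" using closed_segment_paramE f(2) q(2) by metis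
   then have "k *\<^sub>R slope w = 1 *\<^sub>R (q - v0) + t *\<^sub>R (r - q)" unfolding k(2) by simp
   then show False using slopes_in_planesI[OF differencesI[OF in_V(2,1)] differencesI[OF in_V(3,2)] _ k(1)] w(2) by blast
  qed
  then show "p = v" using vp by simp
 next
  fix p q r assume "p \<in> shear w ` edge_union K" "q \<in> shear w ` edge_union K" "r \<in> shear w ` edge_union K" and eq: "fst p = fst q \<and> fst q = fst r"
  then obtain p0 q0 r0 where 0: "p = shear w p0" "p0 \<in> edge_union K" "q = shear w q0" "q0 \<in> edge_union K" "r = shear w r0" "r0 \<in> edge_union K" by blast
  obtain e where e: "e \<in> K" "p0 \<in> conv e" using 0(2) by (rule edge_unionE)
  obtain f where f: "f \<in> K" "q0 \<in> conv f" using 0(4) by (rule edge_unionE)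
  obtain g where g: "g \<in> K" "r0 \<in> conv g" using 0(6) by (rule edge_unionE)
  have sh: "fst (shear w p0) = fst (shear w q0)" "fst (shear w q0) = fst (shear w r0)" using eq 0 by simp_all
  show "p = q \<or> q = r \<or> p = r"
  proof (rule ccontr)
   assume "\<not> (p = q \<or> q = r \<or> p = r)"
   then have n: "p0 \<noteq> q0" "q0 \<noteq> r0" "p0 \<noteq> r0" using 0 by blast+
   have "e \<inter> f = {}" "f \<inter> g = {}" "e \<inter> g = {}"
    using disjoint[OF e(1) f(1) e(2) f(2) sh(1) n(1)] disjoint[OF f(1) g(1) f(2) g(2) sh(2) n(2)]
     disjoint[OF e(1) g(1) e(2) g(2) trans[OF sh] n(3)] .
   moreover have "w \<in> triple_shadow (conv e) (conv f) (conv g)"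
    unfolding triple_shadow_def using e(2) f(2) g(2) sh by blast
   ultimately show False using w(1) e(1) f(1) g(1) unfolding bad_shears_def by blast
  qed
 qed
qed

text \<open>If the sheared triangle projected to a line, a point of the line through
  \<open>a\<close> and \<open>b\<close> would have the same projection as \<open>c\<close>, and the
  direction would lie in the plane of the triangle.\<close>

lemma noncollinear_shear:
 assumes v: "a \<in> V" "b \<in> V" "c \<in> V" and nc: "\<not> collinear {a, b, c}" and w: "w \<notin> slopes_in_planes (differences V)"
 shows "det2 (fst (shear w b) - fst (shear w a)) (fst (shear w c) - fst (shear w a)) \<noteq> 0"
proof
 assume d: "det2 (fst (shear w b) - fst (shear w a)) (fst (shear w c) - fst (shear w a)) = 0"
 have ab: "b \<noteq> a" using nc by auto
 have n: "fst (shear w b) - fst (shear w a) \<noteq> 0" using edges_at_vertex_shadow[OF v(1,1,2) w, of a b] ab by auto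
 obtain m where m: "fst (shear w c) - fst (shear w a) = m *\<^sub>R (fst (shear w b) - fst (shear w a))" by (rule det2_zeroE[OF d n])
 let ?c = "a + m *\<^sub>R (b - a)"
 have "fst (shear w ?c) = fst (shear w c)" using m by (simp add: shear_def algebra_simps)
 moreover have "?c \<noteq> c"
 proof
  assume "?c = c"
  then have "collinear {a, b, c}" by (subst insert_commute, subst collinear_3) (auto simp: collinear_lemma intro!: exI[of _ m])
  then show False using nc by blast
 qed
 ultimately obtain k where k: "k \<noteq> 0" "k *\<^sub>R slope w = c - ?c" using same_shadow by metis
 then have "k *\<^sub>R slope w = 1 *\<^sub>R (c - a) + (- m) *\<^sub>R (b - a)" by simp
 then show False using slopes_in_planesI[OF differencesI[OF v(3,1)] differencesI[OF v(2,1)] _ k(1)] w by blast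
qed

text \<open>Noncollinearity is demanded for the vertices of the whole family at once, so that it
  covers the triangles of all moves between its members.\<close>

definition generic_for :: "space set set set \<Rightarrow> plane \<Rightarrow> bool" where
 "generic_for \<K> w \<longleftrightarrow> (\<forall>K\<in>\<K>. regular_position (shear_link w K)) \<and>
   (\<forall>a b c. {a, b, c} \<subseteq> \<Union>(\<Union>\<K>) \<longrightarrow> \<not> collinear {a, b, c} \<longrightarrow>
    det2 (fst (shear w b) - fst (shear w a)) (fst (shear w c) - fst (shear w a)) \<noteq> 0)"

lemma generic_for_mono:
 assumes "\<L> \<subseteq> \<K>" "generic_for \<K> w" shows "generic_for \<L> w"
proof -
 have "\<Union>(\<Union>\<L>) \<subseteq> \<Union>(\<Union>\<K>)" using assms(1) by blast
 then show ?thesis using assms unfolding generic_for_def by (meson subset_iff subset_trans)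
qed

text \<open>The bad shears of finitely many links form a closed set with empty interior, which
  cannot contain a ball.\<close>

lemma generic_shear:
 assumes "finite \<K>" "\<And>K. K \<in> \<K> \<Longrightarrow> polygonal_link K" "\<epsilon> > 0"
 obtains w where "norm w < \<epsilon>" "generic_for \<K> w"
proof -
 let ?V = "\<Union>(\<Union>\<K>)" and ?A = "slopes_in_planes (differences (\<Union>(\<Union>\<K>)))"
 have "finite e" if "e \<in> K" "K \<in> \<K>" for e K using edgeE[OF assms(2)[OF that(2)] that(1)] by (metis finite.emptyI finite_insert)
 then have V: "finite ?V" using assms(1) finite_link[OF assms(2)] by (intro finite_Union) blast+
 then have fin: "finite (differences ?V)" by (simp add: differences_def)
 have b: "nowhere_dense_closed (\<Union>K\<in>\<K>. bad_shears K \<union> ?A)"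
  using assms(2) by (intro nowhere_dense_closed_Union[OF assms(1)] nowhere_dense_bad[OF _ V]) blast+
 have "interior ((\<Union>K\<in>\<K>. bad_shears K \<union> ?A) \<union> ?A) = {}"
  using b nowhere_dense_slopes[OF fin] interior_closed_Un_empty_interior unfolding nowhere_dense_closed_def by metis
 then have "\<not> ball 0 \<epsilon> \<subseteq> (\<Union>K\<in>\<K>. bad_shears K \<union> ?A) \<union> ?A"
  using interior_maximal[OF _ open_ball[of "0::plane" \<epsilon>]] centre_in_ball[of "0::plane" \<epsilon>] assms(3) by blast
 then obtain w where w: "w \<in> ball 0 \<epsilon>" "w \<notin> ?A" "\<And>K. K \<in> \<K> \<Longrightarrow> w \<notin> bad_shears K" by blast
 show ?thesis
 proof (rule that)
  show "norm w < \<epsilon>" using w(1) by simp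
  show "generic_for \<K> w" unfolding generic_for_def
  proof (intro conjI ballI allI impI)
   show "regular_position (shear_link w K)" if "K \<in> \<K>" for K
    using regular_shear[OF assms(2)[OF that] _ w(3)[OF that] w(2)] that by blast
  qed (rule noncollinear_shear[OF _ _ _ _ w(2)], blast+)
 qed
qed


section \<open>Stability under small shears\<close>

text \<open>Weaker than being affine: the parametrisation of a segment may be distorted.\<close>

definition segment_map_on :: "('v::real_vector \<Rightarrow> 'w::real_vector) \<Rightarrow> 'v set \<Rightarrow> bool" where
 "segment_map_on G C \<longleftrightarrow> (\<forall>x\<in>C. \<forall>y\<in>C. G ` seg x y = seg (G x) (G y))"

text \<open>Projections and heights may change, but edges, crossings and the over-under relation
  correspond. This is all that a coloring sees, as flatness involves only segments within an edge
  and the points above their under points.\<close>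

definition reparametrisation :: "(space \<Rightarrow> space) \<Rightarrow> space set set \<Rightarrow> space set set \<Rightarrow> bool" where
 "reparametrisation H K K' \<longleftrightarrow> bij_betw H (edge_union K) (edge_union K') \<and>
   (\<forall>e\<in>K. segment_map_on H (conv e) \<and> (\<exists>e'\<in>K'. H ` (conv e) = conv e')) \<and>
   (\<forall>e'\<in>K'. \<exists>e\<in>K. H ` (conv e) = conv e') \<and>
   (\<forall>p\<in>edge_union K. \<forall>q\<in>edge_union K.
    fst (H p) = fst (H q) \<and> snd (H p) < snd (H q) \<longleftrightarrow> fst p = fst q \<and> snd p < snd q)"

lemma reparametrisation_inverse:
 assumes "reparametrisation H K K'"
 shows "reparametrisation (the_inv_into (edge_union K) H) K' K"
proof -
 let ?X = "edge_union K" let ?X' = "edge_union K'" let ?G = "the_inv_into ?X H"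
 have b: "bij_betw H ?X ?X'" and inj: "inj_on H ?X" and im: "H ` ?X = ?X'"
  using assms unfolding reparametrisation_def bij_betw_def by blast+
 have G: "bij_betw ?G ?X' ?X" by (rule bij_betw_the_inv_into[OF b])
 have GH: "?G (H x) = x" if "x \<in> ?X" for x by (rule the_inv_into_f_f[OF inj that])
 have GHim: "?G ` H ` A = A" if "A \<subseteq> ?X" for A
  unfolding image_image using GH that by (simp add: subset_iff image_cong[of A A _ "\<lambda>x. x"] del: split_paired_All)
 have HG: "H (?G y) = y" "?G y \<in> ?X" if "y \<in> ?X'" for y
  using f_the_inv_into_f[OF inj] bij_betwE[OF G] im that by blast+
 have inv_edge: "segment_map_on ?G (conv e') \<and> (\<exists>e\<in>K. ?G ` (conv e') = conv e)" if e': "e' \<in> K'" for e'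
 proof -
  obtain e where e: "e \<in> K" "H ` (conv e) = conv e'" using assms e' unfolding reparametrisation_def by blast
  have sub: "conv e \<subseteq> ?X" by (rule edge_hull_subset[OF e(1)])
  have s: "segment_map_on H (conv e)" using assms e(1) unfolding reparametrisation_def by blast
  have "segment_map_on ?G (conv e')" unfolding segment_map_on_def
  proof (intro ballI)
   fix x' y' assume "x' \<in> conv e'" "y' \<in> conv e'"
   then obtain x y where xy: "x \<in> conv e" "x' = H x" "y \<in> conv e" "y' = H y" unfolding e(2)[symmetric] by blast
   have "seg x y \<subseteq> ?X" using closed_segment_subset[OF xy(1,3) convex_convex_hull] sub by blast
   then have "?G ` seg (H x) (H y) = seg x y"
    using s xy(1,3) GHim unfolding segment_map_on_def by metis
   then show "?G ` seg x' y' = seg (?G x') (?G y')"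
    unfolding xy(2,4) using GH sub xy(1,3) by (metis subsetD)
  qed
  then show ?thesis using GHim[OF sub] e by metis
 qed
 show ?thesis unfolding reparametrisation_def
 proof (intro conjI ballI G)
  show "segment_map_on ?G (conv e')" "\<exists>e\<in>K. ?G ` (conv e') = conv e" if "e' \<in> K'" for e'
   using inv_edge[OF that] by blast+
  show "\<exists>e'\<in>K'. ?G ` (conv e') = conv e" if e: "e \<in> K" for e
  proof -
   obtain e' where "e' \<in> K'" "H ` (conv e) = conv e'" using assms e unfolding reparametrisation_def by blast
   then show ?thesis using GHim[OF edge_hull_subset[OF e]] by metis
  qed
  show "fst (?G p) = fst (?G q) \<and> snd (?G p) < snd (?G q) \<longleftrightarrow> fst p = fst q \<and> snd p < snd q" if p: "p \<in> ?X'" and q: "q \<in> ?X'" for p q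
  proof -
   have "\<forall>p\<in>?X. \<forall>q\<in>?X. fst (H p) = fst (H q) \<and> snd (H p) < snd (H q) \<longleftrightarrow> fst p = fst q \<and> snd p < snd q"
    using assms unfolding reparametrisation_def by blast
   from this[rule_format, OF HG(2)[OF p] HG(2)[OF q]] show ?thesis unfolding HG(1)[OF p] HG(1)[OF q] by (rule sym)
  qed
 qed
qed

lemma reparametrisation_under:
 assumes H: "reparametrisation H K K'" and x: "x \<in> edge_union K"
 shows "H x \<in> under_points K' \<longleftrightarrow> x \<in> under_points K"
proof -
 have im: "H ` edge_union K = edge_union K'" using H unfolding reparametrisation_def bij_betw_def by blast
 have ord: "fst (H p) = fst (H q) \<and> snd (H p) < snd (H q) \<longleftrightarrow> fst p = fst q \<and> snd p < snd q"
  if "p \<in> edge_union K" "q \<in> edge_union K" for p q using H that unfolding reparametrisation_def by blast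
 have "H x \<in> under_points K' \<longleftrightarrow> (\<exists>y\<in>edge_union K. fst (H x) = fst (H y) \<and> snd (H x) < snd (H y))"
  using x unfolding under_points_def im[symmetric] by (simp add: eq_commute[of "fst (H x)"] del: split_paired_Ex)
 also have "\<dots> \<longleftrightarrow> x \<in> under_points K" using x ord[OF x] unfolding under_points_def
  by (simp add: eq_commute[of "fst x"] del: split_paired_Ex)
 finally show ?thesis .
qed

context kei
begin

lemma reparametrised_coloring:
 assumes H: "reparametrisation G K' K" and RK: "regular_position K" "regular_position K'" and c: "c \<in> point_colorings K"
 shows "(\<lambda>x\<in>edge_union K' - under_points K'. c (G x)) \<in> point_colorings K'"
proof -
 let ?c = "\<lambda>x\<in>edge_union K' - under_points K'. c (G x)"
 have b: "bij_betw G (edge_union K') (edge_union K)" using H unfolding reparametrisation_def by blast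
 have G: "G x \<in> edge_union K" if "x \<in> edge_union K'" for x using bij_betwE[OF b] that by blast
 note u = reparametrisation_under[OF H]
 have c_app: "?c x = c (G x)" if "x \<in> edge_union K'" "x \<notin> under_points K'" for x using that by simp
 have "?c \<in> edge_union K' - under_points K' \<rightarrow>\<^sub>E Q"
  using point_coloring_in[OF c] G u by (intro restrict_PiE_iff[THEN iffD2] ballI) blast
 moreover have "flat (conv e') (under_points K') (Some \<circ> ?c \<circ> over K') ?c" if e': "e' \<in> K'" for e'
 proof -
  have e'X: "conv e' \<subseteq> edge_union K'" by (rule edge_hull_subset[OF e'])
  obtain e where e: "e \<in> K" "G ` (conv e') = conv e" and s: "segment_map_on G (conv e')"
   using H e' unfolding reparametrisation_def by blast
  note f = point_coloring_flat[OF c e(1)]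
  have seg: "seg (G x) (G y) \<inter> under_points K = G ` (seg x y \<inter> under_points K')"
   if xy: "x \<in> conv e'" "y \<in> conv e'" for x y
  proof -
   have sub: "seg x y \<subseteq> edge_union K'" using closed_segment_subset[OF xy convex_convex_hull] e'X by blast
   have "seg x y \<inter> G -` under_points K = seg x y \<inter> under_points K'"
    by (rule Set.set_eqI, unfold Int_iff vimage_eq) (metis u subsetD[OF sub])
   moreover have "seg (G x) (G y) = G ` seg x y" by (rule s[unfolded segment_map_on_def, rule_format, OF xy, symmetric])
   moreover have "G ` A \<inter> B = G ` (A \<inter> G -` B)" for A B by blast
   ultimately show ?thesis by metis
  qed
  have in_e: "G x \<in> conv e" if "x \<in> conv e'" for x using e(2) that by blast
  show ?thesis
  proof (rule flatI)
   fix x assume x: "x \<in> conv e'" "x \<notin> under_points K'"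
   have X: "x \<in> edge_union K'" using e'X x(1) by blast
   then show "?c x \<in> Q" using point_coloring_in[OF c G[OF X]] u[OF X] x by simp
  next
   fix x y assume xy: "x \<in> conv e'" "x \<notin> under_points K'" "y \<in> conv e'" "y \<notin> under_points K'"
    and d: "seg x y \<inter> under_points K' = {}"
   have "c (G y) = c (G x)" by (rule flat_const[OF f in_e[OF xy(1)] in_e[OF xy(3)]]) (simp add: seg[OF xy(1,3)] d)
   then show "?c y = ?c x" using c_app e'X xy by (metis subsetD)
  next
   fix x y s q assume xy: "x \<in> conv e'" "x \<notin> under_points K'" "y \<in> conv e'" "y \<notin> under_points K'"
    and d: "seg x y \<inter> under_points K' = {s}" and q: "(Some \<circ> ?c \<circ> over K') s = Some q"
   have sU: "s \<in> under_points K'" using d by blast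
   obtain v where v: "over K' s = v" "v \<in> edge_union K'" "v \<notin> under_points K'" "fst v = fst s" "snd s < snd v" "s \<in> edge_union K'"
    by (rule under_pointE[OF RK(2) sU])
   have "\<forall>p\<in>edge_union K'. \<forall>q\<in>edge_union K'. fst (G p) = fst (G q) \<and> snd (G p) < snd (G q) \<longleftrightarrow> fst p = fst q \<and> snd p < snd q"
    using H unfolding reparametrisation_def by blast
   from this[rule_format, OF v(6,2)] have "fst (G s) = fst (G v) \<and> snd (G s) < snd (G v)" using v(4,5) by simp
   then have "over K (G s) = G v" using over_eq[OF RK(1) G[OF v(6)] G[OF v(2)]] by simp
   moreover have "q = c (G v)" using q v(1) c_app[OF v(2,3)] by simp
   ultimately have k: "(Some \<circ> c \<circ> over K) (G s) = Some q" by simp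
   have X: "x \<in> edge_union K'" "y \<in> edge_union K'" using e'X xy by blast+
   have "seg (G x) (G y) \<inter> under_points K = {G s}" unfolding seg[OF xy(1,3)] d by simp
   from flat_cross[OF f in_e[OF xy(1)] _ in_e[OF xy(3)] _ this k] have "c (G y) = c (G x) \<rhd> q"
    unfolding u[OF X(1)] u[OF X(2)] using xy(2,4) by blast
   then show "?c y = ?c x \<rhd> q" unfolding c_app[OF X(1) xy(2)] c_app[OF X(2) xy(4)] .
  qed
 qed
 ultimately show ?thesis unfolding point_colorings_def by blast
qed

text \<open>Composition with the map and with its inverse are mutually inverse bijections;
  recoloring acts on the values and so commutes with them.\<close>

lemma reparametrisation_iso:
 assumes H: "reparametrisation H K K'" and RK: "regular_position K" "regular_position K'"
 shows "coloring_iso K K'"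
proof -
 let ?X = "edge_union K" and ?U = "under_points K" and ?X' = "edge_union K'" and ?U' = "under_points K'"
 let ?G = "the_inv_into ?X H"
 note G = reparametrisation_inverse[OF H]
 let ?\<Phi> = "\<lambda>c. \<lambda>x\<in>?X' - ?U'. c (?G x)" and ?\<Psi> = "\<lambda>c. \<lambda>x\<in>?X - ?U. c (H x)"
 have b: "bij_betw H ?X ?X'" and inj: "inj_on H ?X" and im: "H ` ?X = ?X'"
  using H unfolding reparametrisation_def bij_betw_def by blast+
 have GH: "?G (H x) = x" if "x \<in> ?X" for x by (rule the_inv_into_f_f[OF inj that])
 have HG: "H (?G y) = y" if "y \<in> ?X'" for y using f_the_inv_into_f[OF inj] im that by blast
 have HX: "H x \<in> ?X' - ?U'" if "x \<in> ?X - ?U" for x using reparametrisation_under[OF H] im that by blast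
 have GX: "?G y \<in> ?X - ?U" if "y \<in> ?X' - ?U'" for y
 proof -
  have "?G y \<in> ?X" using bij_betwE[OF bij_betw_the_inv_into[OF b]] that by blast
  then show ?thesis using reparametrisation_under[OF G, of y] that by blast
 qed
 show ?thesis unfolding coloring_iso_def
 proof (intro exI[of _ ?\<Phi>] conjI ballI allI impI)
  show "bij_betw ?\<Phi> (point_colorings K) (point_colorings K')"
  proof (rule bij_betw_byWitness[where f' = ?\<Psi>])
   show "\<forall>c\<in>point_colorings K. ?\<Psi> (?\<Phi> c) = c"
   proof
    fix c assume "c \<in> point_colorings K"
    then have "c \<in> extensional (?X - ?U)" unfolding point_colorings_def PiE_def by blast
    then show "?\<Psi> (?\<Phi> c) = c" by (rule extensionalityI[rotated]) (use HX GH in \<open>simp_all del: split_paired_All\<close>)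
   qed
   show "\<forall>c\<in>point_colorings K'. ?\<Phi> (?\<Psi> c) = c"
   proof
    fix c assume "c \<in> point_colorings K'"
    then have "c \<in> extensional (?X' - ?U')" unfolding point_colorings_def PiE_def by blast
    then show "?\<Phi> (?\<Psi> c) = c" by (rule extensionalityI[rotated]) (use GX HG in \<open>simp_all del: split_paired_All\<close>)
   qed
  qed (use reparametrised_coloring[OF H RK(2,1)] reparametrised_coloring[OF G RK] in blast)+
  show "?\<Phi> (recolor K h c) = recolor K' h (?\<Phi> c)" for c h
   unfolding recolor_def by (rule restrict_ext) (use GX in simp)
 qed
qed

end

lemma finite_uniform:
 assumes "finite I" "\<And>i. i \<in> I \<Longrightarrow> \<exists>\<delta>>0. P i \<delta>" "\<And>i \<delta> \<epsilon>. i \<in> I \<Longrightarrow> P i \<delta> \<Longrightarrow> 0 < \<epsilon> \<Longrightarrow> \<epsilon> \<le> \<delta> \<Longrightarrow> P i \<epsilon>"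
 shows "\<exists>\<delta>>0::real. \<forall>i\<in>I. P i \<delta>"
 using assms
proof (induction I rule: finite_induct)
 case empty
 then show ?case by (intro exI[of _ 1]) simp
next
 case (insert i I)
 obtain d where d: "d > 0" "\<forall>i\<in>I. P i d" using insert.IH insert.prems by (metis insertI2)
 obtain e where e: "e > 0" "P i e" using insert.prems(1) by blast
 have "\<forall>j\<in>insert i I. P j (min d e)"
 proof
  fix j assume j: "j \<in> insert i I"
  have m: "0 < min d e" "min d e \<le> d" "min d e \<le> e" using d(1) e(1) by simp_all
  show "P j (min d e)"
   using insert.prems(2)[OF j _ m(1,3)] insert.prems(2)[OF j _ m(1,2)] d(2) e(2) j by blast
 qed
 then show ?case using d(1) e(1) by (intro exI[of _ "min d e"]) simp
qed

text \<open>A bump function at \<open>u\<close> of height 1, supported within radius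
  \<open>\<delta>\<close> and Lipschitz with constant \<open>1 / \<delta>\<close>.\<close>

definition tent :: "real \<Rightarrow> 'v::metric_space \<Rightarrow> 'v \<Rightarrow> real" where
 "tent \<delta> u x = max 0 (1 - dist x u / \<delta>)"

lemma tent_far: "\<delta> > 0 \<Longrightarrow> dist u x \<ge> \<delta> \<Longrightarrow> tent \<delta> u x = 0"
 by (simp add: tent_def dist_commute field_simps)

lemma tent_centre: "tent \<delta> u u = 1"
 by (simp add: tent_def)

lemma tent_lipschitz:
 assumes "\<delta> > 0" shows "\<bar>tent \<delta> u x - tent \<delta> u y\<bar> \<le> dist x y / \<delta>"
proof -
 have "\<bar>dist x u / \<delta> - dist y u / \<delta>\<bar> = \<bar>dist x u - dist y u\<bar> / \<delta>" using assms by (simp add: abs_divide flip: diff_divide_distrib)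
 also have "\<dots> \<le> dist x y / \<delta>" using abs_dist_diff_le[of x u y] assms by (simp add: divide_right_mono dist_commute)
 finally show ?thesis unfolding tent_def by linarith
qed

text \<open>\<open>h\<close> differs from the identity by a map with Lipschitz constant 1/2, so it
  is monotone and continuous, and the intermediate value theorem applies.\<close>

lemma expanding_image:
 fixes h :: "real \<Rightarrow> real"
 assumes h: "\<And>s t. 0 \<le> s \<Longrightarrow> s \<le> t \<Longrightarrow> t \<le> 1 \<Longrightarrow> \<bar>(h t - h s) - (t - s)\<bar> \<le> (t - s) / 2" and st: "0 \<le> s" "s \<le> t" "t \<le> 1"
 shows "h s \<le> h t" "h ` {s..t} = {h s..h t}"
proof -
 show st': "h s \<le> h t" using abs_le_D2[OF h[OF st]] st(2) by (simp add: field_simps)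
 have m: "h x \<le> h y" "h y - h x \<le> 2 * (y - x)" if "x \<in> {s..t}" "y \<in> {s..t}" "x \<le> y" for x y
  using abs_le_D1[OF h[of x y]] abs_le_D2[OF h[of x y]] that st by (simp_all add: field_simps)
 have "2-lipschitz_on {s..t} h"
 proof (rule lipschitz_onI)
  show "dist (h x) (h y) \<le> 2 * dist x y" if "x \<in> {s..t}" "y \<in> {s..t}" for x y
   using m[of x y] m[of y x] that unfolding dist_real_def by (cases "x \<le> y") simp_all
 qed simp
 then have c: "continuous_on {s..t} h" by (rule lipschitz_on_continuous_on)
 show "h ` {s..t} = {h s..h t}"
 proof
  show "h ` {s..t} \<subseteq> {h s..h t}" using m(1) st by auto
  show "{h s..h t} \<subseteq> h ` {s..t}" using IVT'[OF _ _ st(2) c] by (auto simp: image_iff) force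
 qed
qed

text \<open>The identity is perturbed by a sum of tents that carries each marked point to its
  target. The supports are so small that vertices stay fixed and each edge is moved only within
  itself. The perturbation has Lipschitz constant 1/2, which makes the map injective and monotone
  along edges.\<close>

lemma slide_along_edges:
 assumes K: "polygonal_link K" and N: "finite N" "N \<subseteq> edge_union K" "N \<inter> \<Union>K = {}"
 shows "\<exists>\<eta>>0. \<forall>m. (\<forall>u\<in>N. dist (m u) u < \<eta> \<and> (\<exists>e\<in>K. u \<in> conv e \<and> m u \<in> conv e)) \<longrightarrow>
  (\<exists>\<psi>. inj \<psi> \<and> (\<forall>e\<in>K. segment_map_on \<psi> (conv e) \<and> \<psi> ` (conv e) = conv e) \<and> (\<forall>u\<in>N. \<psi> u = m u))"
proof -
 have "\<exists>\<delta>>0. \<forall>u\<in>N. (\<forall>v\<in>N. dist u v < \<delta> \<longrightarrow> v = u) \<and> (\<forall>e\<in>K. u \<notin> conv e \<longrightarrow> (\<forall>x\<in>conv e. \<delta> \<le> dist u x))"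
 proof (rule finite_uniform[OF N(1)])
  fix u
  obtain d where d: "d > 0" "\<And>v. v \<in> N \<Longrightarrow> dist u v < d \<Longrightarrow> v = u" using isolated_from_finite[OF N(1), of u] by blast
  obtain e where e: "e > 0" "\<And>f x. f \<in> K \<Longrightarrow> x \<in> conv f \<Longrightarrow> dist u x < e \<Longrightarrow> u \<in> conv f"
   using edges_near[OF K subset_refl, of u] by blast
  show "\<exists>\<delta>>0. (\<forall>v\<in>N. dist u v < \<delta> \<longrightarrow> v = u) \<and> (\<forall>e\<in>K. u \<notin> conv e \<longrightarrow> (\<forall>x\<in>conv e. \<delta> \<le> dist u x))"
  proof (intro exI[of _ "min d e"] conjI ballI impI)
   show "0 < min d e" using d(1) e(1) by simp
   show "v = u" if "v \<in> N" "dist u v < min d e" for v using d(2)[OF that(1)] that(2) by simp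
   show "min d e \<le> dist u x" if "f \<in> K" "u \<notin> conv f" "x \<in> conv f" for f x using e(2)[OF that(1,3)] that(2) by (meson min.coboundedI2 not_less)
  qed
 qed (meson order_trans less_le_trans)
 then obtain \<delta> where \<delta>: "\<delta> > 0" and iso: "\<And>u v. u \<in> N \<Longrightarrow> v \<in> N \<Longrightarrow> v \<noteq> u \<Longrightarrow> \<delta> \<le> dist u v"
  and far: "\<And>u e x. u \<in> N \<Longrightarrow> e \<in> K \<Longrightarrow> u \<notin> conv e \<Longrightarrow> x \<in> conv e \<Longrightarrow> \<delta> \<le> dist u x" by (metis not_less)
 \<comment> \<open>Each tent contributes at most \<open>\<eta> / \<delta>\<close> to the Lipschitz
   constant, and there are \<open>card N\<close> of them; the added 1 keeps the denominator positive
   when \<open>N\<close> is empty.\<close>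
 define \<eta> where "\<eta> = \<delta> / (2 * (real (card N) + 1))"
 have \<eta>: "\<eta> > 0" using \<delta> by (simp add: \<eta>_def)
 have N\<eta>: "real (card N) * \<eta> / \<delta> \<le> 1 / 2"
 proof -
  have eq: "real (card N) * \<eta> / \<delta> = real (card N) / (2 * (real (card N) + 1))" using \<delta> by (simp add: \<eta>_def)
  show ?thesis unfolding eq by (simp add: field_simps)
 qed
 have "\<exists>\<psi>. inj \<psi> \<and> (\<forall>e\<in>K. segment_map_on \<psi> (conv e) \<and> \<psi> ` (conv e) = conv e) \<and> (\<forall>u\<in>N. \<psi> u = m u)"
  if m: "\<forall>u\<in>N. dist (m u) u < \<eta> \<and> (\<exists>e\<in>K. u \<in> conv e \<and> m u \<in> conv e)" for m
 proof -
  define T where "T x = (\<Sum>u\<in>N. tent \<delta> u x *\<^sub>R (m u - u))" for x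
  have lip: "norm (T x - T y) \<le> norm (x - y) / 2" for x y
  proof -
   have "norm (T x - T y) \<le> (\<Sum>u\<in>N. norm ((tent \<delta> u x - tent \<delta> u y) *\<^sub>R (m u - u)))"
    unfolding T_def sum_subtractf[symmetric] scaleR_diff_left[symmetric] by (rule norm_sum)
   also have "\<dots> \<le> (\<Sum>u\<in>N. norm (x - y) / \<delta> * \<eta>)"
   proof (rule sum_mono)
    fix u assume "u \<in> N"
    then have "norm (m u - u) \<le> \<eta>" using m by (simp add: dist_norm less_imp_le)
    then show "norm ((tent \<delta> u x - tent \<delta> u y) *\<^sub>R (m u - u)) \<le> norm (x - y) / \<delta> * \<eta>"
     using mult_mono[OF tent_lipschitz[OF \<delta>, of u x y]] \<delta> by (simp add: dist_norm)
   qed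
   also have "\<dots> = norm (x - y) * (real (card N) * \<eta> / \<delta>)" by simp
   also have "\<dots> \<le> norm (x - y) / 2" using mult_left_mono[OF N\<eta> norm_ge_zero[of "x - y"]] by simp
   finally show ?thesis .
  qed
  have vertex: "T v = 0" if v: "v \<in> \<Union>K" for v
   unfolding T_def
  proof (intro sum.neutral ballI)
   fix u assume u: "u \<in> N"
   obtain e where e: "e \<in> K" "v \<in> e" using v by blast
   obtain f where f: "f \<in> K" "f \<noteq> e" "v \<in> f" by (rule vertex_other_edge[OF K e])
   \<comment> \<open>Two edges at \<open>v\<close> share no marked point, so \<open>u\<close> misses
     one of them and is far from \<open>v\<close>.\<close>
   have "\<not> (u \<in> conv e \<and> u \<in> conv f)" using nonvertex_edge_unique[OF K e(1) f(1)] u N(3) f(2) by blast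
   then have fv: "\<delta> \<le> dist u v" using far[OF u e(1) _ hull_inc[OF e(2)]] far[OF u f(1) _ hull_inc[OF f(3)]] by blast
   show "tent \<delta> u v *\<^sub>R (m u - u) = 0" using tent_far[OF \<delta> fv] by simp
  qed
  have centre: "T u = m u - u" if u: "u \<in> N" for u
  proof -
   have "T u = (\<Sum>v\<in>N. if v = u then m u - u else 0)"
    unfolding T_def using iso[OF _ u] by (intro sum.cong refl) (auto simp: tent_centre tent_far[OF \<delta>])
   then show ?thesis using u N(1) by simp
  qed
  define \<psi> where "\<psi> x = x + T x" for x
  have edge: "segment_map_on \<psi> (conv e) \<and> \<psi> ` (conv e) = conv e" if e: "e \<in> K" for e
  proof -
   obtain p q where pq: "e = {p, q}" "p \<noteq> q" "conv e = seg p q" by (rule edgeE[OF K e])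
   define d where "d = q - p"
   have d: "norm d > 0" using pq(2) by (simp add: d_def)
   have hull: "conv e = (\<lambda>t. p + t *\<^sub>R d) ` {0..1}"
    using closed_segment_param[of 0 1 p d] unfolding pq(3) d_def by simp
   \<comment> \<open>Only marked points on this edge contribute here, and each of them is displaced
     along the edge.\<close>
   have along: "\<exists>k. T x = k *\<^sub>R d" if x: "x \<in> conv e" for x
   proof -
    have "T x \<in> span {d}" unfolding T_def
    proof (rule span_sum)
     fix u assume u: "u \<in> N"
     show "tent \<delta> u x *\<^sub>R (m u - u) \<in> span {d}"
     proof (cases "u \<in> conv e")
      case True
      obtain f where f: "f \<in> K" "u \<in> conv f" "m u \<in> conv f" using m u by blast
      have "f = e" using nonvertex_edge_unique[OF K f(1) e _ f(2) True] u N(3) by blast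
      then have "m u \<in> conv e" using f(3) by blast
      then obtain s t where "m u = p + s *\<^sub>R d" "u = p + t *\<^sub>R d" using True unfolding hull by blast
      then have "m u - u = (s - t) *\<^sub>R d" by (simp add: algebra_simps)
      then show ?thesis by (simp add: span_base span_scale)
     next
      case False
      then show ?thesis using tent_far[OF \<delta> far[OF u e False x]] by (simp add: span_zero)
     qed
    qed
    then show ?thesis unfolding span_singleton by blast
   qed
   then obtain k where k: "\<And>x. x \<in> conv e \<Longrightarrow> T x = k x *\<^sub>R d" by metis
   define h where "h t = t + k (p + t *\<^sub>R d)" for t
   have \<psi>h: "\<psi> (p + t *\<^sub>R d) = p + h t *\<^sub>R d" if "t \<in> {0..1}" for t
   proof -
    have "p + t *\<^sub>R d \<in> conv e" unfolding hull using that by (rule imageI)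
    from k[OF this] show ?thesis unfolding \<psi>_def h_def by (simp add: algebra_simps)
   qed
   have "k p = 0" "k q = 0" using k[of p] k[of q] vertex[of p] vertex[of q] e pq d by (auto simp del: split_paired_All)
   then have h01: "h 0 = 0" "h 1 = 1" by (simp_all add: h_def d_def)
   have hh: "\<bar>(h t - h s) - (t - s)\<bar> \<le> (t - s) / 2" if st: "0 \<le> s" "s \<le> t" "t \<le> 1" for s t
   proof -
    have "p + s *\<^sub>R d \<in> conv e" "p + t *\<^sub>R d \<in> conv e" using st unfolding hull by auto
    then have "norm ((h t - h s - (t - s)) *\<^sub>R d) = norm (T (p + t *\<^sub>R d) - T (p + s *\<^sub>R d))"
     using k by (simp add: h_def algebra_simps)
    also have "\<dots> \<le> norm ((t - s) *\<^sub>R d) / 2" using lip[of "p + t *\<^sub>R d" "p + s *\<^sub>R d"] by (simp add: algebra_simps)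
    finally show ?thesis using d st by simp
   qed
   have seg: "\<psi> ` seg (p + s *\<^sub>R d) (p + t *\<^sub>R d) = seg (\<psi> (p + s *\<^sub>R d)) (\<psi> (p + t *\<^sub>R d))"
    if st: "0 \<le> s" "s \<le> t" "t \<le> 1" for s t
   proof -
    have "\<psi> ` seg (p + s *\<^sub>R d) (p + t *\<^sub>R d) = (\<lambda>r. p + r *\<^sub>R d) ` h ` {s..t}"
     unfolding closed_segment_param[OF st(2)] image_image using \<psi>h st by (intro image_cong) auto
    also have "\<dots> = seg (p + h s *\<^sub>R d) (p + h t *\<^sub>R d)"
     using expanding_image[of h, OF hh st] closed_segment_param[of "h s" "h t" p d] by simp
    finally show ?thesis using \<psi>h[of s] \<psi>h[of t] st by simp
   qed
   have "segment_map_on \<psi> (conv e)" unfolding segment_map_on_def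
   proof (intro ballI)
    fix x y assume "x \<in> conv e" "y \<in> conv e"
    then obtain s t where st: "s \<in> {0..1}" "x = p + s *\<^sub>R d" "t \<in> {0..1}" "y = p + t *\<^sub>R d" unfolding hull by blast
    show "\<psi> ` seg x y = seg (\<psi> x) (\<psi> y)"
    proof (cases "s \<le> t")
     case True
     then show ?thesis using seg[of s t] st by simp
    next
     case False
     then show ?thesis
      unfolding closed_segment_commute[of x y] closed_segment_commute[of "\<psi> x" "\<psi> y"] using seg[of t s] st by simp
    qed
   qed
   moreover have "\<psi> ` seg p q = seg p q"
    using seg[of 0 1] \<psi>h[of 0] \<psi>h[of 1] h01 by (simp add: d_def)
   ultimately show ?thesis unfolding pq(3) by blast
  qed
  have "inj \<psi>"
  proof (rule injI)
   fix x y assume "\<psi> x = \<psi> y"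
   then have "T x - T y = y - x" by (simp add: \<psi>_def algebra_simps)
   then show "x = y" using lip[of x y] by (simp add: norm_minus_commute)
  qed
  then show ?thesis using edge centre by (intro exI[of _ \<psi>]) (simp add: \<psi>_def del: split_paired_All)
 qed
 then show ?thesis using \<eta> by blast
qed

lemma shear_zero: "shear 0 x = x"
 by (simp add: shear_def)

text \<open>For small \<open>w\<close> the crossing is found by solving a linear system of two
  equations with Cramer's rule. The determinant is continuous in \<open>w\<close> and nonzero at 0,
  and the right-hand side vanishes at 0, so the solution is small.\<close>

lemma crossing_persists:
 assumes det: "det2 (fst q - fst p) (fst r - fst t) \<noteq> 0"
  and uv: "u \<in> open_segment p q" "v \<in> open_segment t r" "fst u = fst v" and \<eta>: "\<eta> > 0"
 shows "\<exists>\<epsilon>>0. \<forall>w. norm w < \<epsilon> \<longrightarrow> (\<exists>u'\<in>seg p q. \<exists>v'\<in>seg t r.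
  dist u' u < \<eta> \<and> dist v' v < \<eta> \<and> fst (shear w u') = fst (shear w v'))"
proof -
 obtain a where a: "0 < a" "a < 1" "u = p + a *\<^sub>R (q - p)" by (rule open_segment_paramE[OF uv(1)])
 obtain b where b: "0 < b" "b < 1" "v = t + b *\<^sub>R (r - t)" by (rule open_segment_paramE[OF uv(2)])
 define E F k where EFk: "E w = fst (shear w (q - p))" "F w = fst (shear w (r - t))" "k = snd v - snd u" for w
 \<comment> \<open>\<open>x w\<close> and \<open>y w\<close> are the changes of the two edge
   parameters; they solve
   \<open>x w *\<^sub>R E w - y w *\<^sub>R F w = k *\<^sub>R w\<close>.\<close>
 define x where "x w = det2 (k *\<^sub>R w) (F w) / det2 (E w) (F w)" for w
 define y where "y w = det2 (k *\<^sub>R w) (E w) / det2 (E w) (F w)" for w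
 have d0: "det2 (E 0) (F 0) \<noteq> 0" using det by (simp add: EFk shear_zero)
 have c: "isCont E 0" "isCont F 0" unfolding EFk shear_def by (auto intro!: continuous_intros)
 have cd: "isCont (\<lambda>w. det2 (f w) (g w)) 0" if "isCont f 0" "isCont g 0" for f g :: "plane \<Rightarrow> plane"
  unfolding det2_def using that by (intro continuous_intros)
 have ck: "isCont (\<lambda>w. k *\<^sub>R w) (0::plane)" by (intro continuous_intros)
 have xy0: "x 0 = 0" "y 0 = 0" by (simp_all add: x_def y_def det2_def)
 have "isCont x 0" "isCont y 0" unfolding x_def y_def using d0 by (intro isCont_divide cd c ck; simp)+
 then have lim: "x \<midarrow>0\<rightarrow> 0" "y \<midarrow>0\<rightarrow> 0" "(\<lambda>w. det2 (E w) (F w)) \<midarrow>0\<rightarrow> det2 (E 0) (F 0)"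
  using cd[OF c] xy0 unfolding isCont_def by simp_all
 define \<zeta> where "\<zeta> = Min {a, 1 - a, b, 1 - b, \<eta> / (norm (q - p) + 1), \<eta> / (norm (r - t) + 1)}"
 have np: "norm (q - p) + 1 > 0" "norm (r - t) + 1 > 0" using norm_ge_zero add_nonneg_pos zero_less_one by blast+
 have \<zeta>: "\<zeta> > 0" unfolding \<zeta>_def using a b \<eta> np by (simp add: Min_gr_iff)
 have \<zeta>le: "\<zeta> \<le> a" "\<zeta> \<le> 1 - a" "\<zeta> \<le> b" "\<zeta> \<le> 1 - b" "\<zeta> \<le> \<eta> / (norm (q - p) + 1)" "\<zeta> \<le> \<eta> / (norm (r - t) + 1)"
  unfolding \<zeta>_def by (intro Min_le; simp)+
 have "\<forall>\<^sub>F w in at 0. \<bar>x w\<bar> < \<zeta> \<and> \<bar>y w\<bar> < \<zeta> \<and> det2 (E w) (F w) \<noteq> 0"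
  using tendstoD[OF lim(1) \<zeta>] tendstoD[OF lim(2) \<zeta>] tendsto_imp_eventually_ne[OF lim(3) d0]
  by eventually_elim simp
 then obtain \<epsilon> where \<epsilon>: "\<epsilon> > 0" "\<And>w. w \<noteq> 0 \<Longrightarrow> norm w < \<epsilon> \<Longrightarrow> \<bar>x w\<bar> < \<zeta> \<and> \<bar>y w\<bar> < \<zeta> \<and> det2 (E w) (F w) \<noteq> 0"
  unfolding eventually_at by (auto simp: dist_norm)
 have small: "dist (z + (c + x) *\<^sub>R d) (z + c *\<^sub>R d) < \<eta>" if "\<bar>x\<bar> < \<zeta>" "\<zeta> \<le> \<eta> / (norm d + 1)" for x c z and d :: space
 proof -
  have "\<bar>x\<bar> * (norm d + 1) < \<eta>" using less_le_trans[OF that] by (simp add: pos_less_divide_eq add_nonneg_pos)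
  moreover have "dist (z + (c + x) *\<^sub>R d) (z + c *\<^sub>R d) = \<bar>x\<bar> * norm d" by (simp add: dist_norm algebra_simps)
  ultimately show ?thesis by (simp add: distrib_left)
 qed
 show ?thesis
 proof (intro exI[of _ \<epsilon>] conjI allI impI \<epsilon>(1))
  fix w :: plane assume w: "norm w < \<epsilon>"
  have s: "\<bar>x w\<bar> < \<zeta>" "\<bar>y w\<bar> < \<zeta>" "det2 (E w) (F w) \<noteq> 0"
   using \<epsilon>(2)[OF _ w] xy0 \<zeta> d0 by (cases "w = 0"; simp)+
  let ?u = "p + (a + x w) *\<^sub>R (q - p)" and ?v = "t + (b + y w) *\<^sub>R (r - t)"
  have "?u \<in> seg p q" using s(1) \<zeta>le by (intro in_segment_param) linarith+
  moreover have "?v \<in> seg t r" using s(2) \<zeta>le by (intro in_segment_param) linarith+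
  moreover have "dist ?u u < \<eta>" "dist ?v v < \<eta>" unfolding a(3) b(3) by (rule small[OF s(1) \<zeta>le(5)], rule small[OF s(2) \<zeta>le(6)])
  moreover have "fst (shear w ?u) = fst (shear w ?v)"
  proof -
   have cramer: "x w *\<^sub>R E w - y w *\<^sub>R F w = k *\<^sub>R w"
   proof -
    have dx: "det2 (E w) (F w) * x w = det2 (k *\<^sub>R w) (F w)" and dy: "det2 (E w) (F w) * y w = det2 (k *\<^sub>R w) (E w)"
     using s(3) by (simp_all add: x_def y_def)
    have "det2 (E w) (F w) * (x w * fst (E w) - y w * fst (F w)) = det2 (E w) (F w) * (k * fst w)"
     "det2 (E w) (F w) * (x w * snd (E w) - y w * snd (F w)) = det2 (E w) (F w) * (k * snd w)"
     using dx dy unfolding det2_def fst_scaleR snd_scaleR real_scaleR_def by algebra+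
    then show ?thesis using s(3) by (simp add: prod_eq_iff)
   qed
   have "shear w ?u = shear w u + x w *\<^sub>R shear w (q - p)" "shear w ?v = shear w v + y w *\<^sub>R shear w (r - t)"
    unfolding a(3) b(3) by (simp_all add: linear_add[OF linear_shear] linear_scale[OF linear_shear] scaleR_add_left)
   moreover have "fst (shear w v) - fst (shear w u) = k *\<^sub>R w" using uv(3) by (simp add: shear_def EFk(3) algebra_simps)
   ultimately show ?thesis using cramer unfolding EFk(1,2) by (simp add: algebra_simps)
  qed
  ultimately show "\<exists>u'\<in>seg p q. \<exists>v'\<in>seg t r. dist u' u < \<eta> \<and> dist v' v < \<eta> \<and> fst (shear w u') = fst (shear w v')" by blast
 qed
qed

text \<open>The shears for which the shadows meet form a closed set, obtained from
  \<open>triple_shadow\<close> with the second set repeated, and 0 is not among them.\<close>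

lemma disjoint_shadows_persist:
 assumes "compact A" "compact B" "fst ` A \<inter> fst ` B = {}"
 shows "\<exists>\<epsilon>>0. \<forall>w. norm w < \<epsilon> \<longrightarrow> fst ` shear w ` A \<inter> fst ` shear w ` B = {}"
proof -
 let ?S = "triple_shadow A B B"
 have S: "w \<in> ?S \<longleftrightarrow> fst ` shear w ` A \<inter> fst ` shear w ` B \<noteq> {}" for w unfolding triple_shadow_def by blast
 have "open (- ?S)" using closed_triple_shadow[OF assms(1,2,2)] by (rule open_Compl)
 moreover have "0 \<in> - ?S" unfolding Compl_iff S using assms(3) by (simp add: shear_zero)
 ultimately obtain \<epsilon> where "\<epsilon> > 0" "ball 0 \<epsilon> \<subseteq> - ?S" by (metis open_contains_ball)
 then show ?thesis using S by (intro exI[of _ \<epsilon>]) (auto simp: subset_iff)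
qed

lemma crossing_pointsI:
 "u \<in> edge_union K \<Longrightarrow> v \<in> edge_union K \<Longrightarrow> fst u = fst v \<Longrightarrow> u \<noteq> v \<Longrightarrow> u \<in> crossing_points K"
 unfolding crossing_points_def by (rule CollectI, rule conjI, assumption, rule bexI[of _ v]) simp_all

lemma crossing_pointsE:
 assumes "u \<in> crossing_points K"
 obtains v where "u \<in> edge_union K" "v \<in> edge_union K" "fst u = fst v" "u \<noteq> v"
proof -
 obtain v where "u \<in> edge_union K" "v \<in> edge_union K" "fst v = fst u" "v \<noteq> u" using assms unfolding crossing_points_def by blast
 then show ?thesis using that[of v] by simp
qed

text \<open>A small shear moves each crossing a little along the two edges involved and creates none
  between disjoint edges whose projections were disjoint. Sliding every crossing point to its new
  position and then shearing therefore maps one crossing pattern onto the other.\<close>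

lemma shear_reparametrisation:
 assumes K: "polygonal_link K" "regular_position K"
 shows "\<exists>\<epsilon>>0. \<forall>w. norm w < \<epsilon> \<longrightarrow> regular_position (shear_link w K) \<longrightarrow> (\<exists>H. reparametrisation H K (shear_link w K))"
proof -
 let ?X = "edge_union K" and ?N = "crossing_points K"
 have N: "finite ?N" "?N \<subseteq> ?X" "?N \<inter> \<Union>K = {}"
  using finite_crossing_points[OF K] vertex_not_crossing[OF K(2)] unfolding crossing_points_def by blast+
 obtain \<eta>0 where \<eta>0: "\<eta>0 > 0" and slide: "\<And>m. \<forall>u\<in>?N. dist (m u) u < \<eta>0 \<and> (\<exists>e\<in>K. u \<in> conv e \<and> m u \<in> conv e) \<Longrightarrow>
  \<exists>\<psi>. inj \<psi> \<and> (\<forall>e\<in>K. segment_map_on \<psi> (conv e) \<and> \<psi> ` (conv e) = conv e) \<and> (\<forall>u\<in>?N. \<psi> u = m u)"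
  using slide_along_edges[OF K(1) N] by blast
 \<comment> \<open>Twice \<open>\<eta>1\<close> is at most every positive height difference between
   crossing points, so moving both of them by less than \<open>\<eta>1\<close> keeps their
   order.\<close>
 have "\<exists>\<eta>1>0. \<forall>uv\<in>?N \<times> ?N. snd (fst uv) < snd (snd uv) \<longrightarrow> 2 * \<eta>1 \<le> snd (snd uv) - snd (fst uv)"
 proof (rule finite_uniform)
  fix uv :: "space \<times> space"
  show "\<exists>\<eta>1>0. snd (fst uv) < snd (snd uv) \<longrightarrow> 2 * \<eta>1 \<le> snd (snd uv) - snd (fst uv)"
   by (intro exI[of _ "if snd (fst uv) < snd (snd uv) then (snd (snd uv) - snd (fst uv)) / 2 else 1"]) simp
 qed (use N(1) in auto)
 then obtain \<eta>1 where \<eta>1: "\<eta>1 > 0" "\<And>u v. u \<in> ?N \<Longrightarrow> v \<in> ?N \<Longrightarrow> snd u < snd v \<Longrightarrow> 2 * \<eta>1 \<le> snd v - snd u" by fastforce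
 define \<eta> where "\<eta> = min \<eta>0 \<eta>1"
 have \<eta>: "\<eta> > 0" "\<eta> \<le> \<eta>0" "\<eta> \<le> \<eta>1" using \<eta>0 \<eta>1(1) by (simp_all add: \<eta>_def)
 define crosses where "crosses w e f u v u' v' \<longleftrightarrow> u \<in> conv e \<and> v \<in> conv f \<and> fst u = fst v \<and> u \<noteq> v \<and>
  u' \<in> conv e \<and> v' \<in> conv f \<and> dist u' u < \<eta> \<and> dist v' v < \<eta> \<and> fst (shear w u') = fst (shear w v')" for w e f u v u' v'
 \<comment> \<open>A common vertex, paired with itself, would be a second pair with equal
   projections, contrary to \<open>crossing_unique\<close>.\<close>
 have distinct_edges: "e \<inter> f = {}" if R: "polygonal_link L" "regular_position L" and ef: "e \<in> L" "f \<in> L"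
  and c: "u \<in> conv e" "v \<in> conv f" "fst u = fst v" "u \<noteq> v" for L e f u v
 proof (rule ccontr)
  assume "e \<inter> f \<noteq> {}"
  then obtain x where x: "x \<in> conv e" "x \<in> conv f" by (meson hull_inc disjoint_iff)
  from crossing_unique[OF R ef c x refl] c(4) show False by blast
 qed
 define stable where "stable ef \<epsilon> \<longleftrightarrow> (case ef of (e, f) \<Rightarrow> e \<inter> f = {} \<longrightarrow> (\<forall>w. norm w < \<epsilon> \<longrightarrow>
  (if fst ` (conv e) \<inter> fst ` (conv f) = {} then fst ` shear w ` (conv e) \<inter> fst ` shear w ` (conv f) = {}
   else \<exists>u v u' v'. crosses w e f u v u' v')))" for ef \<epsilon>
 have "\<exists>\<epsilon>>0. \<forall>ef\<in>K \<times> K. stable ef \<epsilon>"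
 proof (rule finite_uniform)
  show "finite (K \<times> K)" using finite_link[OF K(1)] by simp
  show "stable ef \<epsilon>'" if "stable ef \<epsilon>" "\<epsilon>' \<le> \<epsilon>" for ef \<epsilon> \<epsilon>'
   using that unfolding stable_def by (cases ef) (simp only: prod.case, meson less_le_trans)
  fix ef assume "ef \<in> K \<times> K"
  then obtain e f where ef: "ef = (e, f)" "e \<in> K" "f \<in> K" by blast
  show "\<exists>\<epsilon>>0. stable ef \<epsilon>"
  proof (cases "fst ` (conv e) \<inter> fst ` (conv f) = {}")
   case True
   then obtain \<epsilon> where "\<epsilon> > 0" "\<forall>w. norm w < \<epsilon> \<longrightarrow> fst ` shear w ` (conv e) \<inter> fst ` shear w ` (conv f) = {}"
    using disjoint_shadows_persist[OF edge_compact[OF K(1) ef(2)] edge_compact[OF K(1) ef(3)]] by blast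
   then show ?thesis using True unfolding stable_def ef(1) by (intro exI[of _ \<epsilon>]) simp
  next
   case False
   have "\<exists>\<epsilon>>0. \<forall>w. norm w < \<epsilon> \<longrightarrow> (\<exists>u v u' v'. crosses w e f u v u' v')" if dj: "e \<inter> f = {}"
   proof -
    obtain u v where uv: "u \<in> conv e" "v \<in> conv f" "fst u = fst v" using False by (blast elim: equalityE)
    have ne: "e \<noteq> f" using dj edgeE[OF K(1) ef(2)] by blast
    have uv_ne: "u \<noteq> v" using edges_meet[OF K(1) ef(2,3) ne] dj uv(1,2) by blast
    obtain p q where pq: "e = {p, q}" "p \<noteq> q" "conv e = seg p q" by (rule edgeE[OF K(1) ef(2)])
    obtain t r where tr: "f = {t, r}" "t \<noteq> r" "conv f = seg t r" by (rule edgeE[OF K(1) ef(3)])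
    have X: "u \<in> ?X" "v \<in> ?X" using uv(1,2) edge_hull_subset[OF ef(2)] edge_hull_subset[OF ef(3)] by blast+
    have nv: "u \<notin> \<Union>K" "v \<notin> \<Union>K" using crossing_nonvertex[OF K(2) X uv(3) uv_ne] crossing_nonvertex[OF K(2) X(2,1) uv(3)[symmetric] uv_ne[symmetric]] .
    have e': "{p, q} \<in> K" "{t, r} \<in> K" using ef(2,3) pq(1) tr(1) by simp_all
    have cs: "u \<in> seg p q" "v \<in> seg t r" using uv(1,2) pq(3) tr(3) by simp_all
    note io = nonvertex_interior[OF K(1) e'(1) cs(1) nv(1)] nonvertex_interior[OF K(1) e'(2) cs(2) nv(2)]
    note det = crossing_transversal[OF K e' cs uv(3) uv_ne]
    from crossing_persists[OF det io uv(3) \<eta>(1)] obtain \<epsilon> where eps: "\<epsilon> > 0"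
     "\<forall>w. norm w < \<epsilon> \<longrightarrow> (\<exists>u'\<in>conv e. \<exists>v'\<in>conv f. dist u' u < \<eta> \<and> dist v' v < \<eta> \<and> fst (shear w u') = fst (shear w v'))"
     unfolding pq(3)[symmetric] tr(3)[symmetric] by blast
    show ?thesis unfolding crosses_def
    proof (intro exI[of _ \<epsilon>] conjI allI impI eps(1))
     fix w :: plane assume w: "norm w < \<epsilon>"
     obtain u' v' where "u' \<in> conv e" "v' \<in> conv f" "dist u' u < \<eta>" "dist v' v < \<eta>" "fst (shear w u') = fst (shear w v')"
      using eps(2)[rule_format, OF w] by blast
     then show "\<exists>u v u' v'. u \<in> conv e \<and> v \<in> conv f \<and> fst u = fst v \<and> u \<noteq> v \<and>
      u' \<in> conv e \<and> v' \<in> conv f \<and> dist u' u < \<eta> \<and> dist v' v < \<eta> \<and> fst (shear w u') = fst (shear w v')"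
      using uv uv_ne by metis
    qed
   qed
   then show ?thesis using False unfolding stable_def ef(1) by (simp only: if_False prod.case) (metis zero_less_one)
  qed
 qed
 then obtain \<epsilon> where \<epsilon>: "\<epsilon> > 0" "\<And>e f. e \<in> K \<Longrightarrow> f \<in> K \<Longrightarrow> stable (e, f) \<epsilon>" by blast
 have cross: "\<exists>u v u' v'. crosses w e f u v u' v'"
  if "e \<in> K" "f \<in> K" "e \<inter> f = {}" "norm w < \<epsilon>" "fst ` (conv e) \<inter> fst ` (conv f) \<noteq> {} \<or> fst ` shear w ` (conv e) \<inter> fst ` shear w ` (conv f) \<noteq> {}" for e f w
 proof -
  have st: "if fst ` (conv e) \<inter> fst ` (conv f) = {} then fst ` shear w ` (conv e) \<inter> fst ` shear w ` (conv f) = {}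
   else \<exists>u v u' v'. crosses w e f u v u' v'"
   using \<epsilon>(2)[OF that(1,2), unfolded stable_def prod.case, rule_format, OF that(3,4)] .
  show ?thesis
  proof (cases "fst ` (conv e) \<inter> fst ` (conv f) = {}")
   case True
   then show ?thesis using st[unfolded if_P[OF True]] that(5) by blast
  qed (use st in \<open>simp only: if_False\<close>)
 qed
 have "\<exists>H. reparametrisation H K (shear_link w K)" if w: "norm w < \<epsilon>" and R: "regular_position (shear_link w K)" for w
 proof -
  let ?K' = "shear_link w K"
  have K': "polygonal_link ?K'" by (rule polygonal_shear[OF K(1)])
  have in_K': "shear w ` e \<in> ?K'" if "e \<in> K" for e using that unfolding shear_link_def by blast
  have unique: "p = u' \<and> q = v'" if ef: "e \<in> K" "f \<in> K" and c: "crosses w e f u v u' v'"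
   and pq: "p \<in> conv e" "q \<in> conv f" "fst (shear w p) = fst (shear w q)" for e f u v u' v' p q
  proof -
   note c' = c[unfolded crosses_def]
   have dj: "e \<inter> f = {}" using distinct_edges[OF K ef] c' by blast
   have "e \<noteq> f" using dj edgeE[OF K(1) ef(1)] by blast
   then have "u' \<noteq> v'" using edges_meet[OF K(1) ef] dj c' by blast
   then have "shear w u' \<noteq> shear w v'" by (simp only: shear_eq_iff not_False_eq_True)
   moreover have "shear w u' \<in> conv (shear w ` e)" "shear w v' \<in> conv (shear w ` f)" "fst (shear w u') = fst (shear w v')"
    "shear w p \<in> conv (shear w ` e)" "shear w q \<in> conv (shear w ` f)" using c' pq(1,2) unfolding hull_shear by blast+
   ultimately have "shear w p = shear w u' \<and> shear w q = shear w v'"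
    using crossing_unique[OF K' R in_K'[OF ef(1)] in_K'[OF ef(2)]] pq(3) by blast
   then show ?thesis by (simp only: shear_eq_iff)
  qed
  have exists: "\<exists>e\<in>K. \<exists>f\<in>K. \<exists>u' v'. crosses w e f u v u' v'" if uv: "u \<in> ?X" "v \<in> ?X" "fst u = fst v" "u \<noteq> v" for u v
  proof -
   obtain e where e: "e \<in> K" "u \<in> conv e" using uv(1) by (rule edge_unionE)
   obtain f where f: "f \<in> K" "v \<in> conv f" using uv(2) by (rule edge_unionE)
   have "e \<inter> f = {}" by (rule distinct_edges[OF K e(1) f(1) e(2) f(2) uv(3,4)])
   moreover have "fst u \<in> fst ` (conv e) \<inter> fst ` (conv f)" using e(2) f(2) uv(3) by (metis IntI imageI)
   ultimately obtain x y x' y' where c: "crosses w e f x y x' y'" using cross[OF e(1) f(1) _ w] by blast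
   have "x = u \<and> y = v" using crossing_unique[OF K e(1) f(1) e(2) f(2) uv(3,4)] c unfolding crosses_def by blast
   then show ?thesis using c e(1) f(1) by blast
  qed
  have sym: "crosses w f e v u v' u'" if "crosses w e f u v u' v'" for e f u v u' v' using that unfolding crosses_def by metis
  \<comment> \<open>The new position of the crossing point \<open>u\<close>. It is well defined:
    regularity of \<open>K\<close> determines the other point and both edges, and regularity of the
    sheared link determines the new pair.\<close>
  define m where "m u = (SOME u'. \<exists>e\<in>K. \<exists>f\<in>K. \<exists>v v'. crosses w e f u v u' v')" for u
  have m_eq: "m u = u'" if ef: "e \<in> K" "f \<in> K" and c: "crosses w e f u v u' v'" for e f u v u' v'
   unfolding m_def
  proof (rule some_equality)
   show "\<exists>e\<in>K. \<exists>f\<in>K. \<exists>v v'. crosses w e f u v u' v'" using ef c by blast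
   fix x assume "\<exists>e\<in>K. \<exists>f\<in>K. \<exists>v v'. crosses w e f u v x v'"
   then obtain e2 f2 v2 x' where c2: "e2 \<in> K" "f2 \<in> K" "crosses w e2 f2 u v2 x x'" by blast
   note d = c[unfolded crosses_def] and d2 = c2(3)[unfolded crosses_def]
   have X: "u \<in> ?X" "v \<in> ?X" "v2 \<in> ?X" using d d2 edge_hull_subset ef c2(2) by blast+
   have v: "v2 = v" using regular_triple[OF K(2) X(2,1,3)] d d2 by metis
   have "u \<notin> \<Union>K" "v \<notin> \<Union>K" using crossing_nonvertex[OF K(2) X(1,2)] crossing_nonvertex[OF K(2) X(2,1)] d by metis+
   then have "e2 = e" "f2 = f" using nonvertex_edge_unique[OF K(1) c2(1) ef(1)] nonvertex_edge_unique[OF K(1) c2(2) ef(2)] d d2 v by blast+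
   then show "x = u'" using unique[OF ef c] d2 by blast
  qed
  have pair: "m u \<in> ?X \<and> fst (shear w (m u)) = fst (shear w (m v)) \<and> dist (m u) u < \<eta> \<and> dist (m v) v < \<eta> \<and> (\<exists>e\<in>K. u \<in> conv e \<and> m u \<in> conv e)"
   if uv: "u \<in> ?X" "v \<in> ?X" "fst u = fst v" "u \<noteq> v" for u v
  proof -
   obtain e f u' v' where c: "e \<in> K" "f \<in> K" "crosses w e f u v u' v'" using exists[OF uv] by blast
   note m = m_eq[OF c] m_eq[OF c(2,1) sym[OF c(3)]]
   show ?thesis using c(3) edge_hull_subset[OF c(1)] c(1) unfolding m crosses_def by blast
  qed
  have "\<forall>u\<in>?N. dist (m u) u < \<eta>0 \<and> (\<exists>e\<in>K. u \<in> conv e \<and> m u \<in> conv e)"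
  proof
   fix u assume "u \<in> ?N"
   then obtain v where "u \<in> ?X" "v \<in> ?X" "fst u = fst v" "u \<noteq> v" by (rule crossing_pointsE)
   from pair[OF this] show "dist (m u) u < \<eta>0 \<and> (\<exists>e\<in>K. u \<in> conv e \<and> m u \<in> conv e)" using \<eta>(2) by (metis less_le_trans)
  qed
  from slide[OF this] obtain \<psi> where \<psi>: "inj \<psi>" "\<And>e. e \<in> K \<Longrightarrow> segment_map_on \<psi> (conv e)"
   "\<And>e. e \<in> K \<Longrightarrow> \<psi> ` (conv e) = conv e" "\<And>u. u \<in> ?N \<Longrightarrow> \<psi> u = m u" by blast
  have forward: "fst (shear w (\<psi> p)) = fst (shear w (\<psi> q)) \<and> snd (\<psi> p) < snd (\<psi> q)"
   if pq: "p \<in> ?X" "q \<in> ?X" "fst p = fst q" "snd p < snd q" for p q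
  proof -
   have ne: "p \<noteq> q" using pq(4) by blast
   note N' = crossing_pointsI[OF pq(1-3) ne] crossing_pointsI[OF pq(2,1) pq(3)[symmetric] ne[symmetric]]
   note P = pair[OF pq(1-3) ne]
   have "\<bar>snd (m p) - snd p\<bar> < \<eta>" "\<bar>snd (m q) - snd q\<bar> < \<eta>"
    using P dist_snd_le[of "m p" p] dist_snd_le[of "m q" q] unfolding dist_real_def by linarith+
   then have "snd (m p) < snd (m q)" using \<eta>1(2)[OF N' pq(4)] \<eta>(3) by linarith
   then show ?thesis using P \<psi>(4)[OF N'(1)] \<psi>(4)[OF N'(2)] by simp
  qed
  \<comment> \<open>A crossing of the sheared link lies on two disjoint edges, whose projections
    already met before the shear; uniqueness identifies it with the image of that earlier
    crossing.\<close>
  have backward: "fst p = fst q \<and> snd p < snd q"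
   if pq: "p \<in> ?X" "q \<in> ?X" and s: "fst (shear w (\<psi> p)) = fst (shear w (\<psi> q))" "snd (\<psi> p) < snd (\<psi> q)" for p q
  proof -
   obtain e where e: "e \<in> K" "p \<in> conv e" using pq(1) by (rule edge_unionE)
   obtain f where f: "f \<in> K" "q \<in> conv f" using pq(2) by (rule edge_unionE)
   have \<psi>in: "\<psi> p \<in> conv e" "\<psi> q \<in> conv f" using \<psi>(3)[OF e(1)] \<psi>(3)[OF f(1)] e(2) f(2) by blast+
   have "\<psi> p \<noteq> \<psi> q" using s(2) by (metis less_irrefl)
   then have "shear w (\<psi> p) \<noteq> shear w (\<psi> q)" by (simp only: shear_eq_iff not_False_eq_True)
   then have "shear w ` e \<inter> shear w ` f = {}"
    using distinct_edges[OF K' R in_K'[OF e(1)] in_K'[OF f(1)] _ _ s(1)] \<psi>in unfolding hull_shear by blast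
   then have dj: "e \<inter> f = {}" by blast
   have "fst ` shear w ` (conv e) \<inter> fst ` shear w ` (conv f) \<noteq> {}" using \<psi>in s(1) by (metis IntI empty_iff imageI)
   then obtain u v u' v' where c: "crosses w e f u v u' v'" using cross[OF e(1) f(1) dj w] by blast
   have c': "u \<in> conv e" "v \<in> conv f" "fst u = fst v" "u \<noteq> v" using c unfolding crosses_def by blast+
   then have X: "u \<in> ?X" "v \<in> ?X" using edge_hull_subset e(1) f(1) by blast+
   note N' = crossing_pointsI[OF X c'(3,4)] crossing_pointsI[OF X(2,1) c'(3)[symmetric] c'(4)[symmetric]]
   have "\<psi> u = \<psi> p" "\<psi> v = \<psi> q"
    using unique[OF e(1) f(1) c \<psi>in s(1)] \<psi>(4)[OF N'(1)] \<psi>(4)[OF N'(2)] m_eq[OF e(1) f(1) c] m_eq[OF f(1) e(1) sym[OF c]] by simp_all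
   then have "u = p" "v = q" using injD[OF \<psi>(1)] by blast+
   then have eq: "fst p = fst q" "p \<noteq> q" using c'(3,4) by simp_all
   then have "snd p < snd q \<or> snd q < snd p" by (metis linorder_neqE_linordered_idom prod_eqI)
   then show ?thesis using forward[OF pq(2,1) eq(1)[symmetric]] s(2) eq(1) by auto
  qed
  have XK: "\<psi> ` ?X = ?X" unfolding edge_union_def image_UN using \<psi>(3) by simp
  have "reparametrisation (shear w \<circ> \<psi>) K ?K'"
   unfolding reparametrisation_def
  proof (intro conjI ballI)
   show "bij_betw (shear w \<circ> \<psi>) ?X (edge_union ?K')"
    unfolding bij_betw_def edge_union_shear image_comp[symmetric] XK
    using inj_on_subset[OF inj_compose[OF inj_shear \<psi>(1)]] by blast
   have im: "(shear w \<circ> \<psi>) ` (conv e) = conv (shear w ` e)" if "e \<in> K" for e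
    unfolding image_comp[symmetric] \<psi>(3)[OF that] hull_shear ..
   show "segment_map_on (shear w \<circ> \<psi>) (conv e)" if e: "e \<in> K" for e
    using \<psi>(2)[OF e] unfolding segment_map_on_def image_comp[symmetric] o_apply
    by (simp add: closed_segment_linear_image[OF linear_shear] del: split_paired_All)
   show "\<exists>e'\<in>?K'. (shear w \<circ> \<psi>) ` (conv e) = conv e'" if "e \<in> K" for e
    using im[OF that] in_K'[OF that] by blast
   show "\<exists>e\<in>K. (shear w \<circ> \<psi>) ` (conv e) = conv e'" if "e' \<in> ?K'" for e'
    using that im unfolding shear_link_def by blast
   show "fst ((shear w \<circ> \<psi>) p) = fst ((shear w \<circ> \<psi>) q) \<and> snd ((shear w \<circ> \<psi>) p) < snd ((shear w \<circ> \<psi>) q) \<longleftrightarrow> fst p = fst q \<and> snd p < snd q"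
    if "p \<in> ?X" "q \<in> ?X" for p q
    unfolding o_apply snd_shear using forward[OF that] backward[OF that] by blast
  qed
  then show ?thesis by blast
 qed
 then show ?thesis using \<epsilon>(1) by blast
qed

context kei
begin

lemma sheared_move_iso:
 assumes tm: "triangle_move K K'" and w: "generic_for {K, K'} w"
 shows "coloring_iso (shear_link w K) (shear_link w K')"
proof -
 let ?s = "shear w"
 obtain a b c where ab: "{a, b} \<in> K" and nc: "\<not> collinear {a, b, c}"
  and hull: "conv {a, b, c} \<inter> edge_union K = seg a b" and K': "K' = (K - {{a, b}}) \<union> {{a, c}, {c, b}}"
  and P: "polygonal_link K" "polygonal_link K'"
  using tm unfolding triangle_move_def by blast
 have R: "regular_position (shear_link w K)" "regular_position (shear_link w K')" using w unfolding generic_for_def by blast+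
 have "{a, b, c} \<subseteq> \<Union>(\<Union>{K, K'})" using ab unfolding K' by blast
 then have d: "det2 (fst (?s b) - fst (?s a)) (fst (?s c) - fst (?s a)) \<noteq> 0" using w nc unfolding generic_for_def by blast
 have ab': "{?s a, ?s b} \<in> shear_link w K" using ab unfolding shear_link_def by (metis image_eqI image_empty image_insert)
 have "inj ((`) ?s)" by (rule injI) (simp only: image_shear_eq_iff)
 then have K'': "shear_link w K' = (shear_link w K - {{?s a, ?s b}}) \<union> {{?s a, ?s c}, {?s c, ?s b}}"
  unfolding K' shear_link_def image_Un by (simp add: image_set_diff)
 have "conv {?s a, ?s b, ?s c} = ?s ` (conv {a, b, c})" using hull_shear[of w "{a, b, c}"] by simp
 then have "conv {?s a, ?s b, ?s c} \<inter> edge_union (shear_link w K) = ?s ` (conv {a, b, c} \<inter> edge_union K)"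
  unfolding edge_union_shear by (simp only: image_Int[OF inj_shear])
 then have hull': "conv {?s a, ?s b, ?s c} \<inter> edge_union (shear_link w K) = seg (?s a) (?s b)"
  unfolding hull by (simp only: closed_segment_linear_image[OF linear_shear])
 show ?thesis by (rule move_iso[OF polygonal_shear[OF P(1)] R(1) polygonal_shear[OF P(2)] R(2) ab' hull' K'' d])
qed

text \<open>The family collects all links of the chain before the shear is chosen, so that one shear
  serves for every move.\<close>

lemma generic_shears_iso:
 assumes "link_equivalent K K'" "polygonal_link K"
 shows "\<exists>\<K>. finite \<K> \<and> K \<in> \<K> \<and> K' \<in> \<K> \<and> (\<forall>L\<in>\<K>. polygonal_link L) \<and>
  (\<forall>w. generic_for \<K> w \<longrightarrow> coloring_iso (shear_link w K) (shear_link w K'))"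
 using assms(1) unfolding link_equivalent_def
proof (induction rule: equivclp_induct)
 case base
 show ?case using assms(2) coloring_iso_refl by (intro exI[of _ "{K}"]) simp
next
 case (step L M)
 obtain \<K> where \<K>: "finite \<K>" "K \<in> \<K>" "L \<in> \<K>" "\<forall>L\<in>\<K>. polygonal_link L"
  "\<And>w. generic_for \<K> w \<Longrightarrow> coloring_iso (shear_link w K) (shear_link w L)" using step.IH by blast
 have M: "polygonal_link M" using step.hyps(2) unfolding triangle_move_def by blast
 have "coloring_iso (shear_link w K) (shear_link w M)" if w: "generic_for (insert M \<K>) w" for w
 proof -
  have 1: "coloring_iso (shear_link w K) (shear_link w L)" by (rule \<K>(5)[OF generic_for_mono[OF _ w]]) blast
  have "{L, M} \<subseteq> insert M \<K>" using \<K>(3) by simp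
  then have g: "generic_for {L, M} w" "generic_for {M, L} w" using generic_for_mono[OF _ w] by (simp_all only: insert_commute)
  have R: "regular_position (shear_link w M)" using w unfolding generic_for_def by blast
  from step.hyps(2) have "coloring_iso (shear_link w L) (shear_link w M)"
  proof
   assume "triangle_move L M"
   then show ?thesis by (rule sheared_move_iso[OF _ g(1)])
  next
   assume "triangle_move M L"
   then show ?thesis by (rule coloring_iso_sym[OF R sheared_move_iso[OF _ g(2)]])
  qed
  then show ?thesis by (rule coloring_iso_trans[OF 1])
 qed
 then show ?case using \<K>(1-4) M by (intro exI[of _ "insert M \<K>"]) simp
qed

text \<open>Only the two end links are known to be regular. They are compared with their sheared
  versions by stability, while the chain is traversed among sheared links.\<close>

lemma equivalent_links_iso:
 assumes "link_equivalent K K'" and K: "polygonal_link K" "regular_position K" and K': "polygonal_link K'" "regular_position K'"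
 shows "coloring_iso K K'"
proof -
 obtain \<K> where \<K>: "finite \<K>" "K \<in> \<K>" "K' \<in> \<K>" "\<And>L. L \<in> \<K> \<Longrightarrow> polygonal_link L"
  "\<And>w. generic_for \<K> w \<Longrightarrow> coloring_iso (shear_link w K) (shear_link w K')" using generic_shears_iso[OF assms(1) K(1)] by blast
 obtain d where d: "d > 0" "\<And>w. norm w < d \<Longrightarrow> regular_position (shear_link w K) \<Longrightarrow> \<exists>H. reparametrisation H K (shear_link w K)"
  using shear_reparametrisation[OF K] by blast
 obtain d' where d': "d' > 0" "\<And>w. norm w < d' \<Longrightarrow> regular_position (shear_link w K') \<Longrightarrow> \<exists>H. reparametrisation H K' (shear_link w K')"
  using shear_reparametrisation[OF K'] by blast
 have m: "min d d' > 0" using d(1) d'(1) by simp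
 obtain w where w: "norm w < min d d'" "generic_for \<K> w" by (rule generic_shear[OF \<K>(1,4) m])
 have R: "regular_position (shear_link w K)" "regular_position (shear_link w K')" using w(2) \<K>(2,3) unfolding generic_for_def by blast+
 have "coloring_iso K (shear_link w K)" using d(2)[OF _ R(1)] w(1) reparametrisation_iso[OF _ K(2) R(1)] by auto
 moreover have "coloring_iso K' (shear_link w K')" using d'(2)[OF _ R(2)] w(1) reparametrisation_iso[OF _ K'(2) R(2)] by auto
 ultimately show ?thesis using \<K>(5)[OF w(2)] coloring_iso_trans coloring_iso_sym[OF K'(2)] by blast
qed

end


section \<open>Diagrams\<close>

lemma starts_alongI:
 assumes x: "x \<in> seg s p" "x \<noteq> s" and A: "seg x s - {s} \<subseteq> A"
 shows "starts_along A s p"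
proof -
 obtain t where t: "0 \<le> t" "t \<le> 1" "x = s + t *\<^sub>R (p - s)" using x(1) by (rule closed_segment_paramE)
 define w where "w = s + (1 / 2) *\<^sub>R (x - s)"
 have "w = s + (t / 2) *\<^sub>R (p - s)" "0 < t" "s \<noteq> p" using t x(2) by (auto simp: w_def simp del: split_paired_All)
 then have "w \<in> open_segment s p" using t unfolding in_segment by (intro conjI exI[of _ "t / 2"]) (simp_all add: algebra_simps)
 moreover have "open_segment s w \<subseteq> A"
 proof
  fix z assume "z \<in> open_segment s w"
  then obtain c where c: "0 < c" "c < 1" "z = s + c *\<^sub>R (w - s)" by (rule open_segment_paramE)
  then have z: "z = s + (c / 2) *\<^sub>R (x - s)" by (simp add: w_def)
  then have "z \<in> seg s x" using c in_segment_param[of "c / 2" s x] by simp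
  moreover have "z \<noteq> s" using z c x(2) by simp
  ultimately show "z \<in> A" using A by (auto simp only: closed_segment_commute)
 qed
 ultimately show ?thesis unfolding starts_along_def by blast
qed

lemma starts_alongE:
 assumes "starts_along A s p"
 obtains y where "y \<in> open_segment p s" "y \<in> A" "seg y s - {s} \<subseteq> A"
proof -
 obtain w where w: "w \<in> open_segment s p" "open_segment s w \<subseteq> A" using assms unfolding starts_along_def by blast
 obtain t where t: "0 < t" "t < 1" "w = s + t *\<^sub>R (p - s)" using w(1) by (rule open_segment_paramE)
 have "w \<noteq> s" using w(1) by (simp add: open_segment_def)
 then have ne: "s \<noteq> p" "s \<noteq> w" using t(3) by auto
 \<comment> \<open>The end point \<open>w\<close> itself need not lie in \<open>A\<close>, so the
   midpoint is used.\<close>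
 define y where "y = s + (1 / 2) *\<^sub>R (w - s)"
 have inA: "s + c *\<^sub>R (w - s) \<in> A" if "0 < c" "c < 1" for c
 proof -
  have "s + c *\<^sub>R (w - s) \<in> open_segment s w"
   unfolding in_segment using that ne(2) by (intro conjI exI[of _ c]) (simp_all add: algebra_simps)
  then show ?thesis using w(2) by blast
 qed
 have "y = s + (t / 2) *\<^sub>R (p - s)" by (simp add: y_def t(3))
 then have "y \<in> open_segment p s"
  unfolding in_segment using ne(1) t(1,2) by (intro conjI exI[of _ "1 - t / 2"]) (simp_all add: algebra_simps)
 moreover have "seg y s - {s} \<subseteq> A"
 proof
  fix z assume z: "z \<in> seg y s - {s}"
  then have "z \<in> seg y s" by blast
  then obtain c where c: "0 \<le> c" "c \<le> 1" "z = y + c *\<^sub>R (s - y)" by (rule closed_segment_paramE)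
  have zs: "z = s + ((1 - c) / 2) *\<^sub>R (w - s)" unfolding c(3) y_def by (simp add: algebra_simps diff_divide_distrib)
  then have "c \<noteq> 1" using z by auto
  then show "z \<in> A" unfolding zs using c(1,2) by (intro inA) simp_all
 qed
 ultimately show ?thesis using that inA[of "1 / 2"] unfolding y_def by simp
qed

text \<open>The two points may occur in either order along the edge; the names of its end points are
  then exchanged.\<close>

lemma segment_sides:
 fixes p q :: "'v::real_vector"
 assumes xy: "x \<in> seg p q" "y \<in> seg p q" and s: "s \<in> seg x y"
 shows "x \<in> seg s p \<and> y \<in> seg s q \<or> x \<in> seg s q \<and> y \<in> seg s p"
proof -
 obtain a where a: "0 \<le> a" "a \<le> 1" "x = p + a *\<^sub>R (q - p)" using xy(1) by (rule closed_segment_paramE)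
 obtain b where b: "0 \<le> b" "b \<le> 1" "y = p + b *\<^sub>R (q - p)" using xy(2) by (rule closed_segment_paramE)
 obtain c where c: "0 \<le> c" "c \<le> 1" "s = x + c *\<^sub>R (y - x)" using s by (rule closed_segment_paramE)
 define r where "r = a + c * (b - a)"
 have r: "s = p + r *\<^sub>R (q - p)" by (simp add: c(3) a(3) b(3) r_def algebra_simps)
 have lo: "seg s p = (\<lambda>t. p + t *\<^sub>R (q - p)) ` {0..r}" if "0 \<le> r"
  using closed_segment_param[OF that, of p "q - p"] by (simp add: r closed_segment_commute)
 have hi: "seg s q = (\<lambda>t. p + t *\<^sub>R (q - p)) ` {r..1}" if "r \<le> 1"
  using closed_segment_param[OF that, of p "q - p"] by (simp add: r)
 show ?thesis
 proof (cases "a \<le> b")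
  case True
  have "0 \<le> c * (b - a)" "c * (b - a) \<le> b - a" using True c mult_left_le_one_le[of "b - a" c] by simp_all
  then have "a \<le> r" "r \<le> b" by (simp_all add: r_def)
  then show ?thesis using a b lo hi by auto
 next
  case False
  have "0 \<le> c * (a - b)" "c * (a - b) \<le> a - b" using False c mult_left_le_one_le[of "a - b" c] by simp_all
  then have "b \<le> r" "r \<le> a" by (simp_all add: r_def algebra_simps)
  then show ?thesis using a b lo hi by auto
 qed
qed

section \<open>Strands, arcs and crossings\<close>

definition strand :: "space set set \<Rightarrow> space \<Rightarrow> space set" where
 "strand K x = connected_component_set (edge_union K - under_points K) x"

lemma strands_eq: "strands K = strand K ` (edge_union K - under_points K)"
 unfolding strands_def components_def strand_def ..

lemma strand_of: "A \<in> strands K \<Longrightarrow> x \<in> A \<Longrightarrow> strand K x = A \<and> x \<in> edge_union K \<and> x \<notin> under_points K"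
 unfolding strands_eq strand_def using connected_component_eq connected_component_subset by (metis (no_types, lifting) DiffE imageE subsetD)

lemma in_strand: "x \<in> edge_union K \<Longrightarrow> x \<notin> under_points K \<Longrightarrow> x \<in> strand K x"
 by (simp add: strand_def)

lemma strand_in: "x \<in> edge_union K \<Longrightarrow> x \<notin> under_points K \<Longrightarrow> strand K x \<in> strands K"
 unfolding strands_eq by blast

lemma segment_in_strand:
 assumes "seg x y \<subseteq> edge_union K - under_points K" shows "y \<in> strand K x"
 unfolding strand_def mem_Collect_eq connected_component_def
 using assms connected_segment(1)[of x y] ends_in_segment[of x y] by blast

text \<open>Two distinct points of the link with the same projection differ in height, and the lower
  one is an under point. Consequently the arcs of the diagram correspond one to one to the
  strands.\<close>

lemma inj_fst_off_under: "inj_on fst (edge_union K - under_points K)"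
proof (rule inj_onI)
 fix x y assume x: "x \<in> edge_union K - under_points K" and y: "y \<in> edge_union K - under_points K" and eq: "fst x = fst y"
 have "\<not> snd x < snd y" "\<not> snd y < snd x" using under_pointI[of x K y] under_pointI[of y K x] x y eq by auto
 then show "x = y" using eq by (simp add: prod_eq_iff)
qed

lemma fst_strand_eq_iff:
 assumes "A \<in> strands K" "B \<in> strands K" shows "fst ` A = fst ` B \<longleftrightarrow> A = B"
 using inj_on_image_eq_iff[OF inj_fst_off_under] assms in_components_subset unfolding strands_def by metis

lemma arcs_diagram: "arcs (diagram_of K) = (\<lambda>A. fst ` A) ` strands K"
 by (simp add: diagram_of_def)

text \<open>The two halves of the segment contain no under point apart from \<open>s\<close>, so
  they lie in the strands of its ends and reach the crossing from the two sides.\<close>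

lemma crossing_over_segment:
 assumes K: "polygonal_link K" "regular_position K" and e: "e \<in> K"
  and x: "x \<in> conv e" "x \<notin> under_points K" and y: "y \<in> conv e" "y \<notin> under_points K"
  and s: "seg x y \<inter> under_points K = {s}"
 shows "(fst s, fst ` strand K x, fst ` strand K (over K s), fst ` strand K y) \<in> crossings (diagram_of K)"
proof -
 let ?X = "edge_union K" and ?U = "under_points K"
 have sU: "s \<in> ?U" "s \<in> seg x y" using s by blast+
 obtain v where v: "over K s = v" "v \<in> ?X" "v \<notin> ?U" "fst v = fst s" "snd s < snd v" "s \<in> ?X"
  by (rule under_pointE[OF K(2) sU(1)])
 have sn: "s \<noteq> x" "s \<noteq> y" using sU(1) x(2) y(2) by blast+
 have xyX: "seg x y \<subseteq> conv e" by (rule closed_segment_subset[OF x(1) y(1) convex_convex_hull])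
 have X: "conv e \<subseteq> ?X" by (rule edge_hull_subset[OF e])
 have arm: "seg z s - {s} \<subseteq> strand K z" if z: "z = x \<or> z = y" for z
 proof
  fix t assume t: "t \<in> seg z s - {s}"
  have zs: "seg z s \<subseteq> seg x y" using z sU(2) ends_in_segment[of x y] by (intro closed_segment_subset) auto
  have nz: "s \<notin> seg z t"
  proof
   assume "s \<in> seg z t"
   moreover have "t \<in> seg z s" "t \<noteq> s" using t by blast+
   ultimately show False using between_antisym[of t z s] by (metis between_mem_segment between_commute)
  qed
  have sub: "seg z t \<subseteq> seg x y" using zs t ends_in_segment[of z s] closed_segment_subset[of z "seg z s" t] by blast
  have "r \<in> ?X - ?U" if r: "r \<in> seg z t" for r
  proof -
   have rx: "r \<in> seg x y" using sub r by blast
   have "r \<notin> ?U"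
   proof
    assume "r \<in> ?U"
    then have "r \<in> {s}" using rx unfolding s[symmetric] by blast
    then show False using nz r by blast
   qed
   then show ?thesis using rx xyX X by blast
  qed
  then have "seg z t \<subseteq> ?X - ?U" by blast
  then show "t \<in> strand K z" by (rule segment_in_strand)
 qed
 obtain p q where pq: "e = {p, q}" "p \<noteq> q" "conv e = seg p q" by (rule edgeE[OF K(1) e])
 have "{p, q} = e" "{q, p} = e" using pq(1) by blast+
 then have "\<exists>p q. {p, q} = e \<and> x \<in> seg s p \<and> y \<in> seg s q"
  using segment_sides[OF x(1)[unfolded pq(3)] y(1)[unfolded pq(3)] sU(2)] by blast
 then obtain p q where pq: "{p, q} = e" "x \<in> seg s p" "y \<in> seg s q" by blast
 have "s \<in> seg p q" using sU(2) xyX unfolding pq(1)[symmetric] edge_hull by blast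
 moreover have "s \<notin> \<Union>K" using vertex_not_crossing[OF K(2)] under_points_crossing sU(1) by blast
 ultimately have so: "s \<in> open_segment p q" using nonvertex_interior[OF K(1)] pq(1) e by blast
 have "starts_along (strand K x) s p" "starts_along (strand K y) s q"
  using starts_alongI[OF pq(2) sn(1)[symmetric] arm] starts_alongI[OF pq(3) sn(2)[symmetric] arm] by blast+
 moreover have "strand K x \<in> strands K" "strand K y \<in> strands K" "strand K v \<in> strands K" "v \<in> strand K v"
  using X x y v(2,3) by (auto intro: strand_in in_strand)
 ultimately show ?thesis unfolding diagram_of_def v(1) using v(2,4-6) so e pq(1) by (simp del: split_paired_Ex) blast
qed

text \<open>Converse of \<open>crossing_over_segment\<close>: the initial pieces of the two
  under-arcs along the edge are joined to one segment through the under point.\<close>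

lemma segment_under_crossing:
 assumes "(z, a, b, d) \<in> crossings (diagram_of K)"
 obtains e x y u v where "e \<in> K" "x \<in> conv e" "x \<notin> under_points K" "y \<in> conv e" "y \<notin> under_points K"
  "seg x y \<inter> under_points K = {u}" "u \<in> edge_union K" "v \<in> edge_union K" "fst v = fst u" "snd u < snd v" "v \<notin> under_points K"
  "a = fst ` strand K x" "b = fst ` strand K v" "d = fst ` strand K y"
proof -
 obtain u v p q A B C where c: "a = fst ` A" "b = fst ` B" "d = fst ` C" "u \<in> edge_union K" "v \<in> edge_union K" "fst v = fst u" "snd u < snd v"
  "{p, q} \<in> K" "u \<in> open_segment p q" "A \<in> strands K" "B \<in> strands K" "C \<in> strands K" "v \<in> B" "starts_along A u p" "starts_along C u q"
  using assms unfolding diagram_of_def by (simp del: split_paired_Ex) blast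
 obtain x where x: "x \<in> open_segment p u" "x \<in> A" "seg x u - {u} \<subseteq> A" by (rule starts_alongE[OF c(14)])
 obtain y where y: "y \<in> open_segment q u" "y \<in> C" "seg y u - {u} \<subseteq> C" by (rule starts_alongE[OF c(15)])
 note sg = segment_points_around[OF c(9) x(1) y(1)]
 note A = strand_of[OF c(10)] and B = strand_of[OF c(11) c(13)] and C = strand_of[OF c(12)]
 have "seg x y = seg x u \<union> seg y u"
  unfolding closed_segment_commute[of y u] using Un_closed_segment[OF sg(5)] by simp
 moreover have "u \<in> under_points K" by (rule under_pointI[OF c(4-7)])
 moreover have "A \<inter> under_points K = {}" "C \<inter> under_points K = {}" using A C by blast+
 ultimately have "seg x y \<inter> under_points K = {u}" using x(3) y(3) ends_in_segment(2)[of u x] by blast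
 then show ?thesis
  using that[OF c(8), of x y u v] sg(1,2) A[OF x(2)] C[OF y(2)] B c(1-7) unfolding edge_hull by blast
qed

section \<open>Fox colorings as colorings by the dihedral kei\<close>

lemma kei_Zmod:
 assumes "m > 0" shows "kei (Zmod m) (dihedral_op m)"
proof (rule kei.intro)
 fix x y z assume "x \<in> Zmod m" "y \<in> Zmod m" "z \<in> Zmod m"
 have "[2 * ((2 * z - y) mod m) - (2 * z - x) mod m = 2 * (2 * z - y) - (2 * z - x)] (mod m)"
  by (intro cong_diff cong_mult cong_refl) (simp_all add: cong_def)
 then show "dihedral_op m (dihedral_op m x y) z = dihedral_op m (dihedral_op m x z) (dihedral_op m y z)"
  by (simp add: dihedral_op_def mod_diff_right_eq cong_def algebra_simps)
qed (use assms in \<open>simp_all add: Zmod_def dihedral_op_def mod_diff_right_eq\<close>)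

definition spread :: "space set set \<Rightarrow> (plane set \<Rightarrow> 'q) \<Rightarrow> space \<Rightarrow> 'q" where
 "spread K C = (\<lambda>x\<in>edge_union K - under_points K. C (fst ` strand K x))"

lemma arc_of: "x \<in> edge_union K \<Longrightarrow> x \<notin> under_points K \<Longrightarrow> fst ` strand K x \<in> arcs (diagram_of K)"
 using strand_in by (simp add: arcs_diagram)

lemma arcE:
 assumes "a \<in> arcs (diagram_of K)"
 obtains x where "x \<in> edge_union K" "x \<notin> under_points K" "a = fst ` strand K x"
 using assms unfolding arcs_diagram strands_eq by blast

lemma spread_apply: "x \<in> edge_union K \<Longrightarrow> x \<notin> under_points K \<Longrightarrow> spread K C x = C (fst ` strand K x)"
 by (simp add: spread_def)

lemma spread_eqI:
 assumes "C \<in> extensional (arcs (diagram_of K))" "C' \<in> extensional (arcs (diagram_of K))" "spread K C = spread K C'"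
 shows "C = C'"
proof (rule extensionalityI[OF assms(1,2)])
 fix a assume "a \<in> arcs (diagram_of K)"
 then obtain x where x: "x \<in> edge_union K" "x \<notin> under_points K" "a = fst ` strand K x" by (rule arcE)
 then show "C a = C' a" using fun_cong[OF assms(3), of x] by (simp add: spread_apply)
qed

text \<open>A point close to \<open>a\<close> on the strand shares an edge with \<open>a\<close>,
  and the short segment between them contains no under point; so the coloring is locally constant on
  a connected set.\<close>

lemma (in kei) coloring_constant_on_strand:
 assumes K: "polygonal_link K" "regular_position K" and c: "c \<in> point_colorings K" and x: "x \<in> edge_union K" "x \<notin> under_points K" and y: "y \<in> strand K x"
 shows "c y = c x"
proof -
 let ?S = "edge_union K - under_points K"
 have sub: "strand K x \<subseteq> ?S" unfolding strand_def by (rule connected_component_subset)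
 have "connected (strand K x)" unfolding strand_def by (rule connected_connected_component)
 moreover have "\<forall>a\<in>strand K x. \<forall>\<^sub>F b in at a within strand K x. c a = c b"
 proof
  fix a assume a: "a \<in> strand K x"
  obtain d where d: "d > 0" "\<And>e b. e \<in> K \<Longrightarrow> b \<in> conv e \<Longrightarrow> dist a b < d \<Longrightarrow> a \<in> conv e"
   using edges_near[OF K(1) subset_refl, of a] by blast
  obtain d' where d': "d' > 0" "\<And>b. b \<in> under_points K \<Longrightarrow> dist a b < d' \<Longrightarrow> b = a"
   using isolated_from_finite[OF finite_under_points[OF K], of a] by blast
  have "c a = c b" if b: "b \<in> strand K x" "dist b a < min d d'" for b
  proof -
   have "b \<in> edge_union K" using b(1) sub by blast
   then obtain e where e: "e \<in> K" "b \<in> conv e" by (rule edge_unionE)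
   have ae: "a \<in> conv e" using d(2)[OF e] b(2) by (simp add: dist_commute)
   have "seg a b \<inter> under_points K = {}"
   proof (rule ccontr)
    assume "seg a b \<inter> under_points K \<noteq> {}"
    then obtain s where s: "s \<in> seg a b" "s \<in> under_points K" by blast
    have "dist a s < d'" using dist_in_closed_segment[OF s(1)] b(2) by (simp add: dist_commute)
    then have "s = a" by (rule d'(2)[OF s(2)])
    then show False using s(2) a sub by blast
   qed
   then show ?thesis using flat_const[OF point_coloring_flat[OF c e(1)] ae e(2)] by simp
  qed
  then show "\<forall>\<^sub>F b in at a within strand K x. c a = c b"
   unfolding eventually_at using d(1) d'(1) by (intro exI[of _ "min d d'"]) (simp del: split_paired_All)
 qed
 ultimately show ?thesis using connected_local_const[of "strand K x" y x c] y in_strand[OF x] by blast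
qed

locale diagram_coloring =
 fixes m :: int and K :: "space set set"
 assumes m: "m > 1" and K: "polygonal_link K" "regular_position K"
begin

sublocale kei "Zmod m" "dihedral_op m"
 using m by (intro kei_Zmod) simp

abbreviation "D \<equiv> diagram_of K"

text \<open>The Fox relation says that one under-arc has the dihedral product of the other under-arc
  and the over-arc as its color. Listed crossings and segments with a single under point correspond
  by \<open>crossing_over_segment\<close> and \<open>segment_under_crossing\<close>.\<close>

lemma spread_coloring_iff:
 assumes C: "C \<in> arcs D \<rightarrow>\<^sub>E Zmod m"
 shows "spread K C \<in> point_colorings K \<longleftrightarrow> C \<in> colorings m D"
proof
 assume c: "spread K C \<in> point_colorings K"
 have "[2 * C b = C a + C d] (mod m)" if cr: "(z, a, b, d) \<in> crossings D" for z a b d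
 proof -
  obtain e x y u v where e: "e \<in> K" and x: "x \<in> conv e" "x \<notin> under_points K" and y: "y \<in> conv e" "y \<notin> under_points K"
   and u: "seg x y \<inter> under_points K = {u}" and v: "u \<in> edge_union K" "v \<in> edge_union K" "fst v = fst u" "snd u < snd v" "v \<notin> under_points K"
   and abd: "a = fst ` strand K x" "b = fst ` strand K v" "d = fst ` strand K y"
   by (rule segment_under_crossing[OF cr])
  have X: "x \<in> edge_union K" "y \<in> edge_union K" using x y edge_hull_subset[OF e] by blast+
  have k: "(Some \<circ> spread K C \<circ> over K) u = Some (C b)"
   using over_eq[OF K(2) v(1-4)] spread_apply[OF v(2,5), of C] abd(2) by simp
  have "C d = dihedral_op m (C a) (C b)"
   using flat_cross[OF point_coloring_flat[OF c e] x y u k] spread_apply[OF X(1) x(2), of C] spread_apply[OF X(2) y(2), of C] abd by simp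
  then show ?thesis by (simp add: dihedral_op_def cong_def mod_simps)
 qed
 then show "C \<in> colorings m D" using C unfolding colorings_def by blast
next
 assume "C \<in> colorings m D"
 then have cr: "[2 * C b = C a + C d] (mod m)" if "(z, a, b, d) \<in> crossings D" for z a b d
  using that unfolding colorings_def by blast
 have Q: "C (fst ` strand K x) \<in> Zmod m" if "x \<in> edge_union K" "x \<notin> under_points K" for x using C arc_of[OF that] by blast
 have "spread K C \<in> edge_union K - under_points K \<rightarrow>\<^sub>E Zmod m"
  unfolding spread_def using Q by (intro restrict_PiE_iff[THEN iffD2] ballI) blast
 moreover have "flat (conv e) (under_points K) (Some \<circ> spread K C \<circ> over K) (spread K C)" if e: "e \<in> K" for e
 proof (rule flatI)
  have X: "x \<in> edge_union K" if "x \<in> conv e" for x using that edge_hull_subset[OF e] by blast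
  show "spread K C x \<in> Zmod m" if "x \<in> conv e" "x \<notin> under_points K" for x
   using Q[OF X[OF that(1)] that(2)] spread_apply[OF X[OF that(1)] that(2)] by metis
  fix x y assume x: "x \<in> conv e" "x \<notin> under_points K" and y: "y \<in> conv e" "y \<notin> under_points K"
  note sp = spread_apply[OF X[OF x(1)] x(2), of C] spread_apply[OF X[OF y(1)] y(2), of C]
  show "spread K C y = spread K C x" if d: "seg x y \<inter> under_points K = {}"
  proof -
   have "seg x y \<subseteq> edge_union K - under_points K"
    using closed_segment_subset[OF x(1) y(1) convex_convex_hull] X d by blast
   then have "y \<in> strand K x" by (rule segment_in_strand)
   then have "strand K y = strand K x" unfolding strand_def by (rule connected_component_eq)
   then show ?thesis using sp by simp
  qed
  fix s q assume s: "seg x y \<inter> under_points K = {s}" and q: "(Some \<circ> spread K C \<circ> over K) s = Some q"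
  have "s \<in> under_points K" using s by blast
  then obtain v where v: "over K s = v" "v \<in> edge_union K" "v \<notin> under_points K" by (rule under_pointE[OF K(2)])
  have "q = C (fst ` strand K (over K s))" using q v spread_apply[OF v(2,3), of C] by simp
  with cr[OF crossing_over_segment[OF K e x y s]] have "[2 * q = spread K C x + spread K C y] (mod m)" using sp by simp
  then have "(2 * q - spread K C x) mod m = spread K C y mod m"
   unfolding cong_def by (metis add_diff_cancel_left' mod_diff_left_eq)
  then show "spread K C y = dihedral_op m (spread K C x) q"
   using Q[OF X[OF y(1)] y(2)] sp(2) by (simp add: dihedral_op_def Zmod_def)
 qed
 ultimately show "spread K C \<in> point_colorings K" unfolding point_colorings_def by blast
qed

lemma coloring_fun: "C \<in> colorings m D \<Longrightarrow> C \<in> arcs D \<rightarrow>\<^sub>E Zmod m"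
 unfolding colorings_def by blast

lemma spread_bij: "bij_betw (spread K) (colorings m D) (point_colorings K)"
proof (rule bij_betwI')
 show "spread K C = spread K C' \<longleftrightarrow> C = C'" if "C \<in> colorings m D" "C' \<in> colorings m D" for C C'
  using spread_eqI[of C K C'] coloring_fun[OF that(1)] coloring_fun[OF that(2)] unfolding PiE_def by blast
 show "spread K C \<in> point_colorings K" if "C \<in> colorings m D" for C
  using spread_coloring_iff[OF coloring_fun[OF that]] that by blast
 fix c assume c: "c \<in> point_colorings K"
 \<comment> \<open>Any representative of the arc may be chosen, since an arc determines its strand
   and \<open>c\<close> is constant on strands.\<close>
 define C where "C = (\<lambda>a\<in>arcs D. c (SOME x. x \<in> edge_union K \<and> x \<notin> under_points K \<and> a = fst ` strand K x))"
 have C: "C (fst ` strand K x) = c x" if x: "x \<in> edge_union K" "x \<notin> under_points K" for x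
 proof -
  let ?y = "SOME y. y \<in> edge_union K \<and> y \<notin> under_points K \<and> fst ` strand K x = fst ` strand K y"
  have "?y \<in> edge_union K \<and> ?y \<notin> under_points K \<and> fst ` strand K x = fst ` strand K ?y" by (rule someI[of _ x]) (use x in blast)
  then have y: "?y \<in> edge_union K" "?y \<notin> under_points K" "strand K ?y = strand K x"
   using fst_strand_eq_iff[OF strand_in[OF x] strand_in[of ?y]] by blast+
  have "c ?y = c x" using coloring_constant_on_strand[OF K c x] in_strand[OF y(1,2)] y(3) by blast
  then show ?thesis using arc_of[OF x] by (simp add: C_def)
 qed
 have "C \<in> arcs D \<rightarrow>\<^sub>E Zmod m"
 proof (rule PiE_I)
  show "C a \<in> Zmod m" if a: "a \<in> arcs D" for a
  proof -
   obtain x where x: "x \<in> edge_union K" "x \<notin> under_points K" "a = fst ` strand K x" using a by (rule arcE)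
   then show ?thesis using C[OF x(1,2)] point_coloring_in[OF c x(1,2)] by metis
  qed
 qed (simp add: C_def)
 moreover have sC: "spread K C = c"
 proof (rule extensionalityI)
  show "spread K C \<in> extensional (edge_union K - under_points K)" unfolding spread_def by (rule restrict_extensional)
  show "c \<in> extensional (edge_union K - under_points K)" using c unfolding point_colorings_def PiE_def by blast
 qed (use C spread_apply in \<open>metis DiffE\<close>)
 ultimately have "C \<in> colorings m D" using spread_coloring_iff c by blast
 then show "\<exists>C\<in>colorings m D. c = spread K C" using sC by blast
qed

lemma spread_recolor:
 "spread K (\<lambda>a\<in>arcs D. h (C a)) = recolor K h (spread K C)"
 unfolding recolor_def spread_def by (rule restrict_ext) (use arc_of in simp)

lemma recoloring:
 assumes C: "C \<in> colorings m D" and h: "endo h" shows "(\<lambda>a\<in>arcs D. h (C a)) \<in> colorings m D"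
proof -
 have "recolor K h (spread K C) \<in> point_colorings K"
  using recolor_coloring[OF K(2) _ h] spread_coloring_iff[OF coloring_fun[OF C]] C by blast
 moreover have "(\<lambda>a\<in>arcs D. h (C a)) \<in> arcs D \<rightarrow>\<^sub>E Zmod m"
  using coloring_fun[OF C] endo_in[OF h] by (intro restrict_PiE_iff[THEN iffD2] ballI) blast
 ultimately show ?thesis using spread_coloring_iff spread_recolor by metis
qed

lemma endo_const: "k \<in> Zmod m \<Longrightarrow> endo (\<lambda>_. k)"
 unfolding endo_def using act_idem by simp

text \<open>Triviality becomes invariance under a constant recoloring, a form that a natural
  bijection transports.\<close>

lemma trivial_iff:
 assumes C: "C \<in> colorings m D"
 shows "trivial_coloring D C \<longleftrightarrow> (\<exists>k\<in>Zmod m. recolor K (\<lambda>_. k) (spread K C) = spread K C)"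
proof
 \<comment> \<open>An arc is needed to see that the common value \<open>k\<close> is a residue; a
   vertex of the link provides one.\<close>
 have "K \<noteq> {}" using K(1) unfolding polygonal_link_def by blast
 then obtain e where e: "e \<in> K" by blast
 obtain p q where pq: "e = {p, q}" by (rule edgeE[OF K(1) e])
 have p: "p \<in> \<Union>K" using e pq by blast
 then have pX: "p \<in> edge_union K" "p \<notin> under_points K"
  using vertex_in_edge_union vertex_not_crossing[OF K(2)] under_points_crossing by blast+
 assume "trivial_coloring D C"
 then obtain k where k: "\<forall>a\<in>arcs D. C a = k" unfolding trivial_coloring_def by blast
 have "k \<in> Zmod m" using coloring_fun[OF C] k arc_of[OF pX] by fastforce
 moreover have "recolor K (\<lambda>_. k) (spread K C) = spread K C"
  unfolding recolor_def spread_def by (rule restrict_ext) (use k arc_of in simp)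
 ultimately show "\<exists>k\<in>Zmod m. recolor K (\<lambda>_. k) (spread K C) = spread K C" by blast
next
 assume "\<exists>k\<in>Zmod m. recolor K (\<lambda>_. k) (spread K C) = spread K C"
 then obtain k where k: "recolor K (\<lambda>_. k) (spread K C) = spread K C" by blast
 have "C a = k" if a: "a \<in> arcs D" for a
 proof -
  obtain x where x: "x \<in> edge_union K" "x \<notin> under_points K" "a = fst ` strand K x" using a by (rule arcE)
  then show ?thesis using fun_cong[OF k, of x] by (simp add: recolor_apply spread_apply)
 qed
 then show "trivial_coloring D C" unfolding trivial_coloring_def by blast
qed

lemma endo_Aut: "g \<in> carrier (Aut m) \<Longrightarrow> endo g"
 unfolding Aut_def endo_def Bij_def by (auto dest: bij_betwE)

lemma action_eq: "C \<in> nontrivial_colorings m D \<Longrightarrow> color_action m D g C = (\<lambda>a\<in>arcs D. g (C a))"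
 by (simp add: color_action_def)

lemma action_closed:
 assumes C: "C \<in> nontrivial_colorings m D" and g: "g \<in> carrier (Aut m)"
 shows "color_action m D g C \<in> nontrivial_colorings m D"
proof -
 have C': "C \<in> colorings m D" "\<not> trivial_coloring D C" using C unfolding nontrivial_colorings_def by blast+
 have inj: "inj_on g (Zmod m)" using g unfolding Aut_def Bij_def bij_betw_def by simp
 have "\<not> trivial_coloring D (\<lambda>a\<in>arcs D. g (C a))"
 proof
  assume "trivial_coloring D (\<lambda>a\<in>arcs D. g (C a))"
  then obtain k where k: "\<And>a. a \<in> arcs D \<Longrightarrow> g (C a) = k" unfolding trivial_coloring_def by auto
  have "C a = C b" if "a \<in> arcs D" "b \<in> arcs D" for a b
   using inj_onD[OF inj] k[OF that(1)] k[OF that(2)] coloring_fun[OF C'(1)] that by (metis PiE_mem)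
  then have "trivial_coloring D C" unfolding trivial_coloring_def by blast
  then show False using C'(2) by blast
 qed
 then show ?thesis unfolding action_eq[OF C] nontrivial_colorings_def using recoloring[OF C'(1) endo_Aut[OF g]] by blast
qed

end

section \<open>Transport of the equivalence classes\<close>

lemma same_class_iff:
 "same_class m G D C1 C2 \<longleftrightarrow> (\<exists>C\<in>nontrivial_colorings m D. \<exists>g1\<in>G. \<exists>g2\<in>G. C1 = color_action m D g1 C \<and> C2 = color_action m D g2 C)"
 unfolding same_class_def coloring_classes_def orbits_def orbit_def by auto

text \<open>Equivariance maps orbits to orbits. Injectivity turns an equation between images back
  into one between the colorings, and surjectivity provides the base point of an orbit.\<close>

lemma same_class_transfer:
 assumes b: "bij_betw \<Theta> (nontrivial_colorings m D) (nontrivial_colorings m D')"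
  and closed: "\<And>g C. g \<in> G \<Longrightarrow> C \<in> nontrivial_colorings m D \<Longrightarrow> color_action m D g C \<in> nontrivial_colorings m D"
  and equiv: "\<And>g C. g \<in> G \<Longrightarrow> C \<in> nontrivial_colorings m D \<Longrightarrow> \<Theta> (color_action m D g C) = color_action m D' g (\<Theta> C)"
  and C: "C1 \<in> nontrivial_colorings m D" "C2 \<in> nontrivial_colorings m D"
 shows "same_class m G D C1 C2 \<longleftrightarrow> same_class m G D' (\<Theta> C1) (\<Theta> C2)"
proof -
 have inj: "\<Theta> A = \<Theta> B \<longleftrightarrow> A = B" if "A \<in> nontrivial_colorings m D" "B \<in> nontrivial_colorings m D" for A B
  using inj_on_eq_iff[OF bij_betw_imp_inj_on[OF b] that] .
 have key: "\<Theta> A = color_action m D' g (\<Theta> C) \<longleftrightarrow> A = color_action m D g C"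
  if "A \<in> nontrivial_colorings m D" "C \<in> nontrivial_colorings m D" "g \<in> G" for A C g
  using inj[OF that(1) closed[OF that(3,2)]] equiv[OF that(3,2)] by simp
 have im: "nontrivial_colorings m D' = \<Theta> ` nontrivial_colorings m D" using b unfolding bij_betw_def by simp
 show ?thesis
 proof
  assume "same_class m G D C1 C2"
  then obtain C g1 g2 where "C \<in> nontrivial_colorings m D" "g1 \<in> G" "g2 \<in> G" "C1 = color_action m D g1 C" "C2 = color_action m D g2 C"
   unfolding same_class_iff by blast
  then show "same_class m G D' (\<Theta> C1) (\<Theta> C2)" unfolding same_class_iff im using key[OF C(1)] key[OF C(2)] by blast
 next
  assume "same_class m G D' (\<Theta> C1) (\<Theta> C2)"
  then obtain C g1 g2 where "C \<in> nontrivial_colorings m D" "g1 \<in> G" "g2 \<in> G"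
   "\<Theta> C1 = color_action m D' g1 (\<Theta> C)" "\<Theta> C2 = color_action m D' g2 (\<Theta> C)" unfolding same_class_iff im by blast
  then show "same_class m G D C1 C2" unfolding same_class_iff using key[OF C(1)] key[OF C(2)] by blast
 qed
qed

text \<open>Conjugation with \<open>spread\<close> turns the natural bijection of point colorings
  into one of arc colorings; it stays natural because \<open>spread\<close> commutes with
  recoloring.\<close>

lemma equivalent_diagrams:
 assumes "m > 1" and K: "polygonal_link K" "regular_position K" and K': "polygonal_link K'" "regular_position K'"
  and eq: "link_equivalent K K'" and G: "subgroup G (Aut m)"
 shows "\<exists>\<Theta>. bij_betw \<Theta> (nontrivial_colorings m (diagram_of K)) (nontrivial_colorings m (diagram_of K')) \<and>
  (\<forall>C1\<in>nontrivial_colorings m (diagram_of K). \<forall>C2\<in>nontrivial_colorings m (diagram_of K).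
    same_class m G (diagram_of K) C1 C2 \<longleftrightarrow> same_class m G (diagram_of K') (\<Theta> C1) (\<Theta> C2))"
proof -
 let ?D = "diagram_of K" and ?D' = "diagram_of K'"
 interpret A: diagram_coloring m K by unfold_locales (use assms in simp_all)
 interpret B: diagram_coloring m K' by unfold_locales (use assms in simp_all)
 obtain \<Phi> where \<Phi>: "bij_betw \<Phi> (A.point_colorings K) (A.point_colorings K')"
  "\<And>c h. c \<in> A.point_colorings K \<Longrightarrow> A.endo h \<Longrightarrow> \<Phi> (A.recolor K h c) = A.recolor K' h (\<Phi> c)"
  using A.equivalent_links_iso[OF eq K K'] unfolding A.coloring_iso_def by blast
 let ?S = "the_inv_into (colorings m ?D') (spread K')"
 define \<Theta> where "\<Theta> = ?S \<circ> (\<Phi> \<circ> spread K)"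
 have b: "bij_betw \<Theta> (colorings m ?D) (colorings m ?D')"
  unfolding \<Theta>_def by (intro bij_betw_trans[OF bij_betw_trans[OF A.spread_bij \<Phi>(1)] bij_betw_the_inv_into[OF B.spread_bij]])
 have sp: "spread K C \<in> A.point_colorings K" if "C \<in> colorings m ?D" for C using bij_betwE[OF A.spread_bij] that by blast
 have spread_\<Theta>: "spread K' (\<Theta> C) = \<Phi> (spread K C)" if "C \<in> colorings m ?D" for C
  unfolding \<Theta>_def o_apply using f_the_inv_into_f_bij_betw[OF B.spread_bij] bij_betwE[OF \<Phi>(1)] sp[OF that] by blast
 have in': "\<Theta> C \<in> colorings m ?D'" if "C \<in> colorings m ?D" for C using bij_betwE[OF b] that by blast
 have equiv: "\<Theta> (\<lambda>a\<in>arcs ?D. h (C a)) = (\<lambda>a\<in>arcs ?D'. h (\<Theta> C a))" if C: "C \<in> colorings m ?D" and h: "A.endo h" for C h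
 proof -
  have "spread K' (\<Theta> (\<lambda>a\<in>arcs ?D. h (C a))) = spread K' (\<lambda>a\<in>arcs ?D'. h (\<Theta> C a))"
   unfolding spread_\<Theta>[OF A.recoloring[OF C h]] A.spread_recolor B.spread_recolor \<Phi>(2)[OF sp[OF C] h] spread_\<Theta>[OF C] ..
  then show ?thesis
   using inj_onD[OF bij_betw_imp_inj_on[OF B.spread_bij] _ in'[OF A.recoloring[OF C h]] B.recoloring[OF in'[OF C] h]] by blast
 qed
 have triv: "trivial_coloring ?D' (\<Theta> C) \<longleftrightarrow> trivial_coloring ?D C" if C: "C \<in> colorings m ?D" for C
 proof -
  have "A.recolor K' (\<lambda>_. k) (\<Phi> (spread K C)) = \<Phi> (spread K C) \<longleftrightarrow> A.recolor K (\<lambda>_. k) (spread K C) = spread K C" if k: "k \<in> Zmod m" for k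
   using inj_on_eq_iff[OF bij_betw_imp_inj_on[OF \<Phi>(1)] A.recolor_coloring[OF K(2) sp[OF C] A.endo_const[OF k]] sp[OF C]]
    \<Phi>(2)[OF sp[OF C] A.endo_const[OF k]] by simp
  then show ?thesis unfolding A.trivial_iff[OF C] B.trivial_iff[OF in'[OF C]] spread_\<Theta>[OF C] by blast
 qed
 have bn: "bij_betw \<Theta> (nontrivial_colorings m ?D) (nontrivial_colorings m ?D')"
 proof (rule bij_betw_subset[OF b])
  show "nontrivial_colorings m ?D \<subseteq> colorings m ?D" unfolding nontrivial_colorings_def by blast
  have im: "colorings m ?D' = \<Theta> ` colorings m ?D" using b unfolding bij_betw_def by simp
  have "{C \<in> colorings m ?D. \<not> trivial_coloring ?D' (\<Theta> C)} = {C \<in> colorings m ?D. \<not> trivial_coloring ?D C}"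
   using triv by (simp cong: conj_cong)
  then show "\<Theta> ` nontrivial_colorings m ?D = nontrivial_colorings m ?D'"
   unfolding nontrivial_colorings_def im Compr_image_eq by simp
 qed
 have sub: "g \<in> carrier (Aut m)" if "g \<in> G" for g using subgroup.subset[OF G] that by blast
 have "\<Theta> (color_action m ?D g C) = color_action m ?D' g (\<Theta> C)" if "g \<in> G" and C: "C \<in> nontrivial_colorings m ?D" for g C
  unfolding A.action_eq[OF C] B.action_eq[OF bij_betwE[OF bn, rule_format, OF C]]
  using equiv[OF _ A.endo_Aut[OF sub[OF \<open>g \<in> G\<close>]]] C unfolding nontrivial_colorings_def by blast
 then show ?thesis
  using bn same_class_transfer[OF bn A.action_closed[OF _ sub]] by blast
qed

theorem proposition2p3:
 fixes m :: int and L :: "space set set" and D D' :: diagram and G :: "(int \<Rightarrow> int) set"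
 assumes "m > 1"
  and "polygonal_link L"
  and "admits_nontrivial_colorings m L"
  and "is_diagram_of D L"
  and "is_diagram_of D' L"
  and "subgroup G (Aut m)"
 shows "\<exists>\<Phi>. bij_betw \<Phi> (nontrivial_colorings m D) (nontrivial_colorings m D') \<and>
      (\<forall>C1\<in>nontrivial_colorings m D. \<forall>C2\<in>nontrivial_colorings m D.
       same_class m G D C1 C2 \<longleftrightarrow> same_class m G D' (\<Phi> C1) (\<Phi> C2))"
proof -
 obtain K where K: "polygonal_link K" "link_equivalent L K" "regular_position K" "D = diagram_of K"
  using assms(4) unfolding is_diagram_of_def by blast
 obtain K' where K': "polygonal_link K'" "link_equivalent L K'" "regular_position K'" "D' = diagram_of K'"
  using assms(5) unfolding is_diagram_of_def by blast
 have "link_equivalent K K'" using K(2) K'(2) unfolding link_equivalent_def by (metis equivclp_sym equivclp_trans)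
 then show ?thesis unfolding K(4) K'(4) by (rule equivalent_diagrams[OF assms(1) K(1,3) K'(1,3) _ assms(6)])
qed

end
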